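(* Every plane Laman graph $G$ has a pointed pseudo-triangular embedding; that is, there is a non-crossing straight-line embedding of $G$, realizing the given plane structure of $G$ (its faces and its outer face), that is a pointed pseudo-triangulation.
   Context: Graphs are finite and simple. A Laman graph is a graph with $n\ge 2$ vertices and exactly $2n-3$ edges such that every subset of $k\ge 2$ vertices spans at most $2k-3$ edges. A plane graph is a planar graph together with a choice of rotations (the counter-clockwise circular orders of edges around the vertices in some non-crossing drawing, hence a choice of facial structure) and a choice of one face as the outer face. A straight-line embedding maps vertices to distinct points of $\mathbb{R}^2$ and edges to the straight segments between them; it is non-crossing if segments of non-adjacent edges are disjoint and segments of adjacent edges meet only at the common endpoint. A vertex is pointed in such an embedding if some angle at it, between two (circularly) consecutive incident edges, is larger than $\pi$ (a vertex of degree one has a single angle $2\pi$). A pseudo-triangle is a simple polygon with exactly three convex vertices (interior angle less than $\pi$). A pseudo-triangulation is a non-crossing straight-line embedded graph whose outer face is convex (the edges incident to the outer face form the boundary of the convex hull of the points) and all of whose interior faces are pseudo-triangles. It is a pointed pseudo-triangulation if all its vertices are pointed. *)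

theory Defs
  imports "HOL-Analysis.Analysis" "HOL-Combinatorics.Orbits"
begin

text \<open>The Euclidean plane is the type \<^typ>\<open>complex\<close>.\<close>

subsection \<open>Graphs\<close>

definition simple_graph :: "'a set \<Rightarrow> 'a set set \<Rightarrow> bool" where
  "simple_graph V E \<longleftrightarrow> finite V \<and> (\<forall>e\<in>E. e \<subseteq> V \<and> card e = 2)"

definition neighbours :: "'a set set \<Rightarrow> 'a \<Rightarrow> 'a set" where
  "neighbours E v = {u. {v, u} \<in> E}"

definition laman :: "'a set \<Rightarrow> 'a set set \<Rightarrow> bool" where
  "laman V E \<longleftrightarrow> simple_graph V E \<and> 2 \<le> card V \<and> card E = 2 * card V - 3 \<and>
     (\<forall>S\<subseteq>V. 2 \<le> card S \<longrightarrow> card {e\<in>E. e \<subseteq> S} \<le> 2 * card S - 3)"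

subsection \<open>Counter-clockwise order\<close>

text \<open>The angle in the half-open interval from \<open>0\<close> (excluded) to \<open>2\<pi>\<close> (included) by which
  \<open>a\<close> has to be turned counter-clockwise to point in the direction of \<open>b\<close>. The full turn for equal
  directions makes a vertex of degree one its own successor, with a single angle \<open>2\<pi>\<close>.\<close>

definition ccw_angle :: "complex \<Rightarrow> complex \<Rightarrow> real" where
  "ccw_angle a b = (if Arg2pi (b / a) = 0 then 2 * pi else Arg2pi (b / a))"

text \<open>\<open>w\<close> is the element of \<open>N\<close> that follows \<open>u\<close> in counter-clockwise circular order, when each
  \<open>x \<in> N\<close> is seen in the direction \<open>d x\<close>.\<close>

definition ccw_next :: "('a \<Rightarrow> complex) \<Rightarrow> 'a set \<Rightarrow> 'a \<Rightarrow> 'a \<Rightarrow> bool" where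
  "ccw_next d N u w \<longleftrightarrow> w \<in> N \<and> (\<forall>x\<in>N. ccw_angle (d u) (d w) \<le> ccw_angle (d u) (d x))"

subsection \<open>Drawings and plane graphs\<close>

text \<open>A vertex \<open>v\<close> is drawn at \<open>p v\<close>; \<open>g u v\<close> is the arc of the edge \<open>{u, v}\<close>, traversed from
  \<open>u\<close> to \<open>v\<close>.\<close>

definition noncrossing_drawing ::
  "'a set \<Rightarrow> 'a set set \<Rightarrow> ('a \<Rightarrow> complex) \<Rightarrow> ('a \<Rightarrow> 'a \<Rightarrow> real \<Rightarrow> complex) \<Rightarrow> bool" where
  "noncrossing_drawing V E p g \<longleftrightarrow>
     inj_on p V \<and>
     (\<forall>u v. {u, v} \<in> E \<longrightarrow>
        arc (g u v) \<and> pathstart (g u v) = p u \<and> pathfinish (g u v) = p v \<and>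
        g v u = reversepath (g u v) \<and>
        path_image (g u v) \<inter> p ` V = {p u, p v}) \<and>
     (\<forall>u v x y. {u, v} \<in> E \<longrightarrow> {x, y} \<in> E \<longrightarrow> {u, v} \<noteq> {x, y} \<longrightarrow>
        path_image (g u v) \<inter> path_image (g x y) = p ` ({u, v} \<inter> {x, y}))"

text \<open>The point where a path finally leaves the disc of radius \<open>r\<close> around its start.\<close>

definition last_exit :: "(real \<Rightarrow> complex) \<Rightarrow> real \<Rightarrow> complex" where
  "last_exit c r = c (Sup {t \<in> {0..1}. dist (c 0) (c t) \<le> r})"

text \<open>A rotation \<open>\<rho>\<close> maps a vertex \<open>v\<close> and a neighbour \<open>u\<close> of \<open>v\<close> to the neighbour \<open>\<rho> v u\<close> that
  follows \<open>u\<close> counter-clockwise around \<open>v\<close>. Arcs need not have a tangent at their endpoints, so the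
  order of the edges around \<open>v\<close> is read off on circles around \<open>p v\<close>; it is the same on all
  sufficiently small ones. For straight edges it is the order of the directions \<open>p u - p v\<close>.\<close>

definition induces_rotation ::
  "'a set set \<Rightarrow> ('a \<Rightarrow> complex) \<Rightarrow> ('a \<Rightarrow> 'a \<Rightarrow> real \<Rightarrow> complex) \<Rightarrow> ('a \<Rightarrow> 'a \<Rightarrow> 'a) \<Rightarrow> bool" where
  "induces_rotation E p g \<rho> \<longleftrightarrow>
     (\<forall>v u. {v, u} \<in> E \<longrightarrow>
        (\<forall>\<^sub>F r in at_right 0.
           ccw_next (\<lambda>x. last_exit (g v x) r - p v) (neighbours E v) u (\<rho> v u)))"

text \<open>The directed edge \<open>(u, v)\<close> stands for the right-hand side of \<open>{u, v}\<close> when walking from \<open>u\<close>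
  to \<open>v\<close>. As \<open>\<rho>\<close> is counter-clockwise, \<open>face_step \<rho>\<close> leads to the next directed edge on the
  boundary of the face to the right. In a connected graph (every Laman graph is connected) the
  faces correspond to the orbits of \<open>face_step \<rho>\<close>.\<close>

definition face_step :: "('a \<Rightarrow> 'a \<Rightarrow> 'a) \<Rightarrow> 'a \<times> 'a \<Rightarrow> 'a \<times> 'a" where
  "face_step \<rho> = (\<lambda>(u, v). (v, \<rho> v u))"

definition is_face :: "'a set set \<Rightarrow> ('a \<Rightarrow> 'a \<Rightarrow> 'a) \<Rightarrow> ('a \<times> 'a) set \<Rightarrow> bool" where
  "is_face E \<rho> F \<longleftrightarrow> (\<exists>u v. {u, v} \<in> E \<and> F = orbit (face_step \<rho>) (u, v))"

text \<open>A rotation \<open>\<rho>\<close> that comes from a non-crossing drawing, with any of its faces \<open>F\<close> chosen as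
  the outer face (not necessarily the unbounded face of that drawing).\<close>

definition plane_graph ::
  "'a set \<Rightarrow> 'a set set \<Rightarrow> ('a \<Rightarrow> 'a \<Rightarrow> 'a) \<Rightarrow> ('a \<times> 'a) set \<Rightarrow> bool" where
  "plane_graph V E \<rho> F \<longleftrightarrow>
     simple_graph V E \<and>
     (\<exists>p g. noncrossing_drawing V E p g \<and> induces_rotation E p g \<rho>) \<and>
     is_face E \<rho> F"

subsection \<open>Straight-line embeddings\<close>

text \<open>For \<open>e = {u, v}\<close> this is \<open>closed_segment (p u) (p v)\<close>, by \<open>segment_convex_hull\<close>.\<close>

definition edge_segment :: "('a \<Rightarrow> complex) \<Rightarrow> 'a set \<Rightarrow> complex set" where
  "edge_segment p e = convex hull (p ` e)"

definition noncrossing_straight_line_embedding ::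
  "'a set \<Rightarrow> 'a set set \<Rightarrow> ('a \<Rightarrow> complex) \<Rightarrow> bool" where
  "noncrossing_straight_line_embedding V E p \<longleftrightarrow>
     inj_on p V \<and>
     (\<forall>e\<in>E. \<forall>e'\<in>E. e \<noteq> e' \<longrightarrow> edge_segment p e \<inter> edge_segment p e' = p ` (e \<inter> e'))"

definition drawn_points :: "'a set \<Rightarrow> 'a set set \<Rightarrow> ('a \<Rightarrow> complex) \<Rightarrow> complex set" where
  "drawn_points V E p = p ` V \<union> (\<Union>e\<in>E. edge_segment p e)"

text \<open>Multiplication by \<open>- \<i>\<close> is a clockwise quarter turn, so the points below approach the midpoint
  of the edge from the right.\<close>

definition outer_on_right :: "'a set \<Rightarrow> 'a set set \<Rightarrow> ('a \<Rightarrow> complex) \<Rightarrow> 'a \<Rightarrow> 'a \<Rightarrow> bool" where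
  "outer_on_right V E p u v \<longleftrightarrow>
     (\<forall>\<^sub>F \<epsilon> in at_right 0.
        midpoint (p u) (p v) - of_real \<epsilon> * \<i> * (p v - p u) \<in> outside (drawn_points V E p))"

definition realizes_plane_structure ::
  "'a set \<Rightarrow> 'a set set \<Rightarrow> ('a \<Rightarrow> 'a \<Rightarrow> 'a) \<Rightarrow> ('a \<times> 'a) set \<Rightarrow> ('a \<Rightarrow> complex) \<Rightarrow> bool" where
  "realizes_plane_structure V E \<rho> F p \<longleftrightarrow>
     induces_rotation E p (\<lambda>u v. linepath (p u) (p v)) \<rho> \<and>
     (\<forall>u v. {u, v} \<in> E \<longrightarrow> ((u, v) \<in> F \<longleftrightarrow> outer_on_right V E p u v))"

definition pointed :: "'a set set \<Rightarrow> ('a \<Rightarrow> complex) \<Rightarrow> 'a \<Rightarrow> bool" where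
  "pointed E p v \<longleftrightarrow>
     (\<exists>u\<in>neighbours E v. \<exists>w. ccw_next (\<lambda>x. p x - p v) (neighbours E v) u w \<and>
        ccw_angle (p u - p v) (p w - p v) > pi)"

subsection \<open>Pseudo-triangles\<close>

text \<open>A polygon is given by the list of its vertices in circular order, in either direction.\<close>

definition polygon_vertex :: "complex list \<Rightarrow> nat \<Rightarrow> complex" where
  "polygon_vertex ps i = ps ! (i mod length ps)"

definition polygon_side :: "complex list \<Rightarrow> nat \<Rightarrow> complex set" where
  "polygon_side ps i = closed_segment (polygon_vertex ps i) (polygon_vertex ps (i + 1))"

definition polygon_boundary :: "complex list \<Rightarrow> complex set" where
  "polygon_boundary ps = (\<Union>i<length ps. polygon_side ps i)"

definition simple_polygon :: "complex list \<Rightarrow> bool" where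
  "simple_polygon ps \<longleftrightarrow>
     3 \<le> length ps \<and> distinct ps \<and>
     (\<forall>i<length ps. \<forall>j<length ps. i \<noteq> j \<longrightarrow>
        polygon_side ps i \<inter> polygon_side ps j =
          {polygon_vertex ps i, polygon_vertex ps (i + 1)} \<inter>
          {polygon_vertex ps j, polygon_vertex ps (j + 1)})"

text \<open>The two sides at vertex \<open>i\<close> leave two angles between them; the interior one is the one whose
  bisector starts into the interior of the polygon.\<close>

definition interior_angle :: "complex list \<Rightarrow> nat \<Rightarrow> real" where
  "interior_angle ps i =
     (let b = polygon_vertex ps i;
          a = polygon_vertex ps (i + length ps - 1) - b;
          c = polygon_vertex ps (i + 1) - b
      in if \<forall>\<^sub>F \<epsilon> in at_right 0.
              b + of_real \<epsilon> * cis (ccw_angle a c / 2) * a \<in> inside (polygon_boundary ps)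
         then ccw_angle a c else ccw_angle c a)"

definition pseudo_triangle :: "complex list \<Rightarrow> bool" where
  "pseudo_triangle ps \<longleftrightarrow>
     simple_polygon ps \<and> card {i. i < length ps \<and> interior_angle ps i < pi} = 3"

subsection \<open>Pseudo-triangulations\<close>

text \<open>The outer face of an embedding is \<open>outside (drawn_points V E p)\<close>; the interior faces are the
  bounded components of the complement of the drawing.\<close>

definition convex_outer_face :: "'a set \<Rightarrow> 'a set set \<Rightarrow> ('a \<Rightarrow> complex) \<Rightarrow> bool" where
  "convex_outer_face V E p \<longleftrightarrow>
     (\<Union>e \<in> {e\<in>E. edge_segment p e \<subseteq> frontier (outside (drawn_points V E p))}. edge_segment p e)
       = frontier (convex hull (p ` V))"

definition pseudo_triangulation :: "'a set \<Rightarrow> 'a set set \<Rightarrow> ('a \<Rightarrow> complex) \<Rightarrow> bool" where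
  "pseudo_triangulation V E p \<longleftrightarrow>
     noncrossing_straight_line_embedding V E p \<and>
     convex_outer_face V E p \<and>
     (\<forall>C \<in> components (- drawn_points V E p). bounded C \<longrightarrow>
        (\<exists>ps. set ps \<subseteq> p ` V \<and> pseudo_triangle ps \<and> C = inside (polygon_boundary ps)))"

definition pointed_pseudo_triangulation :: "'a set \<Rightarrow> 'a set set \<Rightarrow> ('a \<Rightarrow> complex) \<Rightarrow> bool" where
  "pointed_pseudo_triangulation V E p \<longleftrightarrow>
     pseudo_triangulation V E p \<and> (\<forall>v\<in>V. pointed E p v)"

end

theory Submission
 imports Defs "HOL-Complex_Analysis.Complex_Analysis"
begin

text \<open>Everything is done by induction on the number of vertices, for rotation systems that satisfy Euler's
 inequality. A count of tight sets and of the faces that can be reached from \<open>F\<close> without crossing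
 a tight set gives a triangular face, different from \<open>F\<close>, with an edge whose contraction is again
 Laman. In a realization of the contracted graph the vertex is split again by moving one of the two
 new vertices by a small amount. The direction of this move can be chosen such that both vertices
 are pointed, the new triangle is not degenerate, and every other face but \<open>F\<close> keeps three convex
 corners.

 Euler's inequality for a drawing with curved edges comes from the fundamental cycles of a spanning
 tree: the side of a cycle on which a directed edge lies is constant along faces, and it differs for
 the two directions of the one edge of the cycle outside the tree. Sides are read off from winding
 numbers; near a vertex the initial arcs can be replaced by radii, where this is a computation.

 In a realization the drawing lies on one side of each face cycle, since the other side starts in a
 sector without edges and the graph is connected. So by the Jordan curve theorem the faces of the
 rotation system are exactly the components of the complement of the drawing.\<close>

subsection \<open>Rotation systems\<close>

text \<open>Contracting an edge of a curved drawing would need topological surgery, while for a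
  rotation system it is a short formula; this is why the induction leaves drawings. Euler's
  inequality survives it, since a contraction loses one vertex, two edges and at most one face. For
  n vertices there are 4n-6 directed edges and at least n-1 faces; if every face but
  \<open>F\<close> had four or more of them, 4(n-2)+3 would be needed. The obstacle is that an edge
  of a triangular face may lie in a tight set missing the third vertex, hence an extremal choice of
  such a set. On the geometric side, a small move must not change the number of convex corners.
  Pointedness protects the corners that are not split: an angle above pi at a vertex excludes an
  angle equal to pi there, so convexity is an open condition. What is left is the corner at which
  the vertex is split. It becomes two corners whose angles add up to the old one plus pi, and the
  direction of the move decides which of them are convex.\<close>

definition darts :: "'a set set \<Rightarrow> ('a \<times> 'a) set" where
 "darts E = {(a, b). {a, b} \<in> E}"

text \<open>The second clause is how \<open>\<rho> v\<close> is said to be a single cycle: no proper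
  non-empty set of neighbours is closed under it. In this form it is an induction principle, used
  through \<open>rho_closed\<close>, and no powers of \<open>\<rho> v\<close> have to be
  handled.\<close>

definition rotation_system :: "'a set \<Rightarrow> 'a set set \<Rightarrow> ('a \<Rightarrow> 'a \<Rightarrow> 'a) \<Rightarrow> bool" where
 "rotation_system V E \<rho> \<longleftrightarrow>
   (\<forall>v\<in>V. (\<forall>u\<in>neighbours E v. \<rho> v u \<in> neighbours E v) \<and>
    (\<forall>S. S \<subseteq> neighbours E v \<longrightarrow> S \<noteq> {} \<longrightarrow> \<rho> v ` S \<subseteq> S \<longrightarrow> S = neighbours E v))"

definition triangle_face :: "'a set set \<Rightarrow> ('a \<Rightarrow> 'a \<Rightarrow> 'a) \<Rightarrow> 'a \<Rightarrow> 'a \<Rightarrow> 'a \<Rightarrow> bool" where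
 "triangle_face E \<rho> v u t \<longleftrightarrow> {v, u} \<in> E \<and> {u, t} \<in> E \<and> {t, v} \<in> E \<and>
   \<rho> u v = t \<and> \<rho> t u = v \<and> \<rho> v t = u"

definition edges_in :: "'a set set \<Rightarrow> 'a set \<Rightarrow> 'a set set" where
 "edges_in E S = {e\<in>E. e \<subseteq> S}"

definition tight :: "'a set \<Rightarrow> 'a set set \<Rightarrow> 'a set \<Rightarrow> bool" where
 "tight V E X \<longleftrightarrow> X \<subseteq> V \<and> 2 \<le> card X \<and> card (edges_in E X) = 2 * card X - 3"

text \<open>Contracting the edge \<open>{v, u}\<close> of a triangular face \<open>v u t\<close> loses a vertex and two edges. A tight
 set that contains \<open>u\<close> and \<open>v\<close> but not \<open>t\<close> loses a vertex and only one edge, so it would become too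
 dense.\<close>

definition blocker :: "'a set \<Rightarrow> 'a set set \<Rightarrow> 'a \<Rightarrow> 'a \<Rightarrow> 'a \<Rightarrow> 'a set \<Rightarrow> bool" where
 "blocker V E v u t X \<longleftrightarrow> tight V E X \<and> v \<in> X \<and> u \<in> X \<and> t \<notin> X \<and> 3 \<le> card X"

lemma face_step_simp [simp]: "face_step \<rho> (a, b) = (b, \<rho> b a)"
 by (simp add: face_step_def)

lemma mem_darts [simp]: "(a, b) \<in> darts E \<longleftrightarrow> {a, b} \<in> E"
 by (simp add: darts_def)

lemma mem_neighbours [simp]: "u \<in> neighbours E v \<longleftrightarrow> {v, u} \<in> E"
 by (simp add: neighbours_def)

locale comb_map =
 fixes V :: "'a set" and E :: "'a set set" and \<rho> :: "'a \<Rightarrow> 'a \<Rightarrow> 'a"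
 assumes simple: "simple_graph V E" and rot: "rotation_system V E \<rho>"
begin

abbreviation "f \<equiv> face_step \<rho>"
abbreviation "D \<equiv> darts E"
abbreviation "face \<equiv> orbit f"

lemma finV: "finite V"
 using simple by (simp add: simple_graph_def)

lemma edgeD: assumes "{a, b} \<in> E" shows "a \<noteq> b" "a \<in> V" "b \<in> V"
 using simple assms unfolding simple_graph_def by (fastforce simp: card_insert_if)+

lemma finE: "finite E"
proof -
 have "E \<subseteq> Pow V" using simple by (auto simp: simple_graph_def)
 thus ?thesis using finV by (meson finite_Pow_iff finite_subset)
qed

lemma edgeE: assumes "e \<in> E" obtains a b where "e = {a, b}" "a \<noteq> b" "{a, b} \<in> E"
proof -
 have "card e = 2" using simple assms by (auto simp: simple_graph_def)
 then obtain a b where "e = {a, b}" "a \<noteq> b" by (auto simp: card_2_iff)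
 thus thesis using that assms by auto
qed

lemma finD: "finite D"
proof -
 have "D \<subseteq> V \<times> V" using edgeD by auto
 thus ?thesis using finV finite_subset by blast
qed

lemma finN: "finite (neighbours E v)"
proof -
 have "neighbours E v \<subseteq> V" using edgeD by (auto simp: neighbours_def)
 thus ?thesis using finV finite_subset by blast
qed

lemma rho_in: "{v, u} \<in> E \<Longrightarrow> {v, \<rho> v u} \<in> E"
 using rot edgeD[of v u] unfolding rotation_system_def by auto

lemma rho_ne: "{v, u} \<in> E \<Longrightarrow> \<rho> v u \<noteq> v"
 using edgeD(1)[OF rho_in, of v u] by auto

lemma rho_closed:
 assumes "v \<in> V" "S \<subseteq> neighbours E v" "x \<in> S" "\<And>y. y \<in> S \<Longrightarrow> \<rho> v y \<in> S"
 shows "S = neighbours E v"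
proof -
 have "S \<noteq> {}" "\<rho> v ` S \<subseteq> S" using assms by auto
 thus ?thesis using rot assms(1,2) unfolding rotation_system_def by blast
qed

text \<open>The image of the neighbours is again closed under \<open>\<rho> v\<close>, so it is all
  of them; by finiteness this also yields \<open>rho_inj\<close>.\<close>

lemma rho_surj: assumes "v \<in> V" shows "\<rho> v ` neighbours E v = neighbours E v"
proof (cases "neighbours E v = {}")
 case False
 then obtain x where x: "{v, x} \<in> E" by (auto simp: neighbours_def)
 show ?thesis
  by (rule rho_closed[OF assms, where x = "\<rho> v x"]) (use x rho_in in \<open>auto simp: neighbours_def\<close>)
qed simp

lemma rho_inj: assumes "v \<in> V" shows "inj_on (\<rho> v) (neighbours E v)"
 using rho_surj[OF assms] finN by (metis eq_card_imp_inj_on)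

lemma f_in: "d \<in> D \<Longrightarrow> f d \<in> D"
 using rho_in by (cases d) (auto simp: insert_commute)

lemma f_inj: "inj_on f D"
proof (rule inj_onI)
 fix d d' assume d: "d \<in> D" "d' \<in> D" "f d = f d'"
 obtain a b a' b' where ab: "d = (a, b)" "d' = (a', b')" by (cases d, cases d') auto
 have "b = b'" "\<rho> b a = \<rho> b a'" using d ab by auto
 thus "d = d'" using rho_inj[of b] d ab edgeD[of a b] unfolding inj_on_def
  by (auto simp: insert_commute)
qed

lemma f_image: assumes "S \<subseteq> D" "f ` S \<subseteq> S" shows "f ` S = S"
 using assms f_inj finD by (meson endo_inj_surj finite_subset inj_on_subset)

text \<open>\<open>f\<close> permutes the finite set \<open>D\<close>, so a set closed under
  \<open>f\<close> is mapped onto itself and nothing from outside can enter it. Complements of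
  unions of faces are thus unions of faces.\<close>

lemma f_compl: assumes "S \<subseteq> D" "f ` S \<subseteq> S" "d \<in> D - S" shows "f d \<in> D - S"
proof -
 have "f d \<in> D" using assms f_in by auto
 moreover have "f d \<notin> S"
 proof
  assume "f d \<in> S"
  then obtain d' where "d' \<in> S" "f d' = f d" using f_image[OF assms(1,2)] by (metis imageE)
  thus False using assms f_inj by (metis DiffE inj_on_def subsetD)
 qed
 ultimately show ?thesis by simp
qed

lemma face_sub: assumes "S \<subseteq> D" "f ` S \<subseteq> S" "d \<in> S" shows "face d \<subseteq> S"
proof
 fix x assume "x \<in> face d" thus "x \<in> S" by induction (use assms in auto)
qed

lemma face_D: "d \<in> D \<Longrightarrow> face d \<subseteq> D"
 by (rule face_sub) (use f_in in \<open>simp_all add: image_subset_iff\<close>)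

text \<open>\<open>orbit\<close> starts at \<open>f d\<close>, so \<open>d\<close> has to be shown
  to return: otherwise \<open>f_compl\<close> would keep \<open>f d\<close> out of its own
  orbit.\<close>

lemma face_self: assumes "d \<in> D" shows "d \<in> face d"
proof -
 have c: "f ` face d \<subseteq> face d" by (rule image_subsetI) (rule orbit.step)
 show ?thesis
  using f_compl[OF face_D[OF assms] c, of d] assms orbit.base[of f d] by auto
qed

lemma face_step_eq: "d \<in> D \<Longrightarrow> face (f d) = face d"
 by (simp add: face_self self_in_orbit_step)

lemma face_eq: assumes "d \<in> D" "d' \<in> face d" shows "face d' = face d"
 using assms(2)
proof induction
 case base show ?case using face_step_eq[OF assms(1)] .
next
 case (step y)
 hence "y \<in> D" using face_D[OF assms(1)] by auto
 thus ?case using step face_step_eq by simp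
qed

lemma is_face_iff: "is_face E \<rho> Q \<longleftrightarrow> (\<exists>d\<in>D. Q = face d)"
proof -
 have "\<exists>u v. {u, v} \<in> E \<and> Q = face (u, v)" if "d \<in> D" "Q = face d" for d
  using that by (intro exI[of _ "fst d"] exI[of _ "snd d"]) (auto simp: darts_def)
 thus ?thesis unfolding is_face_def by auto
qed

lemma faces_eq: "{Q. is_face E \<rho> Q} = face ` D"
 using is_face_iff by auto

lemma card_D: "card (darts E') = 2 * card E'" if "E' \<subseteq> E" for E'
proof -
 have fin: "finite E'" using that finE finite_subset by auto
 have U: "darts E' = (\<Union>e\<in>E'. {d. {fst d, snd d} = e})" by auto
 have c: "card {d. {fst d, snd d} = e} = 2 \<and> finite {d. {fst d, snd d} = e}" if "e \<in> E'" for e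
 proof -
  have "e \<in> E" using that \<open>E' \<subseteq> E\<close> by auto
  then obtain a b where ab: "e = {a, b}" "a \<noteq> b" by (rule edgeE)
  have "{d. {fst d, snd d} = e} = {(a, b), (b, a)}" using ab by (auto simp: doubleton_eq_iff)
  thus ?thesis using ab by simp
 qed
 have "card (darts E') = (\<Sum>e\<in>E'. card {d. {fst d, snd d} = e})"
  unfolding U by (rule card_UN_disjoint) (use fin c in auto)
 also have "\<dots> = (\<Sum>e\<in>E'. 2)" by (rule sum.cong) (use c in auto)
 finally have "card (darts E') = (\<Sum>e\<in>E'. 2)" .
 thus ?thesis by simp
qed

text \<open>\<open>f\<close> maps the darts of \<open>S\<close> entering \<open>z\<close>
  bijectively to those leaving \<open>z\<close>: a union of faces is a circulation. The counts in
  \<open>reach_face_count\<close> and \<open>outer_darts_ge_3\<close> rest on this.\<close>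

lemma balance: assumes "S \<subseteq> D" "f ` S \<subseteq> S"
 shows "card {d\<in>S. snd d = z} = card {d\<in>S. fst d = z}"
proof -
 have im: "f ` {d\<in>S. snd d = z} = {d\<in>S. fst d = z}"
 proof
  show "f ` {d\<in>S. snd d = z} \<subseteq> {d\<in>S. fst d = z}"
  proof (rule image_subsetI)
   fix d assume "d \<in> {d\<in>S. snd d = z}"
   hence "f d \<in> S" "fst (f d) = z" using assms(2) by (blast, cases d, simp)
   thus "f d \<in> {d\<in>S. fst d = z}" by simp
  qed
  show "{d\<in>S. fst d = z} \<subseteq> f ` {d\<in>S. snd d = z}"
  proof
   fix d assume d: "d \<in> {d\<in>S. fst d = z}"
   then obtain d' where "d' \<in> S" "d = f d'" using f_image[OF assms] by blast
   moreover have "snd d' = z" using d \<open>d = f d'\<close> by (cases d') auto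
   ultimately show "d \<in> f ` {d\<in>S. snd d = z}" by blast
  qed
 qed
 have "inj_on f {d\<in>S. snd d = z}"
  by (rule inj_on_subset[OF f_inj]) (use assms(1) in \<open>blast\<close>)
 from card_image[OF this] show ?thesis unfolding im by (rule sym)
qed

lemma card_by_faces: assumes "S \<subseteq> D" "f ` S \<subseteq> S" "\<And>d. d \<in> S \<Longrightarrow> k \<le> card (face d)"
 shows "k * card (face ` S) \<le> card S"
proof -
 have fs: "finite S" using assms(1) finD finite_subset by auto
 have U: "\<Union>(face ` S) = S"
 proof
  show "\<Union>(face ` S) \<subseteq> S" using face_sub[OF assms(1,2)] by auto
  show "S \<subseteq> \<Union>(face ` S)" using face_self assms(1) by blast
 qed
 have "card (\<Union>(face ` S)) = sum card (face ` S)"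
 proof (rule card_Union_disjoint)
  show "pairwise disjnt (face ` S)"
   unfolding pairwise_def disjnt_def
  proof (clarify)
   fix d d' assume d: "d \<in> S" "d' \<in> S" "face d \<noteq> face d'"
   show "face d \<inter> face d' = {}"
   proof (rule ccontr)
    assume "face d \<inter> face d' \<noteq> {}"
    then obtain x where "x \<in> face d" "x \<in> face d'" by auto
    thus False using face_eq d assms(1) by (metis subsetD)
   qed
  qed
  show "finite A" if "A \<in> face ` S" for A using that U fs by (metis Union_upper finite_subset)
 qed
 hence "card S = sum card (face ` S)" using U by simp
 also have "\<dots> \<ge> (\<Sum>Q\<in>face ` S. k)" by (rule sum_mono) (use assms(3) in auto)
 finally show ?thesis by (simp add: mult.commute)
qed

end

subsection \<open>Laman graphs and tight sets\<close>

text \<open>A spanning forest hanging from \<open>X\<close>, given by parents and a rank that falls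
  towards the parent; the counts below need no other notion of a tree. It exists because a largest
  set carrying such a forest can be enlarged along a crossing edge unless it is all of
  \<open>V\<close>.\<close>

lemma parent_function:
 assumes "finite V" "X \<subseteq> V"
  and cross: "\<And>S. X \<subseteq> S \<Longrightarrow> S \<subset> V \<Longrightarrow> \<exists>y\<in>S. \<exists>z\<in>V - S. {y, z} \<in> E"
 obtains par and r :: "'a \<Rightarrow> nat"
  where "\<And>z. z \<in> V - X \<Longrightarrow> par z \<in> V \<and> {z, par z} \<in> E \<and> r (par z) < r z"
proof -
 define P where "P S \<longleftrightarrow> X \<subseteq> S \<and> S \<subseteq> V \<and>
  (\<exists>par (r :: 'a \<Rightarrow> nat). \<forall>z\<in>S - X. par z \<in> S \<and> {z, par z} \<in> E \<and> r (par z) < r z)" for S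
 have "P X" unfolding P_def using assms by auto
 moreover have "\<forall>S. P S \<longrightarrow> card S < Suc (card V)"
  unfolding P_def using assms(1) by (auto simp: less_Suc_eq_le card_mono)
 ultimately obtain S where S: "P S" "\<And>S'. P S' \<Longrightarrow> card S' \<le> card S"
  using ex_has_greatest_nat[of P X card "Suc (card V)"] by blast
 have "S = V"
 proof (rule ccontr)
  assume "S \<noteq> V"
  hence SV: "X \<subseteq> S" "S \<subset> V" using S(1) unfolding P_def by auto
  then obtain y z where yz: "y \<in> S" "z \<in> V - S" "{y, z} \<in> E" using cross by blast
  obtain par and r :: "'a \<Rightarrow> nat"
   where pr: "\<forall>z\<in>S - X. par z \<in> S \<and> {z, par z} \<in> E \<and> r (par z) < r z"
   using S(1) unfolding P_def by auto
  let ?par = "par(z := y)" and ?r = "r(z := Suc (r y))"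
  have "\<forall>x\<in>insert z S - X. ?par x \<in> insert z S \<and> {x, ?par x} \<in> E \<and> ?r (?par x) < ?r x"
   using pr yz by (auto simp: insert_commute)
  hence "P (insert z S)" unfolding P_def using SV yz by blast
  moreover have "card (insert z S) = Suc (card S)"
   using yz SV assms(1) by (meson DiffD2 card_insert_disjoint finite_subset psubset_imp_subset)
  ultimately show False using S(2) by fastforce
 qed
 thus thesis using S(1) that unfolding P_def by blast
qed

text \<open>An edge to the parent determines its child, since two vertices cannot each have smaller
  rank than the other. So the forest has one edge per non-root.\<close>

lemma parent_edges:
 assumes "finite A" and par: "\<And>z. z \<in> A \<Longrightarrow> r (par z) < (r z :: nat)"
 shows "inj_on (\<lambda>z. {z, par z}) A" "card ((\<lambda>z. {z, par z}) ` A) = card A"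
proof -
 show i: "inj_on (\<lambda>z. {z, par z}) A"
 proof (rule inj_onI)
  fix z z' assume z: "z \<in> A" "z' \<in> A" "{z, par z} = {z', par z'}"
  show "z = z'"
  proof (rule ccontr)
   assume "z \<noteq> z'"
   hence "z = par z'" "z' = par z" using z by (auto simp: doubleton_eq_iff)
   thus False using par z by (metis less_asym)
  qed
 qed
 show "card ((\<lambda>z. {z, par z}) ` A) = card A" by (rule card_image[OF i])
qed

text \<open>A connected multigraph with nodes \<open>Q\<close> and edges \<open>K\<close> has a
  spanning tree. The ends are given by functions \<open>s1\<close> and \<open>s2\<close> because in
  the application the elements of \<open>K\<close> are edges of the graph and the nodes are the
  faces on their two sides.\<close>

lemma card_le_connecting_edges:
 fixes s1 s2 :: "'e \<Rightarrow> 'q"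
 assumes "finite Q" "finite K" "q0 \<in> Q"
  and cross: "\<And>S. q0 \<in> S \<Longrightarrow> S \<subset> Q \<Longrightarrow>
   \<exists>e\<in>K. (s1 e \<in> S \<and> s2 e \<in> Q - S) \<or> (s2 e \<in> S \<and> s1 e \<in> Q - S)"
 shows "card Q \<le> card K + 1"
proof -
 let ?E = "(\<lambda>e. {s1 e, s2 e}) ` K"
 have c: "\<exists>y\<in>S. \<exists>z\<in>Q - S. {y, z} \<in> ?E" if q: "{q0} \<subseteq> S" "S \<subset> Q" for S
 proof -
  obtain e where e: "e \<in> K" "(s1 e \<in> S \<and> s2 e \<in> Q - S) \<or> (s2 e \<in> S \<and> s1 e \<in> Q - S)"
   using cross[OF _ q(2)] q(1) by blast
  have m: "{s1 e, s2 e} \<in> ?E" "{s2 e, s1 e} \<in> ?E" using e(1) by (auto simp: insert_commute)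
  show ?thesis using e(2) m by blast
 qed
 obtain par and r :: "'q \<Rightarrow> nat"
  where pr: "\<And>z. z \<in> Q - {q0} \<Longrightarrow> par z \<in> Q \<and> {z, par z} \<in> ?E \<and> r (par z) < r z"
 proof (rule parent_function[OF assms(1), of "{q0}" ?E])
  show "{q0} \<subseteq> Q" using assms(3) by simp
  show "\<exists>y\<in>S. \<exists>z\<in>Q - S. {y, z} \<in> ?E" if "{q0} \<subseteq> S" "S \<subset> Q" for S by (rule c[OF that])
 qed blast
 have "card (Q - {q0}) = card ((\<lambda>z. {z, par z}) ` (Q - {q0}))"
  using parent_edges(2)[of "Q - {q0}" r par] assms(1) pr by simp
 also have "\<dots> \<le> card ?E"
  by (rule card_mono) (use pr assms(2) in \<open>auto simp del: insert_iff\<close>)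
 also have "\<dots> \<le> card K" using assms(2) by (rule card_image_le)
 finally show ?thesis using assms by (simp add: card_Diff_singleton_if)
qed

section \<open>Regions of the dual graph\<close>

context comb_map
begin

text \<open>The dual graph in which only edges of \<open>K\<close> may be crossed, explored dart by
  dart: \<open>step\<close> goes on along a face, \<open>swap\<close> passes through an edge into
  the face on its other side.\<close>

inductive_set reach :: "'a set set \<Rightarrow> 'a \<times> 'a \<Rightarrow> ('a \<times> 'a) set" for K d0 where
 base: "d0 \<in> reach K d0"
| step: "d \<in> reach K d0 \<Longrightarrow> f d \<in> reach K d0"
| swap: "(a, b) \<in> reach K d0 \<Longrightarrow> {a, b} \<in> K \<Longrightarrow> (b, a) \<in> reach K d0"

definition crossing_closed :: "'a set set \<Rightarrow> ('a \<times> 'a) set \<Rightarrow> bool" where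
 "crossing_closed K S \<longleftrightarrow> S \<subseteq> D \<and> f ` S \<subseteq> S \<and> (\<forall>a b. (a, b) \<in> S \<longrightarrow> {a, b} \<in> K \<longrightarrow> (b, a) \<in> S)"

lemma reach_closed: assumes "d0 \<in> D" shows "crossing_closed K (reach K d0)"
proof -
 have "d \<in> D" if "d \<in> reach K d0" for d
  using that
 proof induction
  case (step d) thus ?case using f_in by blast
 qed (use assms in \<open>auto simp: insert_commute\<close>)
 thus ?thesis unfolding crossing_closed_def
  using reach.step reach.swap by blast
qed

lemma reach_sub: assumes "crossing_closed K S" "d0 \<in> S" shows "reach K d0 \<subseteq> S"
proof
 fix d assume "d \<in> reach K d0" thus "d \<in> S"
  by induction (use assms in \<open>auto simp: crossing_closed_def\<close>)
qed

lemma closed_compl: assumes "crossing_closed K S" shows "crossing_closed K (D - S)"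
proof -
 have "f ` (D - S) \<subseteq> D - S"
  using f_compl[of S] assms unfolding crossing_closed_def by blast
 moreover have "(b, a) \<in> D - S" if "(a, b) \<in> D - S" "{a, b} \<in> K" for a b
  using that assms unfolding crossing_closed_def by (auto simp: insert_commute)
 ultimately show ?thesis unfolding crossing_closed_def by blast
qed

text \<open>The complement of a region closed under crossing is closed as well, so a region missing
  \<open>d0\<close> cannot be entered from \<open>d0\<close>.\<close>

lemma reach_sym: assumes "d0 \<in> D" "d \<in> reach K d0" shows "d0 \<in> reach K d"
proof (rule ccontr)
 have dD: "d \<in> D" using reach_closed[OF assms(1)] assms(2) unfolding crossing_closed_def by blast
 assume "d0 \<notin> reach K d"
 hence "reach K d0 \<subseteq> D - reach K d"
  using reach_sub[OF closed_compl[OF reach_closed[OF dD]]] assms(1) by blast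
 thus False using assms(2) reach.base[of d K] by blast
qed

lemma closed_face: "crossing_closed K S \<Longrightarrow> d \<in> S \<Longrightarrow> face d \<subseteq> S"
 using face_sub by (auto simp: crossing_closed_def)

text \<open>If all edges at \<open>z\<close> may be crossed, a region touching \<open>z\<close> goes
  all the way round \<open>z\<close>: a step along a face gives a dart leaving \<open>z\<close>, a
  swap turns it into one entering \<open>z\<close>, and the rotation at \<open>z\<close> is a single
  cycle.\<close>

lemma closed_vertex:
 assumes S: "crossing_closed K S" and z: "z \<in> V" and K: "\<And>y. {z, y} \<in> E \<Longrightarrow> {z, y} \<in> K"
  and d: "(x, z) \<in> S \<or> (z, x) \<in> S" and y: "{z, y} \<in> E"
 shows "(y, z) \<in> S" "(z, y) \<in> S"
proof -
 have sw: "(y, z) \<in> S \<longleftrightarrow> (z, y) \<in> S" for y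
 proof
  assume a: "(y, z) \<in> S"
  hence "{y, z} \<in> E" using S by (auto simp: crossing_closed_def)
  thus "(z, y) \<in> S" using a S K[of y] unfolding crossing_closed_def by (simp add: insert_commute)
 next
  assume a: "(z, y) \<in> S"
  hence "{z, y} \<in> E" using S by (auto simp: crossing_closed_def)
  thus "(y, z) \<in> S" using a S K[of y] unfolding crossing_closed_def by (simp add: insert_commute)
 qed
 let ?N = "{y\<in>neighbours E z. (y, z) \<in> S}"
 have "?N = neighbours E z"
 proof (rule rho_closed[OF z, where x = x])
  have "(x, z) \<in> S" using d sw by auto
  thus "x \<in> ?N" using S by (auto simp: crossing_closed_def insert_commute)
  fix y assume y: "y \<in> ?N"
  hence "f (y, z) \<in> S" using S unfolding crossing_closed_def by blast
  thus "\<rho> z y \<in> ?N" using sw rho_in y by auto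
 qed auto
 hence "(y, z) \<in> S" using y by (auto simp: neighbours_def)
 thus "(y, z) \<in> S" "(z, y) \<in> S" using sw by auto
qed

end

section \<open>Sparsity and tight sets\<close>

lemma tightD: "tight V E X \<Longrightarrow> X \<subseteq> V" "tight V E X \<Longrightarrow> 2 \<le> card X"
 "tight V E X \<Longrightarrow> card (edges_in E X) = 2 * card X - 3"
 by (auto simp: tight_def)

lemma blockerD: assumes "blocker V E v u t X"
 shows "tight V E X" "v \<in> X" "u \<in> X" "t \<notin> X" "3 \<le> card X" "X \<subseteq> V"
 using assms by (auto simp: blocker_def tight_def)

locale laman_map = comb_map +
 assumes laman: "laman V E"
begin

lemma cardV: "2 \<le> card V" and cardE: "card E = 2 * card V - 3"
 using laman by (auto simp: laman_def)

lemma sparse: "S \<subseteq> V \<Longrightarrow> 2 \<le> card S \<Longrightarrow> card (edges_in E S) \<le> 2 * card S - 3"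
 using laman unfolding laman_def edges_in_def by blast

lemma edges_in_single: assumes "card S \<le> 1" "S \<subseteq> V" shows "edges_in E S = {}"
proof -
 have fS: "finite S" using assms(2) finV finite_subset by auto
 have False if "e \<in> E" "e \<subseteq> S" for e
  using card_mono[OF fS that(2)] simple that(1) assms(1) by (auto simp: simple_graph_def)
 thus ?thesis unfolding edges_in_def by blast
qed

text \<open>The bound 2k-2 in place of 2k-3 also covers single vertices, so the two halves of a
  partition can be added without a case distinction.\<close>

lemma sparse': assumes "S \<subseteq> V" "S \<noteq> {}" shows "card (edges_in E S) + 2 \<le> 2 * card S"
proof (cases "2 \<le> card S")
 case True thus ?thesis using sparse[OF assms(1)] by linarith
next
 case False
 have "finite S" using assms finV finite_subset by auto
 hence "card S \<noteq> 0" using assms by auto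
 hence "card S = 1" using False by linarith
 thus ?thesis using edges_in_single[of S] assms by simp
qed

lemma fin_edges_in: "finite (edges_in E S)"
 using finE by (auto simp: edges_in_def)

lemma edges_in_V: "edges_in E V = E"
 using simple by (auto simp: edges_in_def simple_graph_def)

lemma tight_V: "tight V E V"
 using cardV cardE edges_in_V by (simp add: tight_def)

lemma finX: "X \<subseteq> V \<Longrightarrow> finite X"
 using finV finite_subset by auto

lemma edges_in_Int: "edges_in E X \<inter> edges_in E Y = edges_in E (X \<inter> Y)"
 by (auto simp: edges_in_def)

text \<open>Spanned edges are supermodular: those of \<open>X\<close> and \<open>Y\<close> add up to
  at most those of \<open>X \<union> Y\<close> and \<open>X \<inter> Y\<close>, while the vertex
  terms balance. So the union is tight, and no slack is left for an edge from \<open>X - Y\<close>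
  to \<open>Y - X\<close>.\<close>

lemma tight_Un:
 assumes X: "tight V E X" and Y: "tight V E Y" and c: "2 \<le> card (X \<inter> Y)"
 shows "tight V E (X \<union> Y)" "edges_in E (X \<union> Y) = edges_in E X \<union> edges_in E Y"
proof -
 have XY: "X \<subseteq> V" "Y \<subseteq> V" using X Y by (auto simp: tight_def)
 have fin: "finite X" "finite Y" using XY finX by auto
 have cu: "card (X \<union> Y) + card (X \<inter> Y) = card X + card Y" using card_Un_Int[OF fin] by simp
 have eu: "card (edges_in E X \<union> edges_in E Y) + card (edges_in E (X \<inter> Y)) =
   card (edges_in E X) + card (edges_in E Y)"
  using card_Un_Int[OF fin_edges_in fin_edges_in, of X Y] by (simp add: edges_in_Int)
 have i: "card (edges_in E (X \<inter> Y)) \<le> 2 * card (X \<inter> Y) - 3" using sparse[of "X \<inter> Y"] XY c by auto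
 have sub: "edges_in E X \<union> edges_in E Y \<subseteq> edges_in E (X \<union> Y)" by (auto simp: edges_in_def)
 have le: "card (edges_in E X \<union> edges_in E Y) \<le> card (edges_in E (X \<union> Y))"
  by (rule card_mono[OF fin_edges_in sub])
 have u2: "2 \<le> card (X \<union> Y)" using cu card_mono[OF fin(1), of "X \<inter> Y", OF Int_lower1] card_mono[OF fin(2), of "X \<inter> Y", OF Int_lower2] c by linarith
 have u: "card (edges_in E (X \<union> Y)) \<le> 2 * card (X \<union> Y) - 3" using sparse[of "X \<union> Y"] XY u2 by auto
 note n = cu eu i le u u2 c tightD[OF X] tightD[OF Y]
 have "card (edges_in E (X \<union> Y)) = 2 * card (X \<union> Y) - 3" using n by linarith
 thus "tight V E (X \<union> Y)" using XY u2 by (simp add: tight_def)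
 have "card (edges_in E X \<union> edges_in E Y) = card (edges_in E (X \<union> Y))" using n by linarith
 thus "edges_in E (X \<union> Y) = edges_in E X \<union> edges_in E Y"
  using card_subset_eq[OF fin_edges_in sub] by simp
qed

text \<open>Without an edge between the parts \<open>A\<close> and \<open>B\<close>, every edge lies
  in \<open>insert v A\<close> or in \<open>insert v B\<close>. The two sparsity bounds add up to
  2k-4, where k is the size of \<open>Y\<close>: one edge too few.\<close>

lemma tight_two_connected:
 assumes Y: "tight V E Y" and v: "v \<in> Y" and A: "A \<subseteq> Y - {v}" "A \<noteq> {}" "A \<noteq> Y - {v}"
 shows "\<exists>a\<in>A. \<exists>b\<in>Y - {v} - A. {a, b} \<in> E"
proof (rule ccontr)
 assume no: "\<not> ?thesis"
 define B where "B = Y - {v} - A"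
 have YV: "Y \<subseteq> V" using Y by (auto simp: tight_def)
 have fin: "finite A" "finite B" "finite Y" using YV A finX unfolding B_def by (auto intro: finite_subset)
 have Yeq: "Y = insert v (A \<union> B)" "A \<inter> B = {}" "v \<notin> A" "v \<notin> B" using v A B_def by auto
 have cY: "card Y = 1 + card A + card B"
  unfolding Yeq(1) using Yeq(2-4) fin by (simp add: card_Un_disjoint)
 have pos: "card A \<ge> 1" "card B \<ge> 1" using A fin unfolding B_def by (auto simp: Suc_le_eq card_gt_0_iff)
 have cA: "card (insert v A) = card A + 1" "card (insert v B) = card B + 1" using Yeq fin by auto
 have "edges_in E Y \<subseteq> edges_in E (insert v A) \<union> edges_in E (insert v B)"
 proof
  fix e assume e: "e \<in> edges_in E Y"
  then obtain a b where ab: "e = {a, b}" "{a, b} \<in> E" by (metis (no_types, lifting) edgeE edges_in_def mem_Collect_eq)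
  have "a \<in> Y" "b \<in> Y" using e ab by (auto simp: edges_in_def)
  thus "e \<in> edges_in E (insert v A) \<union> edges_in E (insert v B)"
   using no ab unfolding B_def edges_in_def by (auto simp: insert_commute)
 qed
 hence "card (edges_in E Y) \<le> card (edges_in E (insert v A)) + card (edges_in E (insert v B))"
  by (meson card_Un_le card_mono fin_edges_in finite_UnI le_trans)
 moreover have "card (edges_in E (insert v A)) \<le> 2 * card (insert v A) - 3"
  by (rule sparse) (use A YV v pos cA in auto)
 moreover have "card (edges_in E (insert v B)) \<le> 2 * card (insert v B) - 3"
  by (rule sparse) (use B_def YV v pos cA in auto)
 ultimately show False using cY cA pos tightD(3)[OF Y] by linarith
qed

text \<open>Two parts with no edge between them span at most 2n-4 edges together.\<close>

lemma connected:
 assumes "S \<subset> V" "S \<noteq> {}" shows "\<exists>y\<in>S. \<exists>z\<in>V - S. {y, z} \<in> E"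
proof (rule ccontr)
 assume no: "\<not> ?thesis"
 have "E \<subseteq> edges_in E S \<union> edges_in E (V - S)"
 proof
  fix e assume "e \<in> E"
  then obtain a b where ab: "e = {a, b}" "{a, b} \<in> E" by (metis edgeE)
  thus "e \<in> edges_in E S \<union> edges_in E (V - S)"
   using no edgeD[OF ab(2)] ab insert_commute[of a b "{}"] unfolding edges_in_def
   by (cases "a \<in> S"; cases "b \<in> S") (simp_all, metis Diff_iff)
 qed
 hence "card E \<le> card (edges_in E S) + card (edges_in E (V - S))"
  by (meson card_Un_le card_mono fin_edges_in finite_UnI le_trans)
 moreover have "card (edges_in E S) + 2 \<le> 2 * card S" by (rule sparse') (use assms in auto)
 moreover have "card (edges_in E (V - S)) + 2 \<le> 2 * card (V - S)" by (rule sparse') (use assms in auto)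
 moreover have "card V = card S + card (V - S)"
  using assms finV by (metis card_Diff_subset card_mono finX le_add_diff_inverse psubset_imp_subset)
 ultimately show False using cardE cardV by linarith
qed

text \<open>If \<open>x\<close> were the only neighbour that \<open>u\<close> may have in
  \<open>X\<close>, removing \<open>u\<close> would lose at most one edge but lower the bound by
  two.\<close>

lemma tight_degree:
 assumes X: "tight V E X" and c: "3 \<le> card X" and u: "u \<in> X" and x: "x \<in> X"
 shows "\<exists>y\<in>X. y \<noteq> x \<and> {u, y} \<in> E"
proof (rule ccontr)
 assume no: "\<not> ?thesis"
 have XV: "X \<subseteq> V" using X by (auto simp: tight_def)
 have "edges_in E X \<subseteq> insert {u, x} (edges_in E (X - {u}))"
 proof
  fix e assume e: "e \<in> edges_in E X"
  then obtain a b where ab: "e = {a, b}" "{a, b} \<in> E"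
   by (metis (no_types, lifting) edgeE edges_in_def mem_Collect_eq)
  hence "a \<in> X" "b \<in> X" using e by (auto simp: edges_in_def)
  thus "e \<in> insert {u, x} (edges_in E (X - {u}))"
   using no ab unfolding edges_in_def by (auto simp: insert_commute)
 qed
 hence "card (edges_in E X) \<le> card (insert {u, x} (edges_in E (X - {u})))"
  by (meson card_mono fin_edges_in finite_insert)
 also have "\<dots> \<le> Suc (card (edges_in E (X - {u})))" by (rule card_insert_le_m1) (auto simp: fin_edges_in)
 also have "card (edges_in E (X - {u})) \<le> 2 * card (X - {u}) - 3"
  by (rule sparse) (use XV u c finX[OF XV] in auto)
 also have "card (X - {u}) = card X - 1" using u finX[OF XV] by simp
 finally show False using tightD(3)[OF X] c by simp
qed

lemma blocker_Un:
 assumes X: "blocker V E v u t X" and Y: "tight V E Y" "t \<notin> Y" "v \<in> Y" "u \<in> Y" "v \<noteq> u"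
 shows "blocker V E v u t (X \<union> Y)"
proof -
 note b = blockerD[OF X]
 have f: "finite X" "finite Y" using b(6) Y(1) finX by (auto simp: tight_def)
 have "card {v, u} \<le> card (X \<inter> Y)" by (rule card_mono) (use f b Y in auto)
 hence "2 \<le> card (X \<inter> Y)" using Y by simp
 hence "tight V E (X \<union> Y)" using tight_Un b Y by blast
 moreover have "3 \<le> card (X \<union> Y)" using b(5) f by (meson card_mono finite_UnI le_trans sup_ge1)
 ultimately show ?thesis using b Y by (simp add: blocker_def)
qed

text \<open>By \<open>blocker_Un\<close> the blockers of one edge are closed under union, so one of
  largest size contains all the others.\<close>

lemma max_blocker:
 assumes "blocker V E v u t X0" "v \<noteq> u"
 obtains X where "blocker V E v u t X" "\<And>Y. blocker V E v u t Y \<Longrightarrow> Y \<subseteq> X"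
proof -
 have "\<forall>Y. blocker V E v u t Y \<longrightarrow> card Y < Suc (card V)"
  using blockerD(6) finV by (metis card_mono less_Suc_eq_le)
 then obtain X where X: "blocker V E v u t X" "\<And>Y. blocker V E v u t Y \<Longrightarrow> card Y \<le> card X"
  using ex_has_greatest_nat[of "blocker V E v u t" X0 card "Suc (card V)"] assms by blast
 have "Y \<subseteq> X" if "blocker V E v u t Y" for Y
 proof -
  have u: "blocker V E v u t (X \<union> Y)" using blocker_Un[OF X(1)] blockerD[OF that] assms(2) by blast
  have "X \<union> Y = X"
   using X(2)[OF u] finX[OF blockerD(6)[OF u]] by (metis card_seteq sup_ge1)
  thus ?thesis by auto
 qed
 thus thesis using that X(1) by blast
qed

text \<open>The third edge \<open>{t, v}\<close> of the triangle joins the two blockers without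
  lying in either of them, which \<open>tight_Un\<close> forbids as soon as they share two
  vertices.\<close>

lemma blockers_meet:
 assumes Y1: "blocker V E v u t Y1" and Y2: "blocker V E u t v Y2" and e: "{t, v} \<in> E"
 shows "Y1 \<inter> Y2 = {u}"
proof -
 note b = blockerD[OF Y1] blockerD[OF Y2]
 have f: "finite (Y1 \<inter> Y2)" using b finX by auto
 have "\<not> 2 \<le> card (Y1 \<inter> Y2)"
 proof
  assume "2 \<le> card (Y1 \<inter> Y2)"
  hence "edges_in E (Y1 \<union> Y2) = edges_in E Y1 \<union> edges_in E Y2" using tight_Un b by blast
  moreover have "{t, v} \<in> edges_in E (Y1 \<union> Y2)" using b e by (auto simp: edges_in_def)
  ultimately show False using b by (auto simp: edges_in_def)
 qed
 hence "card (Y1 \<inter> Y2) \<le> card {u}" by simp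
 thus ?thesis using card_seteq[OF f, of "{u}"] b by auto
qed

end

subsection \<open>A contractible triangular face\<close>

context comb_map
begin

lemma triangle_faceD:
 assumes "triangle_face E \<rho> v u t"
 shows "f (v, u) = (u, t)" "f (u, t) = (t, v)" "f (t, v) = (v, u)"
  "(v, u) \<in> D" "(u, t) \<in> D" "(t, v) \<in> D" "v \<noteq> u" "u \<noteq> t" "t \<noteq> v" "v \<in> V" "u \<in> V" "t \<in> V"
 using assms edgeD[of v u] edgeD[of u t] edgeD[of t v] by (auto simp: triangle_face_def)

lemma triangle_face_rotate: "triangle_face E \<rho> v u t \<Longrightarrow> triangle_face E \<rho> u t v"
 by (simp add: triangle_face_def)

lemma closed_triangle:
 assumes "triangle_face E \<rho> v u t" "crossing_closed K S"
 shows "(v, u) \<in> S \<longleftrightarrow> (u, t) \<in> S" "(u, t) \<in> S \<longleftrightarrow> (t, v) \<in> S"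
proof -
 note t = triangle_faceD[OF assms(1)]
 have c: "d \<in> S \<Longrightarrow> f d \<in> S" for d using assms(2) unfolding crossing_closed_def by blast
 show "(v, u) \<in> S \<longleftrightarrow> (u, t) \<in> S" "(u, t) \<in> S \<longleftrightarrow> (t, v) \<in> S"
  using c[of "(v, u)"] c[of "(u, t)"] c[of "(t, v)"] t by auto
qed

text \<open>A second neighbour of \<open>b\<close> keeps the face from turning back there, because
  \<open>{a}\<close> would be a closed set of neighbours. Three successive darts are then
  distinct.\<close>

lemma face_card_ge_3:
 assumes deg: "\<And>u x. u \<in> V \<Longrightarrow> \<exists>y. y \<noteq> x \<and> {u, y} \<in> E" and d: "d \<in> D"
 shows "3 \<le> card (face d)"
proof -
 obtain a b where ab: "d = (a, b)" "{a, b} \<in> E" using d by (cases d) auto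
 note e = edgeD[OF ab(2)]
 let ?c = "\<rho> b a"
 have bc: "{b, ?c} \<in> E" using rho_in[of b a] ab by (simp add: insert_commute)
 have ne: "?c \<noteq> a"
 proof
  assume "?c = a"
  hence "{a} = neighbours E b"
   by (intro rho_closed[of b "{a}" a]) (use e ab in \<open>auto simp: insert_commute\<close>)
  thus False using deg[OF e(3), of a] by (auto simp: neighbours_def)
 qed
 have dD: "(a, b) \<in> D" using ab by simp
 have "(a, b) \<in> face d" "(b, ?c) \<in> face d" "(?c, \<rho> ?c b) \<in> face d"
  using face_self[OF dD] ab orbit.step[of "(a, b)" f d] orbit.step[of "(b, ?c)" f d] by auto
 hence "{(a, b), (b, ?c), (?c, \<rho> ?c b)} \<subseteq> face d" by auto
 moreover have "finite (face d)" using face_D[OF d] finD finite_subset by blast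
 moreover have "card {(a, b), (b, ?c), (?c, \<rho> ?c b)} = 3"
  using ne e edgeD[OF bc] by simp
 ultimately show ?thesis using card_mono by metis
qed

text \<open>By injectivity of \<open>f\<close>, only the starting dart is left as the successor of
  the third one.\<close>

lemma triangle_from_face:
 assumes d: "(v, u) \<in> D" and c: "card (face (v, u)) = 3"
 obtains t where "triangle_face E \<rho> v u t" "face (v, u) = {(v, u), (u, t), (t, v)}"
proof -
 let ?d = "(v, u)"
 have self: "?d \<in> face ?d" by (rule face_self[OF d])
 have fin: "finite (face ?d)" using c card.infinite by fastforce
 let ?S = "{?d, f ?d, f (f ?d)}"
 have sub: "?S \<subseteq> face ?d" using self by (auto intro: orbit.intros simp del: face_step_simp)
 have DD: "face ?d \<subseteq> D" by (rule face_D[OF d])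
 have inj: "x \<in> face ?d \<Longrightarrow> y \<in> face ?d \<Longrightarrow> f x = f y \<Longrightarrow> x = y" for x y
  using f_inj DD unfolding inj_on_def by blast
 have "f (f (f ?d)) = ?d"
 proof -
  have n1: "f ?d \<noteq> ?d" using edgeD[of v u] d by auto
  have n2: "f (f ?d) \<noteq> ?d"
  proof
   assume a: "f (f ?d) = ?d"
   have "face ?d \<subseteq> {?d, f ?d}"
    by (rule face_sub) (use a DD sub in auto)
   hence "card (face ?d) \<le> card {?d, f ?d}" by (intro card_mono) auto
   also have "\<dots> \<le> 2" by (simp add: card_insert_if)
   finally show False using c by simp
  qed
  have n3: "f (f ?d) \<noteq> f ?d" using inj[of "f ?d" ?d] n1 sub by blast
  have "card ?S = 3" using n1 n2 n3 by auto
  hence "?S = face ?d" using card_subset_eq[OF fin sub] c by simp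
  moreover have "f (f (f ?d)) \<in> face ?d" using sub orbit.step[of "f (f ?d)" f ?d] by blast
  ultimately have "f (f (f ?d)) \<in> ?S" by simp
  moreover have "f (f (f ?d)) \<noteq> f ?d" using inj[of "f (f ?d)" ?d] sub n2 by blast
  moreover have "f (f (f ?d)) \<noteq> f (f ?d)" using inj[of "f (f ?d)" "f ?d"] sub n3 by blast
  ultimately show ?thesis by blast
 qed
 hence r: "\<rho> (\<rho> (\<rho> u v) u) (\<rho> u v) = u" "\<rho> (\<rho> u v) u = v" by auto
 let ?t = "\<rho> u v"
 have e: "{v, u} \<in> E" "{u, ?t} \<in> E" using d rho_in[of u v] by (auto simp: insert_commute)
 hence e3: "{?t, v} \<in> E" using rho_in[of ?t u] r by (auto simp: insert_commute)
 have tri: "triangle_face E \<rho> v u ?t" unfolding triangle_face_def using r e e3 by auto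
 have "face ?d \<subseteq> {(v, u), (u, ?t), (?t, v)}"
 proof (rule face_sub)
  show "{(v, u), (u, ?t), (?t, v)} \<subseteq> D" using triangle_faceD(4-6)[OF tri] by blast
  show "f ` {(v, u), (u, ?t), (?t, v)} \<subseteq> {(v, u), (u, ?t), (?t, v)}"
   by (simp only: image_insert image_empty triangle_faceD(1-3)[OF tri]) blast
 qed simp
 moreover have "{(v, u), (u, ?t), (?t, v)} \<subseteq> face ?d" using sub r by auto
 ultimately show thesis using that tri by blast
qed

end

section \<open>Faces reachable around a tight set\<close>

context laman_map
begin

text \<open>With k vertices in \<open>X\<close>, there are 2(n-k) edges not inside \<open>X\<close>,
  and a forest \<open>T\<close> hanging from \<open>X\<close> uses n-k of them. The other n-k edges
  \<open>L\<close> already connect the reachable faces: if a set of faces is closed under crossing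
  \<open>L\<close>, conservation of flow at the vertices, from the top of the forest down to
  \<open>X\<close>, makes it closed under crossing \<open>T\<close> as well.\<close>

lemma reach_face_count:
 assumes X: "tight V E X" and d0: "d0 \<in> D"
 shows "card (face ` reach (E - edges_in E X) d0) + card X \<le> card V + 1"
proof -
 let ?K = "E - edges_in E X"
 let ?R = "reach ?K d0"
 have XV: "X \<subseteq> V" using X by (simp add: tight_def)
 have Xne: "X \<noteq> {}" using tightD(2)[OF X] by auto
 obtain par and r :: "'a \<Rightarrow> nat"
  where pr: "\<And>z. z \<in> V - X \<Longrightarrow> par z \<in> V \<and> {z, par z} \<in> E \<and> r (par z) < r z"
 proof (rule parent_function[OF finV XV])
  show "\<exists>y\<in>S. \<exists>z\<in>V - S. {y, z} \<in> E" if "X \<subseteq> S" "S \<subset> V" for S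
   using connected[of S] that Xne by blast
 qed blast
 define T where "T = (\<lambda>z. {z, par z}) ` (V - X)"
 have TK: "T \<subseteq> ?K" using pr by (auto simp: T_def edges_in_def)
 have cT: "card T = card V - card X"
  unfolding T_def using parent_edges(2)[of "V - X" r par] finV pr XV
  by (simp add: card_Diff_subset finX)
 have le: "card X \<le> card V" using XV finV by (simp add: card_mono)
 have "card ?K = card E - card (edges_in E X)"
  by (rule card_Diff_subset[OF fin_edges_in]) (auto simp: edges_in_def)
 hence cK: "card ?K = 2 * (card V - card X)"
  using cardE tightD[OF X] le by (simp add: diff_mult_distrib2)
 define L where "L = ?K - T"
 have cL: "card L = card V - card X"
  unfolding L_def using card_Diff_subset[OF _ TK] cT cK finite_subset[OF TK] finE by simp
 \<comment> \<open>An edge is an unordered pair, so a direction is picked by \<open>SOME\<close>;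
   the symmetric disjunction in the connectivity claim covers either choice.\<close>
 define s1 where "s1 e = face (SOME d. d \<in> ?R \<and> {fst d, snd d} = e)" for e
 define s2 where "s2 e = face (prod.swap (SOME d. d \<in> ?R \<and> {fst d, snd d} = e))" for e
 have Rc: "crossing_closed ?K ?R" by (rule reach_closed[OF d0])
 have RD: "?R \<subseteq> D" using Rc by (simp add: crossing_closed_def)
 have "card (face ` ?R) \<le> card L + 1"
 proof (rule card_le_connecting_edges[where ?s1.0 = s1 and ?s2.0 = s2 and ?q0.0 = "face d0"])
  show "finite (face ` ?R)" using RD finD finite_subset by blast
  show "finite L" using finE by (simp add: L_def)
  show "face d0 \<in> face ` ?R" using reach.base by blast
  fix S assume S: "face d0 \<in> S" "S \<subset> face ` ?R"
  define S' where "S' = {d\<in>?R. face d \<in> S}"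
  have S'D: "S' \<subseteq> D" using RD by (auto simp: S'_def)
  have S'f: "f ` S' \<subseteq> S'"
  proof (rule image_subsetI)
   fix d assume "d \<in> S'"
   thus "f d \<in> S'" using face_step_eq[of d] RD reach.step[of d ?K d0] by (auto simp: S'_def)
  qed
  show "\<exists>e\<in>L. (s1 e \<in> S \<and> s2 e \<in> face ` ?R - S) \<or> (s2 e \<in> S \<and> s1 e \<in> face ` ?R - S)"
  proof (rule ccontr)
   assume no: "\<not> ?thesis"
   have Lc: "(b, a) \<in> S'" if ab: "(a, b) \<in> S'" "{a, b} \<in> L" for a b
   proof -
    let ?e = "{a, b}"
    define d where "d = (SOME d. d \<in> ?R \<and> {fst d, snd d} = ?e)"
    have "(a, b) \<in> ?R \<and> {fst (a, b), snd (a, b)} = ?e" using ab by (simp add: S'_def)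
    hence dd: "d \<in> ?R \<and> {fst d, snd d} = ?e" unfolding d_def by (rule someI)
    hence dc: "d = (a, b) \<or> d = (b, a)" by (cases d) (auto simp: doubleton_eq_iff)
    have r: "(a, b) \<in> ?R" "(b, a) \<in> ?R" using ab reach.swap[of a b] by (auto simp: S'_def L_def)
    have s: "s1 ?e = face d" "s2 ?e = face (prod.swap d)" unfolding s1_def s2_def d_def by simp_all
    have "face (a, b) \<in> S" using ab by (simp add: S'_def)
    hence "face (b, a) \<in> S" using no ab(2) dc s r by auto
    thus ?thesis using r by (simp add: S'_def)
   qed
   have Lc': "(a, b) \<in> S' \<longleftrightarrow> (b, a) \<in> S'" if "{a, b} \<in> L" for a b
    using Lc[of a b] Lc[of b a] that by (auto simp: insert_commute)
   \<comment> \<open>The vertices whose edge to the parent belongs to \<open>S'\<close> in one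
     direction only. At such a vertex of largest rank every other edge is balanced, as edges to
     children belong to vertices of larger rank and the remaining ones lie in \<open>L\<close>;
     \<open>balance\<close> then balances the edge to the parent too.\<close>
   define B where "B = {z\<in>V - X. ((z, par z) \<in> S') \<noteq> ((par z, z) \<in> S')}"
   have "B = {}"
   proof (rule ccontr)
    assume "B \<noteq> {}"
    moreover have "finite B" using finV by (simp add: B_def)
    ultimately obtain z where z: "z \<in> B" "\<And>y. y \<in> B \<Longrightarrow> r y \<le> r z"
     using Max_in[of "r ` B"] Max_ge[of "r ` B"] by (metis (no_types, lifting) finite_imageI image_iff image_is_empty)
    have zV: "z \<in> V - X" using z by (simp add: B_def)
    have sw: "(y, z) \<in> S' \<longleftrightarrow> (z, y) \<in> S'" if y: "y \<noteq> par z" for y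
    proof (cases "{y, z} \<in> E")
     case False
     thus ?thesis using S'D by (auto simp: insert_commute)
    next
     case e: True
     hence eK: "{y, z} \<in> ?K" using zV by (auto simp: edges_in_def)
     show ?thesis
     proof (cases "{y, z} \<in> T")
      case True
      then obtain z' where z': "z' \<in> V - X" "{y, z} = {z', par z'}" by (auto simp: T_def)
      hence "y = z'" "z = par z'" using y by (auto simp: doubleton_eq_iff)
      hence "r z < r y" "y \<in> V - X" "par y = z" using z' pr[of z'] by auto
      hence "y \<notin> B" using z(2)[of y] by auto
      thus ?thesis using \<open>y \<in> V - X\<close> \<open>par y = z\<close> by (auto simp: B_def)
     next
      case False
      thus ?thesis using Lc'[of y z] eK by (simp add: L_def)
     qed
    qed
    let ?I = "{d\<in>S'. snd d = z}" and ?O = "{d\<in>S'. fst d = z}"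
    have fin: "finite ?I" "finite ?O" using finite_subset[OF S'D finD] by auto
    have im: "prod.swap ` (?I - {(par z, z)}) = ?O - {(z, par z)}"
    proof
     show "prod.swap ` (?I - {(par z, z)}) \<subseteq> ?O - {(z, par z)}"
     proof (rule image_subsetI)
      fix d assume d: "d \<in> ?I - {(par z, z)}"
      obtain a where a: "d = (a, z)" using d by (cases d) auto
      thus "prod.swap d \<in> ?O - {(z, par z)}" using d sw[of a] by auto
     qed
     show "?O - {(z, par z)} \<subseteq> prod.swap ` (?I - {(par z, z)})"
     proof
      fix d assume d: "d \<in> ?O - {(z, par z)}"
      obtain b where b: "d = (z, b)" using d by (cases d) auto
      hence "(b, z) \<in> ?I - {(par z, z)}" using d sw[of b] by auto
      thus "d \<in> prod.swap ` (?I - {(par z, z)})" using b by force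
     qed
    qed
    have "card (prod.swap ` (?I - {(par z, z)})) = card (?I - {(par z, z)})"
     by (rule card_image[OF inj_on_subset[OF inj_swap subset_UNIV]])
    hence eq: "card (?I - {(par z, z)}) = card (?O - {(z, par z)})" unfolding im by (rule sym)
    have "card ?I = card ?O" by (rule balance[OF S'D S'f])
    moreover have "((z, par z) \<in> ?O) \<noteq> ((par z, z) \<in> ?I)" using z by (simp add: B_def)
    ultimately show False using eq fin card_Suc_Diff1[of ?I "(par z, z)"] card_Suc_Diff1[of ?O "(z, par z)"]
     by (cases "(z, par z) \<in> ?O") (simp_all del: mem_Collect_eq)
   qed
   have "crossing_closed ?K S'"
    unfolding crossing_closed_def
   proof (intro conjI allI impI S'D S'f)
    fix a b assume ab: "(a, b) \<in> S'" "{a, b} \<in> ?K"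
    show "(b, a) \<in> S'"
    proof (cases "{a, b} \<in> T")
     case True
     then obtain z where z: "z \<in> V - X" "{a, b} = {z, par z}" by (auto simp: T_def)
     hence "((z, par z) \<in> S') = ((par z, z) \<in> S')" using \<open>B = {}\<close> by (auto simp: B_def)
     thus ?thesis using z ab by (auto simp: doubleton_eq_iff)
    next
     case False thus ?thesis using ab Lc by (simp add: L_def)
    qed
   qed
   moreover have "d0 \<in> S'" using S(1) reach.base by (auto simp: S'_def)
   ultimately have "?R \<subseteq> S'" by (rule reach_sub)
   hence "face ` ?R \<subseteq> S" by (auto simp: S'_def simp del: split_paired_All)
   thus False using S(2) by blast
  qed
 qed
 thus ?thesis using cL le by linarith
qed

end

context laman_map
begin

lemma closed_all: assumes S: "crossing_closed E S" and ne: "S \<noteq> {}" shows "S = D"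
proof -
 have SD: "S \<subseteq> D" using S by (simp add: crossing_closed_def)
 let ?A = "{z\<in>V. \<exists>y. (y, z) \<in> S}"
 obtain a b where ab: "(a, b) \<in> S" using ne by auto
 hence "b \<in> V" using SD edgeD(3)[of a b] by auto
 hence "?A \<noteq> {}" using ab by blast
 have full: "(y, z) \<in> S \<and> (z, y) \<in> S" if "z \<in> ?A" "{z, y} \<in> E" for y z
  using closed_vertex[OF S, of z] that by blast
 have "?A = V"
 proof (rule ccontr)
  assume "?A \<noteq> V"
  then obtain y z where "y \<in> ?A" "z \<in> V - ?A" "{y, z} \<in> E"
   using connected[of ?A] \<open>?A \<noteq> {}\<close> by blast
  thus False using full[of y z] by blast
 qed
 hence "d \<in> S" if "d \<in> D" for d
  using full[of "snd d" "fst d"] edgeD[of "fst d" "snd d"] that by (auto simp: darts_def insert_commute)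
 thus ?thesis using SD by blast
qed

text \<open>Without \<open>w\<close> the tight set \<open>Y'\<close> is still connected, so a region
  touching it at \<open>p\<close> spreads over all of \<open>Y' - {w}\<close>: these vertices are
  not in \<open>Y\<close>, hence every edge at them may be crossed.\<close>

lemma closed_tight:
 assumes S: "crossing_closed (E - edges_in E Y) S" and Y': "tight V E Y'" and w: "w \<in> Y'"
  and dis: "(Y' - {w}) \<inter> Y = {}" and p: "p \<in> Y' - {w}" and d: "(x, p) \<in> S \<or> (p, x) \<in> S"
  and a: "a \<in> Y' - {w}" and ab: "{a, b} \<in> E"
 shows "(a, b) \<in> S \<and> (b, a) \<in> S"
proof -
 let ?A = "{a\<in>Y' - {w}. \<forall>b. {a, b} \<in> E \<longrightarrow> (a, b) \<in> S \<and> (b, a) \<in> S}"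
 have Y'V: "Y' \<subseteq> V" using Y' by (simp add: tight_def)
 have v: "a \<in> ?A" if "a \<in> Y' - {w}" "(x, a) \<in> S \<or> (a, x) \<in> S" for a x
 proof -
  have "\<And>y. {a, y} \<in> E \<Longrightarrow> {a, y} \<in> E - edges_in E Y" using that dis by (auto simp: edges_in_def)
  hence "(a, b) \<in> S \<and> (b, a) \<in> S" if "{a, b} \<in> E" for b
   using closed_vertex[OF S, of a x b] \<open>a \<in> Y' - {w}\<close> Y'V \<open>(x, a) \<in> S \<or> (a, x) \<in> S\<close> that by blast
  thus ?thesis using that by blast
 qed
 have "?A = Y' - {w}"
 proof (rule ccontr)
  assume "?A \<noteq> Y' - {w}"
  moreover have "p \<in> ?A" using v[OF p d] .
  ultimately obtain a b where "a \<in> ?A" "b \<in> Y' - {w} - ?A" "{a, b} \<in> E"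
   using tight_two_connected[OF Y' w, of ?A] by blast
  thus False using v[of b a] by blast
 qed
 thus ?thesis using a ab by blast
qed

text \<open>The blockers share only \<open>u\<close>, so each of them lies, except for
  \<open>u\<close>, in the region that the triangle reaches when the other one is the barrier. A
  dart outside both regions therefore never meets a barrier: the set \<open>N\<close> of these darts
  is closed under crossing every edge. A non-empty \<open>N\<close> would be all of
  \<open>D\<close>, but the triangle is not in it.\<close>

lemma one_blocker_good:
 assumes tri: "triangle_face E \<rho> v u t" and d0: "d0 \<in> D"
  and Y1: "blocker V E v u t Y1" and Y2: "blocker V E u t v Y2"
 shows "d0 \<in> reach (E - edges_in E Y1) (v, u) \<or> d0 \<in> reach (E - edges_in E Y2) (v, u)"
proof (rule ccontr)
 let ?R1 = "reach (E - edges_in E Y1) (v, u)" and ?R2 = "reach (E - edges_in E Y2) (v, u)"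
 assume no: "\<not> ?thesis"
 note t = triangle_faceD[OF tri]
 note b1 = blockerD[OF Y1] and b2 = blockerD[OF Y2]
 have meet: "Y1 \<inter> Y2 = {u}" using blockers_meet[OF Y1 Y2] t by simp
 have c: "crossing_closed (E - edges_in E Y1) ?R1" "crossing_closed (E - edges_in E Y2) ?R2"
  by (rule reach_closed[OF t(4)])+
 have in1: "(a, b) \<in> ?R1 \<and> (b, a) \<in> ?R1" if "a \<in> Y2 - {u}" "{a, b} \<in> E" for a b
 proof (rule closed_tight[OF c(1) b2(1) b2(2) _ _ _ that])
  show "(Y2 - {u}) \<inter> Y1 = {}" using meet by blast
  show "t \<in> Y2 - {u}" using b2 t by auto
  show "(u, t) \<in> ?R1 \<or> (t, u) \<in> ?R1" using closed_triangle[OF tri c(1)] reach.base by blast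
 qed
 have in2: "(a, b) \<in> ?R2 \<and> (b, a) \<in> ?R2" if "a \<in> Y1 - {u}" "{a, b} \<in> E" for a b
 proof (rule closed_tight[OF c(2) b1(1) b1(3) _ _ _ that])
  show "(Y1 - {u}) \<inter> Y2 = {}" using meet by blast
  show "v \<in> Y1 - {u}" using b1 t by auto
  show "(u, v) \<in> ?R2 \<or> (v, u) \<in> ?R2" using reach.base by blast
 qed
 define N where "N = (D - ?R1) \<inter> (D - ?R2)"
 note cN = closed_compl[OF c(1)] closed_compl[OF c(2)]
 have "crossing_closed E N"
  unfolding crossing_closed_def
 proof (intro conjI allI impI)
  show "N \<subseteq> D" by (auto simp: N_def)
  show "f ` N \<subseteq> N" using cN unfolding N_def crossing_closed_def by blast
  fix a b assume ab: "(a, b) \<in> N" "{a, b} \<in> E"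
  have e: "{a, b} \<notin> edges_in E Y1"
  proof
   assume "{a, b} \<in> edges_in E Y1"
   hence "a \<in> Y1 - {u} \<or> b \<in> Y1 - {u}" using edgeD(1)[OF ab(2)] by (auto simp: edges_in_def)
   hence "(a, b) \<in> ?R2" using in2[of a b] in2[of b a] ab by (auto simp: insert_commute)
   thus False using ab by (simp add: N_def)
  qed
  have e2: "{a, b} \<notin> edges_in E Y2"
  proof
   assume "{a, b} \<in> edges_in E Y2"
   hence "a \<in> Y2 - {u} \<or> b \<in> Y2 - {u}" using edgeD(1)[OF ab(2)] by (auto simp: edges_in_def)
   hence "(a, b) \<in> ?R1" using in1[of a b] in1[of b a] ab by (auto simp: insert_commute)
   thus False using ab by (simp add: N_def)
  qed
  show "(b, a) \<in> N" using e e2 ab cN unfolding N_def crossing_closed_def by blast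
 qed
 moreover have "d0 \<in> N" using no d0 by (simp add: N_def)
 ultimately have "N = D" using closed_all by blast
 thus False using t(4) reach.base unfolding N_def by blast
qed

lemma degree_ge_2: assumes "3 \<le> card V" "u \<in> V" shows "\<exists>y. y \<noteq> x \<and> {u, y} \<in> E"
proof (cases "x \<in> V")
 case True thus ?thesis using tight_degree[OF tight_V] assms by blast
next
 case False
 have "\<exists>y\<in>V. y \<noteq> u \<and> {u, y} \<in> E" using tight_degree[OF tight_V] assms by blast
 thus ?thesis using False by metis
qed

text \<open>The darts of \<open>X\<close> outside \<open>I\<close> form a circulation, as the
  difference of two circulations. One through \<open>(v, u)\<close> has at least three darts or
  consists of \<open>(v, u)\<close> and \<open>(u, v)\<close>. In the latter case all other darts at
  \<open>u\<close> on edges of \<open>X\<close> are in \<open>I\<close>, and turning round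
  \<open>u\<close> from one of them never leaves \<open>I\<close>, so \<open>(v, u)\<close> would be
  in \<open>I\<close> as well.\<close>

lemma outer_darts_ge_3:
 assumes X: "tight V E X" "3 \<le> card X" and I: "I \<subseteq> darts (edges_in E X)" "f ` I \<subseteq> I"
  and uv: "(v, u) \<in> darts (edges_in E X) - I"
 shows "3 \<le> card (darts (edges_in E X) - I)"
proof -
 let ?DX = "darts (edges_in E X)"
 let ?O = "?DX - I"
 have sub: "edges_in E X \<subseteq> E" by (auto simp: edges_in_def)
 have DXD: "?DX \<subseteq> D" using sub by auto
 have fin: "finite ?DX" using DXD finD finite_subset by auto
 have ID: "I \<subseteq> D" using I DXD by auto
 have bal: "card {d\<in>?O. snd d = z} = card {d\<in>?O. fst d = z}" for z
 proof -
  have im: "prod.swap ` {d\<in>?DX. snd d = z} = {d\<in>?DX. fst d = z}"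
  proof
   show "prod.swap ` {d\<in>?DX. snd d = z} \<subseteq> {d\<in>?DX. fst d = z}" by (auto simp: insert_commute)
   show "{d\<in>?DX. fst d = z} \<subseteq> prod.swap ` {d\<in>?DX. snd d = z}"
    by (auto simp: insert_commute image_iff)
  qed
  have "card (prod.swap ` {d\<in>?DX. snd d = z}) = card {d\<in>?DX. snd d = z}"
   by (rule card_image[OF inj_on_subset[OF inj_swap subset_UNIV]])
  hence a: "card {d\<in>?DX. snd d = z} = card {d\<in>?DX. fst d = z}" unfolding im by (rule sym)
  have b: "card {d\<in>I. snd d = z} = card {d\<in>I. fst d = z}" by (rule balance[OF ID I(2)])
  have diff: "card {d\<in>?O. P d} = card {d\<in>?DX. P d} - card {d\<in>I. P d}" for P
  proof -
   have eq: "{d\<in>?O. P d} = {d\<in>?DX. P d} - {d\<in>I. P d}" by blast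
   have "finite {d\<in>I. P d}" using finite_subset[OF I(1) fin] by simp
   moreover have "{d\<in>I. P d} \<subseteq> {d\<in>?DX. P d}" using I(1) by blast
   ultimately show ?thesis unfolding eq by (rule card_Diff_subset)
  qed
  note c = diff[of "\<lambda>d. snd d = z"] and d = diff[of "\<lambda>d. fst d = z"]
  show ?thesis using a b c d by simp
 qed
 have out: "\<exists>y. (b, y) \<in> ?O" if "(a, b) \<in> ?O" for a b
 proof -
  have "(a, b) \<in> {d\<in>?O. snd d = b}" using that by simp
  hence "card {d\<in>?O. snd d = b} \<noteq> 0" using fin by auto
  hence "{d\<in>?O. fst d = b} \<noteq> {}" using bal[of b] by (metis card.empty)
  thus ?thesis by auto
 qed
 have uvE: "{v, u} \<in> E" "u \<in> X" "v \<in> X" using uv by (auto simp: edges_in_def)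
 note e = edgeD[OF uvE(1)]
 obtain y where y: "(u, y) \<in> ?O" using out[OF uv] by blast
 obtain x where x: "(y, x) \<in> ?O" using out[OF y] by blast
 have fO: "finite ?O" using fin by simp
 have "\<exists>d1 d2 d3. {d1, d2, d3} \<subseteq> ?O \<and> d1 \<noteq> d2 \<and> d2 \<noteq> d3 \<and> d1 \<noteq> d3"
 proof (cases "y = v")
  case False
  have "u \<noteq> y" using y edgeD[of u y] by (auto simp: edges_in_def)
  thus ?thesis using False uv y x
   by (intro exI[of _ "(v, u)"] exI[of _ "(u, y)"] exI[of _ "(y, x)"]) auto
 next
  case True
  show ?thesis
  proof (cases "?O = {(v, u), (u, v)}")
   case False
   then obtain d where "d \<in> ?O" "d \<noteq> (v, u)" "d \<noteq> (u, v)" using uv y True by blast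
   thus ?thesis using uv y True e by (intro exI[of _ "(v, u)"] exI[of _ "(u, v)"] exI[of _ d]) auto
  next
   case O: True
   let ?S = "{y\<in>neighbours E u. (y, u) \<in> I}"
   obtain x where x: "x \<in> X" "x \<noteq> v" "{u, x} \<in> E" using tight_degree[OF X uvE(2,3)] by blast
   have xS: "x \<in> ?S"
   proof -
    have "(x, u) \<in> ?DX" using x uvE by (auto simp: edges_in_def insert_commute)
    moreover have "(x, u) \<notin> ?O" using x e unfolding O by auto
    ultimately show ?thesis using x by auto
   qed
   have "?S = neighbours E u"
   proof (rule rho_closed[OF e(3) _ xS])
    fix y assume y: "y \<in> ?S"
    hence "f (y, u) \<in> I" using I(2) by blast
    hence i: "(u, \<rho> u y) \<in> I" by simp
    hence DX: "(\<rho> u y, u) \<in> ?DX" using I(1) by (auto simp: insert_commute)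
    have "(u, v) \<notin> I" using O by auto
    hence "\<rho> u y \<noteq> v" using i by auto
    hence "(\<rho> u y, u) \<notin> ?O" unfolding O using e by auto
    thus "\<rho> u y \<in> ?S" using DX by (auto simp: edges_in_def insert_commute)
   qed auto
   thus ?thesis using uv uvE by (auto simp: neighbours_def insert_commute)
  qed
 qed
 then obtain d1 d2 d3 where d: "{d1, d2, d3} \<subseteq> ?O" "d1 \<noteq> d2" "d2 \<noteq> d3" "d1 \<noteq> d3" by blast
 have "card {d1, d2, d3} = 3" using d by simp
 thus ?thesis using card_mono[OF fO d(1)] by linarith
qed

end

section \<open>Existence of an unblocked edge\<close>

context laman_map
begin

text \<open>If all triangles are blocked, take one with a smallest maximal blocker \<open>X\<close>
  that does not cut the triangle off from the outer face. The part that \<open>X\<close> cuts off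
  has enough faces to contain another triangle. Two of the blockers of that triangle both contain
  \<open>u\<close> and \<open>v\<close>, although they share at most one vertex.\<close>

theorem unblocked_triangle:
 assumes euler: "card E + 2 \<le> card (face ` D) + card V" and n: "3 \<le> card V" and d0: "d0 \<in> D"
 shows "\<exists>v u t. triangle_face E \<rho> v u t \<and> (v, u) \<notin> face d0 \<and> (\<forall>X. \<not> blocker V E v u t X)"
proof (rule ccontr)
 assume neg: "\<not> ?thesis"
 have blocked: "\<exists>X. blocker V E v u t X" if "triangle_face E \<rho> v u t" "(v, u) \<notin> face d0" for v u t
  using neg that by blast
 let ?K = "\<lambda>X. E - edges_in E X"
 have ge3: "3 \<le> card (face d)" if "d \<in> D" for d by (rule face_card_ge_3[OF degree_ge_2[OF n] that])
 \<comment> \<open>The last clause puts the triangle on the same side of the barrier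
   \<open>X\<close> as the dart \<open>d0\<close> of the outer face. Maximality of \<open>X\<close>
   will force all darts on the other side onto edges of \<open>X\<close>.\<close>
 define P where "P v u t X \<longleftrightarrow> triangle_face E \<rho> v u t \<and> (v, u) \<notin> face d0 \<and> blocker V E v u t X \<and>
   (\<forall>Y. blocker V E v u t Y \<longrightarrow> Y \<subseteq> X) \<and> d0 \<in> reach (?K X) (v, u)" for v u t X
 have maxb: "\<exists>X. blocker V E v u t X \<and> (\<forall>Y. blocker V E v u t Y \<longrightarrow> Y \<subseteq> X)"
  if tri: "triangle_face E \<rho> v u t" "(v, u) \<notin> face d0" for v u t
 proof -
  obtain X0 where "blocker V E v u t X0" using blocked[OF tri] by blast
  then obtain X where "blocker V E v u t X" "\<And>Y. blocker V E v u t Y \<Longrightarrow> Y \<subseteq> X"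
   using max_blocker[OF _ triangle_faceD(7)[OF tri(1)]] by blast
  thus ?thesis by blast
 qed
 have fc: "crossing_closed {} (face d0)"
  unfolding crossing_closed_def using face_D[OF d0] orbit.step[of _ f d0] by (auto simp del: face_step_simp)
 have two_good: "\<exists>X Y v1 u1 t1 v2 u2 t2. P v1 u1 t1 X \<and> P v2 u2 t2 Y \<and>
   {v1, u1, t1} = {v, u, t} \<and> {v2, u2, t2} = {v, u, t} \<and> card (X \<inter> Y) \<le> 1"
  if tri: "triangle_face E \<rho> v u t" and nF: "(v, u) \<notin> face d0" for v u t
 proof -
  have tri2: "triangle_face E \<rho> u t v" and tri3: "triangle_face E \<rho> t v u"
   using tri triangle_face_rotate by blast+
  have nF2: "(u, t) \<notin> face d0" and nF3: "(t, v) \<notin> face d0"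
   using closed_triangle[OF tri fc] nF by auto
  obtain Y1 where Y1: "blocker V E v u t Y1" "\<forall>Y. blocker V E v u t Y \<longrightarrow> Y \<subseteq> Y1" using maxb[OF tri nF] by blast
  obtain Y2 where Y2: "blocker V E u t v Y2" "\<forall>Y. blocker V E u t v Y \<longrightarrow> Y \<subseteq> Y2" using maxb[OF tri2 nF2] by blast
  obtain Y3 where Y3: "blocker V E t v u Y3" "\<forall>Y. blocker V E t v u Y \<longrightarrow> Y \<subseteq> Y3" using maxb[OF tri3 nF3] by blast
  note t = triangle_faceD[OF tri]
  have r: "d0 \<in> reach K (v, u) \<longleftrightarrow> d0 \<in> reach K (u, t)" "d0 \<in> reach K (v, u) \<longleftrightarrow> d0 \<in> reach K (t, v)" for K
  proof -
   have c: "crossing_closed K (reach K d0)" by (rule reach_closed[OF d0])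
   have s: "d0 \<in> reach K d \<longleftrightarrow> d \<in> reach K d0" if "d \<in> D" for d
    using reach_sym[OF d0] reach_sym[OF that] by blast
   show "d0 \<in> reach K (v, u) \<longleftrightarrow> d0 \<in> reach K (u, t)" "d0 \<in> reach K (v, u) \<longleftrightarrow> d0 \<in> reach K (t, v)"
    using s t closed_triangle[OF tri c] by auto
  qed
  let ?g = "\<lambda>Y. d0 \<in> reach (?K Y) (v, u)"
  \<comment> \<open>Of any two of the three barriers at least one leaves \<open>d0\<close>
    reachable, so at least two of the three do.\<close>
  have g12: "?g Y1 \<or> ?g Y2" using one_blocker_good[OF tri d0 Y1(1) Y2(1)] .
  have g23: "?g Y2 \<or> ?g Y3" using one_blocker_good[OF tri2 d0 Y2(1) Y3(1)] r by auto
  have g31: "?g Y3 \<or> ?g Y1" using one_blocker_good[OF tri3 d0 Y3(1) Y1(1)] r by auto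
  have p1: "?g Y1 \<Longrightarrow> P v u t Y1" using tri nF Y1 by (simp add: P_def)
  have p2: "?g Y2 \<Longrightarrow> P u t v Y2" using tri2 nF2 Y2 r by (simp add: P_def)
  have p3: "?g Y3 \<Longrightarrow> P t v u Y3" using tri3 nF3 Y3 r by (simp add: P_def)
  have e: "{t, v} \<in> E" "{v, u} \<in> E" "{u, t} \<in> E" using t by auto
  have m: "card (Y1 \<inter> Y2) \<le> 1" "card (Y2 \<inter> Y3) \<le> 1" "card (Y3 \<inter> Y1) \<le> 1"
   using blockers_meet[OF Y1(1) Y2(1) e(1)] blockers_meet[OF Y2(1) Y3(1) e(2)]
    blockers_meet[OF Y3(1) Y1(1) e(3)] by auto
  have s: "{u, t, v} = {v, u, t}" "{t, v, u} = {v, u, t}" by auto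
  consider "?g Y1 \<and> ?g Y2" | "?g Y2 \<and> ?g Y3" | "?g Y3 \<and> ?g Y1" using g12 g23 g31 by blast
  thus ?thesis
  proof cases
   case 1 thus ?thesis using p1 p2 m(1) s by blast
  next
   case 2 thus ?thesis using p2 p3 m(2) s by blast
  next
   case 3 thus ?thesis using p3 p1 m(3) s by blast
  qed
 qed
 have cD: "card D = 4 * card V - 6" using card_D[of E] cardE by simp
 have f3: "face d = face (v, u)" if "d \<in> face (v, u)" "(v, u) \<in> D" for d v u using face_eq that by blast
 have ex_tri: "\<exists>v u t. triangle_face E \<rho> v u t \<and> (v, u) \<in> S"
  if S: "S \<subseteq> D" "f ` S \<subseteq> S" and c: "card S < 4 * card (face ` S)" for S
 proof -
  have "\<exists>d\<in>S. \<not> 4 \<le> card (face d)"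
  proof (rule ccontr)
   assume "\<not> ?thesis"
   hence "4 * card (face ` S) \<le> card S" by (intro card_by_faces[OF S]) blast
   thus False using c by simp
  qed
  then obtain v u where d: "(v, u) \<in> S" "\<not> 4 \<le> card (face (v, u))" by auto
  hence "(v, u) \<in> D" "card (face (v, u)) = 3" using ge3[of "(v, u)"] S by auto
  thus ?thesis using triangle_from_face[of v u] d(1) by metis
 qed
 have "\<exists>v u t X. P v u t X"
 proof -
  \<comment> \<open>At most 4n-9 darts and at least n-2 faces remain, so not every remaining face
    has four darts.\<close>
  let ?S = "D - face d0"
  have S: "?S \<subseteq> D" "f ` ?S \<subseteq> ?S" using closed_compl[OF fc] by (auto simp: crossing_closed_def)
  have fin: "finite (face d0)" using face_D[OF d0] finD finite_subset by blast
  have "card ?S = card D - card (face d0)" by (rule card_Diff_subset[OF fin face_D[OF d0]])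
  hence 1: "card ?S \<le> 4 * card V - 9" using ge3[OF d0] cD by linarith
  have "face ` D \<subseteq> insert (face d0) (face ` ?S)" using face_eq[OF d0] by blast
  hence "card (face ` D) \<le> card (insert (face d0) (face ` ?S))"
   using finD by (intro card_mono) auto
  also have "\<dots> \<le> Suc (card (face ` ?S))" using finD by (simp add: card_insert_if)
  finally have 2: "card (face ` ?S) + 2 \<ge> card V" using euler cardE n by linarith
  have "card ?S < 4 * card (face ` ?S)" using 1 2 n by linarith
  then obtain v u t where "triangle_face E \<rho> v u t" "(v, u) \<notin> face d0" using ex_tri[OF S] by blast
  thus ?thesis using two_good by blast
 qed
 then obtain v u t X where PX: "P v u t X"
  and min: "\<And>v' u' t' Y. P v' u' t' Y \<Longrightarrow> card X \<le> card Y"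
 proof -
  assume a: "\<And>v u t X. P v u t X \<Longrightarrow> (\<And>v' u' t' Y. P v' u' t' Y \<Longrightarrow> card X \<le> card Y) \<Longrightarrow> thesis"
  assume "\<exists>v u t X. P v u t X"
  hence "\<exists>X. (\<exists>v u t. P v u t X)" by blast
  then obtain X where "\<exists>v u t. P v u t X" "\<And>Y. \<exists>v u t. P v u t Y \<Longrightarrow> card X \<le> card Y"
   using ex_has_least_nat[of "\<lambda>X. \<exists>v u t. P v u t X" _ card] by blast
  thus thesis using a by blast
 qed
 have tri: "triangle_face E \<rho> v u t" and X: "blocker V E v u t X"
  and maxX: "\<And>Y. blocker V E v u t Y \<Longrightarrow> Y \<subseteq> X" and d0R': "d0 \<in> reach (?K X) (v, u)"
  using PX by (auto simp: P_def)
 note t = triangle_faceD[OF tri] and b = blockerD[OF X]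
 let ?R = "reach (?K X) d0"
 have Rc: "crossing_closed (?K X) ?R" by (rule reach_closed[OF d0])
 have vuR: "(v, u) \<in> ?R" using reach_sym[OF t(4) d0R'] .
 define I where "I = D - ?R"
 have Ic: "crossing_closed (?K X) I" unfolding I_def by (rule closed_compl[OF Rc])
 have ID: "I \<subseteq> D" by (simp add: I_def)
 have If: "f ` I \<subseteq> I" using Ic by (simp add: crossing_closed_def)
 have IX: "I \<subseteq> darts (edges_in E X)"
 proof -
  \<comment> \<open>The vertices off \<open>X\<close> that are touched by the cut-off part. Their
    neighbours are all in \<open>X\<close> or \<open>Z\<close>, and \<open>t\<close> is not among
    them, so \<open>X \<union> Z\<close> is again a blocker; maximality of \<open>X\<close> leaves
    \<open>Z\<close> empty.\<close>
  define Z where "Z = {z\<in>V - X. \<exists>y. (y, z) \<in> I \<or> (z, y) \<in> I}"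
  have full: "(y, z) \<in> I \<and> (z, y) \<in> I" if "z \<in> Z" "{z, y} \<in> E" for y z
  proof -
   have "\<And>y. {z, y} \<in> E \<Longrightarrow> {z, y} \<in> ?K X" using that by (auto simp: Z_def edges_in_def)
   thus ?thesis using closed_vertex[OF Ic, of z _ y] that unfolding Z_def by blast
  qed
  have ZV: "Z \<subseteq> V" and ZX: "Z \<inter> X = {}" by (auto simp: Z_def)
  have nb: "y \<in> X \<union> Z" if "z \<in> Z" "{z, y} \<in> E" for y z
   using full[OF that] edgeD[OF that(2)] by (auto simp: Z_def)
  have tZ: "t \<notin> Z"
  proof
   assume "t \<in> Z"
   hence "(u, t) \<in> I" using full[of t u] t(5) by (simp add: insert_commute)
   thus False using closed_triangle[OF tri Rc] vuR by (simp add: I_def)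
  qed
  \<comment> \<open>Sparsity of \<open>V - Z\<close> leaves at least twice as many edges meeting
    \<open>Z\<close> as \<open>Z\<close> has vertices, which is what \<open>X\<close> needs to
    remain tight when it absorbs \<open>Z\<close>.\<close>
  have "tight V E (X \<union> Z)"
  proof -
   have finZ: "finite Z" "finite X" using ZV b finX by auto
   have cXZ: "card (X \<union> Z) = card X + card Z" using finZ ZX by (intro card_Un_disjoint) auto
   have Esub: "E = edges_in E (V - Z) \<union> (edges_in E (X \<union> Z) - edges_in E X)"
   proof
    show "E \<subseteq> edges_in E (V - Z) \<union> (edges_in E (X \<union> Z) - edges_in E X)"
    proof
     fix e assume "e \<in> E"
     then obtain a c where e: "e = {a, c}" "{a, c} \<in> E" by (metis edgeE)
     have "{c, a} \<in> E" using e by (simp add: insert_commute)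
     thus "e \<in> edges_in E (V - Z) \<union> (edges_in E (X \<union> Z) - edges_in E X)"
      using e edgeD[OF e(2)] nb[of a c] nb[of c a] ZX by (auto simp: edges_in_def)
    qed
   qed (auto simp: edges_in_def)
   have "card E \<le> card (edges_in E (V - Z)) + card (edges_in E (X \<union> Z) - edges_in E X)"
    by (subst Esub) (rule card_Un_le)
   moreover have "card (edges_in E (X \<union> Z) - edges_in E X) = card (edges_in E (X \<union> Z)) - card (edges_in E X)"
    by (rule card_Diff_subset[OF fin_edges_in]) (auto simp: edges_in_def)
   moreover have cVZ: "card (V - Z) = card V - card Z" using finZ ZV by (intro card_Diff_subset)
   moreover have "card X \<le> card (V - Z)" using ZX b finV by (intro card_mono) auto
   moreover have "card (edges_in E (V - Z)) \<le> 2 * card (V - Z) - 3"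
    by (rule sparse) (use calculation(4) b in auto)
   moreover have "card (edges_in E (X \<union> Z)) \<le> 2 * card (X \<union> Z) - 3"
    by (rule sparse) (use b ZV cXZ in auto)
   moreover have "card (edges_in E X) \<le> card (edges_in E (X \<union> Z))"
    by (rule card_mono[OF fin_edges_in]) (auto simp: edges_in_def)
   ultimately have "card (edges_in E (X \<union> Z)) = 2 * card (X \<union> Z) - 3"
    using cardE cXZ tightD(3)[OF b(1)] b(5) card_mono[OF finV ZV] by linarith
   thus ?thesis unfolding tight_def using b ZV cXZ by auto
  qed
  hence "blocker V E v u t (X \<union> Z)"
   unfolding blocker_def using b tZ finX[of "X \<union> Z"] ZV card_mono[of "X \<union> Z" X] by auto
  hence Z0: "Z = {}" using maxX ZX by blast
  show ?thesis
  proof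
   fix d assume d: "d \<in> I"
   obtain a c where ac: "d = (a, c)" by (cases d)
   have e: "{a, c} \<in> E" using d ID ac by auto
   have "a \<in> X" "c \<in> X" using Z0 d ac edgeD[OF e] unfolding Z_def by auto
   thus "d \<in> darts (edges_in E X)" using e ac by (simp add: edges_in_def)
  qed
 qed
 have fin: "finite (face ` ?R)" "finite (face ` I)" using Rc ID finD finite_subset
  by (auto simp: crossing_closed_def simp del: split_paired_All)
 \<comment> \<open>With k vertices in \<open>X\<close>, this is 4k-6 darts on the edges of
   \<open>X\<close> minus the three of \<open>outer_darts_ge_3\<close>. Against it stand at least
   k-2 faces in \<open>I\<close>, and 4(k-2) exceeds 4k-9, so \<open>I\<close> contains a
   triangle.\<close>
 have cI: "card I + 9 \<le> 4 * card X"
 proof -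
  have "(v, u) \<in> darts (edges_in E X) - I" using t(4) b vuR by (auto simp: I_def edges_in_def)
  hence "3 \<le> card (darts (edges_in E X) - I)" by (rule outer_darts_ge_3[OF b(1) b(5) IX If])
  moreover have sub: "edges_in E X \<subseteq> E" by (auto simp: edges_in_def)
  moreover have "card (darts (edges_in E X) - I) = card (darts (edges_in E X)) - card I"
   using IX ID finD by (intro card_Diff_subset) (auto intro: finite_subset)
  ultimately show ?thesis using card_D[OF sub] tightD[OF b(1)] b(5) by linarith
 qed
 have "face ` D \<subseteq> face ` ?R \<union> face ` I" by (auto simp: I_def)
 hence "card (face ` D) \<le> card (face ` ?R) + card (face ` I)"
  by (meson card_Un_le card_mono fin finite_UnI le_trans)
 hence "card X \<le> card (face ` I) + 2"
  using reach_face_count[OF b(1) d0] euler cardE cardV by linarith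
 hence "card I < 4 * card (face ` I)" using cI by linarith
 then obtain v' u' t' where tri': "triangle_face E \<rho> v' u' t'" "(v', u') \<in> I" using ex_tri[OF ID If] by blast
 have inI: "(u', t') \<in> I" "(t', v') \<in> I" using closed_triangle[OF tri'(1) Ic] tri'(2) by auto
 hence inX: "{v', u', t'} \<subseteq> X" using tri'(2) IX by (auto simp: edges_in_def)
 have "face d0 \<subseteq> ?R" by (rule closed_face[OF Rc reach.base])
 hence "(v', u') \<notin> face d0" using tri'(2) by (auto simp: I_def)
 then obtain Y1 Y2 v1 u1 t1 v2 u2 t2 where Y: "P v1 u1 t1 Y1" "P v2 u2 t2 Y2"
   "{v1, u1, t1} = {v', u', t'}" "{v2, u2, t2} = {v', u', t'}" "card (Y1 \<inter> Y2) \<le> 1"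
  using two_good[OF tri'(1)] by blast
 have uv_in: "u \<in> Y \<and> v \<in> Y" if PY: "P v1 u1 t1 Y" and s: "{v1, u1, t1} = {v', u', t'}" for Y v1 u1 t1
 proof -
  have Yb: "blocker V E v1 u1 t1 Y" using PY by (simp add: P_def)
  have ne: "v1 \<noteq> u1" using PY triangle_faceD(7) unfolding P_def by blast
  note bY = blockerD[OF Yb]
  have sX: "{v1, u1, t1} \<subseteq> X" using s inX by simp
  have "card {v1, u1} \<le> card (X \<inter> Y)" using sX bY b finX by (intro card_mono) auto
  hence c2: "2 \<le> card (X \<inter> Y)" using ne by simp
  note un = tight_Un[OF b(1) bY(1) c2]
  \<comment> \<open>Otherwise \<open>X \<union> Y\<close> is a blocker of the old edge, so
    \<open>Y\<close> is contained in \<open>X\<close>; it misses the vertex \<open>t1\<close> of the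
    new triangle and would be smaller than \<open>X\<close>. With \<open>t\<close> in
    \<open>Y\<close>, the edges from \<open>t\<close> to \<open>u\<close> and \<open>v\<close> lie
    inside the union but not inside \<open>X\<close>, hence inside \<open>Y\<close> by
    \<open>tight_Un\<close>.\<close>
  have tY: "t \<in> Y"
  proof (rule ccontr)
   assume "t \<notin> Y"
   hence "blocker V E v u t (X \<union> Y)"
    unfolding blocker_def using un b finX[of "X \<union> Y"] bY card_mono[of "X \<union> Y" X] by auto
   hence "Y \<subseteq> X" using maxX by blast
   moreover have "t1 \<in> X - Y" using sX bY by auto
   ultimately have "card Y < card X" using b finX by (intro psubset_card_mono) auto
   thus False using min[OF PY] by simp
  qed
  have "{u, t} \<in> edges_in E (X \<union> Y)" "{t, v} \<in> edges_in E (X \<union> Y)"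
   using t b tY by (auto simp: edges_in_def)
  thus ?thesis unfolding un(2) using b by (auto simp: edges_in_def)
 qed
 have sub: "{u, v} \<subseteq> Y1 \<inter> Y2" using uv_in[OF Y(1,3)] uv_in[OF Y(2,4)] by blast
 have "blocker V E v1 u1 t1 Y1" using Y(1) by (simp add: P_def)
 hence "finite (Y1 \<inter> Y2)" using finX[OF blockerD(6)] by blast
 from card_mono[OF this sub] show False using t(7) Y(5) by simp
qed

end

subsection \<open>Contracting an edge\<close>

locale contraction = laman_map +
 fixes v u t :: 'a
 assumes tri: "triangle_face E \<rho> v u t" and nb: "\<not> blocker V E v u t X"
begin

definition c :: "'a \<Rightarrow> 'a" where "c x = (if x = u then v else x)"
definition "V' = V - {u}"
definition "E' = {{c a, c b} |a b. {a, b} \<in> E \<and> {a, b} \<noteq> {v, u}}"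
text \<open>Around the merged vertex come the neighbours of \<open>u\<close> from \<open>t\<close>
  on, followed by those of \<open>v\<close> back to \<open>t\<close>; where the rotation of
  \<open>u\<close> arrives at \<open>v\<close>, it is continued by \<open>\<rho> v u\<close>. The
  common neighbour \<open>t\<close> is handled as a neighbour of \<open>u\<close>, so that its
  successor is \<open>\<rho> u t\<close>. At any other vertex the label \<open>v\<close> stands for
  \<open>u\<close> if only \<open>u\<close> is adjacent.\<close>

definition \<rho>' :: "'a \<Rightarrow> 'a \<Rightarrow> 'a" where
 "\<rho>' b x =
   (if b = v then
    (let y = (if {v, x} \<in> E \<and> x \<noteq> t then \<rho> v x else \<rho> u x) in if y = v then \<rho> v u else y)
   else c (\<rho> b (if x = v \<and> {b, u} \<in> E \<and> {b, v} \<notin> E then u else x)))"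
text \<open>Besides the darts of the triangle and the dart opposite to \<open>(v, u)\<close>, one of
  the two parallel copies of each direction between \<open>t\<close> and the merged vertex is
  dropped: \<open>(v, t)\<close> and \<open>(t, u)\<close> stay. On the rest \<open>\<phi>\<close>
  is a bijection onto the darts of the contraction.\<close>

definition "D0 = D - {(v, u), (u, t), (t, v), (u, v)}"
definition \<phi> :: "'a \<times> 'a \<Rightarrow> 'a \<times> 'a" where "\<phi> d = (c (fst d), c (snd d))"
abbreviation "f' \<equiv> face_step \<rho>'"
abbreviation "face' \<equiv> orbit f'"

lemmas t = triangle_faceD[OF tri]

lemma t_edges: "{v, u} \<in> E" "{u, v} \<in> E" "{u, t} \<in> E" "{t, u} \<in> E" "{t, v} \<in> E" "{v, t} \<in> E"
 using t(4-6) by (auto simp: insert_commute)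

lemma rho_t: "\<rho> u v = t" "\<rho> t u = v" "\<rho> v t = u"
 using tri by (auto simp: triangle_face_def)

lemma c_simps [simp]: "c u = v" "x \<noteq> u \<Longrightarrow> c x = x" "c v = v" "c t = t" "c x \<noteq> u"
 using t by (auto simp: c_def)

lemma \<phi>_simp [simp]: "\<phi> (a, b) = (c a, c b)" by (simp add: \<phi>_def)

text \<open>A further common neighbour \<open>x\<close> would make \<open>{v, u, x}\<close> a
  blocker: its three edges make it tight, and it misses \<open>t\<close>.\<close>

lemma common_nbr: assumes "{v, x} \<in> E" "{u, x} \<in> E" shows "x = t"
proof (rule ccontr)
 assume xt: "x \<noteq> t"
 note e = edgeD[OF assms(1)] edgeD[OF assms(2)]
 have c3: "card {v, u, x} = 3" using e t by auto
 have "{{v, u}, {v, x}, {u, x}} \<subseteq> edges_in E {v, u, x}" using assms t by (auto simp: edges_in_def)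
 hence "card {{v, u}, {v, x}, {u, x}} \<le> card (edges_in E {v, u, x})" by (rule card_mono[OF fin_edges_in])
 moreover have "card {{v, u}, {v, x}, {u, x}} = 3" using e t by (simp add: doubleton_eq_iff)
 moreover have "card (edges_in E {v, u, x}) \<le> 2 * card {v, u, x} - 3" by (rule sparse) (use e c3 in auto)
 ultimately have "tight V E {v, u, x}" using c3 e by (auto simp: tight_def)
 hence "blocker V E v u t {v, u, x}" using c3 xt t by (auto simp: blocker_def)
 thus False using nb by blast
qed

lemma E'_iff: "{x, y} \<in> E' \<longleftrightarrow> (\<exists>a b. {a, b} \<in> E \<and> {a, b} \<noteq> {v, u} \<and> c a = x \<and> c b = y)"
proof
 assume "{x, y} \<in> E'"
 then obtain a b where ab: "{x, y} = {c a, c b}" "{a, b} \<in> E" "{a, b} \<noteq> {v, u}" by (auto simp: E'_def)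
 then consider "x = c a" "y = c b" | "x = c b" "y = c a" by (auto simp: doubleton_eq_iff)
 thus "\<exists>a b. {a, b} \<in> E \<and> {a, b} \<noteq> {v, u} \<and> c a = x \<and> c b = y"
 proof cases
  case 1 thus ?thesis using ab by blast
 next
  case 2 thus ?thesis using ab by (intro exI[of _ b] exI[of _ a]) (simp add: insert_commute)
 qed
qed (auto simp: E'_def)

lemma E'_v: "{v, y} \<in> E' \<longleftrightarrow> y \<noteq> u \<and> y \<noteq> v \<and> ({v, y} \<in> E \<or> {u, y} \<in> E)"
proof
 assume "{v, y} \<in> E'"
 then obtain a b where ab: "{a, b} \<in> E" "{a, b} \<noteq> {v, u}" "c a = v" "c b = y" by (auto simp: E'_iff)
 hence "a = v \<or> a = u" by (metis c_simps(2))
 thus "y \<noteq> u \<and> y \<noteq> v \<and> ({v, y} \<in> E \<or> {u, y} \<in> E)" using ab edgeD[OF ab(1)]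
  by (cases "b = u"; cases "b = v") (auto simp: insert_commute)
next
 assume y: "y \<noteq> u \<and> y \<noteq> v \<and> ({v, y} \<in> E \<or> {u, y} \<in> E)"
 then consider "{v, y} \<in> E" | "{u, y} \<in> E" by blast
 thus "{v, y} \<in> E'"
 proof cases
  case 1 thus ?thesis unfolding E'_iff using y by (intro exI[of _ v] exI[of _ y]) (auto simp: doubleton_eq_iff)
 next
  case 2 thus ?thesis unfolding E'_iff using y by (intro exI[of _ u] exI[of _ y]) (auto simp: doubleton_eq_iff)
 qed
qed

lemma E'_other:
 assumes "b \<noteq> v" "b \<noteq> u"
 shows "{b, y} \<in> E' \<longleftrightarrow> (y \<noteq> u \<and> {b, y} \<in> E) \<or> (y = v \<and> {b, u} \<in> E)"
proof
 assume "{b, y} \<in> E'"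
 then obtain a x where ab: "{a, x} \<in> E" "{a, x} \<noteq> {v, u}" "c a = b" "c x = y" by (auto simp: E'_iff)
 hence "a = b" using assms by (cases "a = u") auto
 thus "(y \<noteq> u \<and> {b, y} \<in> E) \<or> (y = v \<and> {b, u} \<in> E)" using ab by (cases "x = u") auto
next
 assume "(y \<noteq> u \<and> {b, y} \<in> E) \<or> (y = v \<and> {b, u} \<in> E)"
 thus "{b, y} \<in> E'" unfolding E'_iff using assms by (metis c_simps(1,2) doubleton_eq_iff)
qed

lemma simple': "simple_graph V' E'"
proof -
 have "e \<subseteq> V' \<and> card e = 2" if e: "e \<in> E'" for e
 proof -
  obtain a b where ab: "e = {c a, c b}" "{a, b} \<in> E" "{a, b} \<noteq> {v, u}" using e by (auto simp: E'_def)
  have "c a \<noteq> c b" using ab edgeD[OF ab(2)] by (auto simp: c_def split: if_splits)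
  thus ?thesis using ab edgeD[OF ab(2)] t by (auto simp: V'_def c_def)
 qed
 thus ?thesis using finV by (auto simp: simple_graph_def V'_def)
qed

lemma E'_image: "E' = (\<lambda>e. c ` e) ` (E - {{v, u}, {u, t}})"
proof
 show "E' \<subseteq> (\<lambda>e. c ` e) ` (E - {{v, u}, {u, t}})"
 proof
  fix e assume "e \<in> E'"
  then obtain a b where ab: "e = {c a, c b}" "{a, b} \<in> E" "{a, b} \<noteq> {v, u}" by (auto simp: E'_def)
  show "e \<in> (\<lambda>e. c ` e) ` (E - {{v, u}, {u, t}})"
  proof (cases "{a, b} = {u, t}")
   case True
   hence "e = c ` {v, t}" using ab by (auto simp: doubleton_eq_iff)
   moreover have "{v, t} \<in> E - {{v, u}, {u, t}}" using t t_edges by (auto simp: doubleton_eq_iff)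
   ultimately show ?thesis by blast
  next
   case False thus ?thesis using ab by (intro image_eqI[of _ _ "{a, b}"]) auto
  qed
 qed
 show "(\<lambda>e. c ` e) ` (E - {{v, u}, {u, t}}) \<subseteq> E'"
 proof
  fix e assume "e \<in> (\<lambda>e. c ` e) ` (E - {{v, u}, {u, t}})"
  then obtain e0 where e0: "e0 \<in> E" "e0 \<noteq> {v, u}" "e = c ` e0" by auto
  obtain a b where "e0 = {a, b}" using edgeE[OF e0(1)] by metis
  thus "e \<in> E'" using e0 unfolding E'_def by auto
 qed
qed

lemma card_E': "card E' = card E - 2"
proof -
 have "inj_on (\<lambda>e. c ` e) (E - {{v, u}, {u, t}})"
 proof (rule inj_onI)
  fix e1 e2 assume e1: "e1 \<in> E - {{v, u}, {u, t}}" and e2: "e2 \<in> E - {{v, u}, {u, t}}" and eq: "c ` e1 = c ` e2"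
  obtain a1 b1 where ab1: "e1 = {a1, b1}" "{a1, b1} \<in> E" using edgeE e1 by (metis DiffD1)
  obtain a2 b2 where ab2: "e2 = {a2, b2}" "{a2, b2} \<in> E" using edgeE e2 by (metis DiffD1)
  have cn: "x = t" if "{x, v} \<in> E" "{x, u} \<in> E" for x using common_nbr that by (simp add: insert_commute)
  have "{c a1, c b1} = {c a2, c b2}" using eq ab1 ab2 by simp
  thus "e1 = e2"
   using ab1 ab2 e1 e2 common_nbr cn edgeD[OF ab1(2)] edgeD[OF ab2(2)] unfolding c_def
   by (auto simp: doubleton_eq_iff insert_commute split: if_splits)
 qed
 hence "card E' = card (E - {{v, u}, {u, t}})" unfolding E'_image by (rule card_image)
 also have "\<dots> = card E - card {{v, u}, {u, t}}" by (rule card_Diff_subset) (use t in auto)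
 finally show ?thesis using t by (simp add: doubleton_eq_iff)
qed

lemma card_V': "card V' = card V - 1"
 unfolding V'_def using t finV by simp

lemma card_V_ge_3: "3 \<le> card V"
proof -
 have "card {v, u, t} \<le> card V" by (rule card_mono[OF finV]) (use t in auto)
 thus ?thesis using t by simp
qed

text \<open>A set through \<open>v\<close> is compared with the one obtained by adding
  \<open>u\<close>. If it contains \<open>t\<close>, two edges disappear along with the vertex;
  otherwise only one does, and the missing unit comes from \<open>insert u S\<close> not being
  tight, as it would be a blocker.\<close>

lemma laman': "laman V' E'"
proof -
 have "card (edges_in E' S) \<le> 2 * card S - 3" if S: "S \<subseteq> V'" "2 \<le> card S" for S
 proof (cases "v \<in> S")
  case False
  have "edges_in E' S \<subseteq> edges_in E S"
  proof
   fix e assume e: "e \<in> edges_in E' S"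
   then obtain a b where ab: "e = {c a, c b}" "{a, b} \<in> E" by (auto simp: E'_def edges_in_def)
   hence "a \<noteq> u" "b \<noteq> u" using e False by (auto simp: edges_in_def)
   thus "e \<in> edges_in E S" using e ab by (auto simp: edges_in_def)
  qed
  hence "card (edges_in E' S) \<le> card (edges_in E S)" by (rule card_mono[OF fin_edges_in])
  also have "\<dots> \<le> 2 * card S - 3" by (rule sparse) (use S in \<open>auto simp: V'_def\<close>)
  finally show ?thesis .
 next
  case vS: True
  let ?S1 = "insert u S"
  have fS: "finite S" "u \<notin> S" using S finV by (auto simp: V'_def intro: finite_subset)
  hence cS1: "card ?S1 = card S + 1" by simp
  have S1V: "?S1 \<subseteq> V" using S t by (auto simp: V'_def)
  let ?R = "if t \<in> S then {{v, u}, {u, t}} else {{v, u}}"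
  have "edges_in E' S \<subseteq> (\<lambda>e. c ` e) ` (edges_in E ?S1 - ?R)"
  proof
   fix e assume e: "e \<in> edges_in E' S"
   hence "e \<in> E'" by (simp add: edges_in_def)
   then obtain e0 where e0: "e0 \<in> E" "e0 \<noteq> {v, u}" "e0 \<noteq> {u, t}" "e = c ` e0" unfolding E'_image by auto
   have "e0 \<subseteq> ?S1" using e e0 by (force simp: edges_in_def c_def)
   thus "e \<in> (\<lambda>e. c ` e) ` (edges_in E ?S1 - ?R)" using e0 by (auto simp: edges_in_def)
  qed
  hence "card (edges_in E' S) \<le> card ((\<lambda>e. c ` e) ` (edges_in E ?S1 - ?R))"
   by (intro card_mono) (simp add: fin_edges_in)
  also have "\<dots> \<le> card (edges_in E ?S1 - ?R)" by (rule card_image_le) (simp add: fin_edges_in)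
  also have "\<dots> = card (edges_in E ?S1) - card ?R"
   by (rule card_Diff_subset) (use vS t in \<open>auto simp: edges_in_def\<close>)
  finally have le: "card (edges_in E' S) \<le> card (edges_in E ?S1) - card ?R" .
  have s: "card (edges_in E ?S1) \<le> 2 * card ?S1 - 3" by (rule sparse[OF S1V]) (use cS1 S in simp)
  show ?thesis
  proof (cases "t \<in> S")
   case True
   hence "card ?R = 2" using t by (simp add: doubleton_eq_iff)
   thus ?thesis using le s cS1 by simp
  next
   case False
   hence "\<not> tight V E ?S1" using nb[of ?S1] vS cS1 S t by (auto simp: blocker_def)
   hence "card (edges_in E ?S1) \<noteq> 2 * card ?S1 - 3" using cS1 S S1V by (auto simp: tight_def)
   thus ?thesis using le s cS1 S False by simp
  qed
 qed
 moreover have "card E' = 2 * card V' - 3" using card_E' card_V' cardE card_V_ge_3 by simp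
 ultimately show ?thesis unfolding laman_def using simple' card_V' card_V_ge_3 by (auto simp: edges_in_def)
qed

end

section \<open>Rotation and faces of the contraction\<close>

context contraction
begin

lemma rho'_v_in_v: assumes "{v, x} \<in> E" "x \<noteq> t" "x \<noteq> u"
 shows "\<rho>' v x = \<rho> v x" "\<rho> v x \<noteq> v" "\<rho> v x \<noteq> u"
proof -
 show n: "\<rho> v x \<noteq> v" by (rule rho_ne[OF assms(1)])
 thus "\<rho>' v x = \<rho> v x" using assms by (simp add: \<rho>'_def)
 show "\<rho> v x \<noteq> u" using rho_inj[OF t(10)] assms rho_t(3) t_edges unfolding inj_on_def by auto
qed

lemma rho_v_u: "\<rho> v u \<noteq> u" "\<rho> v u \<noteq> v" "{v, \<rho> v u} \<in> E"
proof -
 show "{v, \<rho> v u} \<in> E" by (rule rho_in[OF t_edges(1)])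
 show "\<rho> v u \<noteq> v" by (rule rho_ne[OF t_edges(1)])
 show "\<rho> v u \<noteq> u" using rho_inj[OF t(10)] rho_t(3) t_edges t unfolding inj_on_def by auto
qed

lemma rho'_v_in_u: assumes "{u, x} \<in> E" "x \<noteq> v"
 shows "\<rho>' v x = (if \<rho> u x = v then \<rho> v u else \<rho> u x)"
 using assms common_nbr[of x] by (auto simp: \<rho>'_def)

lemma E'_edges: assumes "{a, b} \<in> E" "{a, b} \<noteq> {v, u}" shows "{c a, c b} \<in> E'"
 using assms E'_iff by blast

lemma rho'_other:
 assumes "b \<noteq> v" "b \<noteq> u" "{b, x} \<in> E" "{x, b} \<noteq> {u, t}"
 shows "\<rho>' b (c x) = c (\<rho> b x)"
proof (cases "x = u")
 case True
 hence "b \<noteq> t" using assms(4) by auto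
 hence "{b, v} \<notin> E" using common_nbr[of b] assms True by (auto simp: insert_commute)
 thus ?thesis using assms True by (simp add: \<rho>'_def)
next
 case False
 show ?thesis
 proof (cases "x = v")
  case True thus ?thesis using assms by (simp add: \<rho>'_def)
 next
  case F: False thus ?thesis using False assms by (simp add: \<rho>'_def)
 qed
qed

lemma D0_iff: "(a, b) \<in> D0 \<longleftrightarrow> {a, b} \<in> E \<and> {a, b} \<noteq> {v, u} \<and> (a, b) \<noteq> (u, t) \<and> (a, b) \<noteq> (t, v)"
 using t by (auto simp: D0_def doubleton_eq_iff)

lemma \<phi>_inj: "inj_on \<phi> D0"
proof (rule inj_onI)
 fix d d' assume d: "d \<in> D0" "d' \<in> D0" "\<phi> d = \<phi> d'"
 obtain a b a' b' where ab: "d = (a, b)" "d' = (a', b')" by (cases d, cases d') auto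
 have e: "{a, b} \<in> E" "{a', b'} \<in> E" using d ab by (auto simp: D0_iff)
 have cn: "x = t" if "{x, v} \<in> E" "{x, u} \<in> E" for x using common_nbr that by (simp add: insert_commute)
 show "d = d'" using d ab e cn common_nbr edgeD[OF e(1)] edgeD[OF e(2)] unfolding c_def
  by (auto simp: D0_iff c_def split: if_splits)
qed

lemma \<phi>_image: "\<phi> ` D0 = darts E'"
proof
 show "\<phi> ` D0 \<subseteq> darts E'"
 proof (rule image_subsetI)
  fix d assume d: "d \<in> D0"
  obtain a b where ab: "d = (a, b)" by (cases d)
  show "\<phi> d \<in> darts E'" using d ab E'_edges[of a b] by (simp add: D0_iff)
 qed
 show "darts E' \<subseteq> \<phi> ` D0"
 proof
  fix d assume d: "d \<in> darts E'"
  obtain x y where xy: "d = (x, y)" by (cases d)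
  then obtain a b where ab: "{a, b} \<in> E" "{a, b} \<noteq> {v, u}" "c a = x" "c b = y" using d E'_iff by auto
  have dab: "d = (c a, c b)" unfolding xy ab(3,4) by (rule refl)
  show "d \<in> \<phi> ` D0"
  proof (cases "(a, b) = (u, t) \<or> (a, b) = (t, v)")
   case False
   hence "(a, b) \<in> D0" using ab by (simp add: D0_iff)
   thus ?thesis using ab xy by (intro image_eqI[of _ _ "(a, b)"]) auto
  next
   case True
   thus ?thesis
   proof
    assume "(a, b) = (u, t)"
    hence "d = \<phi> (v, t)" unfolding dab by simp
    moreover have "(v, t) \<in> D0" using t t_edges by (auto simp: D0_iff doubleton_eq_iff)
    ultimately show ?thesis by blast
   next
    assume "(a, b) = (t, v)"
    hence "d = \<phi> (t, u)" unfolding dab by simp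
    moreover have "(t, u) \<in> D0" using t t_edges by (auto simp: D0_iff doubleton_eq_iff)
    ultimately show ?thesis by blast
   qed
  qed
 qed
qed

lemma D0_D: "D0 \<subseteq> D" by (auto simp: D0_def)

lemma uv_notin_D0: "(u, v) \<notin> D0" "(v, u) \<notin> D0" "(u, t) \<notin> D0" "(t, v) \<notin> D0" by (auto simp: D0_def)

lemma f_D0: assumes "d \<in> D0" shows "f d \<in> D0 \<or> f d = (u, v)"
proof -
 have "f d \<in> D" using assms D0_D f_in by blast
 moreover have "f d \<noteq> f d'" if "d' \<in> {(v, u), (u, t), (t, v)}" for d'
 proof
  assume "f d = f d'"
  moreover have "d \<in> D" "d' \<in> D" using assms D0_D that t by auto
  ultimately have "d = d'" using f_inj by (auto simp: inj_on_def simp del: face_step_simp)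
  thus False using assms that by (auto simp: D0_def)
 qed
 hence "f d \<noteq> (u, t)" "f d \<noteq> (t, v)" "f d \<noteq> (v, u)"
  using t(1-3) by (metis insertCI)+
 ultimately show ?thesis unfolding D0_def by blast
qed

lemma f_uv: "f (u, v) = (v, \<rho> v u)" "f (u, v) \<in> D0"
 using rho_v_u t by (auto simp: D0_iff doubleton_eq_iff)

text \<open>Contraction only shortens faces: \<open>\<phi>\<close> carries \<open>f\<close> to
  \<open>f'\<close>, except that the vanished dart \<open>(u, v)\<close> is passed over.\<close>

lemma f'_\<phi>:
 assumes "d \<in> D0" shows "f' (\<phi> d) = (if f d = (u, v) then \<phi> (f (u, v)) else \<phi> (f d))"
proof -
 obtain a b where ab: "d = (a, b)" by (cases d)
 have e: "{a, b} \<in> E" "{b, a} \<in> E" "{a, b} \<noteq> {v, u}" "(a, b) \<noteq> (u, t)" "(a, b) \<noteq> (t, v)"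
  using assms ab by (auto simp: D0_iff insert_commute)
 note n = edgeD[OF e(1)]
 consider "b = u" | "b = v" | "b \<noteq> u" "b \<noteq> v" by blast
 thus ?thesis
 proof cases
  case 1
  hence a: "a \<noteq> v" "a \<noteq> u" "{u, a} \<in> E" using e n by (auto simp: insert_commute)
  have "\<rho>' v a = (if \<rho> u a = v then \<rho> v u else \<rho> u a)" by (rule rho'_v_in_u[OF a(3,1)])
  moreover have "\<rho> u a \<noteq> u" by (rule rho_ne[OF a(3)])
  ultimately show ?thesis using 1 ab a rho_v_u by auto
 next
  case 2
  hence a: "a \<noteq> t" "a \<noteq> u" "{v, a} \<in> E" using e n by (auto simp: insert_commute)
  thus ?thesis using 2 ab rho'_v_in_v[OF a(3,1,2)] t by auto
 next
  case 3
  hence "\<rho>' b (c a) = c (\<rho> b a)" using rho'_other[of b a] e by (auto simp: doubleton_eq_iff)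
  thus ?thesis using 3 ab by auto
 qed
qed

lemma rot': "rotation_system V' E' \<rho>'"
 unfolding rotation_system_def
proof (intro ballI conjI allI impI)
 fix b x assume b: "b \<in> V'" and x: "x \<in> neighbours E' b"
 hence "(x, b) \<in> darts E'" by (simp add: insert_commute)
 then obtain d where d: "d \<in> D0" "(x, b) = \<phi> d" unfolding \<phi>_image[symmetric] by blast
 have "f' (x, b) \<in> \<phi> ` D0" using f'_\<phi>[OF d(1)] f_D0[OF d(1)] f_uv(2) d(2) by (auto simp del: face_step_simp)
 thus "\<rho>' b x \<in> neighbours E' b" unfolding \<phi>_image by simp
next
 fix b S assume b: "b \<in> V'" and S: "S \<subseteq> neighbours E' b" "S \<noteq> {}" "\<rho>' b ` S \<subseteq> S"
 have bV: "b \<in> V" "b \<noteq> u" using b by (auto simp: V'_def)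
 have cl: "x \<in> S \<Longrightarrow> \<rho>' b x \<in> S" for x using S(3) by blast
 show "S = neighbours E' b"
 proof (cases "b = v")
  case False
  let ?S = "{x\<in>neighbours E b. c x \<in> S}"
  have St: "\<rho> t v \<in> ?S \<and> v \<in> ?S" if "u \<in> ?S" "b = t"
   using that cl[of v] t_edges rho_in[of t v] rho'_other[of t v] t False by (auto simp: doubleton_eq_iff)
  obtain s where s: "s \<in> S" using S(2) by blast
  hence "(s \<noteq> u \<and> {b, s} \<in> E) \<or> (s = v \<and> {b, u} \<in> E)"
   using S(1) E'_other[OF False bV(2)] by auto
  then obtain x where x: "x \<in> ?S" using s by (metis (mono_tags, lifting) c_simps(1,2) mem_Collect_eq mem_neighbours)
  have "?S = neighbours E b"
  proof (rule rho_closed[OF bV(1) _ x])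
   fix y assume y: "y \<in> ?S"
   show "\<rho> b y \<in> ?S"
   proof (cases "{y, b} = {u, t}")
    case True
    hence "y = u" "b = t" using bV by (auto simp: doubleton_eq_iff)
    thus ?thesis using St y rho_t by auto
   next
    case F: False
    hence "\<rho>' b (c y) = c (\<rho> b y)" using rho'_other[OF False bV(2)] y by simp
    thus ?thesis using y cl[of "c y"] rho_in by auto
   qed
  qed auto
  hence all: "c x \<in> S" if "{b, x} \<in> E" for x using that by (auto simp: neighbours_def)
  show ?thesis
  proof (rule equalityI[OF S(1)], rule subsetI)
   fix y assume "y \<in> neighbours E' b"
   thus "y \<in> S" using E'_other[OF False bV(2), of y] all[of y] all[of u] by auto
  qed
 next
  case True
  note S = S[unfolded True] and cl = cl[unfolded True]
  have N: "y \<in> S \<Longrightarrow> y \<noteq> u \<and> y \<noteq> v \<and> ({v, y} \<in> E \<or> {u, y} \<in> E)" for y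
   using S(1) E'_v[of y] mem_neighbours[of y E' v] by blast
  \<comment> \<open>The merged rotation switches from \<open>v\<close> to \<open>u\<close> only at
    \<open>t\<close>. A closed set avoiding \<open>t\<close> would thus end up closed under one of
    the two old rotations alone and reach \<open>u\<close> or \<open>v\<close>, neither of which is
    a neighbour any more.\<close>
  have tS: "t \<in> S"
  proof (rule ccontr)
   assume tS: "t \<notin> S"
   have B: False if y0: "y0 \<in> S" "{v, y0} \<in> E" for y0
   proof -
    let ?S = "{y\<in>S. {v, y} \<in> E}"
    have "?S = neighbours E v"
    proof (rule rho_closed[OF t(10)])
     show "y0 \<in> ?S" using y0 by simp
     fix y assume y: "y \<in> ?S"
     hence "y \<noteq> t" "y \<noteq> u" "{v, y} \<in> E" using tS N by auto
     thus "\<rho> v y \<in> ?S" using rho'_v_in_v[of y] cl[of y] y rho_in by auto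
    qed auto
    hence "u \<in> ?S" using t_edges by (auto simp: neighbours_def)
    thus False using N by auto
   qed
   obtain s where s: "s \<in> S" using S(2) by blast
   let ?S = "{y\<in>S. {u, y} \<in> E}"
   have "?S = neighbours E u"
   proof (rule rho_closed[OF t(11)])
    show "s \<in> ?S" using B[of s] s N by auto
    fix y assume y: "y \<in> ?S"
    hence r: "\<rho>' v y = (if \<rho> u y = v then \<rho> v u else \<rho> u y)" using rho'_v_in_u N by auto
    have "\<rho>' v y \<in> S" using cl y by auto
    hence "\<rho> u y \<noteq> v" using B[of "\<rho> v u"] rho_v_u(3) r by auto
    thus "\<rho> u y \<in> ?S" using r \<open>\<rho>' v y \<in> S\<close> rho_in y by auto
   qed auto
   hence "v \<in> ?S" using t_edges by (auto simp: neighbours_def)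
   thus False using N by auto
  qed
  let ?Su = "insert v {y\<in>S. {u, y} \<in> E}"
  have Su: "?Su = neighbours E u"
  proof (rule rho_closed[OF t(11)])
   show "v \<in> ?Su" by simp
   show "?Su \<subseteq> neighbours E u" using t_edges by auto
   fix y assume y: "y \<in> ?Su"
   show "\<rho> u y \<in> ?Su"
   proof (cases "y = v")
    case True thus ?thesis using rho_t tS t_edges by simp
   next
    case False
    hence r: "\<rho>' v y = (if \<rho> u y = v then \<rho> v u else \<rho> u y)" using rho'_v_in_u y by auto
    have "\<rho>' v y \<in> S" using cl y False by auto
    thus ?thesis using r rho_in y False by (auto split: if_splits)
   qed
  qed
  obtain x0 where x0: "{u, x0} \<in> E" "\<rho> u x0 = v"
   using rho_surj[OF t(11)] t_edges(2) unfolding neighbours_def by (metis (mono_tags, lifting) image_iff mem_Collect_eq)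
  have "x0 \<noteq> v" using x0 rho_t t by auto
  hence "x0 \<in> S" using Su x0 by (auto simp: neighbours_def)
  hence vuS: "\<rho> v u \<in> S" using cl[of x0] rho'_v_in_u[OF x0(1) \<open>x0 \<noteq> v\<close>] x0 by auto
  let ?Sv = "insert u {y\<in>S. {v, y} \<in> E}"
  have Sv: "?Sv = neighbours E v"
  proof (rule rho_closed[OF t(10)])
   show "u \<in> ?Sv" by simp
   show "?Sv \<subseteq> neighbours E v" using t_edges by auto
   fix y assume y: "y \<in> ?Sv"
   show "\<rho> v y \<in> ?Sv"
   proof (cases "y = u \<or> y = t")
    case True thus ?thesis using rho_t vuS rho_v_u by auto
   next
    case False
    thus ?thesis using rho'_v_in_v[of y] y cl[of y] rho_in by auto
   qed
  qed
  show ?thesis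
  proof (rule equalityI, unfold True, rule S(1), rule subsetI)
   fix y assume "y \<in> neighbours E' v"
   hence "y \<noteq> u \<and> y \<noteq> v \<and> (y \<in> neighbours E v \<or> y \<in> neighbours E u)" using E'_v by auto
   thus "y \<in> S" unfolding Su[symmetric] Sv[symmetric] by auto
  qed
 qed
qed

sublocale m': laman_map V' E' \<rho>'
 by unfold_locales (use simple' rot' laman' in auto)

lemma face'_\<phi>: assumes d: "d \<in> D0" shows "face' (\<phi> d) = \<phi> ` (face d \<inter> D0)"
proof
 have dD: "d \<in> D" using d D0_D by auto
 have DD: "\<phi> ` (face d \<inter> D0) \<subseteq> darts E'" using \<phi>_image by blast
 show "face' (\<phi> d) \<subseteq> \<phi> ` (face d \<inter> D0)"
 proof (rule m'.face_sub[OF DD])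
  show "\<phi> d \<in> \<phi> ` (face d \<inter> D0)" using d face_self[OF dD] by blast
  show "f' ` \<phi> ` (face d \<inter> D0) \<subseteq> \<phi> ` (face d \<inter> D0)"
  proof (rule image_subsetI)
   fix y assume "y \<in> \<phi> ` (face d \<inter> D0)"
   then obtain x where x: "x \<in> face d" "x \<in> D0" "y = \<phi> x" by blast
   have fx: "f x \<in> face d" by (rule orbit.step[OF x(1)])
   hence ffx: "f (f x) \<in> face d" by (rule orbit.step)
   show "f' y \<in> \<phi> ` (face d \<inter> D0)"
    using f'_\<phi>[OF x(2)] f_D0[OF x(2)] f_uv(2) fx ffx x(3) by (cases "f x = (u, v)") (simp_all del: face_step_simp)
  qed
 qed
 \<comment> \<open>The dart \<open>(u, v)\<close> has no image of its own, so it is represented by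
   that of its successor.\<close>
 define S where "S = {x\<in>face d. (x \<in> D0 \<and> \<phi> x \<in> face' (\<phi> d)) \<or> (x = (u, v) \<and> \<phi> (f x) \<in> face' (\<phi> d))}"
 have "face d \<subseteq> S"
 proof (rule face_sub)
  show "S \<subseteq> D" using face_D[OF dD] by (auto simp: S_def)
  have "\<phi> d \<in> darts E'" using d \<phi>_image by blast
  thus "d \<in> S" using face_self[OF dD] d m'.face_self by (auto simp: S_def)
  show "f ` S \<subseteq> S"
  proof (rule image_subsetI)
   fix x assume x: "x \<in> S"
   hence fx: "f x \<in> face d" using orbit.step[of x f d] by (auto simp: S_def simp del: face_step_simp)
   show "f x \<in> S"
   proof (cases "x = (u, v)")
    case True
    hence "\<phi> (f x) \<in> face' (\<phi> d)" using x uv_notin_D0 by (auto simp: S_def)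
    thus ?thesis using fx f_uv(2) True by (simp add: S_def del: face_step_simp)
   next
    case False
    hence x0: "x \<in> D0" "\<phi> x \<in> face' (\<phi> d)" using x by (auto simp: S_def)
    hence s: "f' (\<phi> x) \<in> face' (\<phi> d)" using orbit.step[of "\<phi> x" f' "\<phi> d"] by blast
    show ?thesis using fx s f'_\<phi>[OF x0(1)] f_D0[OF x0(1)] by (cases "f x = (u, v)") (simp_all add: S_def del: face_step_simp)
   qed
  qed
 qed
 thus "\<phi> ` (face d \<inter> D0) \<subseteq> face' (\<phi> d)" using uv_notin_D0 by (auto simp: S_def simp del: split_paired_All \<phi>_simp)
qed

lemma face_triangle: "face (v, u) = {(v, u), (u, t), (t, v)}"
proof
 show "face (v, u) \<subseteq> {(v, u), (u, t), (t, v)}"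
 proof (rule face_sub)
  show "{(v, u), (u, t), (t, v)} \<subseteq> D" using t by blast
  show "f ` {(v, u), (u, t), (t, v)} \<subseteq> {(v, u), (u, t), (t, v)}"
   by (simp only: image_insert image_empty t(1-3)) blast
 qed simp
 show "{(v, u), (u, t), (t, v)} \<subseteq> face (v, u)"
  using face_self[OF t(4)] orbit.step[of "(v, u)" f "(v, u)"] orbit.step[of "(u, t)" f "(v, u)"] t(1-2) by auto
qed

text \<open>Away from the triangle only \<open>(u, v)\<close> is missing from \<open>D0\<close>, and
  the face of \<open>(u, v)\<close> is still represented by \<open>f (u, v)\<close>.\<close>

lemma other_face: assumes "d \<in> D" "(v, u) \<notin> face d" obtains d' where "d' \<in> D0" "face d = face d'" "face d \<inter> D0 = face d - {(u, v)}"
proof -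
 have "face d \<inter> face (v, u) = {}" using face_eq[OF assms(1)] face_eq[OF t(4)] assms(2) face_self[OF t(4)] by blast
 hence e: "face d \<inter> D0 = face d - {(u, v)}"
  unfolding face_triangle D0_def using face_D[OF assms(1)] by blast
 show thesis
 proof (cases "d = (u, v)")
  case True
  hence "face (f d) = face d" using face_step_eq[OF assms(1)] by blast
  thus thesis using that[of "f d"] f_uv True e by (simp del: face_step_simp)
 next
  case False
  hence "d \<in> D0" using e face_self[OF assms(1)] by blast
  thus thesis using that e by blast
 qed
qed

text \<open>The triangle is the only face to vanish; distinct other faces stay distinct because
  \<open>\<phi>\<close> is injective on \<open>D0\<close>.\<close>

lemma euler': assumes "card E + 2 \<le> card (face ` D) + card V"
 shows "card E' + 2 \<le> card (face' ` darts E') + card V'"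
proof -
 have D0: "face ` D \<subseteq> insert (face (v, u)) (face ` D0)"
 proof
  fix O' assume "O' \<in> face ` D"
  then obtain d where d: "d \<in> D" "O' = face d" by blast
  show "O' \<in> insert (face (v, u)) (face ` D0)"
  proof (cases "(v, u) \<in> face d")
   case True thus ?thesis using face_eq d by blast
  next
   case False
   obtain d' where "d' \<in> D0" "face d = face d'" by (rule other_face[OF d(1) False]) blast
   thus ?thesis using d(2) by blast
  qed
 qed
 have im: "(\<lambda>O'. \<phi> ` (O' \<inter> D0)) ` face ` D0 = face' ` darts E'"
  unfolding \<phi>_image[symmetric] image_image using face'_\<phi> by (intro image_cong) auto
 have "inj_on (\<lambda>O'. \<phi> ` (O' \<inter> D0)) (face ` D0)"
 proof (rule inj_onI)
  fix O1 O2 assume O: "O1 \<in> face ` D0" "O2 \<in> face ` D0" "\<phi> ` (O1 \<inter> D0) = \<phi> ` (O2 \<inter> D0)"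
  hence e: "O1 \<inter> D0 = O2 \<inter> D0" using inj_on_image_eq_iff[OF \<phi>_inj, of "O1 \<inter> D0" "O2 \<inter> D0"] by blast
  obtain d1 d2 where d: "d1 \<in> D0" "O1 = face d1" "d2 \<in> D0" "O2 = face d2" using O by blast
  hence "d1 \<in> face d2" using e face_self[of d1] D0_D by blast
  thus "O1 = O2" using face_eq[of d2 d1] d D0_D by blast
 qed
 hence "card (face ` D0) = card (face' ` darts E')" using card_image[of "\<lambda>O'. \<phi> ` (O' \<inter> D0)" "face ` D0"] im by simp
 moreover have "card (face ` D) \<le> card (insert (face (v, u)) (face ` D0))"
  by (rule card_mono[OF _ D0]) (use finD D0_D finite_subset in auto)
 moreover have "\<dots> \<le> Suc (card (face ` D0))" by (rule card_insert_le_m1) auto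
 ultimately show ?thesis using assms card_E' card_V' card_V_ge_3 cardE by linarith
qed

end

subsection \<open>Angles and segments\<close>

definition cross :: "complex \<Rightarrow> complex \<Rightarrow> real" where
 "cross a b = Re a * Im b - Im a * Re b"

lemma cross_simps [simp]:
 "cross a 0 = 0" "cross 0 a = 0" "cross a a = 0" "cross (-a) b = - cross a b" "cross a (-b) = - cross a b"
 by (simp_all add: cross_def)

lemma cross_add: "cross (a + b) c = cross a c + cross b c" "cross a (b + c) = cross a b + cross a c"
 "cross (a - b) c = cross a c - cross b c" "cross a (b - c) = cross a b - cross a c"
 by (simp_all add: cross_def algebra_simps)

lemma cross_scale: "cross (of_real r * a) b = r * cross a b" "cross a (of_real r * b) = r * cross a b"
 by (simp_all add: cross_def algebra_simps)

lemma cross_commute: "cross b a = - cross a b"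
 by (simp add: cross_def algebra_simps)

lemma Im_divide_cross: "Im (b / a) = cross a b / (cmod a)\<^sup>2"
 by (simp add: cross_def Im_divide cmod_power2 algebra_simps)

text \<open>Cramer's rule without division: the coordinates of \<open>z\<close> with respect to
  \<open>a\<close> and \<open>b\<close>.\<close>

lemma cross_decomp: "of_real (cross a b) * z = of_real (cross z b) * a + of_real (cross a z) * b"
 by (simp add: complex_eq_iff cross_def algebra_simps)

lemma cross_mult_right: "cross (a * n) (b * n) = cross a b * ((Re n)\<^sup>2 + (Im n)\<^sup>2)"
 by (simp add: cross_def algebra_simps power2_eq_square)

lemma tendsto_cross [tendsto_intros]:
 assumes "(f \<longlongrightarrow> a) F" "(g \<longlongrightarrow> b) F" shows "((\<lambda>x. cross (f x) (g x)) \<longlongrightarrow> cross a b) F"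
 unfolding cross_def by (intro tendsto_intros assms)

lemma ccw_angle_range: "0 < ccw_angle a b" "ccw_angle a b \<le> 2 * pi"
 using Arg2pi_ge_0[of "b / a"] Arg2pi_lt_2pi[of "b / a"] pi_gt_zero by (auto simp: ccw_angle_def)

lemma Arg2pi_one [simp]: "Arg2pi 1 = 0"
 using Arg2pi_of_real[of 1] by simp

lemma ccw_angle_self [simp]: "ccw_angle a a = 2 * pi"
 by (cases "a = 0") (auto simp: ccw_angle_def)

lemma ccw_angle_scale:
 assumes "0 < r" "0 < s" shows "ccw_angle (of_real r * a) (of_real s * b) = ccw_angle a b"
proof -
 have eq: "of_real s * b / (of_real r * a) = of_real (s / r) * (b / a)" by simp
 have "Arg2pi (of_real (s / r) * (b / a)) = Arg2pi (b / a)"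
  by (rule Arg2pi_times_of_real) (use assms in simp)
 thus ?thesis unfolding ccw_angle_def eq by simp
qed

lemma ccw_angle_lt_pi: assumes "a \<noteq> 0" shows "ccw_angle a b < pi \<longleftrightarrow> 0 < cross a b"
proof -
 have "ccw_angle a b < pi \<longleftrightarrow> 0 < Arg2pi (b / a) \<and> Arg2pi (b / a) < pi"
  using Arg2pi_ge_0[of "b / a"] pi_gt_zero by (auto simp: ccw_angle_def)
 also have "\<dots> \<longleftrightarrow> 0 < Im (b / a)" by (rule Arg2pi_lt_pi)
 also have "\<dots> \<longleftrightarrow> 0 < cross a b" using assms by (simp add: Im_divide_cross zero_less_divide_iff)
 finally show ?thesis .
qed

lemma ccw_angle_gt_pi: assumes "a \<noteq> 0" "cross a b < 0" shows "ccw_angle a b > pi"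
proof -
 have "Im (b / a) < 0" using assms by (simp add: Im_divide_cross divide_neg_pos)
 hence "\<not> Arg2pi (b / a) \<le> pi" by (simp add: Arg2pi_le_pi)
 thus ?thesis using pi_gt_zero by (auto simp: ccw_angle_def)
qed

text \<open>Vanishing vectors are included, since the quotient and its argument are then 0;
  statements about directions therefore ask separately for non-zero vectors.\<close>

definition same_dir :: "complex \<Rightarrow> complex \<Rightarrow> bool" where
 "same_dir a b \<longleftrightarrow> Arg2pi (b / a) = 0"

lemma same_dir_ccw: "same_dir a b \<longleftrightarrow> ccw_angle a b = 2 * pi"
 using Arg2pi_lt_2pi[of "b / a"] by (auto simp: same_dir_def ccw_angle_def)

lemma same_dirE: assumes "same_dir a b" "a \<noteq> 0" obtains r where "0 \<le> r" "b = of_real r * a"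
proof -
 have "b / a \<in> \<real> \<and> 0 \<le> Re (b / a)" using assms by (simp add: same_dir_def Arg2pi_eq_0)
 hence "b / a = of_real (Re (b / a))" by (simp add: complex_is_Real_iff complex_eq_iff)
 hence "b = of_real (Re (b / a)) * a" using assms(2) by (metis nonzero_divide_eq_eq)
 thus thesis using that \<open>b / a \<in> \<real> \<and> 0 \<le> Re (b / a)\<close> by blast
qed

lemma same_dirI: assumes "0 \<le> r" "b = of_real r * a" shows "same_dir a b"
 using assms by (cases "a = 0") (auto simp: same_dir_def Arg2pi_of_real)

lemma not_same_dir_cross: "cross a b \<noteq> 0 \<Longrightarrow> \<not> same_dir a b"
 by (cases "a = 0") (auto elim!: same_dirE simp: cross_scale)

lemma Arg2pi_polar: assumes "z \<noteq> 0"
 shows "b = of_real (cmod b) * cis (Arg2pi (b / z)) * (z / of_real (cmod z))"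
proof -
 have "b / z = of_real (cmod (b / z)) * cis (Arg2pi (b / z))"
  using Arg2pi_eq[of "b / z"] by (simp add: cis_conv_exp)
 hence "b = of_real (cmod (b / z)) * cis (Arg2pi (b / z)) * z"
  using assms by (metis nonzero_divide_eq_eq)
 thus ?thesis using assms by (simp add: norm_divide)
qed

lemma Arg2pi_cis: assumes "0 \<le> x" "x < 2 * pi" "0 < r" shows "Arg2pi (of_real r * cis x) = x"
 using assms by (intro Arg2pi_unique) (auto simp: cis_conv_exp)

text \<open>The turn from polar angle \<open>x\<close> to polar angle \<open>y\<close>, a full turn
  if they are equal, in agreement with \<open>ccw_angle\<close>. It reduces questions of circular
  order to linear arithmetic.\<close>

definition gap :: "real \<Rightarrow> real \<Rightarrow> real" where
 "gap x y = (if x < y then y - x else y - x + 2 * pi)"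

lemma ccw_angle_gap:
 assumes "z \<noteq> 0" "a \<noteq> 0" "b \<noteq> 0"
 shows "ccw_angle a b = gap (Arg2pi (a / z)) (Arg2pi (b / z))"
proof -
 let ?x = "Arg2pi (a / z)" and ?y = "Arg2pi (b / z)"
 have r: "0 \<le> ?x" "?x < 2 * pi" "0 \<le> ?y" "?y < 2 * pi" using Arg2pi_ge_0 Arg2pi_lt_2pi by auto
 have ba: "b / a = of_real (cmod b / cmod a) * cis (?y - ?x)"
 proof -
  have b: "b = of_real (cmod b) * cis ?y * (z / of_real (cmod z))" by (rule Arg2pi_polar[OF assms(1)])
  have a: "a = of_real (cmod a) * cis ?x * (z / of_real (cmod z))" by (rule Arg2pi_polar[OF assms(1)])
  have "b / a = (of_real (cmod b) * cis ?y * (z / of_real (cmod z))) / (of_real (cmod a) * cis ?x * (z / of_real (cmod z)))"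
   using a b by metis
  also have "\<dots> = of_real (cmod b / cmod a) * (cis ?y / cis ?x)" using assms by simp
  finally show ?thesis by (simp add: cis_divide)
 qed
 have pos: "0 < cmod b / cmod a" using assms by simp
 show ?thesis
 proof (cases "?x \<le> ?y")
  case True
  hence "Arg2pi (b / a) = ?y - ?x" unfolding ba using r pos by (intro Arg2pi_cis) auto
  thus ?thesis using True r by (auto simp: ccw_angle_def gap_def)
 next
  case False
  have c: "cis (?y - ?x) = cis (?y - ?x + 2 * pi)" by (simp add: cis.ctr)
  have "Arg2pi (b / a) = ?y - ?x + 2 * pi" unfolding ba c using r pos False
   by (intro Arg2pi_cis) auto
  thus ?thesis using False r by (auto simp: ccw_angle_def gap_def)
 qed
qed

lemma cross_sin:
 assumes "z \<noteq> 0"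
 shows "cross a b = cmod a * cmod b * sin (Arg2pi (b / z) - Arg2pi (a / z))"
proof -
 let ?x = "Arg2pi (a / z)" and ?y = "Arg2pi (b / z)" and ?n = "z / of_real (cmod z)"
 have n: "(Re ?n)\<^sup>2 + (Im ?n)\<^sup>2 = 1" using assms by (simp add: power_divide add_divide_distrib[symmetric] cmod_power2 sum_power2_eq_zero_iff complex_eq_iff)
 have b: "b = of_real (cmod b) * (cis ?y * ?n)" using Arg2pi_polar[OF assms, of b] by (simp add: mult.assoc)
 have a: "a = of_real (cmod a) * (cis ?x * ?n)" using Arg2pi_polar[OF assms, of a] by (simp add: mult.assoc)
 have "cross (cis ?x * ?n) (cis ?y * ?n) = cross (cis ?x) (cis ?y) * ((Re ?n)\<^sup>2 + (Im ?n)\<^sup>2)"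
  by (rule cross_mult_right)
 also have "cross (cis ?x) (cis ?y) = sin (?y - ?x)" by (simp add: cross_def sin_diff algebra_simps)
 finally have "cross (cis ?x * ?n) (cis ?y * ?n) = sin (?y - ?x) * ((Re ?n)\<^sup>2 + (Im ?n)\<^sup>2)" .
 hence "cross (cis ?x * ?n) (cis ?y * ?n) = sin (?y - ?x)" using n by simp
 moreover have "cross a b = cross (of_real (cmod a) * (cis ?x * ?n)) (of_real (cmod b) * (cis ?y * ?n))"
  using a b by metis
 moreover have "\<dots> = cmod a * (cmod b * cross (cis ?x * ?n) (cis ?y * ?n))"
  by (simp only: cross_scale mult_ac)
 ultimately show ?thesis by simp
qed

text \<open>The only jump of \<open>ccw_angle\<close>, between 2 pi and 0, is at equal directions;
  elsewhere \<open>Arg2pi\<close> is continuous.\<close>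

lemma tendsto_ccw_angle:
 assumes "(f \<longlongrightarrow> a) F" "(g \<longlongrightarrow> b) F" "a \<noteq> 0" "\<not> same_dir a b"
 shows "((\<lambda>x. ccw_angle (f x) (g x)) \<longlongrightarrow> ccw_angle a b) F"
proof -
 have q: "((\<lambda>x. g x / f x) \<longlongrightarrow> b / a) F" by (intro tendsto_intros assms)
 have n: "\<not> (b / a \<in> \<real> \<and> 0 \<le> Re (b / a))" using assms(4) by (simp add: same_dir_def Arg2pi_eq_0)
 hence "b / a \<notin> \<real>\<^sub>\<ge>\<^sub>0" by (auto simp: nonneg_Reals_def)
 hence c: "isCont Arg2pi (b / a)" by (rule continuous_at_Arg2pi)
 have l: "((\<lambda>x. Arg2pi (g x / f x)) \<longlongrightarrow> Arg2pi (b / a)) F" by (rule isCont_tendsto_compose[OF c q])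
 have ne: "Arg2pi (b / a) \<noteq> 0" using assms(4) by (simp add: same_dir_def)
 have "eventually (\<lambda>x. Arg2pi (g x / f x) \<noteq> 0) F" using tendsto_imp_eventually_ne[OF l ne] .
 hence "eventually (\<lambda>x. Arg2pi (g x / f x) = ccw_angle (f x) (g x)) F"
  by eventually_elim (simp add: ccw_angle_def)
 from Lim_transform_eventually[OF l this] show ?thesis using ne by (simp add: ccw_angle_def)
qed

lemma ccw_angle_inj:
 assumes "a \<noteq> 0" "b \<noteq> 0" "c \<noteq> 0" "ccw_angle a b = ccw_angle a c" shows "same_dir b c"
proof -
 have "gap (Arg2pi (a / a)) (Arg2pi (b / a)) = gap (Arg2pi (a / a)) (Arg2pi (c / a))"
  using assms ccw_angle_gap[of a a] by metis
 hence "Arg2pi (b / a) = Arg2pi (c / a)"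
  using assms Arg2pi_ge_0[of "b / a"] Arg2pi_ge_0[of "c / a"] Arg2pi_lt_2pi[of "b / a"] Arg2pi_lt_2pi[of "c / a"]
  by (auto simp: gap_def split: if_splits)
 hence "ccw_angle b c = 2 * pi" using ccw_angle_gap[of a b c] assms by (simp add: gap_def)
 thus ?thesis by (simp add: same_dir_ccw)
qed

lemma ccw_angle_sum: assumes "a \<noteq> 0" "b \<noteq> 0" "\<not> same_dir a b" shows "ccw_angle a b + ccw_angle b a = 2 * pi"
proof -
 have "Arg2pi (b / a) \<noteq> 0" using assms by (simp add: same_dir_def)
 thus ?thesis
  using ccw_angle_gap[of a a b] ccw_angle_gap[of a b a] assms Arg2pi_ge_0[of "b / a"] by (auto simp: gap_def split: if_splits)
qed

lemma ccw_next_scale: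
 assumes "\<And>x. x \<in> N \<Longrightarrow> 0 < s x \<and> g x = of_real (s x) * d x" "x \<in> N"
 shows "ccw_next g N x z \<longleftrightarrow> ccw_next d N x z"
proof -
 have "ccw_angle (g a) (g b) = ccw_angle (d a) (d b)" if "a \<in> N" "b \<in> N" for a b
  using assms(1)[OF that(1)] assms(1)[OF that(2)] ccw_angle_scale by simp
 thus ?thesis unfolding ccw_next_def using assms(2) by auto
qed

text \<open>The angles to be compared are distinct in the limit, so the strict inequality between
  them survives. Where directions vanish or merge in the limit, as at \<open>u\<close> and
  \<open>t\<close> in a vertex split, this cannot be applied to them as they stand.\<close>

lemma eventually_ccw_next:
 assumes fin: "finite N" and x: "x \<in> N" and nx: "ccw_next d N x z"
  and lim: "\<And>y. y \<in> N \<Longrightarrow> ((\<lambda>e. g e y) \<longlongrightarrow> d y) F"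
  and nz: "\<And>y. y \<in> N \<Longrightarrow> d y \<noteq> 0"
  and dist: "\<And>y y'. y \<in> N \<Longrightarrow> y' \<in> N \<Longrightarrow> y \<noteq> y' \<Longrightarrow> \<not> same_dir (d y) (d y')"
 shows "\<forall>\<^sub>F e in F. ccw_next (g e) N x z"
proof -
 have z: "z \<in> N" using nx by (simp add: ccw_next_def)
 have "\<forall>\<^sub>F e in F. ccw_angle (g e x) (g e z) \<le> ccw_angle (g e x) (g e y)" if y: "y \<in> N" for y
 proof (cases "y = x \<or> y = z")
  case True thus ?thesis using ccw_angle_range(2) by (auto intro!: always_eventually)
 next
  case False
  have le: "ccw_angle (d x) (d z) \<le> ccw_angle (d x) (d y)" using nx y by (simp add: ccw_next_def)
  have yx: "\<not> same_dir (d x) (d y)" using dist[OF x y] False by auto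
  have "ccw_angle (d x) (d y) < 2 * pi" using yx ccw_angle_range(2)[of "d x" "d y"] by (auto simp: same_dir_ccw)
  hence zx: "\<not> same_dir (d x) (d z)" using le by (simp add: same_dir_ccw)
  have ne: "ccw_angle (d x) (d z) \<noteq> ccw_angle (d x) (d y)"
   using ccw_angle_inj[of "d x" "d z" "d y"] dist[OF z y] nz x y z False by auto
  have "((\<lambda>e. ccw_angle (g e x) (g e z)) \<longlongrightarrow> ccw_angle (d x) (d z)) F"
   by (rule tendsto_ccw_angle[OF lim[OF x] lim[OF z] nz[OF x] zx])
  moreover have "((\<lambda>e. ccw_angle (g e x) (g e y)) \<longlongrightarrow> ccw_angle (d x) (d y)) F"
   by (rule tendsto_ccw_angle[OF lim[OF x] lim[OF y] nz[OF x] yx])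
  ultimately have "((\<lambda>e. ccw_angle (g e x) (g e y) - ccw_angle (g e x) (g e z)) \<longlongrightarrow>
    ccw_angle (d x) (d y) - ccw_angle (d x) (d z)) F" by (intro tendsto_diff)
  hence "\<forall>\<^sub>F e in F. 0 < ccw_angle (g e x) (g e y) - ccw_angle (g e x) (g e z)"
   using le ne by (intro order_tendstoD(1)) auto
  thus ?thesis by eventually_elim simp
 qed
 hence "\<forall>\<^sub>F e in F. \<forall>y\<in>N. ccw_angle (g e x) (g e z) \<le> ccw_angle (g e x) (g e y)"
  by (intro eventually_ball_finite[OF fin]) auto
 thus ?thesis by eventually_elim (simp add: ccw_next_def z)
qed

lemma segments_same_start:
 fixes a b z :: complex
 assumes "a \<noteq> z" "b \<noteq> z"
 shows "closed_segment z a \<inter> closed_segment z b = {z} \<longleftrightarrow> \<not> same_dir (a - z) (b - z)"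
proof
 assume i: "closed_segment z a \<inter> closed_segment z b = {z}"
 show "\<not> same_dir (a - z) (b - z)"
 proof
  assume "same_dir (a - z) (b - z)"
  then obtain r where r: "0 \<le> r" "b - z = of_real r * (a - z)" using assms same_dirE[of "a - z"] by auto
  have r0: "0 < r" using r assms by (cases "r = 0") auto
  show False
  proof (cases "r \<le> 1")
   case True
   have "b = z + r *\<^sub>R (a - z)" using r by (simp add: scaleR_conv_of_real algebra_simps)
   hence "b \<in> closed_segment z a" using True r by (auto simp: in_segment algebra_simps)
   thus False using i assms by auto
  next
   case False
   have "a - z = of_real (1 / r) * (b - z)" using r r0 by simp
   hence "a = z + (1 / r) *\<^sub>R (b - z)" by (simp add: scaleR_conv_of_real algebra_simps)
   moreover have "0 \<le> 1 / r" "1 / r \<le> 1" using False by auto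
   ultimately have "a \<in> closed_segment z b" unfolding in_segment by (metis add_diff_cancel_left' diff_add_eq scaleR_left_diff_distrib scaleR_one scaleR_right_diff_distrib diff_add_cancel add.commute)
   thus False using i assms by auto
  qed
 qed
next
 assume n: "\<not> same_dir (a - z) (b - z)"
 show "closed_segment z a \<inter> closed_segment z b = {z}"
 proof -
  have "y = z" if y: "y \<in> closed_segment z a" "y \<in> closed_segment z b" for y
  proof (rule ccontr)
   assume yz: "y \<noteq> z"
   obtain s where s: "0 \<le> s" "y = (1 - s) *\<^sub>R z + s *\<^sub>R a" using y(1) by (auto simp: in_segment)
   obtain r where r: "0 \<le> r" "y = (1 - r) *\<^sub>R z + r *\<^sub>R b" using y(2) by (auto simp: in_segment)
   have sy: "y - z = of_real s * (a - z)" unfolding s(2) by (simp add: scaleR_conv_of_real algebra_simps)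
   have ry: "y - z = of_real r * (b - z)" unfolding r(2) by (simp add: scaleR_conv_of_real algebra_simps)
   have "r \<noteq> 0" using ry yz by auto
   hence "b - z = of_real (s / r) * (a - z)" using sy ry by (simp add: field_simps)
   moreover have "0 \<le> s / r" using s r by simp
   ultimately show False using n same_dirI by blast
  qed
  thus ?thesis by auto
 qed
qed

text \<open>Once the ends have moved by less than \<open>m\<close>, half the distance of the two
  segments, every point of a moved segment is closer than \<open>m\<close> to its old
  segment.\<close>

lemma eventually_segments_disjoint:
 fixes a b x y :: complex
 assumes "closed_segment a b \<inter> closed_segment x y = {}"
  and "(fa \<longlongrightarrow> a) F" "(fb \<longlongrightarrow> b) F" "(fx \<longlongrightarrow> x) F" "(fy \<longlongrightarrow> y) F"
 shows "\<forall>\<^sub>F e in F. closed_segment (fa e) (fb e) \<inter> closed_segment (fx e) (fy e) = {}"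
proof -
 have pos: "0 < setdist (closed_segment a b) (closed_segment x y)"
  using assms(1) setdist_eq_0_compact_closed[of "closed_segment a b" "closed_segment x y"]
   setdist_pos_le[of "closed_segment a b" "closed_segment x y"] by (auto simp: less_le)
 define m where "m = setdist (closed_segment a b) (closed_segment x y) / 2"
 have m: "m > 0" using pos by (simp add: m_def)
 have near: "\<exists>w'\<in>closed_segment p q. dist w w' < m"
  if h: "w \<in> closed_segment p' q'" "dist p' p < m" "dist q' q < m" for p q p' q' w :: complex
 proof -
  obtain s where s: "0 \<le> s" "s \<le> 1" "w = (1 - s) *\<^sub>R p' + s *\<^sub>R q'" using h(1) by (auto simp: in_segment)
  let ?w = "(1 - s) *\<^sub>R p + s *\<^sub>R q"
  have "w - ?w = (1 - s) *\<^sub>R (p' - p) + s *\<^sub>R (q' - q)" by (simp add: s(3) algebra_simps)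
  hence "norm (w - ?w) \<le> (1 - s) * norm (p' - p) + s * norm (q' - q)"
   using norm_triangle_ineq[of "(1 - s) *\<^sub>R (p' - p)" "s *\<^sub>R (q' - q)"] s by simp
  also have "\<dots> < m"
  proof (cases "s = 0")
   case True thus ?thesis using h by (simp add: dist_norm)
  next
   case False
   have "(1 - s) * norm (p' - p) \<le> (1 - s) * m" using h s by (intro mult_left_mono) (auto simp: dist_norm)
   moreover have "s * norm (q' - q) < s * m" using h s False by (intro mult_strict_left_mono) (auto simp: dist_norm)
   ultimately show ?thesis by (simp add: algebra_simps)
  qed
  finally show ?thesis using s by (intro bexI[of _ ?w]) (auto simp: dist_norm in_segment)
 qed
 have "\<forall>\<^sub>F e in F. dist (fa e) a < m \<and> dist (fb e) b < m \<and> dist (fx e) x < m \<and> dist (fy e) y < m"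
  using assms(2-5) m by (auto simp: tendsto_iff intro!: eventually_conj)
 thus ?thesis
 proof eventually_elim
  case (elim e)
  show ?case
  proof (rule ccontr)
   assume "\<not> ?thesis"
   then obtain w where w: "w \<in> closed_segment (fa e) (fb e)" "w \<in> closed_segment (fx e) (fy e)" by auto
   obtain w1 where w1: "w1 \<in> closed_segment a b" "dist w w1 < m" using near[OF w(1)] elim by blast
   obtain w2 where w2: "w2 \<in> closed_segment x y" "dist w w2 < m" using near[OF w(2)] elim by blast
   have "setdist (closed_segment a b) (closed_segment x y) \<le> dist w1 w2" by (rule setdist_le_dist[OF w1(1) w2(1)])
   also have "\<dots> \<le> dist w w1 + dist w w2" by (metis dist_commute dist_triangle)
   finally show False using w1(2) w2(2) by (simp add: m_def)
  qed
 qed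
qed

subsection \<open>Realizations and vertex splits\<close>

definition corner :: "('a \<Rightarrow> complex) \<Rightarrow> ('a \<Rightarrow> 'a \<Rightarrow> 'a) \<Rightarrow> 'a \<Rightarrow> 'a \<Rightarrow> real" where
 "corner p \<rho> x b = ccw_angle (p x - p b) (p (\<rho> b x) - p b)"

text \<open>Every face lies on the right of its directed edges; as \<open>F\<close> is the outer face, the other
 vertices are on the left. Injectivity of \<^const>\<open>fst\<close> says that a face visits no vertex twice.\<close>

definition realization ::
 "'a set \<Rightarrow> 'a set set \<Rightarrow> ('a \<Rightarrow> 'a \<Rightarrow> 'a) \<Rightarrow> ('a \<times> 'a) set \<Rightarrow> ('a \<Rightarrow> complex) \<Rightarrow> bool" where
 "realization V E \<rho> F p \<longleftrightarrow>
   noncrossing_straight_line_embedding V E p \<and>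
   (\<forall>b x. {b, x} \<in> E \<longrightarrow> ccw_next (\<lambda>y. p y - p b) (neighbours E b) x (\<rho> b x)) \<and>
   (\<forall>b\<in>V. \<exists>x. {b, x} \<in> E \<and> pi < corner p \<rho> x b) \<and>
   (\<forall>a b. (a, b) \<in> F \<longrightarrow> (\<forall>c\<in>V - {a, b}. 0 < cross (p b - p a) (p c - p a))) \<and>
   (\<forall>Q. is_face E \<rho> Q \<longrightarrow> inj_on fst Q) \<and>
   (\<forall>Q. is_face E \<rho> Q \<longrightarrow> Q \<noteq> F \<longrightarrow> card {d\<in>Q. corner p \<rho> (fst d) (snd d) < pi} = 3)"

section \<open>Corners of a realization\<close>

locale realized = laman_map +
 fixes F :: "('a \<times> 'a) set" and p :: "'a \<Rightarrow> complex"
 assumes faceF: "is_face E \<rho> F" and real: "realization V E \<rho> F p"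
begin

lemma noncross: assumes "e \<in> E" "e' \<in> E" "e \<noteq> e'"
 shows "edge_segment p e \<inter> edge_segment p e' = p ` (e \<inter> e')"
 using real assms by (auto simp: realization_def noncrossing_straight_line_embedding_def)

lemma p_inj: "inj_on p V"
 using real by (auto simp: realization_def noncrossing_straight_line_embedding_def)

lemma p_eq: "a \<in> V \<Longrightarrow> b \<in> V \<Longrightarrow> p a = p b \<longleftrightarrow> a = b"
 using p_inj by (auto simp: inj_on_def)

lemma edge_segment_pair: "edge_segment p {a, b} = closed_segment (p a) (p b)"
 by (simp add: edge_segment_def segment_convex_hull)

lemma nxt: "{b, x} \<in> E \<Longrightarrow> ccw_next (\<lambda>y. p y - p b) (neighbours E b) x (\<rho> b x)"
 using real by (auto simp: realization_def)

lemma next_le: "{b, x} \<in> E \<Longrightarrow> {b, y} \<in> E \<Longrightarrow> corner p \<rho> x b \<le> ccw_angle (p x - p b) (p y - p b)"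
 using nxt[of b x] by (auto simp: ccw_next_def corner_def)

lemma dir_nz: "{b, x} \<in> E \<Longrightarrow> p x - p b \<noteq> 0"
 using p_eq edgeD by auto

lemma dist_dir: assumes "{b, x} \<in> E" "{b, y} \<in> E" "x \<noteq> y" shows "\<not> same_dir (p x - p b) (p y - p b)"
proof -
 have ne: "{b, x} \<noteq> {b, y}" using assms by (auto simp: doubleton_eq_iff)
 have i: "{b, x} \<inter> {b, y} = {b}" using assms edgeD[OF assms(1)] edgeD[OF assms(2)] by auto
 have "closed_segment (p b) (p x) \<inter> closed_segment (p b) (p y) = {p b}"
  using noncross[OF assms(1,2) ne] unfolding i edge_segment_pair by simp
 thus ?thesis using segments_same_start[of "p x" "p b" "p y"] dir_nz[OF assms(1)] dir_nz[OF assms(2)] by auto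
qed

lemma rho_ne_self: assumes "{b, x} \<in> E" "{b, y} \<in> E" "x \<noteq> y" shows "\<rho> b x \<noteq> x"
proof
 assume r: "\<rho> b x = x"
 hence "2 * pi \<le> ccw_angle (p x - p b) (p y - p b)" using next_le[OF assms(1,2)] by (simp add: corner_def)
 thus False using dist_dir[OF assms] ccw_angle_range(2)[of "p x - p b" "p y - p b"] by (simp add: same_dir_ccw)
qed

text \<open>The turns from \<open>x\<close> to \<open>y\<close> and from \<open>y\<close> to
  \<open>x\<close> add up to 2 pi, and each is at least the corner with which it begins.\<close>

lemma big_unique:
 assumes "{b, x} \<in> E" "{b, y} \<in> E" "pi \<le> corner p \<rho> x b" "pi < corner p \<rho> y b" shows "x = y"
proof (rule ccontr)
 assume ne: "x \<noteq> y"
 have "ccw_angle (p x - p b) (p y - p b) + ccw_angle (p y - p b) (p x - p b) = 2 * pi"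
  by (rule ccw_angle_sum[OF dir_nz[OF assms(1)] dir_nz[OF assms(2)] dist_dir[OF assms(1,2) ne]])
 thus False using next_le[OF assms(1,2)] next_le[OF assms(2,1)] assms(3,4) by linarith
qed

lemma big: assumes "b \<in> V" obtains x where "{b, x} \<in> E" "pi < corner p \<rho> x b"
 using real assms by (auto simp: realization_def)

text \<open>The vertex has a corner above pi, and a different one of size pi would exceed the full
  turn. This strictness is what makes convexity of corners stable under small moves.\<close>

lemma corner_ne_pi: assumes "{b, x} \<in> E" shows "corner p \<rho> x b \<noteq> pi"
proof
 assume c: "corner p \<rho> x b = pi"
 obtain y where "{b, y} \<in> E" "pi < corner p \<rho> y b" using big[of b] edgeD[OF assms] by blast
 thus False using big_unique[OF assms] c by fastforce
qed

lemma F_closed: "F \<subseteq> D" "f ` F \<subseteq> F"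
proof -
 obtain d where d: "d \<in> D" "F = face d" using faceF is_face_iff by auto
 show "F \<subseteq> D" using face_D[OF d(1)] d(2) by simp
 show "f ` F \<subseteq> F" unfolding d(2) by (rule image_subsetI) (rule orbit.step)
qed

lemma hull: "(a, b) \<in> F \<Longrightarrow> c \<in> V \<Longrightarrow> c \<noteq> a \<Longrightarrow> c \<noteq> b \<Longrightarrow> 0 < cross (p b - p a) (p c - p a)"
 using real by (auto simp: realization_def)

lemma hull_in: assumes "(a, b) \<in> F" "c \<in> V" "c \<noteq> a" "c \<noteq> b" shows "cross (p a - p b) (p c - p b) < 0"
 using hull[OF assms] by (simp add: cross_def algebra_simps)

text \<open>All other vertices are to the left of a hull edge, so the outer face, on its right,
  turns by more than pi at its end. On the outer face a vertex thus spends its only big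
  corner.\<close>

lemma hull_corner: assumes "(a, b) \<in> F" shows "pi < corner p \<rho> a b"
proof -
 have e: "{b, a} \<in> E" using assms F_closed by (auto simp: insert_commute)
 show ?thesis
 proof (cases "\<rho> b a = a")
  case True thus ?thesis using pi_gt_zero by (simp add: corner_def)
 next
  case False
  have "{b, \<rho> b a} \<in> E" by (rule rho_in[OF e])
  hence "cross (p a - p b) (p (\<rho> b a) - p b) < 0"
   using hull_in[OF assms, of "\<rho> b a"] False edgeD[of b "\<rho> b a"] by auto
  thus ?thesis unfolding corner_def by (rule ccw_angle_gt_pi[OF dir_nz[OF e]])
 qed
qed

lemma F_pred: assumes "(b, y) \<in> F" obtains z where "(z, b) \<in> F" "\<rho> b z = y"
proof -
 have "(b, y) \<in> f ` F" using f_image[OF F_closed] assms by simp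
 then obtain d where "d \<in> F" "f d = (b, y)" by (metis imageE)
 thus thesis using that by (cases d) auto
qed

end

section \<open>Directions around the contracted vertex\<close>

locale geo_step = contraction +
 fixes F :: "('a \<times> 'a) set" and p' :: "'a \<Rightarrow> complex"
 assumes faceF: "is_face E \<rho> F" and vuF: "(v, u) \<notin> F"
  and real': "realization V' E' \<rho>' (\<phi> ` (F \<inter> D0)) p'"
begin

abbreviation "F' \<equiv> \<phi> ` (F \<inter> D0)"

lemma F_face: obtains d0 where "d0 \<in> D0" "F = face d0" "F \<inter> D0 = F - {(u, v)}"
proof -
 obtain d where d: "d \<in> D" "F = face d" using faceF is_face_iff by auto
 show thesis using other_face[OF d(1)] d(2) vuF that by auto
qed

lemma faceF': "is_face E' \<rho>' F'"
proof -
 obtain d0 where d0: "d0 \<in> D0" "F = face d0" by (rule F_face)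
 hence "F' = face' (\<phi> d0)" using face'_\<phi> by simp
 moreover have "\<phi> d0 \<in> darts E'" using d0 \<phi>_image by blast
 ultimately show ?thesis using m'.is_face_iff by blast
qed

sublocale r': realized V' E' \<rho>' F' p'
 by unfold_locales (use faceF' real' in auto)

lemma F_closed: "F \<subseteq> D" "f ` F \<subseteq> F"
proof -
 obtain d where d: "d \<in> D" "F = face d" using faceF is_face_iff by auto
 show "F \<subseteq> D" using face_D[OF d(1)] d(2) by simp
 show "f ` F \<subseteq> F" unfolding d(2) by (rule image_subsetI) (rule orbit.step)
qed

lemma F_pred: assumes "(b, y) \<in> F" obtains z where "(z, b) \<in> F" "\<rho> b z = y"
proof -
 have "(b, y) \<in> f ` F" using f_image[OF F_closed] assms by simp
 then obtain d where "d \<in> F" "f d = (b, y)" by (metis imageE)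
 thus thesis using that by (cases d) auto
qed

lemma T_notin_F: "(v, u) \<notin> F" "(u, t) \<notin> F" "(t, v) \<notin> F"
proof -
 have c: "d \<in> F \<Longrightarrow> f d \<in> F" for d using F_closed(2) by blast
 show "(v, u) \<notin> F" "(u, t) \<notin> F" "(t, v) \<notin> F"
  using c[of "(u, t)"] c[of "(t, v)"] vuF t(2,3) by auto
qed

lemma F'_I: assumes "(a, b) \<in> F" "(a, b) \<noteq> (u, v)" shows "(c a, c b) \<in> F'"
proof -
 have "(a, b) \<in> F \<inter> D0" using assms T_notin_F F_closed(1) by (auto simp: D0_def)
 thus ?thesis by force
qed

text \<open>Angles at the merged vertex are measured from the direction of \<open>t\<close>. The
  neighbours \<open>A\<close> inherited from \<open>u\<close> occupy the angles from 0 to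
  \<open>\<Theta>i\<close>, those in \<open>B\<close> inherited from \<open>v\<close> the angles
  from \<open>\<Theta>1\<close> to 2 pi, with \<open>t\<close> at both ends. Between
  \<open>xi\<close> and \<open>y1\<close> there is an empty corner, through which the line of the
  split edge has to run.\<close>

definition "w = p' v"
definition "e x = p' x - w"
definition "\<theta> x = Arg2pi (e x / e t)"
definition "A = {x. {u, x} \<in> E \<and> x \<noteq> v}"
definition "B = {x. {v, x} \<in> E \<and> x \<noteq> u}"
definition "xi = (SOME x. {u, x} \<in> E \<and> \<rho> u x = v)"
definition "y1 = \<rho> v u"
definition "\<Theta>i = \<theta> xi"
text \<open>If \<open>v\<close> has no neighbours but \<open>u\<close> and \<open>t\<close>, the
  empty corner ends at \<open>t\<close> again, one full turn later.\<close>

definition "\<Theta>1 = (if y1 = t then 2 * pi else \<theta> y1)"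

lemma xi: "{u, xi} \<in> E" "\<rho> u xi = v" "xi \<noteq> v" "xi \<in> A"
proof -
 have "\<exists>x. {u, x} \<in> E \<and> \<rho> u x = v"
  using rho_surj[OF t(11)] t_edges(2) unfolding neighbours_def by (metis (mono_tags, lifting) image_iff mem_Collect_eq)
 hence a: "{u, xi} \<in> E \<and> \<rho> u xi = v" unfolding xi_def by (rule someI_ex)
 thus "{u, xi} \<in> E" "\<rho> u xi = v" by auto
 show "xi \<noteq> v" using a rho_t t by auto
 thus "xi \<in> A" using a by (simp add: A_def)
qed

lemma N'_v: "{v, x} \<in> E' \<longleftrightarrow> x \<in> A \<union> B"
 unfolding E'_v A_def B_def using edgeD by blast

lemma A_B: "A \<inter> B = {t}" "t \<in> A" "t \<in> B" "u \<notin> A" "v \<notin> A" "u \<notin> B" "v \<notin> B" "A \<subseteq> V'" "B \<subseteq> V'"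
proof -
 show tt: "t \<in> A" "t \<in> B" using t_edges t by (auto simp: A_def B_def)
 show "A \<inter> B = {t}" using common_nbr tt by (auto simp: A_def B_def)
 show "u \<notin> A" "v \<notin> A" "u \<notin> B" "v \<notin> B" using edgeD(1)[of u u] edgeD(1)[of v v] by (auto simp: A_def B_def)
 show "A \<subseteq> V'" "B \<subseteq> V'" using edgeD by (auto simp: A_def B_def V'_def)
qed

lemma A_rho: assumes "x \<in> A" "x \<noteq> xi" shows "\<rho> u x \<in> A" "\<rho>' v x = \<rho> u x"
proof -
 have ux: "{u, x} \<in> E" "x \<noteq> v" using assms by (auto simp: A_def)
 have "\<rho> u x \<noteq> v" using rho_inj[OF t(11)] xi ux assms(2) unfolding inj_on_def by auto
 thus "\<rho> u x \<in> A" "\<rho>' v x = \<rho> u x" using rho_in[OF ux(1)] rho'_v_in_u[OF ux] by (auto simp: A_def)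
qed

lemma xi_rho: "\<rho>' v xi = y1" "y1 \<in> B"
 using rho'_v_in_u[OF xi(1,3)] xi rho_v_u by (auto simp: y1_def B_def)

lemma B_rho: assumes "x \<in> B" "x \<noteq> t" shows "\<rho> v x \<in> B" "\<rho>' v x = \<rho> v x"
 using assms rho'_v_in_v[of x] rho_in[of v x] by (auto simp: B_def)

lemma e_nz: "x \<in> A \<union> B \<Longrightarrow> e x \<noteq> 0"
 using r'.dir_nz[of v x] N'_v by (simp add: e_def w_def)

lemma et_nz: "e t \<noteq> 0" using e_nz A_B by blast

lemma th_t [simp]: "\<theta> t = 0" using et_nz by (simp add: \<theta>_def)

lemma th_range: "0 \<le> \<theta> x" "\<theta> x < 2 * pi"
 using Arg2pi_ge_0 Arg2pi_lt_2pi by (auto simp: \<theta>_def)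

lemma e_gap: "x \<in> A \<union> B \<Longrightarrow> y \<in> A \<union> B \<Longrightarrow> ccw_angle (e x) (e y) = gap (\<theta> x) (\<theta> y)"
 unfolding \<theta>_def by (rule ccw_angle_gap) (use et_nz e_nz in auto)

lemma e_dist: "x \<in> A \<union> B \<Longrightarrow> y \<in> A \<union> B \<Longrightarrow> x \<noteq> y \<Longrightarrow> \<not> same_dir (e x) (e y)"
 using r'.dist_dir[of v x y] N'_v by (simp add: e_def w_def)

lemma th_inj: assumes "x \<in> A \<union> B" "y \<in> A \<union> B" "\<theta> x = \<theta> y" shows "x = y"
 using e_dist[OF assms(1,2)] e_gap[OF assms(1,2)] assms(3) by (auto simp: same_dir_ccw gap_def)

lemma th_pos: "x \<in> A \<union> B \<Longrightarrow> x \<noteq> t \<Longrightarrow> 0 < \<theta> x"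
 using th_inj[of x t] th_range(1)[of x] A_B by (auto simp: less_le)

lemma corner_gap: "x \<in> A \<union> B \<Longrightarrow> corner p' \<rho>' x v = gap (\<theta> x) (\<theta> (\<rho>' v x))"
 using e_gap[of x "\<rho>' v x"] m'.rho_in[of v x] N'_v by (simp add: corner_def e_def w_def)

lemma next': "x \<in> A \<union> B \<Longrightarrow> y \<in> A \<union> B \<Longrightarrow> gap (\<theta> x) (\<theta> (\<rho>' v x)) \<le> gap (\<theta> x) (\<theta> y)"
 using r'.next_le[of v x y] N'_v corner_gap[of x] e_gap[of x y] by (simp add: e_def w_def)

lemma A_step: assumes "x \<in> A" "x \<noteq> xi" "\<theta> x \<le> \<Theta>i" shows "\<theta> x < \<theta> (\<rho> u x)" "\<theta> (\<rho> u x) \<le> \<Theta>i"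
proof -
 have "\<theta> x \<noteq> \<theta> xi" using th_inj[of x xi] assms xi by auto
 hence "\<theta> x < \<Theta>i" using assms by (simp add: \<Theta>i_def)
 hence "gap (\<theta> x) (\<theta> (\<rho> u x)) \<le> \<Theta>i - \<theta> x"
  using next'[of x xi] A_rho[OF assms(1,2)] assms xi by (simp add: \<Theta>i_def gap_def)
 thus "\<theta> x < \<theta> (\<rho> u x)" "\<theta> (\<rho> u x) \<le> \<Theta>i"
  using th_range(1)[of "\<rho> u x"] th_range(2)[of xi] by (auto simp: gap_def \<Theta>i_def split: if_splits)
qed

text \<open>Turning round \<open>u\<close> from \<open>v\<close>, the angles start at 0 with
  \<open>t\<close> and grow until \<open>xi\<close>, whose successor is \<open>v\<close> again.
  Since the rotation at \<open>u\<close> is a single cycle, this meets all of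
  \<open>A\<close>.\<close>

lemma A_le: assumes "x \<in> A" shows "\<theta> x \<le> \<Theta>i"
proof -
 let ?S = "insert v {x\<in>A. \<theta> x \<le> \<Theta>i}"
 have "?S = neighbours E u"
 proof (rule rho_closed[OF t(11)])
  show "v \<in> ?S" by simp
  show "?S \<subseteq> neighbours E u" using t_edges by (auto simp: A_def)
  fix y assume y: "y \<in> ?S"
  show "\<rho> u y \<in> ?S"
  proof (cases "y = v")
   case True thus ?thesis using rho_t A_B th_range(1)[of xi] by (simp add: \<Theta>i_def)
  next
   case False
   hence yA: "y \<in> A" "\<theta> y \<le> \<Theta>i" using y by auto
   show ?thesis
   proof (cases "y = xi")
    case True thus ?thesis using xi by simp
   next
    case False thus ?thesis using A_step[OF yA(1) False yA(2)] A_rho[OF yA(1) False] by simp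
   qed
  qed
 qed
 thus ?thesis using assms by (auto simp: A_def neighbours_def)
qed

lemma B_step: assumes "x \<in> B" "x \<noteq> t" shows "\<rho> v x = t \<or> \<theta> x < \<theta> (\<rho> v x)"
 "gap (\<theta> x) (\<theta> (\<rho> v x)) \<le> 2 * pi - \<theta> x"
proof -
 have "gap (\<theta> x) (\<theta> (\<rho> v x)) \<le> gap (\<theta> x) (\<theta> t)"
  using next'[of x t] B_rho[OF assms] assms A_B by auto
 also have "\<dots> = 2 * pi - \<theta> x" using th_range(1)[of x] by (simp add: gap_def)
 finally show g: "gap (\<theta> x) (\<theta> (\<rho> v x)) \<le> 2 * pi - \<theta> x" .
 show "\<rho> v x = t \<or> \<theta> x < \<theta> (\<rho> v x)"
 proof (cases "\<rho> v x = t")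
  case False
  hence "0 < \<theta> (\<rho> v x)" using th_pos B_rho[OF assms] by blast
  thus ?thesis using g by (auto simp: gap_def split: if_splits)
 qed simp
qed

lemma Th1: "\<Theta>1 \<le> 2 * pi" "\<Theta>i < \<Theta>1" "gap \<Theta>i (\<theta> y1) = \<Theta>1 - \<Theta>i" "0 \<le> \<Theta>i"
proof -
 show "\<Theta>1 \<le> 2 * pi" using th_range(2)[of y1] by (auto simp: \<Theta>1_def)
 show "0 \<le> \<Theta>i" using th_range by (simp add: \<Theta>i_def)
 have y1N: "y1 \<in> A \<union> B" using xi_rho by blast
 have "\<Theta>i < \<Theta>1 \<and> gap \<Theta>i (\<theta> y1) = \<Theta>1 - \<Theta>i"
 proof (cases "y1 = t")
  case True thus ?thesis using th_range[of xi] by (auto simp: \<Theta>1_def \<Theta>i_def gap_def)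
 next
  case False
  hence p: "0 < \<theta> y1" using th_pos y1N by blast
  have "gap \<Theta>i (\<theta> y1) \<le> gap \<Theta>i (\<theta> t)" using next'[of xi t] xi xi_rho A_B by (simp add: \<Theta>i_def)
  also have "\<dots> = 2 * pi - \<Theta>i" using th_range(1)[of xi] by (simp add: gap_def \<Theta>i_def)
  finally show ?thesis using p False by (auto simp: gap_def \<Theta>1_def split: if_splits)
 qed
 thus "\<Theta>i < \<Theta>1" "gap \<Theta>i (\<theta> y1) = \<Theta>1 - \<Theta>i" by auto
qed

lemma B_ge: assumes "y \<in> B" "y \<noteq> t" shows "\<Theta>1 \<le> \<theta> y"
proof -
 let ?S = "insert u (insert t {y\<in>B. y \<noteq> t \<and> \<Theta>1 \<le> \<theta> y})"
 have "?S = neighbours E v"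
 proof (rule rho_closed[OF t(10)])
  show "u \<in> ?S" by simp
  show "?S \<subseteq> neighbours E v" using t_edges by (auto simp: B_def)
  fix y assume y: "y \<in> ?S"
  consider "y = u" | "y = t" | "y \<in> B" "y \<noteq> t" "\<Theta>1 \<le> \<theta> y" using y by blast
  thus "\<rho> v y \<in> ?S"
  proof cases
   case 1 thus ?thesis using xi_rho by (auto simp: y1_def \<Theta>1_def)
  next
   case 2 thus ?thesis using rho_t by simp
  next
   case 3 thus ?thesis using B_step(1)[OF 3(1,2)] B_rho[OF 3(1,2)] by auto
  qed
 qed
 thus ?thesis using assms A_B by (auto simp: B_def neighbours_def)
qed

end

section \<open>The direction of the split\<close>

context geo_step
begin

lemma V'_x: "c x \<in> V' \<longleftrightarrow> x \<in> V"
 using t by (auto simp: c_def V'_def)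

lemma v_V': "v \<in> V'" using t by (simp add: V'_def)

text \<open>\<open>u\<close> is to be moved away from \<open>w\<close> by a small multiple of
  \<open>d\<close>. The range of \<open>\<delta>\<close> gives the triangle \<open>v u t\<close> its
  orientation, and \<open>d\<close> or its opposite must point into the empty corner so that edges
  of \<open>A\<close> and \<open>B\<close> do not cross. The two new corners measure
  \<open>\<delta> + pi - \<Theta>i\<close> at \<open>u\<close> and
  \<open>\<Theta>1 - \<delta>\<close> at \<open>v\<close>. Neither may be pi, a split big corner
  must leave two big ones, and each of \<open>u\<close> and \<open>v\<close> is pointed at its new
  corner or at one inherited from \<open>w\<close>. The remaining conditions keep the outer face
  convex.\<close>

definition good_dir :: "complex \<Rightarrow> bool" where
 "good_dir d \<longleftrightarrow> (\<exists>\<delta>. 0 < \<delta> \<and> \<delta> < pi \<and> d = cis \<delta> * e t \<and>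
   ((\<Theta>i < \<delta> \<and> \<delta> < \<Theta>1) \<or> (\<Theta>i < \<delta> + pi \<and> \<delta> + pi < \<Theta>1)) \<and>
   \<delta> + pi - \<Theta>i \<noteq> pi \<and> \<Theta>1 - \<delta> \<noteq> pi \<and>
   (pi < \<Theta>1 - \<Theta>i \<longrightarrow> pi < \<delta> + pi - \<Theta>i \<and> pi < \<Theta>1 - \<delta>) \<and>
   (pi < \<delta> + pi - \<Theta>i \<or> (\<exists>x\<in>A. x \<noteq> xi \<and> pi < corner p' \<rho>' x v)) \<and>
   (pi < \<Theta>1 - \<delta> \<or> (\<exists>x\<in>B. x \<noteq> t \<and> pi < corner p' \<rho>' x v)) \<and>
   (\<forall>x. (x, u) \<in> F \<longrightarrow> x \<noteq> v \<longrightarrow> 0 < cross (e x) d) \<and>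
   (\<forall>x. (u, x) \<in> F \<longrightarrow> x \<noteq> v \<longrightarrow> cross (e x) d < 0) \<and>
   (\<forall>x. (x, v) \<in> F \<longrightarrow> x \<noteq> u \<longrightarrow> cross (e x) d < 0) \<and>
   (\<forall>x. (v, x) \<in> F \<longrightarrow> x \<noteq> u \<longrightarrow> 0 < cross (e x) d) \<and>
   ((u, v) \<in> F \<longrightarrow> (\<forall>x\<in>V' - {v}. cross d (e x) < 0)))"

lemma Arg_d: "0 \<le> \<delta> \<Longrightarrow> \<delta> < 2 * pi \<Longrightarrow> Arg2pi (cis \<delta> * e t / e t) = \<delta>"
 using Arg2pi_cis[of \<delta> 1] et_nz by simp

lemma cross_d: assumes "0 \<le> \<delta>" "\<delta> < 2 * pi"
 shows "cross (e x) (cis \<delta> * e t) = cmod (e x) * cmod (e t) * sin (\<delta> - \<theta> x)"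
 using cross_sin[OF et_nz, of "e x" "cis \<delta> * e t"] Arg_d[OF assms] by (simp add: \<theta>_def norm_mult)

lemma cross_e: "cross (e x) (e y) = cmod (e x) * cmod (e y) * sin (\<theta> y - \<theta> x)"
 using cross_sin[OF et_nz, of "e x" "e y"] by (simp add: \<theta>_def)

lemma cross_d_pos: assumes "0 \<le> \<delta>" "\<delta> < 2 * pi" "x \<in> A \<union> B" "0 < sin (\<delta> - \<theta> x)"
 shows "0 < cross (e x) (cis \<delta> * e t)"
 using cross_d[OF assms(1,2)] e_nz[OF assms(3)] et_nz assms(4) by simp

lemma sin_y1: "sin (\<delta> - \<theta> y1) = sin (\<delta> - \<Theta>1)"
 using sin_periodic[of "\<delta> - 2 * pi"] by (simp add: \<Theta>1_def)

text \<open>At the vertex \<open>v\<close> of the contracted graph, a corner of the outer face is the big angle, so that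
 the outer face passes through only one of the two ends of the split.\<close>

lemma F_xu: assumes "(x, u) \<in> F" "x \<noteq> v"
 shows "x \<in> A" "pi < corner p' \<rho>' x v" "\<And>y. y \<in> V' \<Longrightarrow> y \<noteq> v \<Longrightarrow> y \<noteq> x \<Longrightarrow> cross (e x) (e y) < 0"
proof -
 have xE: "{u, x} \<in> E" using F_closed assms(1) by (auto simp: insert_commute)
 hence xu: "x \<noteq> u" using edgeD by blast
 show "x \<in> A" using xE assms by (simp add: A_def)
 have F': "(x, v) \<in> F'" using F'_I[OF assms(1)] assms(2) xu t by auto
 show "pi < corner p' \<rho>' x v" by (rule r'.hull_corner[OF F'])
 show "cross (e x) (e y) < 0" if "y \<in> V'" "y \<noteq> v" "y \<noteq> x" for y
  using r'.hull_in[OF F' that(1)] that by (auto simp: e_def w_def)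
qed

lemma F_xv: assumes "(x, v) \<in> F" "x \<noteq> u"
 shows "x \<in> B" "x \<noteq> t" "pi < corner p' \<rho>' x v" "\<And>y. y \<in> V' \<Longrightarrow> y \<noteq> v \<Longrightarrow> y \<noteq> x \<Longrightarrow> cross (e x) (e y) < 0"
proof -
 have xE: "{v, x} \<in> E" using F_closed assms(1) by (auto simp: insert_commute)
 show "x \<in> B" using xE assms by (simp add: B_def)
 show "x \<noteq> t" using assms T_notin_F by auto
 have F': "(x, v) \<in> F'" using F'_I[OF assms(1)] assms(2) by auto
 show "pi < corner p' \<rho>' x v" by (rule r'.hull_corner[OF F'])
 show "cross (e x) (e y) < 0" if "y \<in> V'" "y \<noteq> v" "y \<noteq> x" for y
  using r'.hull_in[OF F' that(1)] that by (auto simp: e_def w_def)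
qed

lemma F_ux: assumes "(u, x) \<in> F" "x \<noteq> v"
 shows "\<exists>z\<in>A. z \<noteq> xi \<and> pi < corner p' \<rho>' z v" "x \<in> A"
  "\<And>y. y \<in> V' \<Longrightarrow> y \<noteq> v \<Longrightarrow> y \<noteq> x \<Longrightarrow> 0 < cross (e x) (e y)"
proof -
 obtain z where z: "(z, u) \<in> F" "\<rho> u z = x" by (rule F_pred[OF assms(1)])
 have xt: "x \<noteq> t" using assms T_notin_F by auto
 hence zv: "z \<noteq> v" using z rho_t by auto
 have "z \<noteq> xi" using z xi assms by auto
 thus "\<exists>z\<in>A. z \<noteq> xi \<and> pi < corner p' \<rho>' z v" using F_xu[OF z(1) zv] by blast
 have xE: "{u, x} \<in> E" using F_closed assms(1) by auto
 thus "x \<in> A" using assms by (simp add: A_def)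
 have "x \<noteq> u" using xE edgeD by blast
 hence F': "(v, x) \<in> F'" using F'_I[OF assms(1)] assms(2) by auto
 show "0 < cross (e x) (e y)" if "y \<in> V'" "y \<noteq> v" "y \<noteq> x" for y
  using r'.hull[OF F' that] by (simp add: e_def w_def)
qed

lemma F_uv: assumes "(u, v) \<in> F"
 shows "pi < corner p' \<rho>' xi v" "\<And>y. y \<in> V' \<Longrightarrow> y \<noteq> v \<Longrightarrow> y \<noteq> xi \<Longrightarrow> cross (e xi) (e y) < 0"
  "\<And>y. y \<in> V' \<Longrightarrow> y \<noteq> v \<Longrightarrow> y \<noteq> y1 \<Longrightarrow> 0 < cross (e y1) (e y)"
proof -
 obtain z where z: "(z, u) \<in> F" "\<rho> u z = v" by (rule F_pred[OF assms])
 have "{u, z} \<in> E" using F_closed z(1) by (auto simp: insert_commute)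
 hence "z = xi" using rho_inj[OF t(11)] xi z unfolding inj_on_def by auto
 hence xF: "(xi, u) \<in> F" using z by simp
 show "pi < corner p' \<rho>' xi v" "\<And>y. y \<in> V' \<Longrightarrow> y \<noteq> v \<Longrightarrow> y \<noteq> xi \<Longrightarrow> cross (e xi) (e y) < 0"
  using F_xu[OF xF xi(3)] by auto
 have "f (u, v) \<in> F" using F_closed(2) assms by blast
 hence vy: "(v, y1) \<in> F" by (simp add: y1_def)
 have "y1 \<noteq> u" using xi_rho(2) A_B(6) by auto
 hence cc: "c v = v" "c y1 = y1" by auto
 have ne: "(v, y1) \<noteq> (u, v)" using t(7) by blast
 have F': "(v, y1) \<in> F'" using F'_I[OF vy ne] by (simp only: cc)
 show "0 < cross (e y1) (e y)" if "y \<in> V'" "y \<noteq> v" "y \<noteq> y1" for y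
  using r'.hull[OF F' that] by (simp add: e_def w_def)
qed

lemma F_vx: assumes "(v, x) \<in> F" "x \<noteq> u"
 shows "(x = y1 \<and> pi < corner p' \<rho>' xi v) \<or> (\<exists>z\<in>B. z \<noteq> t \<and> pi < corner p' \<rho>' z v)" "x \<in> B"
  "\<And>y. y \<in> V' \<Longrightarrow> y \<noteq> v \<Longrightarrow> y \<noteq> x \<Longrightarrow> 0 < cross (e x) (e y)"
proof -
 obtain z where z: "(z, v) \<in> F" "\<rho> v z = x" by (rule F_pred[OF assms(1)])
 show "(x = y1 \<and> pi < corner p' \<rho>' xi v) \<or> (\<exists>z\<in>B. z \<noteq> t \<and> pi < corner p' \<rho>' z v)"
 proof (cases "z = u")
  case True thus ?thesis using F_uv z by (auto simp: y1_def)
 next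
  case False thus ?thesis using F_xv[OF z(1) False] by blast
 qed
 have xE: "{v, x} \<in> E" using F_closed assms(1) by auto
 thus "x \<in> B" using assms by (simp add: B_def)
 have F': "(v, x) \<in> F'" using F'_I[OF assms(1)] assms(2) t by auto
 show "0 < cross (e x) (e y)" if "y \<in> V'" "y \<noteq> v" "y \<noteq> x" for y
  using r'.hull[OF F' that] by (simp add: e_def w_def)
qed

text \<open>A direction inside the convex empty corner is a positive combination of
  \<open>e xi\<close> and \<open>e y1\<close>, so it lies strictly on the same side of a hull edge
  at \<open>w\<close> as the other vertices do.\<close>

lemma cross_in_corner:
 assumes K: "\<Theta>1 - \<Theta>i < pi" and d: "\<Theta>i < \<delta>" "\<delta> < \<Theta>1" and x: "x \<in> V'"
 shows "(\<And>y. y \<in> V' \<Longrightarrow> y \<noteq> v \<Longrightarrow> y \<noteq> x \<Longrightarrow> cross (e x) (e y) < 0) \<Longrightarrow> cross (e x) (cis \<delta> * e t) < 0"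
  "(\<And>y. y \<in> V' \<Longrightarrow> y \<noteq> v \<Longrightarrow> y \<noteq> x \<Longrightarrow> 0 < cross (e x) (e y)) \<Longrightarrow> 0 < cross (e x) (cis \<delta> * e t)"
proof -
 let ?d = "cis \<delta> * e t"
 have r: "0 \<le> \<delta>" "\<delta> < 2 * pi" using d Th1 by auto
 have N: "xi \<in> A \<union> B" "y1 \<in> A \<union> B" using xi xi_rho by auto
 have V: "xi \<in> V'" "xi \<noteq> v" "y1 \<in> V'" "y1 \<noteq> v" using xi(4) xi_rho(2) A_B(5,7,8,9) by auto
 have "0 < sin (\<delta> - \<Theta>i)" by (rule sin_gt_zero) (use d K in linarith)+
 hence c1: "0 < cross (e xi) ?d" unfolding \<Theta>i_def by (rule cross_d_pos[OF r N(1)])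
 have neg: "sin (x - \<Theta>1) < 0" if "\<Theta>i \<le> x" "x < \<Theta>1" for x
  using sin_gt_zero[of "\<Theta>1 - x"] sin_minus[of "\<Theta>1 - x"] that K by simp
 have "sin (\<delta> - \<theta> y1) < 0" unfolding sin_y1 by (rule neg) (use d in auto)
 hence c2: "cross (e y1) ?d < 0" using cross_d[OF r, of y1] e_nz[OF N(2)] et_nz by (simp add: mult_pos_neg)
 have "sin (\<Theta>i - \<theta> y1) < 0" unfolding sin_y1 by (rule neg) (use Th1 in auto)
 hence c3: "0 < cross (e xi) (e y1)"
  using cross_e[of y1 xi] cross_commute[of "e xi" "e y1"] e_nz[OF N(1)] e_nz[OF N(2)]
  by (simp add: \<Theta>i_def mult_pos_neg)
 have ne: "xi \<noteq> y1" using c3 by auto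
 define k where "k = cross (e xi) (e y1)"
 define l where "l = cross ?d (e y1)"
 define m where "m = cross (e xi) ?d"
 have pos: "0 < k" "0 < l" "0 < m" using c1 c2 c3 cross_commute[of "e y1" ?d] by (auto simp: k_def l_def m_def)
 have "k * cross (e x) ?d = cross (e x) (of_real k * ?d)" by (simp add: cross_scale(2))
 also have "of_real k * ?d = of_real l * e xi + of_real m * e y1"
  using cross_decomp[of "e xi" "e y1" ?d] by (simp add: k_def l_def m_def)
 finally have id: "k * cross (e x) ?d = l * cross (e x) (e xi) + m * cross (e x) (e y1)"
  by (simp add: cross_add cross_scale)
 show "cross (e x) ?d < 0" if h: "\<And>y. y \<in> V' \<Longrightarrow> y \<noteq> v \<Longrightarrow> y \<noteq> x \<Longrightarrow> cross (e x) (e y) < 0"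
 proof -
  have i: "cross (e x) (e xi) \<le> 0" "cross (e x) (e y1) \<le> 0"
   using h[OF V(1,2)] h[OF V(3,4)] by (cases "xi = x"; cases "y1 = x"; simp)+
  have "cross (e x) (e xi) < 0 \<or> cross (e x) (e y1) < 0"
   using h[OF V(1,2)] h[OF V(3,4)] ne by (cases "xi = x") auto
  hence "l * cross (e x) (e xi) + m * cross (e x) (e y1) < 0"
   using i pos by (smt (verit) mult_nonneg_nonpos mult_pos_neg)
  hence "k * cross (e x) ?d < 0" using id by simp
  thus ?thesis using pos by (simp add: mult_less_0_iff)
 qed
 show "0 < cross (e x) ?d" if h: "\<And>y. y \<in> V' \<Longrightarrow> y \<noteq> v \<Longrightarrow> y \<noteq> x \<Longrightarrow> 0 < cross (e x) (e y)"
 proof -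
  have i: "0 \<le> cross (e x) (e xi)" "0 \<le> cross (e x) (e y1)"
   using h[OF V(1,2)] h[OF V(3,4)] by (cases "xi = x"; cases "y1 = x"; simp)+
  have "0 < cross (e x) (e xi) \<or> 0 < cross (e x) (e y1)"
   using h[OF V(1,2)] h[OF V(3,4)] ne by (cases "xi = x") auto
  hence "0 < l * cross (e x) (e xi) + m * cross (e x) (e y1)"
   using i pos by (smt (verit) mult_nonneg_nonneg mult_pos_pos)
  hence "0 < k * cross (e x) ?d" using id by simp
  thus ?thesis using pos by (simp add: zero_less_mult_iff)
 qed
qed

lemma cis_add_pi: "cis (\<delta> + pi) * z = - (cis \<delta> * z)"
 by (simp add: cis.ctr complex_eq_iff)

text \<open>The cases are the possible places of the one big corner at \<open>w\<close>: the empty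
  corner itself, a corner starting at another vertex of \<open>A\<close>, or one starting at a
  vertex of \<open>B\<close> other than \<open>t\<close>. A vertex that does not inherit the big
  corner becomes pointed at a new one.\<close>

lemma ex_good_dir: "\<exists>d. good_dir d"
proof -
 obtain xb where xb: "{v, xb} \<in> E'" "pi < corner p' \<rho>' xb v" by (rule r'.big[OF v_V'])
 have xbN: "xb \<in> A \<union> B" using xb N'_v by blast
 have uniq: "x = xb" if "x \<in> A \<union> B" "pi < corner p' \<rho>' x v" for x
  using r'.big_unique[of v x xb] that xb N'_v by auto
 have Kc: "corner p' \<rho>' xi v = \<Theta>1 - \<Theta>i" using corner_gap[of xi] xi xi_rho Th1 by (simp add: \<Theta>i_def)
 consider "xb = xi" | "xb \<in> A" "xb \<noteq> xi" | "xb \<in> B" "xb \<noteq> t" using xbN A_B by blast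
 thus ?thesis
 proof cases
  case 1
  have K: "pi < \<Theta>1 - \<Theta>i" using 1 xb Kc by simp
  \<comment> \<open>The empty corner is wider than pi; this choice places both
    \<open>\<delta>\<close> and \<open>\<delta> + pi\<close> in it, which makes both new corners
    larger than pi.\<close>
  define \<delta> where "\<delta> = (\<Theta>i + min pi (\<Theta>1 - pi)) / 2"
  have d: "\<Theta>i < \<delta>" "\<delta> < pi" "\<delta> < \<Theta>1 - pi" "0 < \<delta>"
   using K Th1 pi_gt_zero by (auto simp: \<delta>_def min_def)
  have r: "0 \<le> \<delta>" "\<delta> < 2 * pi" using d pi_gt_zero by auto
  let ?d = "cis \<delta> * e t"
  have N: "xi \<in> A \<union> B" "y1 \<in> A \<union> B" using xi xi_rho by auto
  have cxi: "0 < cross (e xi) ?d"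
   by (rule cross_d_pos[OF r N(1)]) (use d Th1 in \<open>auto simp: \<Theta>i_def intro!: sin_gt_zero\<close>)
  have "0 < sin (\<delta> - \<Theta>1 + 2 * pi)" by (rule sin_gt_zero) (use d Th1 in auto)
  hence cy1: "0 < cross (e y1) ?d" by (intro cross_d_pos[OF r N(2)]) (simp add: sin_y1)
  have noA: "\<not> (\<exists>z\<in>A. z \<noteq> xi \<and> pi < corner p' \<rho>' z v)" using uniq 1 by blast
  have noB: "\<not> (\<exists>z\<in>B. z \<noteq> t \<and> pi < corner p' \<rho>' z v)"
  proof
   assume "\<exists>z\<in>B. z \<noteq> t \<and> pi < corner p' \<rho>' z v"
   then obtain z where z: "z \<in> B" "z \<noteq> t" "z = xi" using uniq 1 by blast
   thus False using xi A_B by blast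
  qed
  \<comment> \<open>If \<open>(u, v)\<close> is on the outer face, all other vertices are seen from
    \<open>w\<close> in the convex wedge spanned by \<open>e y1\<close> and \<open>e xi\<close>. As
    \<open>?d\<close> lies to the left of both of these, it lies to the left of everything in the
    wedge.\<close>
  have uv: "cross ?d (e x) < 0" if "(u, v) \<in> F" "x \<in> V' - {v}" for x
  proof (cases "x = xi \<or> x = y1")
   case True
   thus ?thesis using cxi cy1 cross_commute[of "e xi" ?d] cross_commute[of "e y1" ?d] by auto
  next
   case False
   have cx: "cross (e xi) (e x) < 0" "0 < cross (e y1) (e x)" using F_uv(2,3)[OF that(1)] that(2) False by auto
   have ne: "xi \<noteq> y1" using cx by auto
   have "0 < cross (e y1) (e xi)" using F_uv(3)[OF that(1), of xi] xi A_B ne by auto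
   moreover have "cross (e y1) (e xi) * cross ?d (e x) = cross ?d (of_real (cross (e y1) (e xi)) * e x)"
    by (simp only: cross_scale(2))
   moreover have "of_real (cross (e y1) (e xi)) * e x = of_real (cross (e x) (e xi)) * e y1 + of_real (cross (e y1) (e x)) * e xi"
    by (rule cross_decomp)
   ultimately have "cross (e y1) (e xi) * cross ?d (e x) =
     - (cross (e x) (e xi) * cross (e y1) ?d) - cross (e y1) (e x) * cross (e xi) ?d"
    using cross_commute[of "e xi" ?d] cross_commute[of "e y1" ?d] by (simp add: cross_add cross_scale)
   moreover have "0 < cross (e x) (e xi) * cross (e y1) ?d" using cx cy1 cross_commute[of "e xi" "e x"] by simp
   moreover have "0 < cross (e y1) (e x) * cross (e xi) ?d" using cx cxi by simp
   ultimately have "cross (e y1) (e xi) * cross ?d (e x) < 0" by linarith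
   thus ?thesis using \<open>0 < cross (e y1) (e xi)\<close> by (simp add: mult_less_0_iff)
  qed
  have "good_dir ?d"
   unfolding good_dir_def
  proof (intro exI[of _ \<delta>] conjI allI impI ballI)
   show "0 < cross (e x) ?d" if "(x, u) \<in> F" "x \<noteq> v" for x
   proof -
    have "x = xi" using F_xu[OF that] uniq[of x] 1 by blast
    thus ?thesis using cxi by simp
   qed
   show "cross (e x) ?d < 0" if "(u, x) \<in> F" "x \<noteq> v" for x using F_ux(1)[OF that] noA by blast
   show "cross (e x) ?d < 0" if "(x, v) \<in> F" "x \<noteq> u" for x using F_xv(1-3)[OF that] noB by blast
   show "0 < cross (e x) ?d" if "(v, x) \<in> F" "x \<noteq> u" for x using F_vx(1)[OF that] noB cy1 by blast
   show "cross ?d (e x) < 0" if "(u, v) \<in> F" "x \<in> V' - {v}" for x by (rule uv[OF that])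
  qed (use d Th1 K in auto)
  thus ?thesis by blast
 next
  case 2
  have "pi < gap (\<theta> xb) (\<theta> (\<rho> u xb))" using xb(2) corner_gap[OF xbN] A_rho[OF 2] by simp
  moreover note s = A_step[OF 2 A_le[OF 2(1)]]
  ultimately have Ti: "pi < \<Theta>i" using th_range(1)[of xb] by (simp add: gap_def)
  have K: "\<Theta>1 - \<Theta>i < pi" using Ti Th1 by auto
  \<comment> \<open>The big corner is inherited by \<open>u\<close>, and \<open>\<Theta>i\<close>
    exceeds pi. The opposite of \<open>d\<close> halves the empty corner; then
    \<open>\<Theta>1 - \<delta>\<close> is above pi and \<open>v\<close> is pointed there.\<close>
  define \<delta> where "\<delta> = (\<Theta>i + \<Theta>1) / 2 - pi"
  have d: "0 < \<delta>" "\<delta> < pi" "\<Theta>i < \<delta> + pi" "\<delta> + pi < \<Theta>1" using Ti Th1 by (auto simp: \<delta>_def)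
  let ?d = "cis \<delta> * e t"
  have md: "cis (\<delta> + pi) * e t = - ?d" by (rule cis_add_pi)
  note cc = cross_in_corner[OF K d(3,4), unfolded md]
  have nxi: "\<not> pi < corner p' \<rho>' xi v" using uniq[of xi] xi 2 by blast
  have noB: "\<not> (\<exists>z\<in>B. z \<noteq> t \<and> pi < corner p' \<rho>' z v)"
  proof
   assume "\<exists>z\<in>B. z \<noteq> t \<and> pi < corner p' \<rho>' z v"
   then obtain z where z: "z \<in> B" "z \<noteq> t" "z = xb" using uniq by blast
   thus False using 2 A_B by blast
  qed
  have "good_dir ?d"
   unfolding good_dir_def
  proof (intro exI[of _ \<delta>] conjI allI impI ballI)
   show "0 < cross (e x) ?d" if "(x, u) \<in> F" "x \<noteq> v" for x
    using cc(1)[of x] F_xu[OF that] A_B by auto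
   show "cross (e x) ?d < 0" if "(u, x) \<in> F" "x \<noteq> v" for x
    using cc(2)[of x] F_ux[OF that] A_B by auto
   show "cross (e x) ?d < 0" if "(x, v) \<in> F" "x \<noteq> u" for x using F_xv(1-3)[OF that] noB by blast
   show "0 < cross (e x) ?d" if "(v, x) \<in> F" "x \<noteq> u" for x using F_vx(1)[OF that] noB nxi by blast
   show "cross ?d (e x) < 0" if "(u, v) \<in> F" "x \<in> V' - {v}" for x using F_uv(1)[OF that(1)] nxi by blast
   show "pi < \<delta> + pi - \<Theta>i \<or> (\<exists>x\<in>A. x \<noteq> xi \<and> pi < corner p' \<rho>' x v)" using 2 xb by blast
  qed (use d Th1 K Ti in auto)
  thus ?thesis by blast
 next
  case 3
  have "pi < gap (\<theta> xb) (\<theta> (\<rho> v xb))" using xb(2) corner_gap[OF xbN] B_rho[OF 3] by simp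
  hence T1: "\<Theta>1 < pi" using B_step(2)[OF 3] B_ge[OF 3] by linarith
  have K: "\<Theta>1 - \<Theta>i < pi" using T1 Th1 by auto
  \<comment> \<open>The big corner is inherited by \<open>v\<close>, and \<open>\<Theta>1\<close> is
    below pi. Here \<open>d\<close> itself halves the empty corner, so the new corner at
    \<open>u\<close> is above pi.\<close>
  define \<delta> where "\<delta> = (\<Theta>i + \<Theta>1) / 2"
  have d: "\<Theta>i < \<delta>" "\<delta> < \<Theta>1" "0 < \<delta>" "\<delta> < pi" using T1 Th1 by (auto simp: \<delta>_def)
  let ?d = "cis \<delta> * e t"
  note cc = cross_in_corner[OF K d(1,2)]
  have nxi: "\<not> pi < corner p' \<rho>' xi v"
  proof
   assume "pi < corner p' \<rho>' xi v"
   hence "xi = xb" using uniq[of xi] xi by blast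
   thus False using 3 xi A_B by blast
  qed
  have noA: "\<not> (\<exists>z\<in>A. pi < corner p' \<rho>' z v)"
  proof
   assume "\<exists>z\<in>A. pi < corner p' \<rho>' z v"
   then obtain z where z: "z \<in> A" "z = xb" using uniq by blast
   thus False using 3 A_B by blast
  qed
  have "good_dir ?d"
   unfolding good_dir_def
  proof (intro exI[of _ \<delta>] conjI allI impI ballI)
   show "0 < cross (e x) ?d" if "(x, u) \<in> F" "x \<noteq> v" for x
    using F_xu[OF that] noA by blast
   show "cross (e x) ?d < 0" if "(u, x) \<in> F" "x \<noteq> v" for x
    using F_ux(1)[OF that] noA by blast
   show "cross (e x) ?d < 0" if "(x, v) \<in> F" "x \<noteq> u" for x
    using cc(1)[of x] F_xv[OF that] A_B by auto
   show "0 < cross (e x) ?d" if "(v, x) \<in> F" "x \<noteq> u" for x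
    using cc(2)[of x] F_vx[OF that] A_B by auto
   show "cross ?d (e x) < 0" if "(u, v) \<in> F" "x \<in> V' - {v}" for x using F_uv(1)[OF that(1)] nxi by blast
   show "pi < \<Theta>1 - \<delta> \<or> (\<exists>x\<in>B. x \<noteq> t \<and> pi < corner p' \<rho>' x v)" using 3 xb by blast
  qed (use d Th1 K T1 in auto)
  thus ?thesis by blast
 qed
qed

end

lemma ev_not_same_dir:
 assumes "(h \<longlongrightarrow> a) G" "(g \<longlongrightarrow> b) G" "a \<noteq> 0" "\<not> same_dir a b"
 shows "eventually (\<lambda>x. \<not> same_dir (h x) (g x)) G"
proof -
 have "ccw_angle a b < 2 * pi" using assms(4) ccw_angle_range(2)[of a b] by (auto simp: same_dir_ccw)
 from order_tendstoD(2)[OF tendsto_ccw_angle[OF assms] this] show ?thesis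
  by eventually_elim (simp add: same_dir_ccw)
qed

section \<open>The moved drawing and its rotations\<close>

locale geo_dir = geo_step +
 fixes \<delta> :: real and d :: complex
 assumes d01: "0 < \<delta>" "\<delta> < pi" and d_eq: "d = cis \<delta> * e t"
  and d_cases: "(\<Theta>i < \<delta> \<and> \<delta> < \<Theta>1) \<or> (\<Theta>i < \<delta> + pi \<and> \<delta> + pi < \<Theta>1)"
begin

definition pe :: "real \<Rightarrow> 'a \<Rightarrow> complex" where
 "pe eps = p'(u := w + of_real eps * d)"

lemma pe_simps [simp]: "pe eps u = w + of_real eps * d" "x \<noteq> u \<Longrightarrow> pe eps x = p' x"
 by (simp_all add: pe_def)

lemma p'_e: "p' x = w + e x" by (simp add: e_def)

lemma e_v [simp]: "e v = 0" by (simp add: e_def w_def)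

lemma pe_v [simp]: "pe eps v = w" using t by (simp add: w_def)

abbreviation "ev P \<equiv> eventually P (at_right (0::real))"

lemma ev_pos: "ev (\<lambda>eps. 0 < eps)" by (rule eventually_at_right_less)

lemma lim_eps: "((\<lambda>eps. of_real eps * z) \<longlongrightarrow> (0::complex)) (at_right 0)"
 by (rule tendsto_eq_intros refl | simp)+

lemma pe_lim: "((\<lambda>eps. pe eps x) \<longlongrightarrow> p' (c x)) (at_right 0)"
proof (cases "x = u")
 case True
 have "((\<lambda>eps. w + of_real eps * d) \<longlongrightarrow> w + 0) (at_right 0)" by (intro tendsto_intros lim_eps)
 thus ?thesis using True by (simp add: w_def)
qed simp

lemma d_nz: "d \<noteq> 0" using et_nz by (simp add: d_eq)

lemma d_arg: "Arg2pi (d / e t) = \<delta>" "Arg2pi (- d / e t) = \<delta> + pi"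
proof -
 show "Arg2pi (d / e t) = \<delta>" unfolding d_eq by (rule Arg_d) (use d01 in auto)
 show "Arg2pi (- d / e t) = \<delta> + pi"
  unfolding d_eq cis_add_pi[symmetric] by (rule Arg_d) (use d01 in auto)
qed

lemma dbounds: "\<delta> < \<Theta>1" "\<Theta>i < \<delta> + pi" "\<delta> + pi < 2 * pi"
 using d_cases d01 by auto

lemma cross_e_d: "cross (e x) d = cmod (e x) * cmod (e t) * sin (\<delta> - \<theta> x)"
 unfolding d_eq by (rule cross_d) (use d01 in auto)

lemma cross_et_d: "0 < cross (e t) d"
 using cross_e_d[of t] et_nz sin_gt_zero[OF d01] by simp

text \<open>Polar angles and limit directions around \<open>u\<close> and \<open>v\<close>. However
  short the split edge becomes, it keeps the direction \<open>- d\<close> seen from \<open>u\<close>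
  and \<open>d\<close> seen from \<open>v\<close>, so it is entered with these values in place of
  its vanishing limit.\<close>

definition "thU x = (if x = v then \<delta> + pi else \<theta> x)"
definition "thV x = (if x = u then \<delta> else \<theta> x)"
definition "Du x = (if x = v then - d else e x)"
definition "Dv x = (if x = u then d else e x)"

lemma N_u_iff: "{u, x} \<in> E \<longleftrightarrow> x \<in> insert v A" using t_edges by (auto simp: A_def)
lemma N_v_iff: "{v, x} \<in> E \<longleftrightarrow> x \<in> insert u B" using t_edges by (auto simp: B_def)
lemma N_u: "neighbours E u = insert v A" by (rule set_eqI) (simp only: mem_neighbours N_u_iff)
lemma N_v: "neighbours E v = insert u B" by (rule set_eqI) (simp only: mem_neighbours N_v_iff)

lemma uvt: "v \<noteq> u" "u \<noteq> v" "u \<noteq> t" "t \<noteq> u" "t \<noteq> v" "v \<noteq> t" using t(7-9) by auto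

lemma Du_gap: "x \<in> insert v A \<Longrightarrow> y \<in> insert v A \<Longrightarrow> ccw_angle (Du x) (Du y) = gap (thU x) (thU y)"
 using ccw_angle_gap[OF et_nz, of "Du x" "Du y"] e_nz d_nz d_arg
 by (auto simp: Du_def thU_def \<theta>_def)

lemma Dv_gap: "x \<in> insert u B \<Longrightarrow> y \<in> insert u B \<Longrightarrow> ccw_angle (Dv x) (Dv y) = gap (thV x) (thV y)"
 using ccw_angle_gap[OF et_nz, of "Dv x" "Dv y"] e_nz d_nz d_arg
 by (auto simp: Dv_def thV_def \<theta>_def)

lemma Du_nz: "x \<in> insert v A \<Longrightarrow> Du x \<noteq> 0" using e_nz d_nz by (auto simp: Du_def)
lemma thU_A: "x \<in> A \<Longrightarrow> thU x = \<theta> x \<and> \<theta> x < \<delta> + pi"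
 using A_B A_le[of x] dbounds by (auto simp: thU_def)

lemma thV_B: "x \<in> B \<Longrightarrow> x \<noteq> t \<Longrightarrow> thV x = \<theta> x \<and> \<delta> < \<theta> x"
 using A_B B_ge[of x] dbounds by (auto simp: thV_def)

lemma thV_t: "thV t = 0" "thV u = \<delta>" "thU v = \<delta> + pi" "thU t = 0" using t by (auto simp: thV_def thU_def)

lemma Du_dist: assumes "x \<in> insert v A" "y \<in> insert v A" "x \<noteq> y" shows "\<not> same_dir (Du x) (Du y)"
proof -
 have "thU x \<noteq> thU y"
  using assms thU_A[of x] thU_A[of y] thV_t th_inj[of x y] by auto
 thus ?thesis using Du_gap[OF assms(1,2)] assms th_range[of x] th_range[of y] d01
  by (auto simp: same_dir_ccw gap_def thU_def)
qed

lemma Dv_dist: assumes "x \<in> insert u B" "y \<in> insert u B" "x \<noteq> y" shows "\<not> same_dir (Dv x) (Dv y)"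
proof -
 have b: "x \<in> B \<Longrightarrow> thV x \<noteq> \<delta>" for x using thV_B[of x] thV_t d01 by (cases "x = t") auto
 have "thV x \<noteq> thV y"
 proof (cases "x = u \<or> y = u")
  case True
  thus ?thesis using assms b[of x] b[of y] thV_t(2) by auto
 next
  case False
  hence "x \<in> B" "y \<in> B" "thV x = \<theta> x" "thV y = \<theta> y" using assms by (auto simp: thV_def)
  thus ?thesis using th_inj[of x y] assms(3) by auto
 qed
 thus ?thesis using Dv_gap[OF assms(1,2)] assms th_range[of x] th_range[of y] d01
  by (auto simp: same_dir_ccw gap_def thV_def)
qed

text \<open>At \<open>u\<close> the split edge has angle \<open>\<delta> + pi\<close>, beyond all of
  \<open>A\<close>; it comes between \<open>xi\<close> and the next passage of
  \<open>t\<close>.\<close>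

lemma nextU: assumes "x \<in> insert v A" shows "ccw_next Du (insert v A) x (\<rho> u x)"
proof -
 have r: "\<rho> u x \<in> insert v A" using rho_in[of u x] assms unfolding N_u_iff by blast
 have "gap (thU x) (thU (\<rho> u x)) \<le> gap (thU x) (thU y)" if y: "y \<in> insert v A" for y
 proof -
  consider "x = v" | "x = xi" | "x \<in> A" "x \<noteq> xi" "x \<noteq> v" using assms by blast
  thus ?thesis
  proof cases
   case 1
   thus ?thesis using rho_t thV_t thU_A[of y] y d01 th_range[of y] by (auto simp: gap_def)
  next
   case 2
   have "thU xi = \<Theta>i" using xi by (simp add: thU_def \<Theta>i_def)
   thus ?thesis using 2 xi thV_t A_le[of y] thU_A[of y] y dbounds d01 th_range[of y] by (auto simp: gap_def)
  next
   case 3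
   note s = A_step[OF 3(1,2) A_le[OF 3(1)]] and rr = A_rho[OF 3(1,2)]
   show ?thesis
   proof (cases "y = v")
    case True
    thus ?thesis using s thU_A[OF 3(1)] thU_A[OF rr(1)] thV_t dbounds by (auto simp: gap_def)
   next
    case False
    thus ?thesis using next'[of x y] y 3 rr thU_A by auto
   qed
  qed
 qed
 thus ?thesis unfolding ccw_next_def using r Du_gap[OF assms] by auto
qed

text \<open>At \<open>v\<close> the split edge has angle \<open>\<delta>\<close>, after
  \<open>t\<close> at 0 and before the rest of \<open>B\<close>, which starts at
  \<open>\<Theta>1\<close>.\<close>

lemma nextV: assumes "x \<in> insert u B" shows "ccw_next Dv (insert u B) x (\<rho> v x)"
proof -
 have r: "\<rho> v x \<in> insert u B" using rho_in[of v x] assms unfolding N_v_iff by blast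
 have "gap (thV x) (thV (\<rho> v x)) \<le> gap (thV x) (thV y)" if y: "y \<in> insert u B" for y
 proof -
  have yc: "y = u \<or> y = t \<or> (y \<in> B \<and> y \<noteq> t)" using y by auto
  consider "x = u" | "x = t" | "x \<in> B" "x \<noteq> t" "x \<noteq> u" using assms by blast
  thus ?thesis
  proof cases
   case 1
   have y1: "thV y1 = \<theta> y1" using xi_rho(2) A_B(6) by (auto simp: thV_def)
   have "gap \<delta> (\<theta> y1) = \<Theta>1 - \<delta>"
    using dbounds d01 by (auto simp: gap_def \<Theta>1_def)
   thus ?thesis using 1 y1 yc thV_t thV_B[of y] B_ge[of y] dbounds d01 Th1
    by (auto simp: gap_def y1_def)
  next
   case 2
   thus ?thesis using rho_t yc thV_t thV_B[of y] d01 dbounds by (auto simp: gap_def)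
  next
   case 3
   note rr = B_rho[OF 3(1,2)] and s = B_step(2)[OF 3(1,2)]
   have tr: "thV (\<rho> v x) = \<theta> (\<rho> v x)" "thV x = \<theta> x" using rr(1) A_B(6) 3 by (auto simp: thV_def)
   show ?thesis
   proof (cases "y = u")
    case True
    thus ?thesis using s tr thV_B[OF 3(1,2)] thV_t d01 by (auto simp: gap_def)
   next
    case False
    hence "y \<in> B" "thV y = \<theta> y" using y by (auto simp: thV_def)
    thus ?thesis using next'[of x y] 3 rr tr by auto
   qed
  qed
 qed
 thus ?thesis unfolding ccw_next_def using r Dv_gap[OF assms] by auto
qed

definition dir :: "real \<Rightarrow> 'a \<Rightarrow> 'a \<Rightarrow> complex" where "dir eps b x = pe eps x - pe eps b"

text \<open>The direction from \<open>u\<close> to \<open>v\<close> shrinks to 0 with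
  \<open>eps\<close>. Divided by \<open>eps\<close> it is \<open>- d\<close>, so that all directions
  at \<open>u\<close> have non-zero limits, and positive factors do not affect the rotation.\<close>

definition gU :: "real \<Rightarrow> 'a \<Rightarrow> complex" where "gU eps y = (if y = v then - d else e y - of_real eps * d)"

lemma gU_lim: "((\<lambda>eps. gU eps y) \<longlongrightarrow> Du y) (at_right 0)"
proof (cases "y = v")
 case True thus ?thesis by (simp add: gU_def Du_def)
next
 case False
 have "((\<lambda>eps. e y - of_real eps * d) \<longlongrightarrow> e y - 0) (at_right 0)" by (intro tendsto_intros lim_eps)
 thus ?thesis using False by (simp add: gU_def Du_def)
qed

lemma dir_u: "0 < eps \<Longrightarrow> x \<in> insert v A \<Longrightarrow>
  dir eps u x = of_real (if x = v then eps else 1) * gU eps x"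
 using A_B(4) uvt by (cases "x = v"; cases "x = u") (auto simp: dir_def gU_def p'_e)

lemma dir_v: "0 < eps \<Longrightarrow> x \<in> insert u B \<Longrightarrow>
  dir eps v x = of_real (if x = u then eps else 1) * Dv x"
 using uvt by (cases "x = u") (auto simp: dir_def Dv_def p'_e)

lemma rot_u: assumes "{u, x} \<in> E" shows "ev (\<lambda>eps. ccw_next (dir eps u) (neighbours E u) x (\<rho> u x))"
proof -
 have x: "x \<in> insert v A" using assms by (simp only: N_u_iff)
 have "ev (\<lambda>eps. ccw_next (gU eps) (insert v A) x (\<rho> u x))"
  by (rule eventually_ccw_next[OF _ x nextU[OF x] gU_lim Du_nz Du_dist]) (use finN[of u] N_u in auto)
 thus ?thesis using ev_pos
 proof eventually_elim
  case (elim eps)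
  have "ccw_next (dir eps u) (insert v A) x (\<rho> u x) \<longleftrightarrow> ccw_next (gU eps) (insert v A) x (\<rho> u x)"
   by (rule ccw_next_scale[where s = "\<lambda>x. if x = v then eps else 1"]) (use dir_u[OF elim(2)] elim x in auto)
  thus ?case using elim(1) by (simp add: N_u)
 qed
qed

lemma rot_v: assumes "{v, x} \<in> E" shows "ev (\<lambda>eps. ccw_next (dir eps v) (neighbours E v) x (\<rho> v x))"
 using ev_pos
proof eventually_elim
 case (elim eps)
 have x: "x \<in> insert u B" using assms by (simp only: N_v_iff)
 have "ccw_next (dir eps v) (insert u B) x (\<rho> v x) \<longleftrightarrow> ccw_next Dv (insert u B) x (\<rho> v x)"
  by (rule ccw_next_scale[where s = "\<lambda>x. if x = u then eps else 1"]) (use dir_v[OF elim] elim x in auto)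
 thus ?case using nextV[OF x] by (simp add: N_v)
qed

lemma N'_t: "{t, y} \<in> E' \<longleftrightarrow> {t, y} \<in> E \<and> y \<noteq> u"
 using E'_other[of t y] t t_edges by auto

text \<open>At \<open>t\<close> the edges to \<open>u\<close> and \<open>v\<close> merge in the
  limit, so their order cannot be read off there. Angles are measured from the edge to
  \<open>v\<close>, and the edge to \<open>u\<close> then has an angle \<open>eta\<close> that
  approaches a full turn from below.\<close>

definition "tht y = Arg2pi ((p' y - p' t) / (p' v - p' t))"

lemma tv_nz: "p' v - p' t \<noteq> 0" using et_nz by (simp add: e_def w_def)

lemma t_gap: "{t, x} \<in> E' \<Longrightarrow> {t, y} \<in> E' \<Longrightarrow> ccw_angle (p' x - p' t) (p' y - p' t) = gap (tht x) (tht y)"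
 unfolding tht_def by (rule ccw_angle_gap[OF tv_nz]) (use r'.dir_nz in auto)

lemma dir_t_lim: "((\<lambda>eps. dir eps t x) \<longlongrightarrow> p' (c x) - p' t) (at_right 0)"
 unfolding dir_def using tendsto_diff[OF pe_lim[of x] pe_lim[of t]] by simp

definition "eta eps = Arg2pi (dir eps t u / (p' v - p' t))"

lemma eta: assumes "0 < eps" shows "pi < eta eps" "eta eps < 2 * pi"
proof -
 have "dir eps t u = - e t + of_real eps * d" using t by (simp add: dir_def p'_e)
 moreover have "p' v - p' t = - e t" by (simp add: p'_e)
 ultimately have "cross (p' v - p' t) (dir eps t u) = - (eps * cross (e t) d)" by (simp add: cross_add cross_scale)
 hence "cross (p' v - p' t) (dir eps t u) < 0" using cross_et_d assms by simp
 hence "Im (dir eps t u / (p' v - p' t)) < 0" using tv_nz by (simp add: Im_divide_cross divide_neg_pos)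
 thus "pi < eta eps" unfolding eta_def using Arg2pi_le_pi by (meson linorder_not_le)
 show "eta eps < 2 * pi" unfolding eta_def by (rule Arg2pi_lt_2pi)
qed

lemma tht_v: "tht v = 0" using tv_nz by (simp add: tht_def)

lemma tht_range: "0 \<le> tht y" "tht y < 2 * pi" using Arg2pi_ge_0 Arg2pi_lt_2pi by (auto simp: tht_def)

lemma dir_t_nz: assumes "{t, x} \<in> E" "0 < eps" shows "dir eps t x \<noteq> 0"
proof (cases "x = u")
 case True
 thus ?thesis using eta[OF assms(2)] pi_gt_zero by (auto simp: eta_def)
next
 case False thus ?thesis using r'.dir_nz[of t x] N'_t assms t by (simp add: dir_def)
qed

text \<open>A limit of \<open>eta\<close> itself would run into the jump of \<open>Arg2pi\<close>.
  The turn from \<open>u\<close> to \<open>y\<close>, on the other hand, converges to the turn from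
  \<open>v\<close> to \<open>y\<close>, which is \<open>tht y\<close>. Since \<open>eta\<close> is
  above pi, the opposite order would make that turn smaller than \<open>tht y - pi\<close>.\<close>

lemma tht_less_eta: assumes y: "{t, y} \<in> E'" shows "ev (\<lambda>eps. tht y < eta eps)"
proof (cases "y = v")
 case True
 have "ev (\<lambda>eps. 0 < eta eps)" using ev_pos by eventually_elim (rule less_trans[OF pi_gt_zero eta(1)])
 thus ?thesis using True tht_v by simp
next
 case False
 have yu: "y \<noteq> u" "{t, y} \<in> E" using y N'_t by auto
 have tv: "{t, v} \<in> E'" using N'_t t t_edges by auto
 have sd: "\<not> same_dir (p' v - p' t) (p' y - p' t)" by (rule r'.dist_dir[OF tv y]) (use False in auto)
 have "((\<lambda>eps. ccw_angle (dir eps t u) (dir eps t y)) \<longlongrightarrow> ccw_angle (p' v - p' t) (p' y - p' t)) (at_right 0)"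
  by (rule tendsto_ccw_angle[OF _ _ tv_nz sd]) (use dir_t_lim[of u] dir_t_lim[of y] yu in auto)
 moreover have "ccw_angle (p' v - p' t) (p' y - p' t) = tht y"
  using t_gap[OF tv y] tht_v tht_range[of y] sd by (auto simp: gap_def same_dir_ccw)
 ultimately have l: "((\<lambda>eps. ccw_angle (dir eps t u) (dir eps t y)) \<longlongrightarrow> tht y) (at_right 0)" by simp
 have "ev (\<lambda>eps. ccw_angle (dir eps t u) (dir eps t y) < 2 * pi)"
  by (rule order_tendstoD(2)[OF l tht_range(2)])
 moreover have "ev (\<lambda>eps. tht y - pi < ccw_angle (dir eps t u) (dir eps t y))"
  by (rule order_tendstoD(1)[OF l]) (use pi_gt_zero in auto)
 ultimately show ?thesis using ev_pos
 proof eventually_elim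
  case (elim eps)
  have "dir eps t y = p' y - p' t" using yu uvt by (simp add: dir_def)
  hence "ccw_angle (dir eps t u) (dir eps t y) = gap (eta eps) (tht y)"
   using ccw_angle_gap[OF tv_nz dir_t_nz[OF t_edges(4) elim(3)] dir_t_nz[OF yu(2) elim(3)]]
   by (simp only: eta_def tht_def)
  thus ?case using elim eta[OF elim(3)] by (auto simp: gap_def split: if_splits)
 qed
qed

lemma all_tht_less_eta: "ev (\<lambda>eps. 0 < eps \<and> (\<forall>y. {t, y} \<in> E' \<longrightarrow> tht y < eta eps))"
proof -
 have "ev (\<lambda>eps. \<forall>y\<in>neighbours E' t. tht y < eta eps)"
  by (rule eventually_ball_finite[OF m'.finN]) (use tht_less_eta in auto)
 thus ?thesis using ev_pos by eventually_elim auto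
qed

definition "thT eps y = (if y = u then eta eps else tht y)"

lemma t_gap': assumes "{t, x} \<in> E" "{t, y} \<in> E" "0 < eps"
 shows "ccw_angle (dir eps t x) (dir eps t y) = gap (thT eps x) (thT eps y)"
 using ccw_angle_gap[OF tv_nz dir_t_nz[OF assms(1,3)] dir_t_nz[OF assms(2,3)]] t
 by (auto simp: thT_def eta_def tht_def dir_def)

text \<open>Seen from \<open>t\<close>, the edge to \<open>u\<close> is inserted immediately before
  the edge to \<open>v\<close> at angle 0; all other angles are those of the contraction.\<close>

lemma rot_t: assumes x: "{t, x} \<in> E" shows "ev (\<lambda>eps. ccw_next (dir eps t) (neighbours E t) x (\<rho> t x))"
 using all_tht_less_eta
proof eventually_elim
 case (elim eps)
 have pos: "0 < eps" using elim by simp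
 have less: "tht y < eta eps" if "{t, y} \<in> E" "y \<noteq> u" for y using elim that N'_t by auto
 have r: "{t, \<rho> t x} \<in> E" by (rule rho_in[OF x])
 have "gap (thT eps x) (thT eps (\<rho> t x)) \<le> gap (thT eps x) (thT eps y)" if y: "{t, y} \<in> E" for y
 proof (cases "x = u")
  case True
  thus ?thesis using rho_t t tht_v eta[OF pos] less[OF y] tht_range(1)[of y] by (auto simp: thT_def gap_def)
 next
  case False
  have xE': "{t, x} \<in> E'" using x False N'_t by simp
  have rx: "\<rho>' t x = c (\<rho> t x)" using rho'_other[of t x] t x False by (auto simp: doubleton_eq_iff)
  have nx: "gap (tht x) (tht (c (\<rho> t x))) \<le> gap (tht x) (tht z)" if "{t, z} \<in> E'" for z
   using r'.next_le[OF xE' that] t_gap[OF xE' that] t_gap[OF xE' m'.rho_in[OF xE']] rx by (simp add: corner_def)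
  have tv: "{t, v} \<in> E'" using N'_t t t_edges by auto
  have tx: "thT eps x = tht x" using False by (simp add: thT_def)
  show ?thesis
  proof (cases "\<rho> t x = u")
   case True
   hence le: "gap (tht x) 0 \<le> gap (tht x) (tht z)" if "{t, z} \<in> E'" for z using nx[OF that] tht_v by simp
   show ?thesis
   proof (cases "y = u")
    case T: True thus ?thesis using True by simp
   next
    case F: False
    hence yE': "{t, y} \<in> E'" using y N'_t by simp
    show ?thesis
     using le[OF yE'] True F tx less[OF x False] tht_range[of x] tht_range[of y] eta[OF pos]
     by (auto simp: thT_def gap_def split: if_splits)
   qed
  next
   case F: False
   hence r': "c (\<rho> t x) = \<rho> t x" "thT eps (\<rho> t x) = tht (\<rho> t x)" by (auto simp: thT_def)
   show ?thesis
   proof (cases "y = u")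
    case True
    have "\<rho> t x \<noteq> v" using rho_inj[of t] rho_t(2) x t_edges False t unfolding inj_on_def by auto
    hence nv: "\<not> same_dir (p' v - p' t) (p' (\<rho> t x) - p' t)"
     using r'.dist_dir[OF tv, of "\<rho> t x"] N'_t r F by auto
    hence "0 < tht (\<rho> t x)" using tht_range(1)[of "\<rho> t x"] by (auto simp: tht_def same_dir_def less_le)
    moreover have "gap (tht x) (tht (\<rho> t x)) \<le> gap (tht x) 0" using nx[OF tv] r' tht_v by simp
    ultimately have "tht x < tht (\<rho> t x)" using tht_range(1)[of x] by (auto simp: gap_def split: if_splits)
    thus ?thesis using True tx r' less[OF r F] less[OF x False] by (auto simp: thT_def gap_def)
   next
    case Fy: False
    thus ?thesis using nx[of y] y N'_t tx r' by (simp add: thT_def)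
   qed
  qed
 qed
 thus ?case unfolding ccw_next_def using r t_gap'[OF x _ pos] by auto
qed

lemma other_N: assumes "b \<noteq> u" "b \<noteq> v" "{b, x} \<in> E" shows "{b, c x} \<in> E'"
 using E'_other[OF assms(2,1)] assms(3) by (cases "x = u") auto

lemma other_c_inj: assumes "b \<noteq> u" "b \<noteq> v" "b \<noteq> t" "{b, x} \<in> E" "{b, y} \<in> E" "x \<noteq> y" shows "c x \<noteq> c y"
 using common_nbr[of b] assms by (auto simp: c_def insert_commute split: if_splits)

lemma dir_lim: assumes "b \<noteq> u" shows "((\<lambda>eps. dir eps b x) \<longlongrightarrow> p' (c x) - p' b) (at_right 0)"
 unfolding dir_def using tendsto_diff[OF pe_lim[of x] pe_lim[of b]] assms by simp

text \<open>Away from the triangle \<open>c\<close> is injective on the neighbours by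
  \<open>common_nbr\<close>, so no two directions merge and the order is that of the limit.\<close>

lemma rot_other: assumes b: "b \<noteq> u" "b \<noteq> v" "b \<noteq> t" and x: "{b, x} \<in> E"
 shows "ev (\<lambda>eps. ccw_next (dir eps b) (neighbours E b) x (\<rho> b x))"
proof (rule eventually_ccw_next[where d = "\<lambda>y. p' (c y) - p' b"])
 show "finite (neighbours E b)" by (rule finN)
 show "x \<in> neighbours E b" using x by simp
 show "((\<lambda>eps. dir eps b y) \<longlongrightarrow> p' (c y) - p' b) (at_right 0)" for y by (rule dir_lim[OF b(1)])
 show "p' (c y) - p' b \<noteq> 0" if "y \<in> neighbours E b" for y using r'.dir_nz other_N[OF b(1,2)] that by auto
 show "\<not> same_dir (p' (c y) - p' b) (p' (c y') - p' b)"
  if "y \<in> neighbours E b" "y' \<in> neighbours E b" "y \<noteq> y'" for y y'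
  using r'.dist_dir[OF other_N[OF b(1,2)] other_N[OF b(1,2)]] other_c_inj[OF b] that by auto
 have "\<rho>' b (c x) = c (\<rho> b x)" using rho'_other[of b x] b x by (auto simp: doubleton_eq_iff)
 thus "ccw_next (\<lambda>y. p' (c y) - p' b) (neighbours E b) x (\<rho> b x)"
  unfolding ccw_next_def using rho_in[OF x] r'.next_le[OF other_N[OF b(1,2) x] other_N[OF b(1,2)]]
  by (auto simp: corner_def)
qed

lemma rot_all: assumes "{b, x} \<in> E" shows "ev (\<lambda>eps. ccw_next (dir eps b) (neighbours E b) x (\<rho> b x))"
 using assms rot_u rot_v rot_t rot_other by (cases "b = u"; cases "b = v"; cases "b = t") auto

lemma dir_nz: assumes "{b, x} \<in> E" shows "ev (\<lambda>eps. dir eps b x \<noteq> 0)"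
proof (cases "{b, x} = {v, u}")
 case True
 have "dir eps b x = of_real eps * d \<or> dir eps b x = - (of_real eps * d)" for eps
  using True t by (auto simp: doubleton_eq_iff dir_def w_def)
 thus ?thesis using d_nz by (intro eventually_mono[OF ev_pos]) (metis mult_eq_0_iff neg_equal_0_iff_equal of_real_eq_0_iff less_irrefl)
next
 case False
 hence "p' (c x) - p' (c b) \<noteq> 0" using r'.dir_nz[OF E'_edges[OF assms]] by simp
 moreover have "((\<lambda>eps. dir eps b x) \<longlongrightarrow> p' (c x) - p' (c b)) (at_right 0)"
  unfolding dir_def by (intro tendsto_diff pe_lim)
 ultimately show ?thesis by (intro tendsto_imp_eventually_ne)
qed

lemma dir_dist: assumes "{b, x} \<in> E" "{b, y} \<in> E" "x \<noteq> y" shows "ev (\<lambda>eps. \<not> same_dir (dir eps b x) (dir eps b y))"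
proof -
 consider "b = u" | "b = v" | "b = t" | "b \<noteq> u" "b \<noteq> v" "b \<noteq> t" by blast
 thus ?thesis
 proof cases
  case 1
  have N: "x \<in> insert v A" "y \<in> insert v A" using assms(1,2) unfolding 1 N_u_iff .
  have "ev (\<lambda>eps. \<not> same_dir (gU eps x) (gU eps y))"
   by (rule ev_not_same_dir[OF gU_lim gU_lim Du_nz[OF N(1)] Du_dist[OF N assms(3)]])
  thus ?thesis using ev_pos
  proof eventually_elim
   case (elim eps)
   thus ?case unfolding 1 dir_u[OF elim(2) N(1)] dir_u[OF elim(2) N(2)] same_dir_ccw
    by (subst ccw_angle_scale) auto
  qed
 next
  case 2
  have N: "x \<in> insert u B" "y \<in> insert u B" using assms(1,2) unfolding 2 N_v_iff .
  show ?thesis using ev_pos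
  proof eventually_elim
   case (elim eps)
   show ?case using Dv_dist[OF N assms(3)] elim unfolding 2 dir_v[OF elim N(1)] dir_v[OF elim N(2)] same_dir_ccw
    by (subst ccw_angle_scale) auto
  qed
 next
  case 3
  show ?thesis using all_tht_less_eta
  proof eventually_elim
   case (elim eps)
   have pos: "0 < eps" using elim by simp
   have less: "tht y < eta eps" if "{t, y} \<in> E" "y \<noteq> u" for y using elim that N'_t by auto
   have neq: "tht x \<noteq> tht y" if "x \<noteq> u" "y \<noteq> u"
   proof
    assume "tht x = tht y"
    hence "ccw_angle (p' x - p' t) (p' y - p' t) = 2 * pi" using t_gap[of x y] N'_t assms that 3 by (simp add: gap_def)
    thus False using r'.dist_dir[of t x y] N'_t assms that 3 by (auto simp: same_dir_ccw)
   qed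
   have "thT eps x \<noteq> thT eps y" using neq less[of x] less[of y] assms 3 by (auto simp: thT_def)
   thus ?case unfolding 3 same_dir_ccw t_gap'[OF assms(1)[unfolded 3] assms(2)[unfolded 3] pos]
    using tht_range[of x] tht_range[of y] eta[OF pos] pi_gt_zero by (auto simp: gap_def thT_def)
  qed
 next
  case 4
  show ?thesis
   by (rule ev_not_same_dir[OF dir_lim[OF 4(1)] dir_lim[OF 4(1)]])
    (use r'.dir_nz r'.dist_dir[OF other_N[OF 4(1,2)] other_N[OF 4(1,2)]] other_N[OF 4(1,2)] other_c_inj[OF 4] assms in auto)
 qed
qed

end

section \<open>No crossings after the split\<close>

context geo_dir
begin

text \<open>These edges have no common vertex but meet at \<open>w\<close> in the limit, so
  closeness to the limit says nothing, and the claim is shown for every positive \<open>eps\<close>.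
  A common point is a linear relation between \<open>d\<close>, \<open>e x\<close> and
  \<open>e y\<close> with coefficients of known sign; its cross products with these vectors
  contradict the order of the angles.\<close>

lemma split_segments_disjoint:
 assumes x: "x \<in> A" and y: "y \<in> B" and xy: "x \<noteq> y" and pos: "0 < eps"
 shows "closed_segment (pe eps u) (pe eps x) \<inter> closed_segment (pe eps v) (pe eps y) = {}"
proof (rule ccontr)
 assume "\<not> ?thesis"
 then obtain z where z: "z \<in> closed_segment (pe eps u) (pe eps x)" "z \<in> closed_segment (pe eps v) (pe eps y)" by blast
 obtain s where s: "0 \<le> s" "s \<le> 1" "z = (1 - s) *\<^sub>R pe eps u + s *\<^sub>R pe eps x" using z(1) by (auto simp: in_segment)
 obtain r where r: "0 \<le> r" "r \<le> 1" "z = (1 - r) *\<^sub>R pe eps v + r *\<^sub>R pe eps y" using z(2) by (auto simp: in_segment)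
 have xu: "x \<noteq> u" "y \<noteq> u" using x y A_B(4,6) by auto
 define k where "k = (1 - s) * eps"
 have eq: "of_real k * d + of_real s * e x = of_real r * e y"
 proof -
  have "(1 - s) *\<^sub>R (w + of_real eps * d) + s *\<^sub>R (w + e x) = (1 - r) *\<^sub>R w + r *\<^sub>R (w + e y)"
   using s(3) r(3) xu by (simp add: p'_e)
  thus ?thesis by (simp add: k_def scaleR_conv_of_real algebra_simps)
 qed
 have xN: "x \<in> A \<union> B" and yN: "y \<in> A \<union> B" using x y by auto
 have k0: "0 \<le> k" using s pos by (simp add: k_def)
 have "k \<noteq> 0"
 proof
  assume "k = 0"
  hence "s = 1" using pos by (simp add: k_def)
  hence "e x = of_real r * e y" using eq \<open>k = 0\<close> by simp
  hence "same_dir (e y) (e x)" using r same_dirI by blast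
  thus False using e_dist[OF yN xN] xy by simp
 qed
 hence k: "0 < k" using k0 by simp
 have nx: "0 < cmod (e x)" "0 < cmod (e y)" "0 < cmod (e t)" using e_nz[OF xN] e_nz[OF yN] et_nz by auto
 have "cross (e x) (of_real k * d + of_real s * e x) = cross (e x) (of_real r * e y)" using eq by simp
 hence c1: "k * cross (e x) d = r * cross (e x) (e y)" by (simp add: cross_add cross_scale)
 have "cross d (of_real k * d + of_real s * e x) = cross d (of_real r * e y)" using eq by simp
 hence c2: "s * cross d (e x) = r * cross d (e y)" by (simp add: cross_add cross_scale)
 have "cross (of_real k * d + of_real s * e x) (e y) = cross (of_real r * e y) (e y)" using eq by simp
 hence c3: "k * cross d (e y) + s * cross (e x) (e y) = 0" by (simp add: cross_add cross_scale)
 have dx: "cross d (e x) = - cross (e x) d" and dy: "cross d (e y) = - cross (e y) d" by (rule cross_commute)+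
 have gp: "gap (\<theta> x) (\<theta> y) < pi" if "0 < cross (e x) (e y)"
  using that ccw_angle_lt_pi[OF e_nz[OF xN], of "e y"] e_gap[OF xN yN] by simp
 have ty: "y = t \<and> \<theta> y = 0 \<or> \<Theta>1 \<le> \<theta> y" using B_ge[OF y] th_t by blast
 note xA = A_le[OF x]
 show False
 proof (cases "\<Theta>i < \<delta> \<and> \<delta> < \<Theta>1")
  \<comment> \<open>With \<open>d\<close> in the empty corner, \<open>y\<close> follows
    \<open>x\<close> by a turn below pi and lies beyond \<open>d\<close>, while the linear relation
    puts it on the other side of \<open>d\<close>. The second case exchanges the roles of
    \<open>x\<close> and \<open>y\<close>.\<close>
  case True
  have "0 < sin (\<delta> - \<theta> x)" by (rule sin_gt_zero) (use True xA d01 th_range(1)[of x] in auto)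
  hence p1: "0 < cross (e x) d" unfolding cross_e_d using nx by simp
  hence "0 < r * cross (e x) (e y)" using k c1 by (metis mult_pos_pos)
  hence r0: "0 < r" and cxy: "0 < cross (e x) (e y)" using r(1) by (auto simp: zero_less_mult_iff)
  have "0 \<le> s * cross (e x) d" using s p1 by simp
  hence "0 \<le> r * cross (e y) d" using c2 dx dy by simp
  hence le: "0 \<le> cross (e y) d" using r0 by (simp add: zero_le_mult_iff)
  have "\<Theta>1 \<le> \<theta> y" using gp[OF cxy] ty xA True d01 th_range(1)[of x] by (auto simp: gap_def split: if_splits)
  hence "0 < \<theta> y - \<delta>" "\<theta> y - \<delta> < pi" using gp[OF cxy] xA True by (auto simp: gap_def split: if_splits)
  hence "0 < sin (\<theta> y - \<delta>)" by (rule sin_gt_zero)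
  hence "cross (e y) d < 0" unfolding cross_e_d using nx sin_minus[of "\<theta> y - \<delta>"] by (simp add: mult_pos_neg)
  thus False using le by simp
 next
  case False
  hence D: "\<Theta>i < \<delta> + pi" "\<delta> + pi < \<Theta>1" using d_cases by auto
  have p1: "0 < cross (e y) d"
  proof (cases "y = t")
   case True thus ?thesis using cross_et_d by simp
  next
   case False
   hence "\<Theta>1 \<le> \<theta> y" using B_ge[OF y] by blast
   hence "0 < sin (\<delta> - \<theta> y + 2 * pi)" using D th_range[of y] d01 by (intro sin_gt_zero) auto
   thus ?thesis unfolding cross_e_d using nx by simp
  qed
  hence "0 < s * cross (e x) (e y)" using c3 dy k by (smt (verit) mult_pos_neg)
  hence cxy: "0 < cross (e x) (e y)" using s(1) by (simp add: zero_less_mult_iff)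
  hence "0 \<le> k * cross (e x) d" using c1 r by simp
  hence le: "0 \<le> cross (e x) d" using k by (simp add: zero_le_mult_iff)
  have "\<delta> < \<theta> x" using gp[OF cxy] ty D d01 xA th_range(2)[of y] th_range(1)[of x] by (auto simp: gap_def split: if_splits)
  hence "0 < sin (\<theta> x - \<delta>)" using xA D by (intro sin_gt_zero) auto
  hence "cross (e x) d < 0" unfolding cross_e_d using nx sin_minus[of "\<theta> x - \<delta>"] by (simp add: mult_pos_neg)
  thus False using le by simp
 qed
qed

lemma seg_pair: "edge_segment q {a, b} = closed_segment (q a) (q b)"
 by (simp add: edge_segment_def segment_convex_hull)

lemma share_vertex:
 assumes za: "{z, a} \<in> E" and zb: "{z, b} \<in> E" and ab: "a \<noteq> b"
 shows "ev (\<lambda>eps. edge_segment (pe eps) {z, a} \<inter> edge_segment (pe eps) {z, b} = pe eps ` ({z, a} \<inter> {z, b}))"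
 using dir_nz[OF za] dir_nz[OF zb] dir_dist[OF za zb ab]
proof eventually_elim
 case (elim eps)
 have i: "{z, a} \<inter> {z, b} = {z}" using edgeD(1)[OF za] edgeD(1)[OF zb] ab by auto
 have "closed_segment (pe eps z) (pe eps a) \<inter> closed_segment (pe eps z) (pe eps b) = {pe eps z}"
  using segments_same_start[of "pe eps a" "pe eps z" "pe eps b"] elim by (auto simp: dir_def)
 thus ?case unfolding i seg_pair by simp
qed

lemma v_not_on_edge: assumes "{x, y} \<in> E'" "x \<noteq> v" "y \<noteq> v" shows "w \<notin> closed_segment (p' x) (p' y)"
proof
 assume a: "w \<in> closed_segment (p' x) (p' y)"
 have tv: "{v, t} \<in> E'" using E'_v t_edges uvt by auto
 have ne: "{v, t} \<noteq> {x, y}" using assms by auto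
 have "w \<in> edge_segment p' {v, t} \<inter> edge_segment p' {x, y}" using a by (simp add: seg_pair w_def)
 then obtain q where q: "q \<in> {v, t} \<inter> {x, y}" "w = p' q" unfolding r'.noncross[OF tv assms(1) ne] by blast
 have "q \<in> V'" using q m'.edgeD[OF assms(1)] by auto
 hence "q = v" using q r'.p_eq[of v q] v_V' by (simp add: w_def)
 thus False using q assms by auto
qed

text \<open>Segments that are disjoint in the limit stay disjoint; here the split edge counts as the
  point \<open>w\<close>, which lies on no edge away from it. Otherwise one edge ends in
  \<open>u\<close> and the other in \<open>v\<close>, as in
  \<open>split_segments_disjoint\<close>.\<close>

lemma disjoint_edges:
 assumes ab: "{a, b} \<in> E" and xy: "{x, y} \<in> E" and dis: "{a, b} \<inter> {x, y} = {}"
 shows "ev (\<lambda>eps. edge_segment (pe eps) {a, b} \<inter> edge_segment (pe eps) {x, y} = pe eps ` ({a, b} \<inter> {x, y}))"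
proof (cases "{c a, c b} \<inter> {c x, c y} = {}")
 case True
 have "closed_segment (p' (c a)) (p' (c b)) \<inter> closed_segment (p' (c x)) (p' (c y)) = {}"
 proof -
  consider "{a, b} = {v, u}" | "{x, y} = {v, u}" | "{a, b} \<noteq> {v, u}" "{x, y} \<noteq> {v, u}" by blast
  thus ?thesis
  proof cases
   case 1
   hence cab: "c a = v" "c b = v" by (auto simp: doubleton_eq_iff)
   have "{x, y} \<noteq> {v, u}" using dis 1 by auto
   hence "w \<notin> closed_segment (p' (c x)) (p' (c y))"
    using v_not_on_edge[OF E'_edges[OF xy]] True cab by auto
   thus ?thesis using cab by (simp add: w_def)
  next
   case 2
   hence cab: "c x = v" "c y = v" by (auto simp: doubleton_eq_iff)
   have "{a, b} \<noteq> {v, u}" using dis 2 by auto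
   hence "w \<notin> closed_segment (p' (c a)) (p' (c b))"
    using v_not_on_edge[OF E'_edges[OF ab]] True cab by auto
   thus ?thesis using cab by (simp add: w_def)
  next
   case 3
   have "{c a, c b} \<noteq> {c x, c y}" using True by auto
   from r'.noncross[OF E'_edges[OF ab 3(1)] E'_edges[OF xy 3(2)] this] show ?thesis
    using True by (simp add: seg_pair)
  qed
 qed
 from eventually_segments_disjoint[OF this pe_lim pe_lim pe_lim pe_lim] show ?thesis
  by eventually_elim (use dis in \<open>simp add: seg_pair\<close>)
next
 case False
 have key: "ev (\<lambda>eps. closed_segment (pe eps u) (pe eps x) \<inter> closed_segment (pe eps v) (pe eps y) = {})"
  if "{u, x} \<in> E" "{v, y} \<in> E" "{u, x} \<inter> {v, y} = {}" for x y
 proof -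
  have "x \<in> A" "y \<in> B" "x \<noteq> y" using that by (auto simp: A_def B_def)
  thus ?thesis using split_segments_disjoint by (intro eventually_mono[OF ev_pos]) blast
 qed
 have "u \<in> {a, b} \<and> v \<in> {x, y} \<or> v \<in> {a, b} \<and> u \<in> {x, y}"
  using False dis by (auto simp: c_def split: if_splits)
 then consider b' y' where "{a, b} = {u, b'}" "{x, y} = {v, y'}" | b' y' where "{a, b} = {v, b'}" "{x, y} = {u, y'}"
 proof -
  assume h: "\<And>b' y'. {a, b} = {u, b'} \<Longrightarrow> {x, y} = {v, y'} \<Longrightarrow> thesis"
   "\<And>b' y'. {a, b} = {v, b'} \<Longrightarrow> {x, y} = {u, y'} \<Longrightarrow> thesis"
  have s: "\<exists>m'. {k, l} = {m, m'}" if "m \<in> {k, l}" for k l m :: 'a using that by (auto simp: insert_commute)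
  show thesis using \<open>u \<in> {a, b} \<and> v \<in> {x, y} \<or> v \<in> {a, b} \<and> u \<in> {x, y}\<close> s h by blast
 qed
 thus ?thesis
 proof cases
  case 1
  have "ev (\<lambda>eps. closed_segment (pe eps u) (pe eps b') \<inter> closed_segment (pe eps v) (pe eps y') = {})"
   by (rule key) (use ab xy dis 1 in auto)
  thus ?thesis unfolding 1 by eventually_elim (use dis[unfolded 1] in \<open>simp add: seg_pair\<close>)
 next
  case 2
  have "ev (\<lambda>eps. closed_segment (pe eps u) (pe eps y') \<inter> closed_segment (pe eps v) (pe eps b') = {})"
   by (rule key) (use ab xy dis 2 in auto)
  thus ?thesis unfolding 2 by eventually_elim (use dis[unfolded 2] in \<open>simp add: seg_pair Int_commute\<close>)
 qed
qed

lemma noncross_pair: assumes "e1 \<in> E" "e2 \<in> E" "e1 \<noteq> e2"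
 shows "ev (\<lambda>eps. edge_segment (pe eps) e1 \<inter> edge_segment (pe eps) e2 = pe eps ` (e1 \<inter> e2))"
proof (cases "e1 \<inter> e2 = {}")
 case True
 obtain a b where ab: "e1 = {a, b}" by (rule edgeE[OF assms(1)])
 obtain x y where xy: "e2 = {x, y}" by (rule edgeE[OF assms(2)])
 show ?thesis using disjoint_edges[of a b x y] assms True unfolding ab xy by blast
next
 case False
 then obtain z where z: "z \<in> e1" "z \<in> e2" by blast
 obtain a where a: "e1 = {z, a}" using edgeE[OF assms(1)] z(1) by (metis insertE insert_commute singletonD)
 obtain b where b: "e2 = {z, b}" using edgeE[OF assms(2)] z(2) by (metis insertE insert_commute singletonD)
 show ?thesis unfolding a b by (rule share_vertex) (use assms a b in auto)
qed

lemma pe_inj: "ev (\<lambda>eps. inj_on (pe eps) V)"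
proof -
 have "ev (\<lambda>eps. pe eps x \<noteq> pe eps y)" if "x \<in> V" "y \<in> V" "x \<noteq> y" for x y
 proof (cases "c x = c y")
  case True
  hence "{x, y} = {u, v}" using that by (auto simp: c_def split: if_splits)
  hence "x = u \<and> y = v \<or> x = v \<and> y = u" by (auto simp: doubleton_eq_iff)
  thus ?thesis using d_nz by (intro eventually_mono[OF ev_pos]) auto
 next
  case False
  hence "p' (c x) - p' (c y) \<noteq> 0" using r'.p_eq V'_x that by auto
  moreover have "((\<lambda>eps. pe eps x - pe eps y) \<longlongrightarrow> p' (c x) - p' (c y)) (at_right 0)" by (intro tendsto_diff pe_lim)
  ultimately have "ev (\<lambda>eps. pe eps x - pe eps y \<noteq> 0)" by (intro tendsto_imp_eventually_ne)
  thus ?thesis by eventually_elim simp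
 qed
 hence "ev (\<lambda>eps. \<forall>x\<in>V. \<forall>y\<in>V. x \<noteq> y \<longrightarrow> pe eps x \<noteq> pe eps y)"
  by (intro eventually_ball_finite finV ballI) (simp add: eventually_mono)
 thus ?thesis by eventually_elim (auto simp: inj_on_def)
qed

lemma pe_noncross: "ev (\<lambda>eps. noncrossing_straight_line_embedding V E (pe eps))"
proof -
 have "ev (\<lambda>eps. \<forall>e1\<in>E. \<forall>e2\<in>E. e1 \<noteq> e2 \<longrightarrow>
   edge_segment (pe eps) e1 \<inter> edge_segment (pe eps) e2 = pe eps ` (e1 \<inter> e2))"
 proof (intro eventually_ball_finite finE ballI)
  fix e1 e2 assume "e1 \<in> E" "e2 \<in> E"
  thus "ev (\<lambda>eps. e1 \<noteq> e2 \<longrightarrow> edge_segment (pe eps) e1 \<inter> edge_segment (pe eps) e2 = pe eps ` (e1 \<inter> e2))"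
   using noncross_pair by (cases "e1 = e2") auto
 qed
 thus ?thesis using pe_inj by eventually_elim (simp add: noncrossing_straight_line_embedding_def)
qed

lemma pe_rotation: "ev (\<lambda>eps. \<forall>b x. {b, x} \<in> E \<longrightarrow> ccw_next (\<lambda>y. pe eps y - pe eps b) (neighbours E b) x (\<rho> b x))"
proof -
 have "ev (\<lambda>eps. \<forall>b\<in>V. \<forall>x\<in>V. {b, x} \<in> E \<longrightarrow> ccw_next (dir eps b) (neighbours E b) x (\<rho> b x))"
 proof (intro eventually_ball_finite finV ballI)
  fix b x show "ev (\<lambda>eps. {b, x} \<in> E \<longrightarrow> ccw_next (dir eps b) (neighbours E b) x (\<rho> b x))"
   using rot_all by (cases "{b, x} \<in> E") auto
 qed
 thus ?thesis by eventually_elim (use edgeD in \<open>auto simp: dir_def[abs_def]\<close>)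
qed

end

section \<open>Convex corners after the split\<close>

context geo_dir
begin

text \<open>Predicts, without reference to \<open>eps\<close>, which corners end up below pi;
  \<open>pe_corners\<close> shows that the prediction is right for all small
  \<open>eps\<close>.\<close>

definition convex_corner :: "'a \<Rightarrow> 'a \<Rightarrow> bool" where
 "convex_corner x b \<longleftrightarrow>
   (if (x, b) \<in> {(v, u), (u, t), (t, v)} then True
   else if (x, b) = (u, v) then \<Theta>1 - \<delta> < pi
   else if (x, b) = (xi, u) then \<delta> + pi - \<Theta>i < pi
   else corner p' \<rho>' (c x) (c b) < pi)"

lemma ccw_gt_pi_lim:
 assumes "(h \<longlongrightarrow> a) G" "(g \<longlongrightarrow> b) G" "a \<noteq> 0" "\<not> same_dir a b" "ccw_angle a b \<noteq> pi"
 shows "eventually (\<lambda>x. (ccw_angle (h x) (g x) < pi \<longleftrightarrow> ccw_angle a b < pi) \<and>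
   (pi < ccw_angle (h x) (g x) \<longleftrightarrow> \<not> ccw_angle a b < pi)) G"
proof -
 note l = tendsto_ccw_angle[OF assms(1-4)]
 show ?thesis
 proof (cases "ccw_angle a b < pi")
  case True
  from order_tendstoD(2)[OF l True] show ?thesis by eventually_elim (use True in simp)
 next
  case False
  hence "pi < ccw_angle a b" using assms(5) by simp
  from order_tendstoD(1)[OF l this] show ?thesis by eventually_elim (use False in simp)
 qed
qed

lemma uv_corner: "ccw_angle d (e y1) = \<Theta>1 - \<delta>"
proof -
 have "y1 \<in> B" "y1 \<noteq> u" using xi_rho(2) A_B(6) by auto
 hence "ccw_angle (Dv u) (Dv y1) = gap \<delta> (\<theta> y1)" using Dv_gap[of u y1] by (simp add: thV_def)
 also have "\<dots> = \<Theta>1 - \<delta>" using dbounds d01 by (auto simp: gap_def \<Theta>1_def)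
 finally show ?thesis using \<open>y1 \<noteq> u\<close> by (simp add: Dv_def)
qed

lemma xi_corner: "ccw_angle (e xi) (- d) = \<delta> + pi - \<Theta>i"
proof -
 have "ccw_angle (Du xi) (Du v) = gap \<Theta>i (\<delta> + pi)"
  using Du_gap[of xi v] xi(3,4) by (simp add: thU_def \<Theta>i_def)
 also have "\<dots> = \<delta> + pi - \<Theta>i" using dbounds by (simp add: gap_def)
 finally show ?thesis using xi(3) by (simp add: Du_def)
qed

lemma corner_dir: "corner (pe eps) \<rho> x b = ccw_angle (dir eps b x) (dir eps b (\<rho> b x))"
 by (simp add: corner_def dir_def)

lemma corners:
 assumes gd: "\<delta> + pi - \<Theta>i \<noteq> pi" "\<Theta>1 - \<delta> \<noteq> pi" and xb: "{x, b} \<in> E"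
 shows "ev (\<lambda>eps. (corner (pe eps) \<rho> x b < pi \<longleftrightarrow> convex_corner x b) \<and>
         (pi < corner (pe eps) \<rho> x b \<longleftrightarrow> \<not> convex_corner x b))"
proof -
 have bx: "{b, x} \<in> E" using xb by (simp add: insert_commute)
 note ne = edgeD[OF xb]
 consider "(x, b) = (v, u)" | "(x, b) = (t, v)" | "(x, b) = (u, t)" | "(x, b) = (u, v)" | "(x, b) = (xi, u)"
  | "(x, b) \<notin> {(v, u), (u, t), (t, v), (u, v), (xi, u)}" by blast
 thus ?thesis
 proof cases
  case 1
  show ?thesis using ev_pos
  proof eventually_elim
   case (elim eps)
   have xu: "x = v" "b = u" using 1 by auto
   have "dir eps u v = - (of_real eps * d)" "dir eps u t = e t - of_real eps * d" using uvt by (simp_all add: dir_def p'_e)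
   hence "corner (pe eps) \<rho> x b < pi"
    unfolding corner_dir xu rho_t using ccw_angle_lt_pi d_nz elim cross_et_d cross_commute[of "e t" d]
    by (simp add: cross_add cross_scale mult_pos_neg)
   moreover have "convex_corner x b" using 1 by (simp add: convex_corner_def)
   ultimately show ?case by auto
  qed
 next
  case 2
  show ?thesis using ev_pos
  proof eventually_elim
   case (elim eps)
   have xu: "x = t" "b = v" using 2 by auto
   have "dir eps v t = e t" "dir eps v u = of_real eps * d" using uvt by (simp_all add: dir_def p'_e)
   hence "corner (pe eps) \<rho> x b < pi"
    unfolding corner_dir xu rho_t using ccw_angle_lt_pi[OF et_nz] elim cross_et_d by (simp add: cross_scale)
   moreover have "convex_corner x b" using 2 by (simp add: convex_corner_def)
   ultimately show ?case by auto
  qed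
 next
  case 3
  show ?thesis using ev_pos
  proof eventually_elim
   case (elim eps)
   have xu: "x = u" "b = t" using 3 by auto
   have "dir eps t u = - e t + of_real eps * d" "dir eps t v = - e t" using uvt by (simp_all add: dir_def p'_e)
   hence "corner (pe eps) \<rho> x b < pi"
    unfolding corner_dir xu rho_t using ccw_angle_lt_pi dir_t_nz[OF t_edges(4) elim] elim cross_et_d cross_commute[of "e t" d]
    by (simp add: cross_add cross_scale mult_pos_neg)
   moreover have "convex_corner x b" using 3 by (simp add: convex_corner_def)
   ultimately show ?case by auto
  qed
 next
  case 4
  show ?thesis using ev_pos
  proof eventually_elim
   case (elim eps)
   have xu: "x = u" "b = v" using 4 by auto
   have "y1 \<noteq> u" using xi_rho(2) A_B(6) by auto
   hence "dir eps v u = of_real eps * d" "dir eps v y1 = of_real 1 * e y1" by (simp_all add: dir_def p'_e)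
   hence "corner (pe eps) \<rho> x b = \<Theta>1 - \<delta>"
    unfolding corner_dir xu y1_def[symmetric] uv_corner[symmetric] using ccw_angle_scale[OF elim zero_less_one] by metis
   moreover have "convex_corner x b \<longleftrightarrow> \<Theta>1 - \<delta> < pi" using 4 uvt by (simp add: convex_corner_def)
   ultimately show ?case using gd(2) by auto
  qed
 next
  case 5
  have xu: "x = xi" "b = u" using 5 by auto
  have g: "Du xi = e xi" "Du v = - d" using xi(3) by (simp_all add: Du_def)
  have cc: "ccw_angle (Du xi) (Du v) = \<delta> + pi - \<Theta>i" unfolding g by (rule xi_corner)
  have "ev (\<lambda>eps. (ccw_angle (gU eps xi) (gU eps v) < pi \<longleftrightarrow> \<delta> + pi - \<Theta>i < pi) \<and>
    (pi < ccw_angle (gU eps xi) (gU eps v) \<longleftrightarrow> \<not> \<delta> + pi - \<Theta>i < pi))"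
  proof (rule ccw_gt_pi_lim[OF gU_lim gU_lim, of xi v, unfolded cc])
   show "Du xi \<noteq> 0" by (rule Du_nz) (use xi(4) in blast)
   show "\<not> same_dir (Du xi) (Du v)" by (rule Du_dist) (use xi(3,4) in blast)+
  qed (rule gd(1))
  thus ?thesis using ev_pos
  proof eventually_elim
   case (elim eps)
   have "corner (pe eps) \<rho> x b = ccw_angle (gU eps xi) (gU eps v)"
   proof -
    have m: "xi \<in> insert v A" "v \<in> insert v A" using xi(4) by auto
    have "dir eps u xi = of_real 1 * gU eps xi" using dir_u[OF elim(2) m(1)] xi(3) by (simp only: if_False)
    moreover have "dir eps u v = of_real eps * gU eps v" using dir_u[OF elim(2) m(2)] by simp
    ultimately show ?thesis unfolding corner_dir xu xi(2)
     using ccw_angle_scale[OF zero_less_one elim(2)] by simp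
   qed
   moreover have "convex_corner x b \<longleftrightarrow> \<delta> + pi - \<Theta>i < pi" using 5 uvt xi(3) by (simp add: convex_corner_def)
   ultimately show ?case using elim by auto
  qed
 next
  case 6
  have D0: "(x, b) \<in> D0" using 6 xb by (auto simp: D0_iff doubleton_eq_iff)
  have nuv: "f (x, b) \<noteq> (u, v)"
  proof
   assume "f (x, b) = (u, v)"
   hence "b = u" "\<rho> u x = v" by auto
   hence "x = xi" using rho_inj[OF t(11)] xi(1,2) bx unfolding inj_on_def by auto
   thus False using 6 \<open>b = u\<close> by simp
  qed
  have "f' (\<phi> (x, b)) = \<phi> (f (x, b))" using f'_\<phi>[OF D0] unfolding if_not_P[OF nuv] .
  hence rr: "\<rho>' (c b) (c x) = c (\<rho> b x)" by simp
  have "{b, x} \<noteq> {v, u}" using 6 by (auto simp: doubleton_eq_iff)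
  from E'_edges[OF bx this] have e': "{c b, c x} \<in> E'" .
  have n6: "(x, b) \<notin> {(v, u), (u, t), (t, v)}" "(x, b) \<noteq> (u, v)" "(x, b) \<noteq> (xi, u)" using 6 by blast+
  have cc: "convex_corner x b \<longleftrightarrow> corner p' \<rho>' (c x) (c b) < pi"
   unfolding convex_corner_def by (simp only: n6 if_False)
  show ?thesis
  proof (cases "c x = c (\<rho> b x)")
   \<comment> \<open>Both edges of the corner merge in the contraction. This happens only if
     \<open>t\<close> has no neighbours but \<open>u\<close> and \<open>v\<close>; the corner is a
     full turn in the contraction and stays above pi.\<close>
   case True
   have c2: "corner p' \<rho>' (c x) (c b) = 2 * pi" unfolding corner_def rr True[symmetric] by simp
   have "\<rho> b x \<noteq> x"
   proof
    assume r: "\<rho> b x = x"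
    have "{x} = neighbours E b" by (rule rho_closed[of b "{x}" x]) (use r bx ne in auto)
    moreover obtain y where "y \<noteq> x" "{b, y} \<in> E" using degree_ge_2[OF card_V_ge_3, of b x] ne by blast
    ultimately show False by (metis mem_neighbours singletonD)
   qed
   hence uv: "{x, \<rho> b x} = {u, v}" using True by (auto simp: c_def split: if_splits)
   have br: "{b, \<rho> b x} \<in> E" by (rule rho_in[OF bx])
   have "b = t" using uv common_nbr[of b] bx br by (auto simp: doubleton_eq_iff insert_commute)
   hence xv: "x = v" "\<rho> t v = u" "b = t" using uv 6 by (auto simp: doubleton_eq_iff)
   show ?thesis using ev_pos
   proof eventually_elim
    case (elim eps)
    have "dir eps t u = - e t + of_real eps * d" "dir eps t v = - e t" using uvt by (simp_all add: dir_def p'_e)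
    hence "pi < corner (pe eps) \<rho> x b"
     unfolding corner_dir xv using et_nz elim cross_et_d
     by (intro ccw_angle_gt_pi) (simp_all add: cross_add cross_scale)
    thus ?case using cc c2 pi_gt_zero by auto
   qed
  next
   case False
   have e2: "{c b, c (\<rho> b x)} \<in> E'" using m'.rho_in[OF e'] rr by simp
   have l: "((\<lambda>eps. dir eps b y) \<longlongrightarrow> p' (c y) - p' (c b)) (at_right 0)" for y
    unfolding dir_def by (intro tendsto_diff pe_lim)
   have c2: "corner p' \<rho>' (c x) (c b) = ccw_angle (p' (c x) - p' (c b)) (p' (c (\<rho> b x)) - p' (c b))"
    unfolding corner_def rr ..
   show ?thesis unfolding corner_dir cc c2
    by (rule ccw_gt_pi_lim[OF l l]) (use r'.dir_nz[OF e'] r'.dist_dir[OF e' e2 False] r'.corner_ne_pi[OF e'] c2 in auto)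
  qed
 qed
qed

lemma pe_corners:
 assumes gd: "\<delta> + pi - \<Theta>i \<noteq> pi" "\<Theta>1 - \<delta> \<noteq> pi"
 shows "ev (\<lambda>eps. \<forall>x b. {x, b} \<in> E \<longrightarrow> (corner (pe eps) \<rho> x b < pi \<longleftrightarrow> convex_corner x b) \<and>
         (pi < corner (pe eps) \<rho> x b \<longleftrightarrow> \<not> convex_corner x b))"
proof -
 have "ev (\<lambda>eps. \<forall>x\<in>V. \<forall>b\<in>V. {x, b} \<in> E \<longrightarrow> (corner (pe eps) \<rho> x b < pi \<longleftrightarrow> convex_corner x b) \<and>
         (pi < corner (pe eps) \<rho> x b \<longleftrightarrow> \<not> convex_corner x b))"
 proof (intro eventually_ball_finite finV ballI)
  fix x b show "ev (\<lambda>eps. {x, b} \<in> E \<longrightarrow> (corner (pe eps) \<rho> x b < pi \<longleftrightarrow> convex_corner x b) \<and>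
         (pi < corner (pe eps) \<rho> x b \<longleftrightarrow> \<not> convex_corner x b))"
   using corners[OF gd] by (cases "{x, b} \<in> E") auto
 qed
 thus ?thesis by eventually_elim (use edgeD in blast)
qed

text \<open>Strict positivity survives a small move, except where the hull edge itself collapses or
  the third vertex merges with an end of it. There the cross product vanishes in the limit, and for
  positive \<open>eps\<close> its sign is the one prescribed by \<open>good_dir\<close>.\<close>

lemma pe_hull:
 assumes F1: "\<And>x. (x, u) \<in> F \<Longrightarrow> x \<noteq> v \<Longrightarrow> 0 < cross (e x) d"
  and F2: "\<And>x. (u, x) \<in> F \<Longrightarrow> x \<noteq> v \<Longrightarrow> cross (e x) d < 0"
  and F3: "\<And>x. (x, v) \<in> F \<Longrightarrow> x \<noteq> u \<Longrightarrow> cross (e x) d < 0"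
  and F4: "\<And>x. (v, x) \<in> F \<Longrightarrow> x \<noteq> u \<Longrightarrow> 0 < cross (e x) d"
  and F5: "\<And>x. (u, v) \<in> F \<Longrightarrow> x \<in> V' - {v} \<Longrightarrow> cross d (e x) < 0"
 shows "ev (\<lambda>eps. \<forall>a b. (a, b) \<in> F \<longrightarrow> (\<forall>x\<in>V - {a, b}. 0 < cross (pe eps b - pe eps a) (pe eps x - pe eps a)))"
proof -
 have one: "ev (\<lambda>eps. 0 < cross (pe eps b - pe eps a) (pe eps x - pe eps a))"
  if ab: "(a, b) \<in> F" and x: "x \<in> V - {a, b}" for a b x
 proof (cases "(a, b) = (u, v)")
  case True
  hence "x \<in> V' - {v}" "x \<noteq> u" using x by (auto simp: V'_def)
  thus ?thesis using F5[of x] ab True by (intro eventually_mono[OF ev_pos]) (simp add: p'_e cross_add cross_scale mult_pos_neg)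
 next
  case False
  note F' = F'_I[OF ab False]
  have abE: "{a, b} \<in> E" using ab F_closed by auto
  note ne = edgeD[OF abE]
  have vu: "(a, b) \<noteq> (v, u)" using ab vuF by auto
  show ?thesis
  proof (cases "c x = c a \<or> c x = c b")
   case F: False
   have "0 < cross (p' (c b) - p' (c a)) (p' (c x) - p' (c a))"
    by (rule r'.hull[OF F']) (use F V'_x x in auto)
   moreover have "((\<lambda>eps. cross (pe eps b - pe eps a) (pe eps x - pe eps a)) \<longlongrightarrow>
     cross (p' (c b) - p' (c a)) (p' (c x) - p' (c a))) (at_right 0)"
    by (intro tendsto_intros pe_lim)
   ultimately show ?thesis by (rule order_tendstoD(1)[rotated])
  next
   case True
   then consider "x = v" "b = u" "a \<noteq> v" | "x = v" "a = u" "b \<noteq> v" | "x = u" "b = v" "a \<noteq> u" | "x = u" "a = v" "b \<noteq> u"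
    using x False vu by (auto simp: c_def split: if_splits)
   thus ?thesis
   proof cases
    case 1
    thus ?thesis using F1[of a] ab ne cross_commute[of "e a" d]
     by (intro eventually_mono[OF ev_pos]) (simp add: p'_e cross_add cross_scale mult_pos_neg)
   next
    case 2
    thus ?thesis using F2[of b] ab ne cross_commute[of "e b" d]
     by (intro eventually_mono[OF ev_pos]) (simp add: p'_e cross_add cross_scale mult_pos_neg)
   next
    case 3
    thus ?thesis using F3[of a] ab ne cross_commute[of "e a" d]
     by (intro eventually_mono[OF ev_pos]) (simp add: p'_e cross_add cross_scale mult_pos_neg)
   next
    case 4
    thus ?thesis using F4[of b] ab ne
     by (intro eventually_mono[OF ev_pos]) (simp add: p'_e cross_add cross_scale)
   qed
  qed
 qed
 have "ev (\<lambda>eps. \<forall>d\<in>F. \<forall>x\<in>V. x \<notin> {fst d, snd d} \<longrightarrow> 0 < cross (pe eps (snd d) - pe eps (fst d)) (pe eps x - pe eps (fst d)))"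
 proof (intro eventually_ball_finite finV ballI)
  show "finite F" using F_closed(1) finD finite_subset by blast
  fix d x assume "d \<in> F" "x \<in> V"
  thus "ev (\<lambda>eps. x \<notin> {fst d, snd d} \<longrightarrow> 0 < cross (pe eps (snd d) - pe eps (fst d)) (pe eps x - pe eps (fst d)))"
   using one[of "fst d" "snd d" x] by (cases "x \<in> {fst d, snd d}") auto
 qed
 thus ?thesis by eventually_elim (force simp: Ball_def)
qed

end

section \<open>Faces compared with those of the contraction\<close>

context geo_step
begin

lemma face'_is_face: "k \<in> D0 \<Longrightarrow> is_face E' \<rho>' (face' (\<phi> k))"
 unfolding m'.is_face_iff \<phi>_image[symmetric] by (intro bexI[of _ "\<phi> k"] refl imageI)

text \<open>Up to \<open>(u, v)\<close> the darts of a face come from a face of the contraction. If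
  another dart of the face also started at \<open>u\<close>, then that dart and the successor of
  \<open>(u, v)\<close>, which starts at \<open>v\<close>, would have the same tail after
  contraction.\<close>

lemma tail_inj: assumes "is_face E \<rho> Q" shows "inj_on fst Q"
proof -
 obtain d where d: "d \<in> D" "Q = face d" using assms is_face_iff by auto
 have QD: "Q \<subseteq> D" using face_D[OF d(1)] d(2) by simp
 show ?thesis
 proof (cases "(v, u) \<in> face d")
  case True
  hence "Q = {(v, u), (u, t), (t, v)}" using face_eq[OF d(1) True] d(2) face_triangle by simp
  thus ?thesis using t(7-9) by (auto simp: inj_on_def)
 next
  case False
  obtain d' where d': "d' \<in> D0" "face d = face d'" "face d \<inter> D0 = face d - {(u, v)}"
   by (rule other_face[OF d(1) False])
  have im: "face' (\<phi> d') = \<phi> ` (Q \<inter> D0)" using face'_\<phi>[OF d'(1)] d' d(2) by simp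
  have "is_face E' \<rho>' (\<phi> ` (Q \<inter> D0))" using face'_is_face[OF d'(1)] unfolding im .
  hence inj': "inj_on fst (\<phi> ` (Q \<inter> D0))" using real' by (simp add: realization_def)
  have eq: "a = b" if "a \<in> Q \<inter> D0" "b \<in> Q \<inter> D0" "fst (\<phi> a) = fst (\<phi> b)" for a b
  proof -
   have "\<phi> a = \<phi> b" using inj_onD[OF inj' that(3)] that by blast
   thus ?thesis using \<phi>_inj that by (auto simp: inj_on_def simp del: \<phi>_simp split_paired_All)
  qed
  have key: "a = b" if a: "a \<in> Q" and b: "b \<in> Q" and f: "fst a = fst b" and au: "a = (u, v)" for a b
  proof (rule ccontr)
   assume ab: "a \<noteq> b"
   hence bD0: "b \<in> Q \<inter> D0" using d'(3) b au d(2) by blast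
   have "f (u, v) \<in> Q" using a au orbit.step[of "(u, v)" f d] d(2) by blast
   hence "(v, \<rho> v u) \<in> Q \<inter> D0" using f_uv by simp
   moreover have fb: "fst b = u" using f au by auto
   moreover have "fst (\<phi> b) = fst (\<phi> (v, \<rho> v u))" unfolding \<phi>_def fb by simp
   ultimately have "b = (v, \<rho> v u)" using eq bD0 by blast
   hence "fst b = v" by simp
   thus False using fb t(7) by metis
  qed
  show ?thesis
  proof (rule inj_onI)
   fix a b assume ab: "a \<in> Q" "b \<in> Q" "fst a = fst b"
   show "a = b"
   proof (cases "a = (u, v) \<or> b = (u, v)")
    case True thus ?thesis using key[of a b] key[of b a] ab by auto
   next
    case F: False
    hence "a \<in> Q \<inter> D0" "b \<in> Q \<inter> D0" using d'(3) ab d(2) by auto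
    thus ?thesis using eq ab(3) by (simp add: \<phi>_def)
   qed
  qed
 qed
qed

end

context geo_dir
begin

lemma convex_corner_\<phi>:
 assumes "k \<in> D0" "k \<noteq> (xi, u)"
 shows "convex_corner (fst k) (snd k) \<longleftrightarrow> corner p' \<rho>' (fst (\<phi> k)) (snd (\<phi> k)) < pi"
proof -
 have n: "(fst k, snd k) \<notin> {(v, u), (u, t), (t, v)}" "(fst k, snd k) \<noteq> (u, v)" "(fst k, snd k) \<noteq> (xi, u)"
  using assms unfolding D0_def prod.collapse by blast+
 show ?thesis unfolding convex_corner_def \<phi>_def fst_conv snd_conv by (simp only: n if_False)
qed

text \<open>Apart from the new triangle, only the face through \<open>(xi, u)\<close> and
  \<open>(u, v)\<close> changes: the corner between \<open>xi\<close> and \<open>y1\<close> becomes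
  two corners adding up to its angle plus pi. If it was above pi, assumption \<open>K\<close> makes
  both new ones big. If it was below pi, they cannot both be big, and not both convex either,
  because \<open>d\<close> or its opposite points into the corner.\<close>

lemma convex_corner_count:
 assumes gd: "\<delta> + pi - \<Theta>i \<noteq> pi" "\<Theta>1 - \<delta> \<noteq> pi"
  and K: "pi < \<Theta>1 - \<Theta>i \<Longrightarrow> pi < \<delta> + pi - \<Theta>i \<and> pi < \<Theta>1 - \<delta>"
  and Q: "is_face E \<rho> Q" "Q \<noteq> F"
 shows "card {d\<in>Q. convex_corner (fst d) (snd d)} = 3"
proof -
 obtain d0 where d: "d0 \<in> D" "Q = face d0" using Q is_face_iff by auto
 have QD: "Q \<subseteq> D" using face_D[OF d(1)] d(2) by simp
 have finQ: "finite Q" using QD finD finite_subset by blast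
 have xiD: "(xi, u) \<in> D" using xi(1) by (simp add: insert_commute)
 have xiD0: "(xi, u) \<in> D0" using xi(1,3) uvt edgeD(1)[OF xi(1)] by (auto simp: D0_iff insert_commute doubleton_eq_iff)
 have uvD: "(u, v) \<in> D" using t_edges by simp
 show ?thesis
 proof (cases "(v, u) \<in> face d0")
  case True
  hence Qe: "Q = {(v, u), (u, t), (t, v)}" using face_eq[OF d(1) True] d(2) face_triangle by simp
  hence "{d\<in>Q. convex_corner (fst d) (snd d)} = {(v, u), (u, t), (t, v)}" by (auto simp: convex_corner_def)
  thus ?thesis using uvt by simp
 next
  case False
  obtain d' where d': "d' \<in> D0" "face d0 = face d'" "face d0 \<inter> D0 = face d0 - {(u, v)}"
   by (rule other_face[OF d(1) False])
  have im: "face' (\<phi> d') = \<phi> ` (Q \<inter> D0)" using face'_\<phi>[OF d'(1)] d' d(2) by simp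
  have Q': "is_face E' \<rho>' (\<phi> ` (Q \<inter> D0))" using face'_is_face[OF d'(1)] unfolding im .
  have "\<phi> ` (Q \<inter> D0) \<noteq> F'"
  proof
   assume "\<phi> ` (Q \<inter> D0) = F'"
   hence "Q \<inter> D0 = F \<inter> D0" using inj_on_image_eq_iff[OF \<phi>_inj, of "Q \<inter> D0" "F \<inter> D0"] by blast
   moreover have "d' \<in> Q" using face_self[of d'] d'(1) D0_D d' d(2) by blast
   ultimately have "d' \<in> F" using d'(1) by blast
   moreover obtain d1 where d1: "d1 \<in> D0" "F = face d1" by (rule F_face)
   ultimately have "face d' = F" using face_eq[of d1 d'] D0_D by blast
   thus False using Q(2) d' d(2) by simp
  qed
  hence c3: "card {d\<in>\<phi> ` (Q \<inter> D0). corner p' \<rho>' (fst d) (snd d) < pi} = 3"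
   using real' Q' by (simp add: realization_def)
  have Q0: "Q \<inter> D0 = Q - {(u, v)}" using d'(3) d(2) by simp
  have uvQ: "(u, v) \<in> Q \<longleftrightarrow> (xi, u) \<in> Q"
  proof
   assume "(xi, u) \<in> Q"
   hence "f (xi, u) \<in> Q" using orbit.step[of "(xi, u)" f d0] d(2) by blast
   thus "(u, v) \<in> Q" using xi by simp
  next
   assume a: "(u, v) \<in> Q"
   have "f (xi, u) = (u, v)" using xi by simp
   hence "face (u, v) = face (xi, u)" using face_step_eq[OF xiD] by simp
   moreover have "face (u, v) = Q" using face_eq[OF d(1)] a d(2) by simp
   ultimately show "(xi, u) \<in> Q" using face_self[OF xiD] by simp
  qed
  let ?C = "\<lambda>d. convex_corner (fst d) (snd d)"
  let ?C' = "\<lambda>d. corner p' \<rho>' (fst d) (snd d) < pi"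
  have i: "card {d\<in>\<phi> ` (Q \<inter> D0). ?C' d} = card {d\<in>Q \<inter> D0. ?C' (\<phi> d)}"
  proof -
   have "{d\<in>\<phi> ` (Q \<inter> D0). ?C' d} = \<phi> ` {d\<in>Q \<inter> D0. ?C' (\<phi> d)}" by blast
   moreover have "inj_on \<phi> {d\<in>Q \<inter> D0. ?C' (\<phi> d)}" by (rule inj_on_subset[OF \<phi>_inj]) blast
   ultimately show ?thesis by (simp add: card_image)
  qed
  let ?R = "{d\<in>Q \<inter> D0. d \<noteq> (xi, u) \<and> ?C d}"
  have Req: "?R = {d\<in>Q \<inter> D0. d \<noteq> (xi, u) \<and> ?C' (\<phi> d)}" using convex_corner_\<phi> by blast
  have finR: "finite ?R" using finQ by simp
  have Kc: "corner p' \<rho>' xi v = \<Theta>1 - \<Theta>i" using corner_gap[of xi] xi(4) xi_rho(1) Th1(3) by (simp add: \<Theta>i_def)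
  have phx: "fst (\<phi> (xi, u)) = xi" "snd (\<phi> (xi, u)) = v" using edgeD(1)[OF xi(1)] by (auto simp: \<phi>_def)
  have tC: "?C (xi, u) \<longleftrightarrow> \<delta> + pi - \<Theta>i < pi" "?C (u, v) \<longleftrightarrow> \<Theta>1 - \<delta> < pi"
   using xi(3) uvt by (auto simp: convex_corner_def)
  show ?thesis
  proof (cases "(xi, u) \<in> Q")
   case False
   hence "{d\<in>Q. ?C d} = ?R" using uvQ Q0 by auto
   moreover have "{d\<in>Q \<inter> D0. ?C' (\<phi> d)} = ?R" using False unfolding Req by blast
   ultimately show ?thesis using c3 i by simp
  next
   case True
   have e1: "{d\<in>Q. ?C d} = ?R \<union> {d\<in>{(xi, u), (u, v)}. ?C d}" using True uvQ Q0 xiD0 uv_notin_D0 by blast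
   have e2: "{d\<in>Q \<inter> D0. ?C' (\<phi> d)} = ?R \<union> {d\<in>{(xi, u)}. ?C' (\<phi> d)}" unfolding Req using True xiD0 by blast
   have nR: "(xi, u) \<notin> ?R" "(u, v) \<notin> ?R" using uv_notin_D0 by auto
   have c1: "card {d\<in>Q. ?C d} = card ?R + card {d\<in>{(xi, u), (u, v)}. ?C d}"
    unfolding e1 by (rule card_Un_disjoint) (use finR nR in auto)
   have c2: "card {d\<in>Q \<inter> D0. ?C' (\<phi> d)} = card ?R + card {d\<in>{(xi, u)}. ?C' (\<phi> d)}"
    unfolding e2 by (rule card_Un_disjoint) (use finR nR in auto)
   have ne: "(xi, u) \<noteq> (u, v)" using uvt by auto
   have "card {d\<in>{(xi, u), (u, v)}. ?C d} = card {d\<in>{(xi, u)}. ?C' (\<phi> d)}"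
   proof (cases "pi < \<Theta>1 - \<Theta>i")
    case True
    have "\<not> ?C (xi, u)" "\<not> ?C (u, v)" "\<not> ?C' (\<phi> (xi, u))" using K[OF True] tC phx Kc True by auto
    hence z: "{d\<in>{(xi, u), (u, v)}. ?C d} = {}" "{d\<in>{(xi, u)}. ?C' (\<phi> d)} = {}" by blast+
    show ?thesis unfolding z by simp
   next
    case False
    have "\<Theta>1 - \<Theta>i \<noteq> pi" using r'.corner_ne_pi[of v xi] N'_v xi(4) Kc by auto
    hence K': "\<Theta>1 - \<Theta>i < pi" using False by simp
    have C': "?C' (\<phi> (xi, u))" using phx Kc K' by simp
    have "?C (xi, u) \<longleftrightarrow> \<not> ?C (u, v)" using tC d_cases K' gd by linarith
    hence "{d\<in>{(xi, u), (u, v)}. ?C d} = {(xi, u)} \<or> {d\<in>{(xi, u), (u, v)}. ?C d} = {(u, v)}" by blast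
    moreover have z: "{d\<in>{(xi, u)}. ?C' (\<phi> d)} = {(xi, u)}" using C' by blast
    ultimately show ?thesis unfolding z by (elim disjE) (erule ssubst, simp)+
   qed
   thus ?thesis using c1 c2 c3 i by simp
  qed
 qed
qed

end

context geo_step
begin

theorem ex_realization: "\<exists>p. realization V E \<rho> F p"
proof -
 obtain d where gd0: "good_dir d" using ex_good_dir by blast
 then obtain \<delta> where gd: "0 < \<delta> \<and> \<delta> < pi \<and> d = cis \<delta> * e t \<and>
   ((\<Theta>i < \<delta> \<and> \<delta> < \<Theta>1) \<or> (\<Theta>i < \<delta> + pi \<and> \<delta> + pi < \<Theta>1)) \<and>
   \<delta> + pi - \<Theta>i \<noteq> pi \<and> \<Theta>1 - \<delta> \<noteq> pi \<and>
   (pi < \<Theta>1 - \<Theta>i \<longrightarrow> pi < \<delta> + pi - \<Theta>i \<and> pi < \<Theta>1 - \<delta>) \<and>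
   (pi < \<delta> + pi - \<Theta>i \<or> (\<exists>x\<in>A. x \<noteq> xi \<and> pi < corner p' \<rho>' x v)) \<and>
   (pi < \<Theta>1 - \<delta> \<or> (\<exists>x\<in>B. x \<noteq> t \<and> pi < corner p' \<rho>' x v)) \<and>
   (\<forall>x. (x, u) \<in> F \<longrightarrow> x \<noteq> v \<longrightarrow> 0 < cross (e x) d) \<and>
   (\<forall>x. (u, x) \<in> F \<longrightarrow> x \<noteq> v \<longrightarrow> cross (e x) d < 0) \<and>
   (\<forall>x. (x, v) \<in> F \<longrightarrow> x \<noteq> u \<longrightarrow> cross (e x) d < 0) \<and>
   (\<forall>x. (v, x) \<in> F \<longrightarrow> x \<noteq> u \<longrightarrow> 0 < cross (e x) d) \<and>
   ((u, v) \<in> F \<longrightarrow> (\<forall>x\<in>V' - {v}. cross d (e x) < 0))"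
  unfolding good_dir_def by (rule exE)
 note g = gd[THEN conjunct1] gd[THEN conjunct2, THEN conjunct1] gd[THEN conjunct2, THEN conjunct2, THEN conjunct1]
 note gd1 = gd[THEN conjunct2, THEN conjunct2, THEN conjunct2]
 note g4 = gd1[THEN conjunct1] and gd2 = gd1[THEN conjunct2]
 note g5 = gd2[THEN conjunct1] and gd3 = gd2[THEN conjunct2]
 note g6 = gd3[THEN conjunct1] and gd4 = gd3[THEN conjunct2]
 note g7 = mp[OF gd4[THEN conjunct1]] and gd5 = gd4[THEN conjunct2]
 note g8 = gd5[THEN conjunct1] and gd6 = gd5[THEN conjunct2]
 note g9 = gd6[THEN conjunct1] and gd7 = gd6[THEN conjunct2]
 note F1 = gd7[THEN conjunct1, rule_format] and gd8 = gd7[THEN conjunct2]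
 note F2 = gd8[THEN conjunct1, rule_format] and gd9 = gd8[THEN conjunct2]
 note F3 = gd9[THEN conjunct1, rule_format] and gd10 = gd9[THEN conjunct2]
 note F4 = gd10[THEN conjunct1, rule_format] and F5 = gd10[THEN conjunct2, rule_format]
 interpret geo_dir V E \<rho> v u t F p' \<delta> d
  by unfold_locales (rule g g4)+
 have hull: "ev (\<lambda>eps. \<forall>a b. (a, b) \<in> F \<longrightarrow>
   (\<forall>x\<in>V - {a, b}. 0 < cross (pe eps b - pe eps a) (pe eps x - pe eps a)))"
  by (rule pe_hull) (erule (1) F1 F2 F3 F4 F5)+
 have count: "card {d\<in>Q. convex_corner (fst d) (snd d)} = 3" if "is_face E \<rho> Q" "Q \<noteq> F" for Q
  by (rule convex_corner_count[OF g5 g6 _ that]) (erule g7)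
 have "ev (\<lambda>eps. realization V E \<rho> F (pe eps))"
  using pe_noncross pe_rotation hull pe_corners[OF g5 g6]
 proof eventually_elim
  case (elim eps)
  have pointed: "\<exists>x. {b, x} \<in> E \<and> pi < corner (pe eps) \<rho> x b" if b: "b \<in> V" for b
  proof -
   have "\<exists>x. {b, x} \<in> E \<and> \<not> convex_corner x b"
   proof (cases "b = u \<or> b = v")
    case False
    hence "b \<in> V'" using b by (simp add: V'_def)
    obtain y where y: "{b, y} \<in> E'" "pi < corner p' \<rho>' y b" by (rule r'.big[OF \<open>b \<in> V'\<close>])
    hence "(y, b) \<in> darts E'" by (simp add: insert_commute)
    then obtain d0 where d0: "d0 \<in> D0" "(y, b) = \<phi> d0" unfolding \<phi>_image[symmetric] by blast
    have sb: "snd d0 = b" using d0(2) False by (auto simp: \<phi>_def c_def split: if_splits)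
    hence "d0 \<noteq> (xi, u)" using False by auto
    hence "\<not> convex_corner (fst d0) (snd d0)"
     using convex_corner_\<phi>[OF d0(1)] y(2) d0(2)[symmetric] by simp
    moreover have "{b, fst d0} \<in> E" using d0(1) D0_D sb by (auto simp: darts_def insert_commute)
    ultimately show ?thesis using sb by auto
   next
    case True
    thus ?thesis
    proof
     assume bu: "b = u"
     show ?thesis using g8
     proof
      assume "pi < \<delta> + pi - \<Theta>i"
      hence "\<not> convex_corner xi u" using xi(3) uvt by (auto simp: convex_corner_def)
      thus ?thesis using xi(1) bu by blast
     next
      assume "\<exists>x\<in>A. x \<noteq> xi \<and> pi < corner p' \<rho>' x v"
      then obtain x where x: "x \<in> A" "x \<noteq> xi" "pi < corner p' \<rho>' x v" by blast
      have "x \<noteq> u" "x \<noteq> v" "{u, x} \<in> E" using x(1) A_B(4,5) by (auto simp: A_def)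
      hence "\<not> convex_corner x u" using x uvt by (auto simp: convex_corner_def)
      thus ?thesis using \<open>{u, x} \<in> E\<close> bu by blast
     qed
    next
     assume bv: "b = v"
     show ?thesis using g9
     proof
      assume "pi < \<Theta>1 - \<delta>"
      hence "\<not> convex_corner u v" using uvt by (auto simp: convex_corner_def)
      thus ?thesis using t_edges bv by blast
     next
      assume "\<exists>x\<in>B. x \<noteq> t \<and> pi < corner p' \<rho>' x v"
      then obtain x where x: "x \<in> B" "x \<noteq> t" "pi < corner p' \<rho>' x v" by blast
      have "x \<noteq> u" "{v, x} \<in> E" using x(1) by (auto simp: B_def)
      hence "\<not> convex_corner x v" using x uvt by (auto simp: convex_corner_def)
      thus ?thesis using \<open>{v, x} \<in> E\<close> bv by blast
     qed
    qed
   qed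
   then obtain x where x: "{b, x} \<in> E" "\<not> convex_corner x b" by blast
   hence "{x, b} \<in> E" by (simp add: insert_commute)
   thus ?thesis using elim(4) x by blast
  qed
  have faces: "card {d\<in>Q. corner (pe eps) \<rho> (fst d) (snd d) < pi} = 3" if Q: "is_face E \<rho> Q" "Q \<noteq> F" for Q
  proof -
   obtain d0 where d: "d0 \<in> D" "Q = face d0" using Q is_face_iff by auto
   have QD: "Q \<subseteq> D" using face_D[OF d(1)] d(2) by simp
   have "corner (pe eps) \<rho> (fst d) (snd d) < pi \<longleftrightarrow> convex_corner (fst d) (snd d)" if "d \<in> Q" for d
    using elim(4) that QD by (auto simp: darts_def)
   hence "{d\<in>Q. corner (pe eps) \<rho> (fst d) (snd d) < pi} = {d\<in>Q. convex_corner (fst d) (snd d)}" by blast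
   thus ?thesis using count[OF Q] by simp
  qed
  show ?case unfolding realization_def using elim pointed faces tail_inj by blast
 qed
 hence "\<exists>eps. realization V E \<rho> F (pe eps)" by (rule eventually_happens'[rotated]) simp
 thus ?thesis by blast
qed

end

text \<open>The base of the induction. A single edge has only the face \<open>F\<close>, so no
  condition on other faces arises.\<close>

lemma realization_two:
 assumes "laman_map V E \<rho>" "card V = 2" "is_face E \<rho> F"
 shows "\<exists>p. realization V E \<rho> F p"
proof -
 interpret laman_map V E \<rho> by fact
 obtain a b where V: "V = {a, b}" "a \<noteq> b" using assms(2) by (auto simp: card_2_iff)
 have "card E = 1" using cardE assms(2) by simp
 then obtain e where "E = {e}" by (auto simp: card_1_singleton_iff)
 moreover have "e \<subseteq> V" "card e = 2" using simple \<open>E = {e}\<close> by (auto simp: simple_graph_def)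
 ultimately have E: "E = {{a, b}}" using V assms(2) card_subset_eq[OF finV] by metis
 have D: "D = {(a, b), (b, a)}" using E by (auto simp: darts_def doubleton_eq_iff)
 have N: "neighbours E a = {b}" "neighbours E b = {a}" using V E by (auto simp: neighbours_def doubleton_eq_iff)
 have r: "\<rho> a b = b" "\<rho> b a = a" using rho_in[of a b] rho_in[of b a] N E V by (auto simp: doubleton_eq_iff)
 have fab: "f (a, b) = (b, a)" "f (b, a) = (a, b)" using r by auto
 have face: "face d = D" if "d \<in> D" for d
 proof (rule equalityI[OF face_D[OF that]])
  have "d = (a, b) \<or> d = (b, a)" using that D by auto
  thus "D \<subseteq> face d" using face_self[OF that] orbit.base[of f d] fab D by auto
 qed
 have F: "F = D" using assms(3) is_face_iff face by auto
 define p where "p x = (if x = a then 0 else 1 :: complex)" for x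
 have pab: "p a = 0" "p b = 1" using V by (auto simp: p_def)
 have A: "noncrossing_straight_line_embedding V E p"
  using V E pab by (auto simp: noncrossing_straight_line_embedding_def inj_on_def)
 have B: "ccw_next (\<lambda>y. p y - p x) (neighbours E x) y (\<rho> x y)" if "{x, y} \<in> E" for x y
 proof -
  have "x = a \<and> y = b \<or> x = b \<and> y = a" using that E by (auto simp: doubleton_eq_iff)
  thus ?thesis using N r that by (auto simp: ccw_next_def)
 qed
 have C: "\<exists>x. {y, x} \<in> E \<and> pi < corner p \<rho> x y" if "y \<in> V" for y
  using that V E r pi_gt_zero by (auto simp: corner_def intro!: exI[of _ "if y = a then b else a"] simp: insert_commute)
 have G: "V - {x, y} = {}" if "(x, y) \<in> F" for x y using that F D V by auto
 have H: "inj_on fst Q \<and> Q = F" if "is_face E \<rho> Q" for Q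
 proof -
  have "Q = D" using that is_face_iff face by auto
  thus ?thesis using D V F by (auto simp: inj_on_def)
 qed
 show ?thesis unfolding realization_def
 proof (intro exI[of _ p] conjI allI impI ballI)
  show "noncrossing_straight_line_embedding V E p" by (rule A)
  show "ccw_next (\<lambda>y. p y - p x) (neighbours E x) y (\<rho> x y)" if "{x, y} \<in> E" for x y by (rule B[OF that])
  show "\<exists>x. {y, x} \<in> E \<and> pi < corner p \<rho> x y" if "y \<in> V" for y by (rule C[OF that])
  show "0 < cross (p y - p x) (p c - p x)" if "(x, y) \<in> F" "c \<in> V - {x, y}" for x y c using G[OF that(1)] that(2) by blast
  show "inj_on fst Q" if "is_face E \<rho> Q" for Q using H[OF that] by (rule conjunct1)
  show "card {d \<in> Q. corner p \<rho> (fst d) (snd d) < pi} = 3" if "is_face E \<rho> Q" "Q \<noteq> F" for Q using H[OF that(1)] that(2) by simp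
 qed
qed

theorem ex_realization:
 assumes "laman_map V E \<rho>" "card E + 2 \<le> card {Q. is_face E \<rho> Q} + card V" "is_face E \<rho> F"
 shows "\<exists>p. realization V E \<rho> F p"
 using assms
proof (induction "card V" arbitrary: V E \<rho> F rule: less_induct)
 case less
 interpret laman_map V E \<rho> by fact
 show ?case
 proof (cases "card V = 2")
  case True thus ?thesis using realization_two less.prems by blast
 next
  case False
  hence n: "3 \<le> card V" using cardV by simp
  obtain d0 where d0: "d0 \<in> D" "F = face d0" using less.prems(3) is_face_iff by auto
  have euler: "card E + 2 \<le> card (face ` D) + card V" using less.prems(2) unfolding faces_eq .
  obtain v u t where T: "triangle_face E \<rho> v u t" "(v, u) \<notin> face d0" "\<forall>X. \<not> blocker V E v u t X"
   using unblocked_triangle[OF euler n d0(1)] by blast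
  interpret contraction V E \<rho> v u t by unfold_locales (use T in auto)
  obtain d' where d': "d' \<in> D0" "face d0 = face d'" "face d0 \<inter> D0 = face d0 - {(u, v)}"
   by (rule other_face[OF d0(1) T(2)])
  have F': "is_face E' \<rho>' (\<phi> ` (F \<inter> D0))"
  proof -
   have "face' (\<phi> d') = \<phi> ` (F \<inter> D0)" using face'_\<phi>[OF d'(1)] d' d0(2) by simp
   moreover have "is_face E' \<rho>' (face' (\<phi> d'))"
    unfolding m'.is_face_iff \<phi>_image[symmetric] by (intro bexI[of _ "\<phi> d'"] refl imageI d'(1))
   ultimately show ?thesis by simp
  qed
  have "card E' + 2 \<le> card {Q. is_face E' \<rho>' Q} + card V'" unfolding m'.faces_eq by (rule euler'[OF euler])
  then obtain p' where p': "realization V' E' \<rho>' (\<phi> ` (F \<inter> D0)) p'"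
   using less.hyps[OF _ m'.laman_map_axioms _ F'] card_V' n by auto
  interpret geo_step V E \<rho> v u t F p'
   by unfold_locales (use less.prems(3) T(2) d0(2) p' in auto)
  show ?thesis by (rule ex_realization)
 qed
qed

subsection \<open>Cycles in drawings\<close>

text \<open>Two vertices form a base case of their own, so that no constant path is joined on at the
  end and a chain along a path is an arc. On shorter lists the value is a dummy.\<close>

fun chain :: "('a \<Rightarrow> 'a \<Rightarrow> real \<Rightarrow> complex) \<Rightarrow> 'a list \<Rightarrow> real \<Rightarrow> complex" where
 "chain g [] = linepath 0 0"
| "chain g [a] = linepath 0 0"
| "chain g [a, b] = g a b"
| "chain g (a # b # c # xs) = g a b +++ chain g (b # c # xs)"

fun steps :: "'a list \<Rightarrow> ('a \<times> 'a) set" where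
 "steps (a # b # xs) = insert (a, b) (steps (b # xs))"
| "steps _ = {}"

lemma chain_Cons: "xs \<noteq> [] \<Longrightarrow> chain g (a # b # xs) = g a b +++ chain g (b # xs)"
 by (cases xs) auto

lemma steps_set: "(a, b) \<in> steps xs \<Longrightarrow> a \<in> set xs \<and> b \<in> set xs"
 by (induction xs rule: steps.induct) auto

lemma steps_nth: "(a, b) \<in> steps xs \<longleftrightarrow> (\<exists>i. Suc i < length xs \<and> a = xs ! i \<and> b = xs ! Suc i)"
proof (induction xs rule: steps.induct)
 case (1 a' b' xs)
 show ?case
 proof
  assume "(a, b) \<in> steps (a' # b' # xs)"
  then consider "a = a'" "b = b'" | "(a, b) \<in> steps (b' # xs)" by auto
  thus "\<exists>i. Suc i < length (a' # b' # xs) \<and> a = (a' # b' # xs) ! i \<and> b = (a' # b' # xs) ! Suc i"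
  proof cases
   case 1 thus ?thesis by (intro exI[of _ 0]) auto
  next
   case 2
   then obtain i where "Suc i < length (b' # xs)" "a = (b' # xs) ! i" "b = (b' # xs) ! Suc i" using "1.IH" by auto
   thus ?thesis by (intro exI[of _ "Suc i"]) auto
  qed
 next
  assume "\<exists>i. Suc i < length (a' # b' # xs) \<and> a = (a' # b' # xs) ! i \<and> b = (a' # b' # xs) ! Suc i"
  then obtain i where i: "Suc i < length (a' # b' # xs)" "a = (a' # b' # xs) ! i" "b = (a' # b' # xs) ! Suc i" by auto
  show "(a, b) \<in> steps (a' # b' # xs)"
  proof (cases i)
   case 0 thus ?thesis using i by auto
  next
   case (Suc j) thus ?thesis using i "1.IH" by auto
  qed
 qed
qed auto

locale drawing =
 fixes V :: "'a set" and E :: "'a set set" and p :: "'a \<Rightarrow> complex" and g :: "'a \<Rightarrow> 'a \<Rightarrow> real \<Rightarrow> complex"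
 assumes simple: "simple_graph V E" and draw: "noncrossing_drawing V E p g"
begin

lemma edgeD: assumes "{a, b} \<in> E" shows "a \<noteq> b" "a \<in> V" "b \<in> V"
 using simple assms unfolding simple_graph_def by (fastforce simp: card_insert_if)+

lemma p_eq: "a \<in> V \<Longrightarrow> b \<in> V \<Longrightarrow> p a = p b \<longleftrightarrow> a = b"
 using draw by (auto simp: noncrossing_drawing_def inj_on_def)

lemma g: assumes "{a, b} \<in> E"
 shows "arc (g a b)" "pathstart (g a b) = p a" "pathfinish (g a b) = p b" "g b a = reversepath (g a b)"
  "path_image (g a b) \<inter> p ` V = {p a, p b}" "path_image (g b a) = path_image (g a b)"
proof -
 show "arc (g a b)" "pathstart (g a b) = p a" "pathfinish (g a b) = p b" "g b a = reversepath (g a b)"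
  "path_image (g a b) \<inter> p ` V = {p a, p b}" using draw assms by (auto simp: noncrossing_drawing_def)
 thus "path_image (g b a) = path_image (g a b)" by simp
qed

lemma meet: assumes "{a, b} \<in> E" "{x, y} \<in> E" "{a, b} \<noteq> {x, y}"
 shows "path_image (g a b) \<inter> path_image (g x y) = p ` ({a, b} \<inter> {x, y})"
 using draw assms by (auto simp: noncrossing_drawing_def)

lemma chain_props:
 assumes "2 \<le> length xs" "distinct xs" "\<And>a b. (a, b) \<in> steps xs \<Longrightarrow> {a, b} \<in> E"
 shows "arc (chain g xs) \<and> pathstart (chain g xs) = p (hd xs) \<and> pathfinish (chain g xs) = p (last xs) \<and>
   path_image (chain g xs) = (\<Union>(a, b)\<in>steps xs. path_image (g a b))"
 using assms
proof (induction xs rule: steps.induct)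
 case (1 a b xs)
 have e: "{a, b} \<in> E" using 1(4) by auto
 show ?case
 proof (cases "xs = []")
  case True thus ?thesis using g[OF e] by auto
 next
  case False
  have IH: "arc (chain g (b # xs))" "pathstart (chain g (b # xs)) = p b"
   "pathfinish (chain g (b # xs)) = p (last xs)"
   "path_image (chain g (b # xs)) = (\<Union>(a, b)\<in>steps (b # xs). path_image (g a b))"
   using "1.IH" 1(3,4) False by (cases xs; auto)+
  have "path_image (g a b) \<inter> path_image (chain g (b # xs)) \<subseteq> {p b}"
  proof
   fix z assume z: "z \<in> path_image (g a b) \<inter> path_image (chain g (b # xs))"
   then obtain c d where cd: "(c, d) \<in> steps (b # xs)" "z \<in> path_image (g c d)" unfolding IH(4) by auto
   have cdE: "{c, d} \<in> E" using 1(4) cd(1) by auto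
   have "c \<in> set (b # xs)" "d \<in> set (b # xs)" using steps_set[OF cd(1)] by auto
   hence na: "a \<notin> {c, d}" using 1(3) by auto
   hence "{a, b} \<noteq> {c, d}" by auto
   hence "z \<in> p ` ({a, b} \<inter> {c, d})" using meet[OF e cdE] z cd(2) by auto
   thus "z \<in> {p b}" using na by auto
  qed
  hence "arc (g a b +++ chain g (b # xs))"
   using g[OF e] IH by (intro arc_join) auto
  moreover have "path_image (g a b +++ chain g (b # xs)) = path_image (g a b) \<union> path_image (chain g (b # xs))"
   by (rule path_image_join) (use g[OF e] IH in auto)
  ultimately show ?thesis using IH g[OF e] False by (simp add: chain_Cons)
 qed
qed auto

definition cyc_darts :: "'a list \<Rightarrow> ('a \<times> 'a) set" where
 "cyc_darts xs = insert (last xs, hd xs) (steps xs)"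

definition cyc_loop :: "'a list \<Rightarrow> real \<Rightarrow> complex" where
 "cyc_loop xs = chain g xs +++ g (last xs) (hd xs)"

definition cyc_curve :: "'a list \<Rightarrow> complex set" where
 "cyc_curve xs = (\<Union>(a, b)\<in>cyc_darts xs. path_image (g a b))"

definition is_cycle :: "'a list \<Rightarrow> bool" where
 "is_cycle xs \<longleftrightarrow> 3 \<le> length xs \<and> distinct xs \<and> (\<forall>(a, b)\<in>cyc_darts xs. {a, b} \<in> E)"

lemma last_hd_not_step:
 assumes "3 \<le> length xs" "distinct xs" "(c, d) \<in> steps xs" shows "{c, d} \<noteq> {last xs, hd xs}"
proof
 assume a: "{c, d} = {last xs, hd xs}"
 have ne: "xs \<noteq> []" using assms(1) by auto
 obtain i where i: "Suc i < length xs" "c = xs ! i" "d = xs ! Suc i" using assms(3) steps_nth by metis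
 have lh: "last xs = xs ! (length xs - 1)" "hd xs = xs ! 0" using ne by (simp_all add: last_conv_nth hd_conv_nth)
 have "{xs ! i, xs ! Suc i} = {xs ! (length xs - 1), xs ! 0}" using a i lh by simp
 thus False using i assms(1,2) ne by (auto simp: doubleton_eq_iff nth_eq_iff_index_eq)
qed

lemma cycle_loop:
 assumes "is_cycle xs"
 shows "simple_path (cyc_loop xs)" "pathfinish (cyc_loop xs) = pathstart (cyc_loop xs)"
  "path_image (cyc_loop xs) = cyc_curve xs"
  "path_image (chain g xs) \<inter> path_image (g (last xs) (hd xs)) = {p (last xs), p (hd xs)}"
proof -
 have xs: "3 \<le> length xs" "distinct xs" "\<And>a b. (a, b) \<in> steps xs \<Longrightarrow> {a, b} \<in> E" "{last xs, hd xs} \<in> E"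
  using assms by (auto simp: is_cycle_def cyc_darts_def)
 have c: "arc (chain g xs)" "pathstart (chain g xs) = p (hd xs)" "pathfinish (chain g xs) = p (last xs)"
   "path_image (chain g xs) = (\<Union>(a, b)\<in>steps xs. path_image (g a b))"
  using chain_props[of xs] xs by auto
 note ge = g[OF xs(4)]
 have sub: "path_image (chain g xs) \<inter> path_image (g (last xs) (hd xs)) \<subseteq> {p (last xs), p (hd xs)}"
 proof
  fix z assume z: "z \<in> path_image (chain g xs) \<inter> path_image (g (last xs) (hd xs))"
  then obtain a b where ab: "(a, b) \<in> steps xs" "z \<in> path_image (g a b)" unfolding c(4) by auto
  have "{a, b} \<noteq> {last xs, hd xs}" by (rule last_hd_not_step[OF xs(1,2) ab(1)])
  hence "z \<in> p ` ({a, b} \<inter> {last xs, hd xs})" using meet[OF xs(3)[OF ab(1)] xs(4)] z ab(2) by auto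
  thus "z \<in> {p (last xs), p (hd xs)}" by auto
 qed
 show "path_image (chain g xs) \<inter> path_image (g (last xs) (hd xs)) = {p (last xs), p (hd xs)}"
  using sub pathstart_in_path_image[of "chain g xs"] pathfinish_in_path_image[of "chain g xs"]
   pathstart_in_path_image[of "g (last xs) (hd xs)"] pathfinish_in_path_image[of "g (last xs) (hd xs)"] c ge by auto
 show "simple_path (cyc_loop xs)"
  unfolding cyc_loop_def by (rule simple_path_join_loop) (use c ge sub in auto)
 show "pathfinish (cyc_loop xs) = pathstart (cyc_loop xs)" using c ge by (simp add: cyc_loop_def)
 show "path_image (cyc_loop xs) = cyc_curve xs"
  unfolding cyc_loop_def cyc_curve_def cyc_darts_def using c ge by (simp add: path_image_join Un_commute)
qed

end

text \<open>The least positive period of \<open>d\<close> lists the orbit without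
  repetition.\<close>

lemma orbit_list:
 assumes self: "d \<in> orbit f d"
 obtains m where "0 < m" "(f ^^ m) d = d" "inj_on (\<lambda>k. (f ^^ k) d) {..<m}" "orbit f d = (\<lambda>k. (f ^^ k) d) ` {..<m}"
proof -
 have ex: "\<exists>m. 0 < m \<and> (f ^^ m) d = d" using self unfolding orbit_altdef by auto
 define m where "m = (LEAST m. 0 < m \<and> (f ^^ m) d = d)"
 have m: "0 < m" "(f ^^ m) d = d" using LeastI_ex[OF ex] by (auto simp: m_def)
 have min: "\<not> (0 < k \<and> (f ^^ k) d = d)" if "k < m" for k using not_less_Least that unfolding m_def by blast
 have "(f ^^ i) d \<noteq> (f ^^ j) d" if ij: "i < j" "j < m" for i j
 proof
  assume eq: "(f ^^ i) d = (f ^^ j) d"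
  have "(f ^^ (m - j + i)) d = (f ^^ (m - j)) ((f ^^ i) d)" by (simp add: funpow_add)
  also have "\<dots> = (f ^^ (m - j + j)) d" by (simp only: eq funpow_add o_apply)
  also have "\<dots> = d" using ij m by simp
  finally have "(f ^^ (m - j + i)) d = d" .
  moreover have "m - j + i < m" "0 < m - j + i" using ij by linarith+
  ultimately show False using min by blast
 qed
 hence "inj_on (\<lambda>k. (f ^^ k) d) {..<m}" by (intro linorder_inj_onI) auto
 moreover have "orbit f d = (\<lambda>k. (f ^^ k) d) ` {..<m}" using orbit_altdef_bounded[OF m(2,1)] by auto
 ultimately show thesis using that m by blast
qed

subsection \<open>Winding numbers near a vertex\<close>

lemma cis_inj: assumes "cis x = cis y" "0 \<le> x" "x < 2 * pi" "0 \<le> y" "y < 2 * pi" shows "x = y"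
 using Arg2pi_cis[of x 1] Arg2pi_cis[of y 1] assms by simp

lemma norm_cis_mult: "cmod (of_real s * cis \<phi> * \<alpha>) = \<bar>s\<bar> * cmod \<alpha>"
 by (simp add: norm_mult)

text \<open>All points of the chord have the same component, \<open>cos h\<close> times the radius,
  in the direction of its midpoint.\<close>

lemma chord_far:
 assumes "\<alpha> \<noteq> 0" "0 \<le> h" "h < pi / 2" "z \<in> closed_segment (x + cis (a - h) * \<alpha>) (x + cis (a + h) * \<alpha>)"
 shows "cos h * cmod \<alpha> \<le> cmod (z - x)"
proof -
 obtain q where q: "0 \<le> q" "q \<le> 1" "z = (1 - q) *\<^sub>R (x + cis (a - h) * \<alpha>) + q *\<^sub>R (x + cis (a + h) * \<alpha>)"
  using assms(4) by (auto simp: in_segment)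
 let ?k = "of_real (1 - q) * cis (- h) + of_real q * cis h"
 have c: "cis (a - h) = cis a * cis (- h)" "cis (a + h) = cis a * cis h" by (simp_all add: cis_mult)
 have "z - x = cis a * ?k * \<alpha>"
  unfolding q(3) c by (simp add: scaleR_conv_of_real algebra_simps)
 hence "cmod (z - x) = cmod ?k * cmod \<alpha>" by (simp add: norm_mult)
 moreover have "Re ?k = cos h" by (simp add: algebra_simps)
 hence "cos h \<le> cmod ?k" using complex_Re_le_cmod[of ?k] by simp
 ultimately show ?thesis by (simp add: mult_right_mono)
qed

lemma convex_functional: "convex {z. 0 \<le> cross m (z - x)}"
proof -
 have "{z. 0 \<le> cross m (z - x)} = {z. (Complex (- Im m) (Re m)) \<bullet> x \<le> (Complex (- Im m) (Re m)) \<bullet> z}"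
  by (auto simp: cross_def inner_complex_def algebra_simps)
 thus ?thesis using convex_halfspace_ge[of "(Complex (- Im m) (Re m)) \<bullet> x" "Complex (- Im m) (Re m)"] by simp
qed

lemma convex_hull_3_cross:
 assumes "0 \<le> cross m (a - x)" "0 \<le> cross m (b - x)" "0 \<le> cross m (c - x)" "cross m (z - x) < 0"
 shows "z \<notin> convex hull {a, b, c}"
 using hull_minimal[of "{a, b, c}" "{z. 0 \<le> cross m (z - x)}" convex] convex_functional assms by auto

text \<open>The two radii are replaced by two chords that keep a small disc around \<open>x\<close>
  free, so the changed loop has equal winding numbers at test points on both sides. The difference
  of the loops consists of two triangles with corner \<open>x\<close>, and only one of them contains
  a test point. In this way the closing path \<open>P\<close> enters only by staying outside the
  disc.\<close>

lemma sector_winding: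
 assumes a0: "\<alpha> \<noteq> 0" and T: "0 < \<Theta>" "\<Theta> < 2 * pi"
  and O': "path P" "pathstart P = x + cis \<Theta> * \<alpha>" "pathfinish P = x + \<alpha>"
   "path_image P \<inter> cball x (cmod \<alpha>) \<subseteq> {x + cis \<Theta> * \<alpha>, x + \<alpha>}"
 defines "\<gamma> \<equiv> (linepath (x + \<alpha>) x +++ linepath x (x + cis \<Theta> * \<alpha>)) +++ P"
 obtains k where
  "\<forall>s \<phi>. 0 < s \<longrightarrow> s < 1 \<longrightarrow> 0 < \<phi> \<longrightarrow> \<phi> < \<Theta> \<longrightarrow>
    x + of_real s * cis \<phi> * \<alpha> \<notin> path_image \<gamma> \<and> winding_number \<gamma> (x + of_real s * cis \<phi> * \<alpha>) = k - 1"
  "\<forall>s \<phi>. 0 < s \<longrightarrow> s < 1 \<longrightarrow> \<Theta> < \<phi> \<longrightarrow> \<phi> < 2 * pi \<longrightarrow>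
    x + of_real s * cis \<phi> * \<alpha> \<notin> path_image \<gamma> \<and> winding_number \<gamma> (x + of_real s * cis \<phi> * \<alpha>) = k"
proof -
 define \<beta> where "\<beta> = cis \<Theta> * \<alpha>"
 define m where "m = cis (\<Theta> / 2) * \<alpha>"
 define A where "A = linepath (x + \<alpha>) x +++ linepath x (x + \<beta>)"
 define A2 where "A2 = linepath (x + \<alpha>) (x + m) +++ linepath (x + m) (x + \<beta>)"
 have g: "\<gamma> = A +++ P" by (simp add: \<gamma>_def A_def \<beta>_def)
 have P: "path P" "pathstart P = x + \<beta>" "pathfinish P = x + \<alpha>" "path_image P \<inter> cball x (cmod \<alpha>) \<subseteq> {x + \<beta>, x + \<alpha>}"
  using O' by (simp_all add: \<beta>_def)
 have nb: "cmod \<beta> = cmod \<alpha>" "cmod m = cmod \<alpha>" by (simp_all add: \<beta>_def m_def norm_mult)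
 have pg: "path \<gamma>" "pathfinish \<gamma> = pathstart \<gamma>" using P by (auto simp: g A_def)
 have ig: "path_image \<gamma> = closed_segment (x + \<alpha>) x \<union> closed_segment x (x + \<beta>) \<union> path_image P"
  using P by (simp add: g A_def path_image_join)
 have inP: "z \<notin> path_image P" if "cmod (z - x) < cmod \<alpha>" for z
 proof
  assume "z \<in> path_image P"
  hence "z \<in> {x + \<beta>, x + \<alpha>}" using P(4) that by (auto simp: dist_norm norm_minus_commute)
  thus False using that nb by auto
 qed
 have insec: "x + of_real s * cis \<phi> * \<alpha> \<notin> path_image \<gamma>"
  if s: "0 < s" "s < 1" and p: "0 < \<phi>" "\<phi> < 2 * pi" "\<phi> \<noteq> \<Theta>" for s \<phi>
 proof -
  let ?z = "x + of_real s * cis \<phi> * \<alpha>"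
  have ray: "?z \<notin> closed_segment x (x + cis \<psi> * \<alpha>)" if "0 \<le> \<psi>" "\<psi> < 2 * pi" "\<psi> \<noteq> \<phi>" for \<psi>
  proof
   assume "?z \<in> closed_segment x (x + cis \<psi> * \<alpha>)"
   then obtain t where t: "0 \<le> t" "?z = (1 - t) *\<^sub>R x + t *\<^sub>R (x + cis \<psi> * \<alpha>)" by (auto simp: in_segment)
   hence "of_real s * cis \<phi> * \<alpha> = of_real t * cis \<psi> * \<alpha>" by (simp add: scaleR_conv_of_real algebra_simps)
   hence e: "of_real s * cis \<phi> = of_real t * cis \<psi>" using a0 by simp
   hence "cmod (of_real s * cis \<phi>) = cmod (of_real t * cis \<psi>)" by simp
   hence "s = t" using s t by (simp add: norm_mult)
   hence "cis \<phi> = cis \<psi>" using e s by simp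
   thus False using cis_inj[of \<phi> \<psi>] that p by auto
  qed
  have "?z \<notin> closed_segment x (x + \<alpha>)" using ray[of 0] p by simp
  moreover have "?z \<notin> closed_segment x (x + \<beta>)" unfolding \<beta>_def by (rule ray) (use T p in auto)
  moreover have "cmod (?z - x) < cmod \<alpha>" using s a0 norm_cis_mult[of s \<phi> \<alpha>] by simp
  ultimately show ?thesis unfolding ig using inP closed_segment_commute by blast
 qed
 have const: "winding_number \<gamma> (x + of_real s * cis \<phi> * \<alpha>) = winding_number \<gamma> (x + of_real s' * cis \<phi>' * \<alpha>)"
  if s: "0 < s" "s < 1" "0 < s'" "s' < 1" and p: "l < \<phi>" "\<phi> < h" "l < \<phi>'" "\<phi>' < h"
   and lh: "0 \<le> l" "h \<le> 2 * pi" "h \<le> \<Theta> \<or> \<Theta> \<le> l" for s \<phi> s' \<phi>' l h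
 proof -
  let ?f = "\<lambda>z::real \<times> real. x + of_real (fst z) * cis (snd z) * \<alpha>"
  let ?S = "?f ` ({0<..<1} \<times> {l<..<h})"
  have "connected ({0<..<1::real} \<times> {l<..<h})" by (intro connected_Times connected_Ioo)
  hence c: "connected ?S" by (intro connected_continuous_image continuous_intros)
  have d: "?S \<inter> path_image \<gamma> = {}" using insec lh by fastforce
  have "x + of_real s * cis \<phi> * \<alpha> \<in> ?S" using s p by (intro image_eqI[of _ _ "(s, \<phi>)"]) auto
  moreover have "x + of_real s' * cis \<phi>' * \<alpha> \<in> ?S" using s p by (intro image_eqI[of _ _ "(s', \<phi>')"]) auto
  ultimately show ?thesis using winding_number_eq[OF pg _ _ c d] by blast
 qed
 \<comment> \<open>Each of the two chords spans \<open>2 * h\<close>, half of the sector. This is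
   below pi even if the sector itself is not, so neither chord passes through
   \<open>x\<close>.\<close>
 define h where "h = \<Theta> / 4"
 have h: "0 < h" "h < pi / 2" using T by (auto simp: h_def)
 have ch: "0 < cos h" "cos h < 1" using h cos_gt_zero_pi[of h] cos_monotone_0_pi[of 0 h] by auto
 have sh: "0 < sin h" using h by (intro sin_gt_zero) auto
 \<comment> \<open>With this factor \<open>zR\<close> becomes \<open>x + (\<alpha> + m) / 4\<close>,
   a point inside the first triangle, and it still lies in the disc that the chords avoid.\<close>
 define s where "s = cos h / 2"
 have s: "0 < s" "s < 1" "s < cos h" using ch by (auto simp: s_def)
 define zR where "zR = x + of_real s * cis h * \<alpha>"
 define zL where "zL = x + of_real s * cis (\<Theta> / 2 + pi) * \<alpha>"
 have zL: "zL = x - of_real s * m" by (simp add: zL_def m_def cis.ctr complex_eq_iff algebra_simps)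
 have chordA: "cos h * cmod \<alpha> \<le> cmod (z - x)" if "z \<in> path_image A2" for z
 proof -
  have "z \<in> closed_segment (x + \<alpha>) (x + m) \<or> z \<in> closed_segment (x + m) (x + \<beta>)"
   using that by (auto simp: A2_def path_image_join)
  moreover have e: "x + cis (h - h) * \<alpha> = x + \<alpha>" "x + cis (h + h) * \<alpha> = x + m"
   "x + cis (3 * h - h) * \<alpha> = x + m" "x + cis (3 * h + h) * \<alpha> = x + \<beta>"
   by (simp_all add: m_def \<beta>_def h_def)
  moreover have "0 \<le> h" using h by simp
  ultimately show ?thesis
   using chord_far[OF a0 _ h(2), of z x h] chord_far[OF a0 _ h(2), of z x "3 * h"] unfolding e by blast
 qed
 have pA2: "path A2" "pathstart A2 = x + \<alpha>" "pathfinish A2 = x + \<beta>" by (auto simp: A2_def)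
 have pA: "path A" "pathstart A = x + \<alpha>" "pathfinish A = x + \<beta>" by (auto simp: A_def)
 have small: "cmod (zR - x) = s * cmod \<alpha>" "cmod (zL - x) = s * cmod \<alpha>"
  using s by (auto simp: zR_def zL norm_mult m_def)
 have sm: "s * cmod \<alpha> < cos h * cmod \<alpha>" "cos h * cmod \<alpha> < cmod \<alpha>" using s ch a0 by auto
 have zz: "winding_number (A2 +++ P) zR = winding_number (A2 +++ P) zL"
 proof (rule winding_number_eq[where S = "ball x (cos h * cmod \<alpha>)"])
  show "path (A2 +++ P)" "pathfinish (A2 +++ P) = pathstart (A2 +++ P)" using P pA2 by auto
  show "zR \<in> ball x (cos h * cmod \<alpha>)" "zL \<in> ball x (cos h * cmod \<alpha>)"
   using small sm by (auto simp: dist_norm norm_minus_commute)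
  show "ball x (cos h * cmod \<alpha>) \<inter> path_image (A2 +++ P) = {}"
  proof -
   have "z \<notin> path_image A2 \<union> path_image P" if "z \<in> ball x (cos h * cmod \<alpha>)" for z
    using chordA[of z] inP[of z] that sm by (auto simp: dist_norm norm_minus_commute)
   thus ?thesis using P pA2 by (auto simp: path_image_join)
  qed
 qed auto
 have nA2: "zR \<notin> path_image A2" "zL \<notin> path_image A2" using chordA small sm by fastforce+
 have nP: "zR \<notin> path_image P" "zL \<notin> path_image P" using inP small sm by auto
 have ng: "zR \<notin> path_image \<gamma>" "zL \<notin> path_image \<gamma>"
  unfolding zR_def zL_def by (rule insec; use s h T in \<open>auto simp: h_def\<close>)+
 have nA: "zR \<notin> path_image A" "zL \<notin> path_image A" using ng P pA by (auto simp: g path_image_join)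
 have cR: "zR - x = of_real (1 / 4) * (\<alpha> + m)"
 proof -
  have "cis (2 * h) = cis h * cis h" by (simp add: cis_mult)
  moreover have "of_real (2 * cos h) * cis h = 1 + cis h * cis h"
  proof -
   have "1 + cis h * cis h = cis h * (cis (- h) + cis h)" by (simp add: distrib_left cis_mult)
   also have "cis (- h) + cis h = of_real (2 * cos h)" by (simp add: complex_eq_iff)
   finally show ?thesis by (simp add: mult.commute)
  qed
  moreover have "m = cis (2 * h) * \<alpha>" by (simp add: m_def h_def)
  ultimately have "\<alpha> + m = of_real (2 * cos h) * cis h * \<alpha>" by (simp add: algebra_simps)
  thus ?thesis by (simp add: zR_def s_def)
 qed
 have cr: "cross (cis a * \<alpha>) (cis b * \<alpha>) = (cmod \<alpha>)\<^sup>2 * sin (b - a)" for a b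
  by (simp add: cross_mult_right cmod_power2) (simp add: cross_def sin_diff algebra_simps)
 have cam: "0 < cross \<alpha> m"
  using cr[of 0 "2 * h"] h a0 sin_gt_zero[of "2 * h"] by (simp add: m_def h_def)
 have cmb: "0 < cross m \<beta>"
  using cr[of "2 * h" "4 * h"] h a0 sin_gt_zero[of "2 * h"] by (simp add: m_def h_def \<beta>_def)
 let ?T1 = "linepath (x + \<alpha>) x +++ linepath x (x + m) +++ linepath (x + m) (x + \<alpha>)"
 let ?T2 = "linepath x (x + \<beta>) +++ linepath (x + \<beta>) (x + m) +++ linepath (x + m) x"
 have diff: "winding_number A z - winding_number A2 z = winding_number ?T1 z + winding_number ?T2 z"
  if "z \<notin> path_image A" "z \<notin> path_image A2" "z \<notin> closed_segment x (x + m)" for z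
 proof -
  have n: "z \<notin> closed_segment (x + \<alpha>) x" "z \<notin> closed_segment x (x + \<beta>)" "z \<notin> closed_segment (x + \<alpha>) (x + m)"
   "z \<notin> closed_segment (x + m) (x + \<beta>)" using that by (auto simp: A_def A2_def path_image_join)
  have n': "z \<notin> closed_segment (x + m) (x + \<alpha>)" "z \<notin> closed_segment (x + \<beta>) (x + m)" "z \<notin> closed_segment (x + m) x"
   using n that(3) by (simp_all add: closed_segment_commute)
  have r: "winding_number (linepath b a) z = - winding_number (linepath a b) z" if "z \<notin> closed_segment a b" for a b
   using winding_number_reversepath[of "linepath a b" z] that by simp
  show ?thesis
   using n n' that(3) r[OF n(3)] r[OF n(4)] r[OF that(3)]
   by (simp add: A_def A2_def winding_number_join path_image_join)
 qed
 have nm: "zR \<notin> closed_segment x (x + m)" "zL \<notin> closed_segment x (x + m)"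
 proof -
  have cz: "cross m (z - x) = 0" if z: "z \<in> closed_segment x (x + m)" for z
  proof -
   obtain q where "z = (1 - q) *\<^sub>R x + q *\<^sub>R (x + m)" using z by (auto simp: in_segment)
   hence "z - x = of_real q * m" by (simp add: scaleR_conv_of_real algebra_simps)
   thus ?thesis by (simp add: cross_scale)
  qed
  have "cross m (zR - x) \<noteq> 0" unfolding cR cross_scale using cam cross_commute[of \<alpha> m] by (simp add: cross_add)
  thus "zR \<notin> closed_segment x (x + m)" using cz by blast
  show "zL \<notin> closed_segment x (x + m)"
  proof
   assume "zL \<in> closed_segment x (x + m)"
   then obtain q where q: "0 \<le> q" "zL = (1 - q) *\<^sub>R x + q *\<^sub>R (x + m)" by (auto simp: in_segment)
   hence "x - of_real s * m = x + of_real q * m" by (simp add: zL scaleR_conv_of_real algebra_simps)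
   hence "of_real s * m + of_real q * m = 0" by (metis add.commute add_diff_cancel_left' diff_add_cancel diff_diff_eq2 eq_iff_diff_eq_0 minus_diff_eq)
   hence "of_real (s + q) * m = 0" by (simp only: of_real_add distrib_right)
   moreover have "m \<noteq> 0" using a0 by (simp add: m_def)
   ultimately have "complex_of_real (s + q) = 0" by simp
   hence "s + q = 0" by (simp only: of_real_eq_0_iff)
   thus False using s q by simp
  qed
 qed
 \<comment> \<open>The triangle runs from \<open>x + \<alpha>\<close> over \<open>x\<close> to
   \<open>x + m\<close>, that is clockwise, hence the value -1.\<close>
 have T1R: "winding_number ?T1 zR = -1"
 proof -
  have nc: "\<not> collinear {x + \<alpha>, x, x + m}"
  proof
   assume "collinear {x + \<alpha>, x, x + m}"
   hence "collinear {0, \<alpha>, m}" using collinear_3[of "x + \<alpha>" x "x + m"] by simp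
   hence "\<alpha> = 0 \<or> m = 0 \<or> (\<exists>q. m = q *\<^sub>R \<alpha>)" unfolding collinear_lemma .
   moreover have "m \<noteq> 0" using a0 by (simp add: m_def)
   ultimately obtain q where "m = q *\<^sub>R \<alpha>" using a0 by blast
   thus False using cam a0 by (auto simp: scaleR_conv_of_real cross_scale)
  qed
  have "zR \<in> interior (convex hull {x + \<alpha>, x, x + m})"
   unfolding interior_convex_hull_3_minimal[OF nc DIM_complex] mem_Collect_eq
  proof (intro exI conjI)
   have "zR = x + of_real (1 / 4) * (\<alpha> + m)" using cR by (metis add.commute diff_add_cancel)
   thus "(1 / 4) *\<^sub>R (x + \<alpha>) + (1 / 2) *\<^sub>R x + (1 / 4) *\<^sub>R (x + m) = zR"
    by (auto simp: complex_eq_iff field_simps)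
  qed auto
  moreover have "Im ((x - (x + \<alpha>)) * cnj (x - zR)) < 0"
  proof -
   have "Im ((x - (x + \<alpha>)) * cnj (x - zR)) = - cross \<alpha> (zR - x)" by (simp add: cross_def algebra_simps)
   also have "\<dots> < 0" unfolding cR cross_scale using cam by (simp add: cross_add)
   finally show ?thesis .
  qed
  ultimately show ?thesis using winding_number_triangle[of zR "x + \<alpha>" x "x + m"] by auto
 qed
 have T2: "winding_number ?T2 z = 0" if "z \<notin> convex hull {x, x + \<beta>, x + m}" for z
 proof (rule winding_number_zero_outside[OF _ convex_convex_hull _ that])
  have i: "{x, x + \<beta>, x + m} \<subseteq> convex hull {x, x + \<beta>, x + m}" by (rule hull_subset)
  thus "path_image ?T2 \<subseteq> convex hull {x, x + \<beta>, x + m}"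
   by (auto simp: path_image_join closed_segment_subset)
 qed auto
 have T1: "winding_number ?T1 z = 0" if "z \<notin> convex hull {x + \<alpha>, x, x + m}" for z
 proof (rule winding_number_zero_outside[OF _ convex_convex_hull _ that])
  have i: "{x + \<alpha>, x, x + m} \<subseteq> convex hull {x + \<alpha>, x, x + m}" by (rule hull_subset)
  thus "path_image ?T1 \<subseteq> convex hull {x + \<alpha>, x, x + m}"
   by (auto simp: path_image_join closed_segment_subset)
 qed auto
 have T2R: "winding_number ?T2 zR = 0"
 proof (rule T2, rule convex_hull_3_cross[of m _ x])
  show "cross m (zR - x) < 0" unfolding cR cross_scale using cam cross_commute[of \<alpha> m] by (simp add: cross_add)
 qed (use cmb in auto)
 have T1L: "winding_number ?T1 zL = 0"
 proof (rule T1, rule convex_hull_3_cross[of \<alpha> _ x])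
  show "cross \<alpha> (zL - x) < 0" using cam s by (simp add: zL cross_scale)
 qed (use cam in auto)
 have T2L: "winding_number ?T2 zL = 0"
 proof (rule T2, rule convex_hull_3_cross[of "- \<beta>" _ x])
  show "cross (- \<beta>) (zL - x) < 0" using cmb s cross_commute[of m \<beta>] by (simp add: zL cross_scale mult_pos_neg)
 qed (use cmb cross_commute[of m \<beta>] in auto)
 have split: "winding_number \<gamma> z = winding_number A z + winding_number P z"
   "winding_number (A2 +++ P) z = winding_number A2 z + winding_number P z"
  if "z \<notin> path_image A" "z \<notin> path_image A2" "z \<notin> path_image P" for z
  unfolding g using that P pA pA2 by (auto simp: winding_number_join)
 have LR: "winding_number \<gamma> zR = winding_number \<gamma> zL - 1"
  using split[OF nA(1) nA2(1) nP(1)] split[OF nA(2) nA2(2) nP(2)] zz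
   diff[OF nA(1) nA2(1) nm(1)] diff[OF nA(2) nA2(2) nm(2)] T1R T2R T1L T2L by (simp add: algebra_simps)
 have R: "x + of_real s' * cis \<phi> * \<alpha> \<notin> path_image \<gamma> \<and> winding_number \<gamma> (x + of_real s' * cis \<phi> * \<alpha>) = winding_number \<gamma> zL - 1"
  if "0 < s'" "s' < 1" "0 < \<phi>" "\<phi> < \<Theta>" for s' \<phi>
  using insec[of s' \<phi>] const[of s' s 0 \<phi> \<Theta> h] s that T h LR unfolding zR_def by (auto simp: h_def)
 have L: "x + of_real s' * cis \<phi> * \<alpha> \<notin> path_image \<gamma> \<and> winding_number \<gamma> (x + of_real s' * cis \<phi> * \<alpha>) = winding_number \<gamma> zL"
  if "0 < s'" "s' < 1" "\<Theta> < \<phi>" "\<phi> < 2 * pi" for s' \<phi>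
  using insec[of s' \<phi>] const[of s' s \<Theta> \<phi> "2 * pi" "\<Theta> / 2 + pi"] s that T unfolding zL_def by auto
 show thesis by (rule that[of "winding_number \<gamma> zL"]) (use R L in blast)+
qed

section \<open>Last exits from small discs and sides of a simple closed curve\<close>

definition exit_time :: "(real \<Rightarrow> complex) \<Rightarrow> real \<Rightarrow> real" where
 "exit_time c r = Sup {t \<in> {0..1}. dist (c 0) (c t) \<le> r}"

lemma last_exit_time: "last_exit c r = c (exit_time c r)"
 by (simp add: last_exit_def exit_time_def)

lemma exit_time:
 assumes c: "path c" and r: "0 < r" "r < dist (c 0) (c 1)"
 shows "0 < exit_time c r" "exit_time c r < 1" "dist (c 0) (c (exit_time c r)) = r"
  "\<And>t. exit_time c r < t \<Longrightarrow> t \<le> 1 \<Longrightarrow> r < dist (c 0) (c t)"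
proof -
 let ?S = "{t \<in> {0..1}. dist (c 0) (c t) \<le> r}"
 let ?T = "exit_time c r"
 have cc: "continuous_on {0..1} c" using c by (simp add: path_def)
 hence cd: "continuous_on {0..1} (\<lambda>t. dist (c 0) (c t))" by (intro continuous_intros)
 have "{0..1} \<inter> (\<lambda>t. dist (c 0) (c t)) -` {..r} = ?S" by auto
 hence S: "closed ?S"
  using continuous_closed_preimage[OF cd closed_atLeastAtMost closed_atMost[of r]] by metis
 have b: "bdd_above ?S" by (intro bdd_aboveI[of _ 1]) auto
 have ne: "?S \<noteq> {}" using r by (auto intro!: exI[of _ 0])
 have TS: "?T \<in> ?S" unfolding exit_time_def by (rule closed_contains_Sup[OF ne b S])
 show gt: "r < dist (c 0) (c t)" if "?T < t" "t \<le> 1" for t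
 proof (rule ccontr)
  assume "\<not> ?thesis"
  hence "t \<in> ?S" using that TS by auto
  hence "t \<le> ?T" unfolding exit_time_def by (rule cSup_upper[OF _ b])
  thus False using that by simp
 qed
 show T1: "?T < 1" using TS r by (cases "?T = 1") auto
 show eq: "dist (c 0) (c ?T) = r"
 proof (rule ccontr)
  assume "dist (c 0) (c ?T) \<noteq> r"
  hence lt: "dist (c 0) (c ?T) < r" using TS by auto
  obtain t where t: "?T \<le> t" "t \<le> 1" "dist (c 0) (c t) = r"
   using IVT'[of "\<lambda>t. dist (c 0) (c t)" ?T r 1] lt r T1 TS continuous_on_subset[OF cd, of "{?T..1}"] by auto
  thus False using gt[of t] lt by (cases "t = ?T") auto
 qed
 show "0 < ?T" using TS eq r by (cases "?T = 0") auto
qed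

text \<open>From time \<open>\<tau>\<close> on, an arc keeps a positive distance from its start, so
  it has left all smaller discs for good by then.\<close>

lemma exit_time_small:
 assumes c: "arc c" and \<tau>: "0 < \<tau>"
 shows "\<forall>\<^sub>F r in at_right 0. 0 < r \<and> r < dist (c 0) (c 1) \<and> exit_time c r < \<tau>"
proof (cases "\<tau> \<le> 1")
 case True
 have pc: "path c" and inj: "inj_on c {0..1}" using c by (auto simp: arc_def)
 have "continuous_on {\<tau>..1} c" using pc \<tau> by (auto simp: path_def intro: continuous_on_subset)
 hence k: "compact (c ` {\<tau>..1})" by (intro compact_continuous_image) auto
 have c0: "c 0 \<notin> c ` {\<tau>..1}"
 proof
  assume "c 0 \<in> c ` {\<tau>..1}"
  then obtain t where "t \<in> {\<tau>..1}" "c 0 = c t" by auto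
  thus False using inj_onD[OF inj, of 0 t] \<tau> by auto
 qed
 then obtain m where m: "0 < m" "\<And>z. z \<in> c ` {\<tau>..1} \<Longrightarrow> m \<le> dist (c 0) z"
  using separate_point_closed[OF compact_imp_closed[OF k] c0] by metis
 have "\<forall>\<^sub>F r in at_right 0. 0 < r \<and> r < m" using m by (auto simp: eventually_at_right_field)
 thus ?thesis
 proof eventually_elim
  case (elim r)
  have r1: "r < dist (c 0) (c 1)" using m(2)[of "c 1"] True elim by auto
  have "exit_time c r < \<tau>"
  proof (rule ccontr)
   assume "\<not> ?thesis"
   hence "c (exit_time c r) \<in> c ` {\<tau>..1}" using exit_time(2)[OF pc _ r1] elim by auto
   from m(2)[OF this] show False using exit_time(3)[OF pc _ r1] elim by simp
  qed
  thus ?case using elim r1 by simp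
 qed
next
 case False
 have "c 0 \<noteq> c 1" using c inj_onD[of c "{0..1}" 0 1] by (auto simp: arc_def)
 hence "0 < dist (c 0) (c 1)" by simp
 hence "\<forall>\<^sub>F r in at_right 0. 0 < r \<and> r < dist (c 0) (c 1)" unfolding eventually_at_right_field by blast
 thus ?thesis
 proof eventually_elim
  case (elim r)
  thus ?case using exit_time(2)[of c r] c False by (auto simp: arc_def)
 qed
qed

lemma arc_near_start: assumes "arc c" "0 < e" obtains \<tau> where "0 < \<tau>" "\<tau> \<le> 1" "c ` {0..\<tau>} \<subseteq> ball (c 0) e"
proof -
 have "continuous_on {0..1} c" using assms by (simp add: arc_def path_def)
 then obtain d where d: "0 < d" "\<And>t. t \<in> {0..1} \<Longrightarrow> dist t 0 < d \<Longrightarrow> dist (c t) (c 0) < e"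
  unfolding continuous_on_iff using assms(2) by (metis atLeastAtMost_iff order_refl zero_le_one)
 show thesis
 proof (rule that[of "min 1 (d / 2)"])
  show "c ` {0..min 1 (d / 2)} \<subseteq> ball (c 0) e" using d by (auto simp: dist_commute)
 qed (use d in auto)
qed

text \<open>Replacing the beginning of an arc by a radius does not change its winding number about a point
 outside a disc that contains both.\<close>

lemma winding_radius:
 assumes c: "arc c" and T: "0 \<le> T" "T < 1" and near: "c ` {0..T} \<subseteq> ball (c 0) e" and z: "e \<le> dist (c 0) z" "z \<notin> path_image c"
 shows "winding_number c z = winding_number (linepath (c 0) (c T)) z + winding_number (subpath T 1 c) z"
proof -
 have pc: "path c" using c by (simp add: arc_def)
 have nT: "c T \<in> ball (c 0) e" by (rule subsetD[OF near imageI]) (use T in auto)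
 have e: "0 < e" using nT by (auto intro: le_less_trans[OF zero_le_dist])
 have seg: "closed_segment (c 0) (c T) \<subseteq> ball (c 0) e" using nT e by (intro closed_segment_subset convex_ball) auto
 have zb: "z \<notin> ball (c 0) e" using z by simp
 have p0: "path (subpath 0 T c)" using pc T by (intro path_subpath) auto
 have i0: "path_image (subpath 0 T c) \<subseteq> ball (c 0) e" using near T by (simp add: path_image_subpath)
 have "winding_number (subpath 0 T c +++ linepath (c T) (c 0)) z = 0"
  by (rule winding_number_zero_outside[OF _ convex_ball _ zb])
   (use p0 i0 seg in \<open>auto simp: path_image_join closed_segment_commute\<close>)
 moreover have "winding_number (subpath 0 T c +++ linepath (c T) (c 0)) z =
   winding_number (subpath 0 T c) z + winding_number (linepath (c T) (c 0)) z"
 proof (rule winding_number_join)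
  show "z \<notin> path_image (linepath (c T) (c 0))" using seg zb unfolding path_image_linepath closed_segment_commute[of "c T" "c 0"] by blast
 qed (use p0 i0 zb in auto)
 moreover have "winding_number (linepath (c T) (c 0)) z = - winding_number (linepath (c 0) (c T)) z"
 proof -
  have "z \<notin> path_image (linepath (c 0) (c T))" using seg zb by auto
  thus ?thesis using winding_number_reversepath[of "linepath (c 0) (c T)" z] by simp
 qed
 moreover have "winding_number (subpath 0 T c) z + winding_number (subpath T 1 c) z = winding_number (subpath 0 1 c) z"
  by (rule winding_number_subpath_combine) (use pc z T in auto)
 ultimately show ?thesis by simp
qed

text \<open>For a simple closed curve, its winding number about the points on its right.\<close>

definition right_winding :: "(real \<Rightarrow> complex) \<Rightarrow> complex" where
 "right_winding \<gamma> = (if \<exists>z. z \<notin> path_image \<gamma> \<and> winding_number \<gamma> z = 1 then 0 else -1)"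

lemma loop_values:
 assumes "simple_path \<gamma>" "pathfinish \<gamma> = pathstart \<gamma>" "z0 \<notin> path_image \<gamma>" "winding_number \<gamma> z0 \<noteq> 0" "z \<notin> path_image \<gamma>"
 shows "winding_number \<gamma> z = 0 \<or> winding_number \<gamma> z = winding_number \<gamma> z0"
proof -
 have o: "winding_number \<gamma> z = 0" if "z \<in> outside (path_image \<gamma>)" for z
  using winding_number_zero_in_outside[OF simple_path_imp_path[OF assms(1)] assms(2) that] .
 have io: "z \<in> inside (path_image \<gamma>) \<or> z \<in> outside (path_image \<gamma>)" if "z \<notin> path_image \<gamma>" for z
  using that inside_Un_outside[of "path_image \<gamma>"] by blast
 have z0: "z0 \<in> inside (path_image \<gamma>)" using io[OF assms(3)] o assms(4) by blast
 show ?thesis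
  using io[OF assms(5)] o z0 by (cases rule: simple_closed_path_winding_number_inside[OF assms(1)]) auto
qed

text \<open>A counter-clockwise curve has its inside, with value 1, on the left; a clockwise curve
  has its inside, with value -1, on the right. In both cases the value on the left is the one on the
  right plus 1.\<close>

lemma right_winding_eq:
 assumes "simple_path \<gamma>" "pathfinish \<gamma> = pathstart \<gamma>" "z0 \<notin> path_image \<gamma>" "winding_number \<gamma> z0 \<noteq> 0"
 shows "winding_number \<gamma> z0 = 1 \<and> right_winding \<gamma> = 0 \<or> winding_number \<gamma> z0 = -1 \<and> right_winding \<gamma> = -1"
proof -
 have z0: "z0 \<in> inside (path_image \<gamma>)"
  using winding_number_zero_in_outside[OF simple_path_imp_path[OF assms(1)] assms(2), of z0] assms(3,4)
   inside_Un_outside[of "path_image \<gamma>"] by blast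
 show ?thesis
 proof (cases rule: simple_closed_path_winding_number_inside[OF assms(1)])
  case 1 thus ?thesis using z0 assms(3) by (auto simp: right_winding_def)
 next
  case 2
  hence "winding_number \<gamma> z0 = -1" using z0 by blast
  moreover have "winding_number \<gamma> z \<noteq> 1" if "z \<notin> path_image \<gamma>" for z
   using loop_values[OF assms that] \<open>winding_number \<gamma> z0 = -1\<close> by auto
  ultimately show ?thesis by (auto simp: right_winding_def)
 qed
qed

text \<open>Replacing the initial arcs by radii changes no winding number away from a small disc. So
  a point \<open>z0\<close> inside the curve determines the two values that
  \<open>sector_winding\<close> leaves open, and \<open>q\<close> leads from its midpoint into one
  of the two sectors without meeting the changed curve.\<close>

theorem local_side:
 assumes arcs: "arc c1" "arc c2" "arc Q" "arc q"
  and x: "c1 0 = x" "c2 0 = x" "q 0 = x"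
  and Q: "pathfinish c1 = pathstart Q" "pathfinish Q = pathfinish c2"
  and m12: "path_image c1 \<inter> path_image c2 = {x}"
  and m1Q: "path_image c1 \<inter> path_image Q = {pathfinish c1}"
  and m2Q: "path_image c2 \<inter> path_image Q = {pathfinish c2}"
  and mq: "path_image q \<inter> (path_image c1 \<union> path_image c2 \<union> path_image Q) \<subseteq> {x, q 1}"
 defines "\<gamma> \<equiv> c1 +++ (Q +++ reversepath c2)"
 shows "\<forall>\<^sub>F r in at_right 0. winding_number \<gamma> (q (1/2)) =
  (if ccw_angle (last_exit c2 r - x) (last_exit q r - x) < ccw_angle (last_exit c2 r - x) (last_exit c1 r - x)
   then right_winding \<gamma> else right_winding \<gamma> + 1)"
proof -
 have P: "path c1" "path c2" "path Q" "path q" using arcs by (auto simp: arc_def)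
 have inj: "inj_on c1 {0..1}" "inj_on c2 {0..1}" "inj_on q {0..1}" using arcs by (auto simp: arc_def)
 have ig: "path_image \<gamma> = path_image c1 \<union> path_image c2 \<union> path_image Q"
  using Q by (auto simp: \<gamma>_def path_image_join)
 have sg: "simple_path \<gamma>"
  unfolding \<gamma>_def
 proof (rule simple_path_join_loop)
  show "arc (Q +++ reversepath c2)" by (rule arc_join) (use arcs Q m2Q in \<open>auto simp: arc_reversepath\<close>)
  have "pathstart c1 = x" "pathstart (Q +++ reversepath c2) = pathfinish c1" using x Q by (simp_all add: pathstart_def[of c1])
  moreover have "path_image (Q +++ reversepath c2) = path_image Q \<union> path_image c2" using Q by (simp add: path_image_join)
  ultimately show "path_image c1 \<inter> path_image (Q +++ reversepath c2) \<subseteq> {pathstart c1, pathstart (Q +++ reversepath c2)}"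
   using m12 m1Q by auto
  show "pathfinish (Q +++ reversepath c2) = pathstart c1" using x by (simp add: pathstart_def)
 qed (use arcs Q in auto)
 have lg: "pathfinish \<gamma> = pathstart \<gamma>" using x unfolding \<gamma>_def by (simp add: pathstart_def[of c2]) (simp add: pathstart_def)
 define z1 where "z1 = q (1/2)"
 have z1q: "z1 \<in> path_image q" by (auto simp: z1_def path_image_def)
 have z1x: "z1 \<noteq> x" "z1 \<noteq> q 1" using inj(3) x(3) unfolding z1_def inj_on_def by (fastforce)+
 hence z1g: "z1 \<notin> path_image \<gamma>" using mq z1q unfolding ig by blast
 \<comment> \<open>The orientation of the curve is unknown. A point inside it, kept away from the
   disc around \<open>x\<close>, serves to transfer it to the curve with radii.\<close>
 obtain z0 where z0: "z0 \<in> inside (path_image \<gamma>)" using Jordan_inside_outside[OF sg lg] by blast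
 hence z0g: "z0 \<notin> path_image \<gamma>" using inside_no_overlap by blast
 have w0: "winding_number \<gamma> z0 \<noteq> 0"
  by (rule simple_closed_path_winding_number_inside[OF sg]) (use z0 in auto)
 have "x \<in> path_image c1" using x(1) unfolding path_image_def by force
 hence z0x: "z0 \<noteq> x" using z0g unfolding ig by blast
 define e where "e = min (dist x z0) (dist x z1)"
 have e: "0 < e" "e \<le> dist x z0" "e \<le> dist x z1" using z0x z1x by (auto simp: e_def)
 obtain \<tau>1 where t1: "0 < \<tau>1" "\<tau>1 \<le> 1" "c1 ` {0..\<tau>1} \<subseteq> ball x e" using arc_near_start[OF arcs(1) e(1)] x by metis
 obtain \<tau>2 where t2: "0 < \<tau>2" "\<tau>2 \<le> 1" "c2 ` {0..\<tau>2} \<subseteq> ball x e" using arc_near_start[OF arcs(2) e(1)] x by metis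
 have xQ: "x \<notin> path_image Q"
 proof
  assume "x \<in> path_image Q"
  moreover have "x \<in> path_image c1" using x by (force simp: path_image_def)
  ultimately have "x = c1 1" using m1Q by (auto simp: pathfinish_def)
  thus False using inj(1) x(1) unfolding inj_on_def by force
 qed
 obtain mQ where mQ: "0 < mQ" "\<And>z. z \<in> path_image Q \<Longrightarrow> mQ \<le> dist x z"
  using separate_point_closed[OF closed_path_image[OF P(3)] xQ] by blast
 have "\<forall>\<^sub>F r in at_right 0. 0 < r \<and> r < mQ" using mQ by (auto simp: eventually_at_right_field)
 thus ?thesis
  using exit_time_small[OF arcs(1) t1(1)] exit_time_small[OF arcs(2) t2(1)] exit_time_small[OF arcs(4), of "1/2", simplified]
 proof eventually_elim
  case (elim r)
  define T1 where "T1 = exit_time c1 r"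
  define T2 where "T2 = exit_time c2 r"
  define T3 where "T3 = exit_time q r"
  have r: "0 < r" "r < mQ" using elim by auto
  note E1 = exit_time[OF P(1) r(1), folded T1_def, unfolded x]
  note E2 = exit_time[OF P(2) r(1), folded T2_def, unfolded x]
  note E3 = exit_time[OF P(4) r(1), folded T3_def, unfolded x]
  have h: "r < dist x (c1 1)" "r < dist x (c2 1)" "r < dist x (q 1)" using elim x by auto
  note E1 = E1[OF h(1)] and E2 = E2[OF h(2)] and E3 = E3[OF h(3)]
  have small: "T1 < \<tau>1" "T2 < \<tau>2" "T3 < 1/2" using elim by (auto simp: T1_def T2_def T3_def)
  define \<alpha> where "\<alpha> = c2 T2 - x"
  define \<beta> where "\<beta> = c1 T1 - x"
  define \<kappa> where "\<kappa> = q T3 - x"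
  have n: "cmod \<alpha> = r" "cmod \<beta> = r" "cmod \<kappa> = r"
   using E1(3) E2(3) E3(3) unfolding \<alpha>_def \<beta>_def \<kappa>_def by (simp_all only: dist_norm norm_minus_commute)
  have nz: "\<alpha> \<noteq> 0" "\<beta> \<noteq> 0" "\<kappa> \<noteq> 0" using n r by auto
  have im: "c1 T1 \<in> path_image c1" "c2 T2 \<in> path_image c2" "q T3 \<in> path_image q"
   using E1 E2 E3 by (auto simp: path_image_def)
  have ab: "\<alpha> \<noteq> \<beta>" 
  proof
   assume "\<alpha> = \<beta>"
   hence e: "c2 T2 = c1 T1" by (simp add: \<alpha>_def \<beta>_def)
   have "c1 T1 \<in> path_image c1 \<inter> path_image c2" using im(1) im(2)[unfolded e] by blast
   thus False using m12 nz by (simp add: \<beta>_def)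
  qed
  have q3: "q T3 \<noteq> q 1" using inj_onD[OF inj(3), of T3 1] E3(1,2) by auto
  have ak: "\<alpha> \<noteq> \<kappa>" 
  proof
   assume "\<alpha> = \<kappa>"
   hence e: "c2 T2 = q T3" by (simp add: \<alpha>_def \<kappa>_def)
   hence "q T3 \<in> {x, q 1}" using mq im(2,3) by auto
   thus False using q3 nz by (simp add: \<kappa>_def)
  qed
  have bk: "\<beta> \<noteq> \<kappa>" 
  proof
   assume "\<beta> = \<kappa>"
   hence e: "c1 T1 = q T3" by (simp add: \<beta>_def \<kappa>_def)
   hence "q T3 \<in> {x, q 1}" using mq im(1,3) by auto
   thus False using q3 nz by (simp add: \<kappa>_def)
  qed
  define \<Theta> where "\<Theta> = Arg2pi (\<beta> / \<alpha>)"
  define \<psi> where "\<psi> = Arg2pi (\<kappa> / \<alpha>)"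
  have pol: "y = cis (Arg2pi (y / \<alpha>)) * \<alpha>" if "cmod y = r" for y
   using Arg2pi_polar[OF nz(1), of y] that n r by simp
  have bT: "\<beta> = cis \<Theta> * \<alpha>" and kT: "\<kappa> = cis \<psi> * \<alpha>" using pol n unfolding \<Theta>_def \<psi>_def by blast+
  have T: "0 \<le> \<Theta>" "\<Theta> < 2 * pi" "0 \<le> \<psi>" "\<psi> < 2 * pi" unfolding \<Theta>_def \<psi>_def by (simp_all add: Arg2pi_ge_0 Arg2pi_lt_2pi)
  have "\<Theta> \<noteq> 0" "\<psi> \<noteq> 0" "\<Theta> \<noteq> \<psi>" using ab ak bk bT kT by auto
  hence T': "0 < \<Theta>" "0 < \<psi>" using T by auto
  have ang: "ccw_angle \<alpha> \<beta> = \<Theta>" "ccw_angle \<alpha> \<kappa> = \<psi>" using T' by (auto simp: ccw_angle_def \<Theta>_def \<psi>_def)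
  define s1 where "s1 = subpath T1 1 c1"
  define s2 where "s2 = subpath T2 1 c2"
  have as: "arc s1" "arc s2" unfolding s1_def s2_def using arcs E1 E2 by (auto intro!: arc_subpath_arc)
  have se: "pathstart s1 = x + \<beta>" "pathfinish s1 = pathfinish c1" "pathstart s2 = x + \<alpha>" "pathfinish s2 = pathfinish c2"
   by (auto simp: s1_def s2_def \<alpha>_def \<beta>_def pathstart_def pathfinish_def subpath_def)
  have is1: "path_image s1 = c1 ` {T1..1}" and is2: "path_image s2 = c2 ` {T2..1}"
   using E1 E2 by (auto simp: s1_def s2_def path_image_subpath)
  have sub: "path_image s1 \<subseteq> path_image c1" "path_image s2 \<subseteq> path_image c2"
   unfolding is1 is2 unfolding path_image_def by (intro image_mono; use E1(1) E2(1) in auto)+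
  define R where "R = s1 +++ (Q +++ reversepath s2)"
  have xs: "x \<notin> path_image s1" "x \<notin> path_image s2"
  proof -
   show "x \<notin> path_image s1"
   proof
    assume "x \<in> path_image s1"
    then obtain t where "t \<in> {T1..1}" "c1 t = x" unfolding is1 by auto
    thus False using inj_onD[OF inj(1), of t 0] E1(1) x by auto
   qed
   show "x \<notin> path_image s2"
   proof
    assume "x \<in> path_image s2"
    then obtain t where "t \<in> {T2..1}" "c2 t = x" unfolding is2 by auto
    thus False using inj_onD[OF inj(2), of t 0] E2(1) x by auto
   qed
  qed
  have aQ: "arc (Q +++ reversepath s2)"
   by (rule arc_join) (use arcs as Q se m2Q sub in \<open>auto simp: arc_reversepath\<close>)
  have aR: "arc R"
   unfolding R_def
  proof (rule arc_join[OF as(1) aQ])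
   show "path_image s1 \<inter> path_image (Q +++ reversepath s2) \<subseteq> {pathstart (Q +++ reversepath s2)}"
    using m12 m1Q sub xs Q se by (auto simp: path_image_join)
  qed (use se Q in auto)
  have Rends: "pathstart R = x + cis \<Theta> * \<alpha>" "pathfinish R = x + \<alpha>" using se bT by (auto simp: R_def)
  have iR: "path_image R = path_image s1 \<union> path_image Q \<union> path_image s2"
   using se Q by (auto simp: R_def path_image_join)
  have far1: "z = x + \<beta> \<or> r < dist x z" if "z \<in> path_image s1" for z
   using that E1(4) unfolding is1 \<beta>_def by force
  have far2: "z = x + \<alpha> \<or> r < dist x z" if "z \<in> path_image s2" for z
   using that E2(4) unfolding is2 \<alpha>_def by force
  have Rball: "path_image R \<inter> cball x (cmod \<alpha>) \<subseteq> {x + cis \<Theta> * \<alpha>, x + \<alpha>}"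
   using far1 far2 mQ(2) r unfolding iR n bT[symmetric] by fastforce
  define \<gamma>' where "\<gamma>' = (linepath (x + \<alpha>) x +++ linepath x (x + cis \<Theta> * \<alpha>)) +++ R"
  have ig': "path_image \<gamma>' = closed_segment (x + \<alpha>) x \<union> closed_segment x (x + \<beta>) \<union> path_image R"
   using Rends unfolding \<gamma>'_def bT by (simp add: path_image_join)
  obtain k where
   kR': "\<forall>s \<phi>. 0 < s \<longrightarrow> s < 1 \<longrightarrow> 0 < \<phi> \<longrightarrow> \<phi> < \<Theta> \<longrightarrow> x + of_real s * cis \<phi> * \<alpha> \<notin> path_image \<gamma>' \<and>
     winding_number \<gamma>' (x + of_real s * cis \<phi> * \<alpha>) = k - 1" and
   kL': "\<forall>s \<phi>. 0 < s \<longrightarrow> s < 1 \<longrightarrow> \<Theta> < \<phi> \<longrightarrow> \<phi> < 2 * pi \<longrightarrow> x + of_real s * cis \<phi> * \<alpha> \<notin> path_image \<gamma>' \<and>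
     winding_number \<gamma>' (x + of_real s * cis \<phi> * \<alpha>) = k"
   by (rule sector_winding[OF nz(1) T'(1) T(2) arc_imp_path[OF aR] Rends Rball, folded \<gamma>'_def])
  note kR = kR'[rule_format] and kL = kL'[rule_format]
  \<comment> \<open>Beyond distance \<open>e\<close> each initial arc and its radius contribute the
    same by \<open>winding_radius\<close>, and the remaining pieces are common to both
    curves.\<close>
  have same: "winding_number \<gamma> z = winding_number \<gamma>' z \<and> z \<notin> path_image \<gamma>'" if z: "e \<le> dist x z" "z \<notin> path_image \<gamma>" for z
  proof -
   have nc: "z \<notin> path_image c1" "z \<notin> path_image c2" "z \<notin> path_image Q" using z ig by auto
   have n1: "c1 ` {0..T1} \<subseteq> ball (c1 0) e" "c2 ` {0..T2} \<subseteq> ball (c2 0) e"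
    using small t1(3) t2(3) unfolding x by fastforce+
   have w1: "winding_number c1 z = winding_number (linepath x (x + \<beta>)) z + winding_number s1 z"
    using winding_radius[OF arcs(1) _ E1(2) n1(1)] E1(1) z nc x by (simp add: s1_def \<beta>_def)
   have w2: "winding_number c2 z = winding_number (linepath x (x + \<alpha>)) z + winding_number s2 z"
    using winding_radius[OF arcs(2) _ E2(2) n1(2)] E2(1) z nc x by (simp add: s2_def \<alpha>_def)
   have re: "r < e"
    using n1(1) E1 x by (auto simp: subset_iff)
   have ns: "z \<notin> closed_segment x (x + \<alpha>)" "z \<notin> closed_segment x (x + \<beta>)"
   proof -
    have "closed_segment x (x + \<alpha>) \<subseteq> ball x e" "closed_segment x (x + \<beta>) \<subseteq> ball x e"
     by (rule closed_segment_subset[OF _ _ convex_ball]; use re e(1) n in \<open>simp add: dist_norm\<close>)+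
    thus "z \<notin> closed_segment x (x + \<alpha>)" "z \<notin> closed_segment x (x + \<beta>)" using z by auto
   qed
   have ns': "z \<notin> closed_segment (x + \<alpha>) x" using ns(1) by (metis closed_segment_commute)
   have nR: "z \<notin> path_image s1" "z \<notin> path_image s2" "z \<notin> path_image R" using sub nc iR by auto
   have ps: "path s1" "path s2" "path R" using as aR by (auto simp: arc_def)
   have wr: "winding_number (linepath (x + \<alpha>) x) z = - winding_number (linepath x (x + \<alpha>)) z"
    using winding_number_reversepath[of "linepath x (x + \<alpha>)" z] ns by simp
   have wR: "winding_number R z = winding_number s1 z + (winding_number Q z - winding_number s2 z)"
    unfolding R_def using ps P nR nc Q se by (simp add: winding_number_join winding_number_reversepath path_image_join)
   have "winding_number \<gamma> z = winding_number c1 z + (winding_number Q z - winding_number c2 z)"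
    unfolding \<gamma>_def using P nc Q by (simp add: winding_number_join winding_number_reversepath path_image_join)
   moreover have "winding_number \<gamma>' z = winding_number (linepath (x + \<alpha>) x) z + winding_number (linepath x (x + \<beta>)) z + winding_number R z"
    unfolding \<gamma>'_def bT[symmetric] using ps nR ns ns' Rends bT
    by (simp add: winding_number_join path_image_join)
   moreover have "z \<notin> path_image \<gamma>'" unfolding ig' using nR ns closed_segment_commute by blast
   ultimately show ?thesis using w1 w2 wR wr by simp
  qed
  have lg': "pathfinish \<gamma>' = pathstart \<gamma>'" using Rends by (simp add: \<gamma>'_def)
  have sg': "simple_path \<gamma>'"
   unfolding \<gamma>'_def
  proof (rule simple_path_join_loop[OF _ aR])
   have sd: "\<not> same_dir \<alpha> \<beta>" using T' by (simp add: same_dir_def \<Theta>_def)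
   have "closed_segment x (x + \<alpha>) \<inter> closed_segment x (x + \<beta>) = {x}"
    using segments_same_start[of "x + \<alpha>" x "x + \<beta>"] nz sd by simp
   thus "arc (linepath (x + \<alpha>) x +++ linepath x (x + cis \<Theta> * \<alpha>))"
    using nz bT by (intro arc_join) (auto simp: closed_segment_commute)
   have inball: "closed_segment x (x + \<alpha>) \<subseteq> cball x (cmod \<alpha>)" "closed_segment x (x + \<beta>) \<subseteq> cball x (cmod \<alpha>)"
    by (rule closed_segment_subset[OF _ _ convex_cball]; use n r(1) in \<open>simp add: dist_norm\<close>)+
   show "path_image (linepath (x + \<alpha>) x +++ linepath x (x + cis \<Theta> * \<alpha>)) \<inter> path_image R
     \<subseteq> {pathstart (linepath (x + \<alpha>) x +++ linepath x (x + cis \<Theta> * \<alpha>)), pathstart R}"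
    using inball Rball Rends bT by (auto simp: path_image_join closed_segment_commute)
  qed (use Rends in auto)
  have s0: "winding_number \<gamma>' z0 = winding_number \<gamma> z0" "z0 \<notin> path_image \<gamma>'" using same[OF e(2) z0g] by auto
  have w0': "winding_number \<gamma>' z0 \<noteq> 0" using s0 w0 by simp
  have v1: "k - 1 = 0 \<or> k - 1 = winding_number \<gamma> z0"
   using loop_values[OF sg' lg' s0(2) w0', of "x + of_real (1/2) * cis (\<Theta> / 2) * \<alpha>"] kR[of "1/2" "\<Theta> / 2"] T' s0 by simp
  have v2: "k = 0 \<or> k = winding_number \<gamma> z0"
   using loop_values[OF sg' lg' s0(2) w0', of "x + of_real (1/2) * cis ((\<Theta> + 2 * pi) / 2) * \<alpha>"]
    kL[of "1/2" "(\<Theta> + 2 * pi) / 2"] T T' s0 by (simp add: field_simps)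
  \<comment> \<open>Both \<open>k - 1\<close> and \<open>k\<close> are among the two values 0 and
    that of \<open>z0\<close>, which is 1 or -1. This leaves only one possibility for
    \<open>k\<close>, in agreement with \<open>right_winding\<close>.\<close>
  have k: "k - 1 = right_winding \<gamma>" using right_winding_eq[OF sg lg z0g w0] v1 v2 by auto
  \<comment> \<open>A connected set from the midpoint of \<open>q\<close> back to its last exit from
    the circle and then along half of the radius there. After that exit \<open>q\<close> stays
    outside the circle, so it cannot meet the inserted radii.\<close>
  let ?S = "q ` {T3..1/2} \<union> closed_segment (x + of_real (1/2) * \<kappa>) (x + \<kappa>)"
  have "continuous_on {T3..1/2} q" using P(4) E3(1) by (auto simp: path_def intro: continuous_on_subset)
  hence c1: "connected (q ` {T3..1/2})" by (intro connected_continuous_image) auto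
  have cS: "connected ?S"
  proof (rule connected_Un[OF c1])
   have "x + \<kappa> \<in> q ` {T3..1/2}" using small by (auto simp: \<kappa>_def)
   thus "q ` {T3..1/2} \<inter> closed_segment (x + of_real (1/2) * \<kappa>) (x + \<kappa>) \<noteq> {}" by auto
  qed simp
  have dS: "?S \<inter> path_image \<gamma>' = {}"
  proof -
   have kin: "x + of_real t * \<kappa> \<notin> path_image \<gamma>'" if t: "0 < t" "t < 1" for t
   proof -
    have "x + of_real t * cis \<psi> * \<alpha> \<notin> path_image \<gamma>'"
     using kR[OF t, of \<psi>] kL[OF t, of \<psi>] T T' \<open>\<Theta> \<noteq> \<psi>\<close> by linarith
    thus ?thesis unfolding kT by (simp add: mult.assoc)
   qed
   have qin: "q t \<notin> path_image \<gamma>'" if t: "T3 \<le> t" "t \<le> 1/2" for t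
   proof
    assume a: "q t \<in> path_image \<gamma>'"
    have "q t \<noteq> x" using inj_onD[OF inj(3), of t 0] x(3) E3(1) t by auto
    moreover have "q t \<noteq> q 1" using inj_onD[OF inj(3), of t 1] E3(1) t by auto
    moreover have "q t \<in> path_image q" using t E3(1) by (auto simp: path_image_def)
    ultimately have "q t \<notin> path_image \<gamma>" using mq unfolding ig by blast
    hence "q t \<notin> path_image R" using sub unfolding ig iR by blast
    hence "q t \<in> closed_segment x (x + \<alpha>) \<union> closed_segment x (x + \<beta>)"
     using a unfolding ig' by (auto simp: closed_segment_commute)
    then obtain y l where yl: "y = \<alpha> \<or> y = \<beta>" "0 \<le> l" "l \<le> 1" "q t = x + of_real l * y"
     by (auto simp: in_segment scaleR_conv_of_real algebra_simps)
    have "r \<le> dist x (q t)" using E3(3) E3(4)[of t] t by (cases "t = T3") auto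
    also have "dist x (q t) = l * r" using yl n by (auto simp: dist_norm norm_mult)
    finally have l1: "l = 1" using yl r by auto
    hence "dist x (q t) = r" using yl n by (auto simp: dist_norm)
    hence "t = T3" using E3(4)[of t] t by (cases "t = T3") auto
    hence "\<kappa> = y" using yl l1 by (simp add: \<kappa>_def)
    thus False using yl ak bk by auto
   qed
   have "z \<notin> path_image \<gamma>'" if z: "z \<in> closed_segment (x + of_real (1/2) * \<kappa>) (x + \<kappa>)" for z
   proof -
    obtain l where l: "0 \<le> l" "l \<le> 1" "z = (1 - l) *\<^sub>R (x + of_real (1/2) * \<kappa>) + l *\<^sub>R (x + \<kappa>)" using z by (auto simp: in_segment)
    have zz: "z = x + of_real ((1 + l) / 2) * \<kappa>" unfolding l(3) by (simp add: scaleR_conv_of_real field_simps)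
    show ?thesis
    proof (cases "l = 1")
     case True
     thus ?thesis using qin[of T3] small zz by (simp add: \<kappa>_def)
    next
     case False thus ?thesis unfolding zz using l by (intro kin) auto
    qed
   qed
   thus ?thesis using qin by auto
  qed
  have "winding_number \<gamma>' z1 = winding_number \<gamma>' (x + of_real (1/2) * \<kappa>)"
   by (rule winding_number_eq[OF _ lg' _ _ cS dS]) (use sg' small z1_def in \<open>auto intro: simple_path_imp_path\<close>)
  also have "x + of_real (1/2) * \<kappa> = x + of_real (1/2) * cis \<psi> * \<alpha>" unfolding kT by simp
  also have "winding_number \<gamma>' \<dots> = (if \<psi> < \<Theta> then k - 1 else k)"
   using kR[of "1/2" \<psi>] kL[of "1/2" \<psi>] T T' \<open>\<Theta> \<noteq> \<psi>\<close> by auto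
  finally have "winding_number \<gamma> z1 = (if \<psi> < \<Theta> then k - 1 else k)" using same[OF e(3) z1g] by simp
  moreover have "last_exit c2 r - x = \<alpha>" "last_exit q r - x = \<kappa>" "last_exit c1 r - x = \<beta>"
   by (simp_all add: last_exit_time \<alpha>_def \<beta>_def \<kappa>_def T1_def T2_def T3_def)
  ultimately show ?case using ang k unfolding z1_def by (auto simp: algebra_simps)
 qed
qed

subsection \<open>The combinatorial map of a drawing\<close>

lemma steps_append: "xs \<noteq> [] \<Longrightarrow> steps (xs @ [a]) = insert (last xs, a) (steps xs)"
 by (induction xs rule: steps.induct) auto

lemma steps_suffix: "steps vs \<subseteq> steps (us @ vs)"
proof (induction us)
 case (Cons u us)
 have "steps (us @ vs) \<subseteq> steps (u # us @ vs)" by (cases "us @ vs") auto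
 thus ?case using Cons by auto
qed auto

lemma rtrancl_distinct_path:
 assumes "(a, b) \<in> R\<^sup>*"
 obtains xs where "xs \<noteq> []" "distinct xs" "hd xs = a" "last xs = b" "steps xs \<subseteq> R"
proof -
 have "\<exists>xs. xs \<noteq> [] \<and> distinct xs \<and> hd xs = a \<and> last xs = b \<and> steps xs \<subseteq> R"
  using assms
 proof (induction rule: converse_rtrancl_induct)
  case base show ?case by (intro exI[of _ "[b]"]) auto
 next
  case (step a c)
  then obtain xs where xs: "xs \<noteq> []" "distinct xs" "hd xs = c" "last xs = b" "steps xs \<subseteq> R" by blast
  show ?case
  proof (cases "a \<in> set xs")
   case True
   then obtain us vs where s: "xs = us @ a # vs" by (auto simp: in_set_conv_decomp)
   hence "steps (a # vs) \<subseteq> R" using xs(5) steps_suffix[of "a # vs" us] by auto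
   thus ?thesis using xs s by (intro exI[of _ "a # vs"]) auto
  next
   case False
   obtain ys where "xs = c # ys" using xs(1,3) by (cases xs) auto
   thus ?thesis using xs step(1) False by (intro exI[of _ "a # xs"]) auto
  qed
 qed
 thus thesis using that by blast
qed

text \<open>Forgetting coordinate \<open>j\<close> identifies two vectors that only
  \<open>\<sigma> j\<close> tells apart, so each coordinate contributes at least one further
  vector.\<close>

lemma card_separated:
 fixes \<sigma> :: "'j \<Rightarrow> 'd \<Rightarrow> complex"
 assumes D: "finite D" "D \<noteq> {}" and J: "finite J"
  and sep: "\<And>j. j \<in> J \<Longrightarrow> \<exists>d\<in>D. \<exists>d'\<in>D. \<sigma> j d \<noteq> \<sigma> j d' \<and> (\<forall>k\<in>J. k \<noteq> j \<longrightarrow> \<sigma> k d = \<sigma> k d')"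
 shows "card J + 1 \<le> card ((\<lambda>d. \<lambda>j. if j \<in> J then \<sigma> j d else 0) ` D)"
 using J sep
proof (induction J)
 case empty
 have "(\<lambda>d. \<lambda>j. if j \<in> {} then \<sigma> j d else 0) ` D = {\<lambda>j. 0}" using D by auto
 thus ?case by simp
next
 case (insert j J)
 let ?\<Phi> = "\<lambda>K d j. if j \<in> K then \<sigma> j d else 0"
 let ?pr = "\<lambda>h. h(j := 0)"
 have pr: "?pr (?\<Phi> (insert j J) d) = ?\<Phi> J d" for d using insert(2) by auto
 have im: "?pr ` (?\<Phi> (insert j J) ` D) = ?\<Phi> J ` D" unfolding image_image pr ..
 have fin: "finite (?\<Phi> (insert j J) ` D)" using D by simp
 obtain d d' where d: "d \<in> D" "d' \<in> D" "\<sigma> j d \<noteq> \<sigma> j d'" "\<forall>k\<in>insert j J. k \<noteq> j \<longrightarrow> \<sigma> k d = \<sigma> k d'"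
  using insert(4)[of j] by auto
 have ne: "?\<Phi> (insert j J) d \<noteq> ?\<Phi> (insert j J) d'" using d(3) by (auto dest!: fun_cong[of _ _ j])
 have "?\<Phi> J d = ?\<Phi> J d'" using d(4) insert(2) by (auto simp: fun_eq_iff)
 hence "?pr (?\<Phi> (insert j J) d) = ?pr (?\<Phi> (insert j J) d')" unfolding pr .
 hence "\<not> inj_on ?pr (?\<Phi> (insert j J) ` D)" using ne d(1,2) unfolding inj_on_def by blast
 hence "card (?pr ` (?\<Phi> (insert j J) ` D)) < card (?\<Phi> (insert j J) ` D)"
  using card_image_le[OF fin, of ?pr] eq_card_imp_inj_on[OF fin, of ?pr] by linarith
 moreover have "card J + 1 \<le> card (?\<Phi> J ` D)"
 proof (rule insert.IH)
  fix i assume i: "i \<in> J"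
  show "\<exists>d\<in>D. \<exists>d'\<in>D. \<sigma> i d \<noteq> \<sigma> i d' \<and> (\<forall>k\<in>J. k \<noteq> i \<longrightarrow> \<sigma> k d = \<sigma> k d')"
   using insert.prems[of i] i by fast
 qed
 ultimately show ?case using insert(1,2) unfolding im by simp
qed

context drawing
begin

lemma finV: "finite V" using simple by (simp add: simple_graph_def)

lemma finN: "finite (neighbours E v)"
proof -
 have "neighbours E v \<subseteq> V" using edgeD by (auto simp: neighbours_def)
 thus ?thesis using finV finite_subset by blast
qed

lemma g_half: "{a, b} \<in> E \<Longrightarrow> g b a (1/2) = g a b (1/2)"
 using g(4)[of a b] by (simp add: reversepath_def)

lemma g_ends: assumes "{a, b} \<in> E" shows "g a b 0 = p a" "g a b 1 = p b"
 using g(2,3)[OF assms] by (simp_all add: pathstart_def pathfinish_def)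

lemma eventually_exit:
 "\<forall>\<^sub>F r in at_right 0. 0 < r \<and> (\<forall>x\<in>neighbours E v. cmod (last_exit (g v x) r - p v) = r) \<and>
   inj_on (\<lambda>x. last_exit (g v x) r) (neighbours E v)"
proof -
 have "\<forall>\<^sub>F r in at_right 0. \<forall>x\<in>neighbours E v. 0 < r \<and> r < dist (g v x 0) (g v x 1) \<and> exit_time (g v x) r < 1"
  by (rule eventually_ball_finite[OF finN]) (use g(1) exit_time_small[of _ 1] in auto)
 moreover have "\<forall>\<^sub>F r in at_right (0::real). 0 < r" by (simp add: eventually_at_right_less)
 ultimately show ?thesis
 proof eventually_elim
  case (elim r)
  have n: "dist (p v) (last_exit (g v x) r) = r" "last_exit (g v x) r \<in> path_image (g v x)" if "{v, x} \<in> E" for x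
  proof -
   have a: "path (g v x)" "r < dist (g v x 0) (g v x 1)" using g(1)[OF that] elim(1) that by (auto simp: arc_def)
   show "dist (p v) (last_exit (g v x) r) = r"
    using exit_time(3)[OF a(1) elim(2) a(2)] g_ends[OF that] by (simp add: last_exit_time)
   show "last_exit (g v x) r \<in> path_image (g v x)"
    using exit_time(1,2)[OF a(1) elim(2) a(2)] by (auto simp: last_exit_time path_image_def)
  qed
  have "x = y" if xy: "{v, x} \<in> E" "{v, y} \<in> E" "last_exit (g v x) r = last_exit (g v y) r" for x y
  proof (rule ccontr)
   assume "x \<noteq> y"
   hence "{v, x} \<noteq> {v, y}" "{v, x} \<inter> {v, y} = {v}" using edgeD xy by (auto simp: doubleton_eq_iff)
   hence "last_exit (g v x) r = p v" using meet[OF xy(1,2)] n(2)[OF xy(1)] n(2)[OF xy(2)] xy(3) by auto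
   thus False using n(1)[OF xy(1)] elim by simp
  qed
  hence "inj_on (\<lambda>x. last_exit (g v x) r) (neighbours E v)" by (intro inj_onI) simp
  thus ?case using n elim(2) by (auto simp: dist_norm norm_minus_commute)
 qed
qed

lemma rotate_cycle:
 assumes "is_cycle xs" "b \<in> set xs"
 obtains s rest where "is_cycle (b # s # rest)" "rest \<noteq> []" "cyc_darts (b # s # rest) = cyc_darts xs" "set (b # s # rest) = set xs"
proof -
 have r1: "is_cycle (ys @ [a]) \<and> cyc_darts (ys @ [a]) = cyc_darts (a # ys)" if c: "is_cycle (a # ys)" for a ys
 proof -
  obtain c zs where ys: "ys = c # zs" using c by (cases ys) (auto simp: is_cycle_def)
  have "cyc_darts (ys @ [a]) = cyc_darts (a # ys)"
   unfolding cyc_darts_def using steps_append[of ys a] by (auto simp: ys)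
  thus ?thesis using c by (auto simp: is_cycle_def)
 qed
 have r2: "is_cycle (vs @ us) \<and> cyc_darts (vs @ us) = cyc_darts (us @ vs)" if "is_cycle (us @ vs)" for us vs
  using that
 proof (induction us arbitrary: vs)
  case (Cons a us)
  thus ?case using r1[of a "us @ vs"] Cons.IH[of "vs @ [a]"] by auto
 qed simp
 obtain us vs where x: "xs = us @ b # vs" using assms(2) by (auto simp: in_set_conv_decomp)
 have c: "is_cycle (b # vs @ us)" "cyc_darts (b # vs @ us) = cyc_darts xs" using r2[of us "b # vs"] assms x by auto
 hence "3 \<le> length (b # vs @ us)" by (simp add: is_cycle_def)
 then obtain s rest where sr: "vs @ us = s # rest" by (cases "vs @ us") auto
 moreover have "rest \<noteq> []" using \<open>3 \<le> length (b # vs @ us)\<close> unfolding sr by auto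
 moreover have "set (b # vs @ us) = set xs" using x by auto
 ultimately show thesis using that c by metis
qed

lemma chain_winding:
 assumes "2 \<le> length xs" "distinct xs" "\<And>a b. (a, b) \<in> steps xs \<Longrightarrow> {a, b} \<in> E"
  "\<And>a b. (a, b) \<in> steps xs \<Longrightarrow> z \<notin> path_image (g a b)"
 shows "winding_number (chain g xs) z = (\<Sum>(a, b)\<in>steps xs. winding_number (g a b) z)"
 using assms
proof (induction xs rule: steps.induct)
 case (1 a b xs)
 show ?case
 proof (cases "xs = []")
  case False
  have c: "arc (chain g (b # xs)) \<and> pathstart (chain g (b # xs)) = p b \<and>
   path_image (chain g (b # xs)) = (\<Union>(a, b)\<in>steps (b # xs). path_image (g a b))"
   using chain_props[of "b # xs"] 1(3,4) False by (cases xs) auto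
  have IH: "winding_number (chain g (b # xs)) z = (\<Sum>(a, b)\<in>steps (b # xs). winding_number (g a b) z)"
   using 1 False by (cases xs) auto
  have e: "{a, b} \<in> E" "z \<notin> path_image (g a b)" using 1(4,5) by auto
  have zc: "z \<notin> path_image (chain g (b # xs))" using c 1(5) by auto
  have "winding_number (chain g (a # b # xs)) z = winding_number (g a b) z + winding_number (chain g (b # xs)) z"
   unfolding chain_Cons[OF False] using c zc e g[OF e(1)] by (intro winding_number_join) (auto simp: arc_def)
  moreover have "(a, b) \<notin> steps (b # xs)" using steps_set[of a b "b # xs"] 1(3) by auto
  moreover have "finite (steps (b # xs))" using finite_subset[of "steps (b # xs)" "set (b # xs) \<times> set (b # xs)"] steps_set by fastforce
  ultimately show ?thesis using IH by simp
 qed simp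
qed auto

lemma finite_steps: "finite (steps xs)"
 using finite_subset[of "steps xs" "set xs \<times> set xs"] steps_set by fastforce

text \<open>Written as a sum over darts, the winding number depends only on the set of darts. A
  cycle may therefore be started at any of its vertices, as \<open>cyc_darts_cong\<close> makes
  precise.\<close>

lemma cycle_winding:
 assumes "is_cycle xs" "z \<notin> cyc_curve xs"
 shows "winding_number (cyc_loop xs) z = (\<Sum>(a, b)\<in>cyc_darts xs. winding_number (g a b) z)"
proof -
 have xs: "3 \<le> length xs" "distinct xs" "\<And>a b. (a, b) \<in> steps xs \<Longrightarrow> {a, b} \<in> E" "{last xs, hd xs} \<in> E"
  using assms(1) by (auto simp: is_cycle_def cyc_darts_def)
 have z: "z \<notin> path_image (g (last xs) (hd xs))" "\<And>a b. (a, b) \<in> steps xs \<Longrightarrow> z \<notin> path_image (g a b)"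
  using assms(2) by (auto simp: cyc_curve_def cyc_darts_def)
 have c: "arc (chain g xs)" "pathfinish (chain g xs) = p (last xs)"
   "path_image (chain g xs) = (\<Union>(a, b)\<in>steps xs. path_image (g a b))"
  using chain_props[of xs] xs by auto
 have zc: "z \<notin> path_image (chain g xs)" using z c(3) by auto
 have "winding_number (cyc_loop xs) z = winding_number (chain g xs) z + winding_number (g (last xs) (hd xs)) z"
  unfolding cyc_loop_def using c zc z g[OF xs(4)] by (intro winding_number_join) (auto simp: arc_def)
 moreover have "(last xs, hd xs) \<notin> steps xs" using last_hd_not_step[OF xs(1,2)] by blast
 moreover have "winding_number (chain g xs) z = (\<Sum>(a, b)\<in>steps xs. winding_number (g a b) z)"
  using chain_winding[of xs z] xs z by auto
 ultimately show ?thesis unfolding cyc_darts_def using finite_steps[of xs] by simp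
qed

lemma cyc_darts_edge: "is_cycle xs \<Longrightarrow> (a, b) \<in> cyc_darts xs \<Longrightarrow> {a, b} \<in> E"
 by (auto simp: is_cycle_def)

lemma cyc_darts_set: "xs \<noteq> [] \<Longrightarrow> (a, b) \<in> cyc_darts xs \<Longrightarrow> a \<in> set xs \<and> b \<in> set xs"
 using steps_set[of a b xs] by (auto simp: cyc_darts_def)

lemma cyc_darts_cong:
 assumes "is_cycle xs" "is_cycle ys" "cyc_darts xs = cyc_darts ys"
 shows "cyc_curve xs = cyc_curve ys"
  "z \<notin> cyc_curve xs \<Longrightarrow> winding_number (cyc_loop xs) z = winding_number (cyc_loop ys) z"
  "right_winding (cyc_loop xs) = right_winding (cyc_loop ys)"
proof -
 show c: "cyc_curve xs = cyc_curve ys" by (simp add: cyc_curve_def assms(3))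
 show w: "winding_number (cyc_loop xs) z = winding_number (cyc_loop ys) z" if "z \<notin> cyc_curve xs" for z
  using cycle_winding[OF assms(1) that] cycle_winding[OF assms(2)] that c assms(3) by simp
 show "right_winding (cyc_loop xs) = right_winding (cyc_loop ys)"
  unfolding right_winding_def cycle_loop(3)[OF assms(1)] cycle_loop(3)[OF assms(2)] using w c by metis
qed

text \<open>The side of a directed edge, measured by the winding number of a cycle just to the right of it.\<close>

definition side :: "'a list \<Rightarrow> 'a \<times> 'a \<Rightarrow> complex" where
 "side xs = (\<lambda>(a, b). if (a, b) \<in> cyc_darts xs then right_winding (cyc_loop xs)
   else if (b, a) \<in> cyc_darts xs then right_winding (cyc_loop xs) + 1
   else winding_number (cyc_loop xs) (g a b (1/2)))"

lemma side_rev: "{a, b} \<in> E \<Longrightarrow> (a, b) \<notin> cyc_darts xs \<Longrightarrow> (b, a) \<notin> cyc_darts xs \<Longrightarrow> side xs (b, a) = side xs (a, b)"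
 by (simp add: side_def g_half)

lemma side_cong: assumes "is_cycle xs" "is_cycle ys" "cyc_darts xs = cyc_darts ys" "{a, b} \<in> E"
 shows "side xs (a, b) = side ys (a, b)"
proof -
 have "g a b (1/2) \<notin> cyc_curve xs" if n: "(a, b) \<notin> cyc_darts xs" "(b, a) \<notin> cyc_darts xs"
 proof
  assume "g a b (1/2) \<in> cyc_curve xs"
  then obtain c d where cd: "(c, d) \<in> cyc_darts xs" "g a b (1/2) \<in> path_image (g c d)" by (auto simp: cyc_curve_def)
  have "{a, b} \<noteq> {c, d}" using cd(1) n by (auto simp: doubleton_eq_iff)
  moreover have i: "g a b (1/2) \<in> path_image (g a b)" by (auto simp: path_image_def)
  ultimately have "g a b (1/2) \<in> {p a, p b}" using meet[OF assms(4) cyc_darts_edge[OF assms(1) cd(1)]] cd(2) by auto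
  moreover have "inj_on (g a b) {0..1}" using g(1)[OF assms(4)] by (simp add: arc_def)
  hence "g a b (1/2) \<noteq> g a b 0" "g a b (1/2) \<noteq> g a b 1" by (auto dest: inj_onD)
  ultimately show False using g_ends[OF assms(4)] by auto
 qed
 thus ?thesis using cyc_darts_cong[OF assms(1-3)] assms(3) by (simp add: side_def)
qed

text \<open>This is \<open>local_side\<close> for the two cycle edges at \<open>b\<close>, with the
  rest of the cycle as the closing arc. The arc \<open>q\<close> is left general because it is an
  edge in \<open>side_step\<close> and a probing segment in \<open>corner_side\<close>.\<close>

lemma side_local:
 assumes c: "is_cycle (b # s # rest)" "rest \<noteq> []"
  and q: "arc q" "q 0 = p b" "path_image q \<inter> cyc_curve (b # s # rest) \<subseteq> {p b, q 1}"
 shows "\<forall>\<^sub>F r in at_right 0. winding_number (cyc_loop (b # s # rest)) (q (1/2)) =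
  (if ccw_angle (last_exit (g b (last rest)) r - p b) (last_exit q r - p b)
    < ccw_angle (last_exit (g b (last rest)) r - p b) (last_exit (g b s) r - p b)
   then right_winding (cyc_loop (b # s # rest)) else right_winding (cyc_loop (b # s # rest)) + 1)"
proof -
 define t where "t = last rest"
 define Q where "Q = chain g (s # rest)"
 let ?xs = "b # s # rest"
 have xs: "distinct ?xs" "\<And>a b. (a, b) \<in> steps (s # rest) \<Longrightarrow> {a, b} \<in> E" "{b, s} \<in> E" "{t, b} \<in> E"
  using c by (auto simp: is_cycle_def cyc_darts_def t_def)
 have bt: "{b, t} \<in> E" using xs(4) by (simp add: insert_commute)
 have tr: "t \<in> set rest" using c(2) by (simp add: t_def)
 have ne: "b \<noteq> s" "b \<noteq> t" "s \<noteq> t" using xs(1) tr by auto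
 have Q: "arc Q" "pathstart Q = p s" "pathfinish Q = p t" "path_image Q = (\<Union>(a, b)\<in>steps (s # rest). path_image (g a b))"
  using chain_props[of "s # rest"] xs c(2) unfolding Q_def t_def by (auto simp: Suc_le_eq)
 have QE: "path_image (g b y') \<inter> path_image Q \<subseteq> {p y'}" if y': "{b, y'} \<in> E" for y'
 proof
  fix z assume z: "z \<in> path_image (g b y') \<inter> path_image Q"
  then obtain a d where ad: "(a, d) \<in> steps (s # rest)" "z \<in> path_image (g a d)" unfolding Q(4) by auto
  have "b \<notin> {a, d}" using steps_set[OF ad(1)] xs(1) by auto
  moreover from this have "{b, y'} \<noteq> {a, d}" by blast
  ultimately show "z \<in> {p y'}" using meet[OF y' xs(2)[OF ad(1)]] z ad(2) by auto
 qed
 let ?\<gamma> = "g b s +++ (Q +++ reversepath (g b t))"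
 have gt: "reversepath (g b t) = g t b" using g(4)[OF bt] by simp
 have cd: "cyc_darts ?xs = insert (t, b) (insert (b, s) (steps (s # rest)))" using c(2) by (simp add: cyc_darts_def t_def)
 have curve: "cyc_curve ?xs = path_image (g b s) \<union> path_image (g b t) \<union> path_image Q"
  unfolding cyc_curve_def cd Q(4) using g(6)[OF bt] by auto
 have loc: "\<forall>\<^sub>F r in at_right 0. winding_number ?\<gamma> (q (1/2)) =
  (if ccw_angle (last_exit (g b t) r - p b) (last_exit q r - p b)
    < ccw_angle (last_exit (g b t) r - p b) (last_exit (g b s) r - p b)
   then right_winding ?\<gamma> else right_winding ?\<gamma> + 1)"
 proof (rule local_side)
  show "arc (g b s)" "arc (g b t)" "arc Q" "arc q" using g(1) xs(3) bt q(1) Q(1) by auto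
  show "g b s 0 = p b" "g b t 0 = p b" "q 0 = p b" using g_ends xs(3) bt q(2) by auto
  show "pathfinish (g b s) = pathstart Q" "pathfinish Q = pathfinish (g b t)" using Q g(3)[OF xs(3)] g(3)[OF bt] by auto
  have "{b, s} \<noteq> {b, t}" "{b, s} \<inter> {b, t} = {b}" using ne by (auto simp: doubleton_eq_iff)
  thus "path_image (g b s) \<inter> path_image (g b t) = {p b}" using meet[OF xs(3) bt] ne by auto
  show "path_image (g b s) \<inter> path_image Q = {pathfinish (g b s)}"
   using QE[OF xs(3)] g(3)[OF xs(3)] Q(2) pathfinish_in_path_image[of "g b s"] pathstart_in_path_image[of Q] by auto
  show "path_image (g b t) \<inter> path_image Q = {pathfinish (g b t)}"
   using QE[OF bt] g(3)[OF bt] Q(3) pathfinish_in_path_image[of "g b t"] pathfinish_in_path_image[of Q] by auto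
  show "path_image q \<inter> (path_image (g b s) \<union> path_image (g b t) \<union> path_image Q) \<subseteq> {p b, q 1}"
   using q(3) unfolding curve .
 qed
 have im: "path_image ?\<gamma> = cyc_curve ?xs"
  unfolding cyc_curve_def cd gt using Q g[OF xs(3)] g[OF xs(4)] by (auto simp: path_image_join)
 have w: "winding_number ?\<gamma> z = winding_number (cyc_loop ?xs) z" if "z \<notin> cyc_curve ?xs" for z
 proof -
  have z: "z \<notin> path_image (g b s)" "z \<notin> path_image Q" "z \<notin> path_image (g t b)" "\<And>a b. (a, b) \<in> steps (s # rest) \<Longrightarrow> z \<notin> path_image (g a b)"
   using that unfolding cyc_curve_def cd Q(4) by auto
  have "winding_number ?\<gamma> z = winding_number (g b s) z + (winding_number Q z + winding_number (g t b) z)"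
   unfolding gt using Q g[OF xs(3)] g[OF xs(4)] z by (simp add: winding_number_join path_image_join arc_imp_path)
  also have "winding_number Q z = (\<Sum>(a, b)\<in>steps (s # rest). winding_number (g a b) z)"
   unfolding Q_def by (rule chain_winding) (use xs z c(2) in \<open>auto simp: Suc_le_eq\<close>)
  finally have "winding_number ?\<gamma> z = winding_number (g b s) z + ((\<Sum>(a, b)\<in>steps (s # rest). winding_number (g a b) z) + winding_number (g t b) z)" .
  moreover have "(b, s) \<notin> steps (s # rest)" "(t, b) \<notin> steps (s # rest)" "(t, b) \<noteq> (b, s)" using steps_set xs(1) ne by fastforce+
  ultimately show ?thesis unfolding cycle_winding[OF c(1) that] cd using finite_steps[of "s # rest"] by simp
 qed
 have rw: "right_winding ?\<gamma> = right_winding (cyc_loop ?xs)"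
  unfolding right_winding_def im cycle_loop(3)[OF c(1)] using w by metis
 have "q (1/2) \<notin> cyc_curve ?xs"
 proof
  assume a: "q (1/2) \<in> cyc_curve ?xs"
  have "q (1/2) \<in> path_image q" by (auto simp: path_image_def)
  hence "q (1/2) = q 0 \<or> q (1/2) = q 1" using q(2,3) a by auto
  moreover have "inj_on q {0..1}" using q(1) by (simp add: arc_def)
  ultimately show False by (auto dest: inj_onD)
 qed
 from w[OF this] show ?thesis using loc unfolding t_def[symmetric] rw by simp
qed

end

section \<open>Sides are constant along faces\<close>

locale rotated_drawing = drawing +
 fixes \<rho> assumes ind: "induces_rotation E p g \<rho>"
begin

lemma eventually_next:
 "\<forall>\<^sub>F r in at_right 0. \<forall>u\<in>neighbours E v. ccw_next (\<lambda>x. last_exit (g v x) r - p v) (neighbours E v) u (\<rho> v u)"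
 by (rule eventually_ball_finite[OF finN]) (use ind in \<open>auto simp: induces_rotation_def\<close>)

lemma rho_in: assumes "{v, u} \<in> E" shows "{v, \<rho> v u} \<in> E"
proof -
 obtain r where "\<forall>u\<in>neighbours E v. ccw_next (\<lambda>x. last_exit (g v x) r - p v) (neighbours E v) u (\<rho> v u)"
  using eventually_happens'[OF _ eventually_next[of v]] by (auto simp: trivial_limit_at_right_real)
 thus ?thesis using assms by (auto simp: ccw_next_def)
qed

lemma rotation: "rotation_system V E \<rho>"
 unfolding rotation_system_def
proof (intro ballI conjI allI impI)
 fix v u assume "u \<in> neighbours E v" thus "\<rho> v u \<in> neighbours E v" using rho_in by simp
next
 fix v S assume S: "S \<subseteq> neighbours E v" "S \<noteq> {}" "\<rho> v ` S \<subseteq> S"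
 show "S = neighbours E v"
 proof (rule ccontr)
  assume "S \<noteq> neighbours E v"
  then obtain y where y: "y \<in> neighbours E v" "y \<notin> S" using S by blast
  obtain r where r: "\<forall>u\<in>neighbours E v. ccw_next (\<lambda>x. last_exit (g v x) r - p v) (neighbours E v) u (\<rho> v u)"
   "0 < r" "\<forall>x\<in>neighbours E v. cmod (last_exit (g v x) r - p v) = r" "inj_on (\<lambda>x. last_exit (g v x) r) (neighbours E v)"
   using eventually_happens'[OF _ eventually_conj[OF eventually_next[of v] eventually_exit[of v]]]
   by (auto simp: trivial_limit_at_right_real)
  define d where "d x = last_exit (g v x) r - p v" for x
  define \<theta> where "\<theta> x = Arg2pi (d x / d y)" for x
  have n1: "cmod (d x) = r" if "x \<in> neighbours E v" for x using r(3) that by (simp only: d_def)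
  have n: "cmod (d x) = r" "d x \<noteq> 0" if "x \<in> neighbours E v" for x using n1[OF that] r(2) by auto
  have gp: "ccw_angle (d x) (d z) = gap (\<theta> x) (\<theta> z)" if "x \<in> neighbours E v" "z \<in> neighbours E v" for x z
   unfolding \<theta>_def by (rule ccw_angle_gap) (use n y that in auto)
  have pos: "0 < \<theta> x" if "x \<in> S" for x
  proof (rule ccontr)
   assume "\<not> 0 < \<theta> x"
   hence "\<theta> x = 0" using Arg2pi_ge_0[of "d x / d y"] by (auto simp: \<theta>_def)
   moreover have xN: "x \<in> neighbours E v" using S that by auto
   have "d x = of_real r * cis (\<theta> x) * (d y / of_real r)"
    using Arg2pi_polar[OF n(2)[OF y(1)], of "d x"] unfolding n1[OF xN] n1[OF y(1)] \<theta>_def .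
   ultimately have "d x = d y" using r(2) by simp
   hence "x = y" using r(4) y S that by (auto simp: d_def inj_on_def)
   thus False using y that by simp
  qed
  \<comment> \<open>Angles are measured from the missing neighbour \<open>y\<close>. The element of
    \<open>S\<close> with the largest angle has a successor that comes no later than
    \<open>y\<close>, so this successor cannot be in \<open>S\<close>.\<close>
  have fS: "finite S" using S finN finite_subset by blast
  have "Max (\<theta> ` S) \<in> \<theta> ` S" using fS S(2) by simp
  then obtain x where x1: "x \<in> S" "\<theta> x = Max (\<theta> ` S)" by auto
  have x: "x \<in> S" "\<And>z. z \<in> S \<Longrightarrow> \<theta> z \<le> \<theta> x" using x1 fS by auto
  have xN: "x \<in> neighbours E v" using x S by auto
  have w: "\<rho> v x \<in> S" "\<theta> (\<rho> v x) \<le> \<theta> x" using S x by auto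
  have "gap (\<theta> x) (\<theta> (\<rho> v x)) \<le> gap (\<theta> x) (\<theta> y)"
  proof -
   have wN: "\<rho> v x \<in> neighbours E v" using w S by auto
   have "ccw_angle (d x) (d (\<rho> v x)) \<le> ccw_angle (d x) (d y)"
    using bspec[OF r(1) xN] y(1) unfolding ccw_next_def d_def by blast
   thus ?thesis unfolding gp[OF xN y(1)] gp[OF xN wN] .
  qed
  moreover have "\<theta> y = 0" using n(2)[OF y(1)] by (simp add: \<theta>_def)
  ultimately show False using w pos[OF w(1)] pos[OF x(1)] by (simp add: gap_def split: if_splits)
 qed
qed

text \<open>If \<open>b\<close> is not on the cycle, both half edges at \<open>b\<close> avoid the
  cycle and are joined there. If the cycle comes from \<open>t\<close> and leaves to
  \<open>s\<close>, its right-hand side at \<open>b\<close> is the turn from \<open>t\<close> to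
  \<open>s\<close>, and no edge lies between \<open>a\<close> and \<open>\<rho> b a\<close> that
  could separate the two darts.\<close>

lemma side_step:
 assumes c: "is_cycle xs" and ab: "{a, b} \<in> E"
 shows "side xs (b, \<rho> b a) = side xs (a, b)"
proof -
 define x where "x = \<rho> b a"
 have ba: "{b, a} \<in> E" using ab by (simp add: insert_commute)
 have bx: "{b, x} \<in> E" using rho_in[OF ba] by (simp add: x_def)
 have ne: "xs \<noteq> []" using c by (auto simp: is_cycle_def)
 show ?thesis
 proof (cases "b \<in> set xs")
  case False
  have nd: "(b, z) \<notin> cyc_darts xs" "(z, b) \<notin> cyc_darts xs" for z using cyc_darts_set[OF ne] False by auto
  let ?\<gamma> = "cyc_loop xs"
  note cl = cycle_loop[OF c]
  have off: "z = p y" if y: "{b, y} \<in> E" and z: "z \<in> path_image (g b y)" "z \<in> cyc_curve xs" for y z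
  proof -
   obtain c' d' where cd: "(c', d') \<in> cyc_darts xs" "z \<in> path_image (g c' d')" using z(2) by (auto simp: cyc_curve_def)
   have "b \<notin> {c', d'}" using cyc_darts_set[OF ne cd(1)] False by auto
   moreover from this have "{b, y} \<noteq> {c', d'}" by blast
   ultimately show ?thesis using meet[OF y cyc_darts_edge[OF c cd(1)]] z(1) cd(2) by auto
  qed
  have "winding_number ?\<gamma> (g b y (1/2)) = winding_number ?\<gamma> (p b)" if y: "{b, y} \<in> E" for y
  proof (rule winding_number_eq[OF simple_path_imp_path[OF cl(1)] cl(2)])
   have gy: "path (g b y)" "inj_on (g b y) {0..1}" using g(1)[OF y] by (auto simp: arc_def)
   have "continuous_on {0..1/2} (g b y)" using gy(1) by (auto simp: path_def intro: continuous_on_subset)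
   thus "connected (g b y ` {0..1/2})" by (intro connected_continuous_image) auto
   show "p b \<in> g b y ` {0..1/2}" using g_ends(1)[OF y] by (intro image_eqI[of _ _ 0]) auto
   show "g b y ` {0..1/2} \<inter> path_image ?\<gamma> = {}"
   proof -
    have "g b y t \<notin> cyc_curve xs" if t: "0 \<le> t" "t \<le> 1/2" for t
    proof
     assume "g b y t \<in> cyc_curve xs"
     hence "g b y t = g b y 1" using off[OF y] g_ends(2)[OF y] t by (auto simp: path_image_def)
     thus False using inj_onD[OF gy(2), of t 1] t by auto
    qed
    thus ?thesis unfolding cl(3) by auto
   qed
  qed auto
  from this[OF bx] this[OF ba] show ?thesis using nd g_half[OF ab] unfolding x_def[symmetric] by (simp add: side_def)
 next
  case True
  obtain s rest where ys: "is_cycle (b # s # rest)" "rest \<noteq> []" "cyc_darts (b # s # rest) = cyc_darts xs"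
   using rotate_cycle[OF c True] by metis
  define t where "t = last rest"
  let ?ys = "b # s # rest"
  define R where "R = right_winding (cyc_loop ?ys)"
  have d: "distinct ?ys" using ys(1) by (simp add: is_cycle_def)
  have tr: "t \<in> set rest" using ys(2) by (simp add: t_def)
  have cd: "cyc_darts ?ys = insert (t, b) (insert (b, s) (steps (s # rest)))" using ys(2) by (simp add: cyc_darts_def t_def)
  have st: "s \<noteq> t" "b \<noteq> s" "b \<noteq> t" using d tr by auto
  have out: "(b, y) \<in> cyc_darts ?ys \<longleftrightarrow> y = s" "(y, b) \<in> cyc_darts ?ys \<longleftrightarrow> y = t" for y
   unfolding cd using steps_set[of b y "s # rest"] steps_set[of y b "s # rest"] d st by auto
  have bs: "{b, s} \<in> E" and bt: "{b, t} \<in> E" using cyc_darts_edge[OF ys(1), of b s] cyc_darts_edge[OF ys(1), of t b] out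
   by (auto simp: insert_commute)
  have L: "\<forall>\<^sub>F r in at_right 0. y \<noteq> s \<longrightarrow> y \<noteq> t \<longrightarrow> winding_number (cyc_loop ?ys) (g b y (1/2)) =
   (if ccw_angle (last_exit (g b t) r - p b) (last_exit (g b y) r - p b)
    < ccw_angle (last_exit (g b t) r - p b) (last_exit (g b s) r - p b) then R else R + 1)" if y: "{b, y} \<in> E" for y
  proof (cases "y = s \<or> y = t")
   case False
   have "path_image (g b y) \<inter> cyc_curve ?ys \<subseteq> {p b, g b y 1}"
   proof
    fix z assume z: "z \<in> path_image (g b y) \<inter> cyc_curve ?ys"
    then obtain c' d' where cd': "(c', d') \<in> cyc_darts ?ys" "z \<in> path_image (g c' d')" by (auto simp: cyc_curve_def)
    have "{b, y} \<noteq> {c', d'}" using cd'(1) out False by (auto simp: doubleton_eq_iff)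
    thus "z \<in> {p b, g b y 1}" using meet[OF y cyc_darts_edge[OF ys(1) cd'(1)]] z cd'(2) g_ends(2)[OF y] by auto
   qed
   from side_local[OF ys(1,2) g(1)[OF y] g_ends(1)[OF y] this] show ?thesis using False unfolding t_def R_def by simp
  qed auto
  obtain r where r: "\<forall>u\<in>neighbours E b. ccw_next (\<lambda>x. last_exit (g b x) r - p b) (neighbours E b) u (\<rho> b u)"
   "0 < r" "\<forall>x\<in>neighbours E b. cmod (last_exit (g b x) r - p b) = r" "inj_on (\<lambda>x. last_exit (g b x) r) (neighbours E b)"
   and La: "a \<noteq> s \<longrightarrow> a \<noteq> t \<longrightarrow> winding_number (cyc_loop ?ys) (g b a (1/2)) =
   (if ccw_angle (last_exit (g b t) r - p b) (last_exit (g b a) r - p b)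
    < ccw_angle (last_exit (g b t) r - p b) (last_exit (g b s) r - p b) then R else R + 1)"
   and Lx: "x \<noteq> s \<longrightarrow> x \<noteq> t \<longrightarrow> winding_number (cyc_loop ?ys) (g b x (1/2)) =
   (if ccw_angle (last_exit (g b t) r - p b) (last_exit (g b x) r - p b)
    < ccw_angle (last_exit (g b t) r - p b) (last_exit (g b s) r - p b) then R else R + 1)"
   using eventually_happens'[OF _ eventually_conj[OF eventually_conj[OF eventually_next[of b] eventually_exit[of b]]
     eventually_conj[OF L[OF ba] L[OF bx]]]]
   by (auto simp: trivial_limit_at_right_real)
  define dd where "dd y = last_exit (g b y) r - p b" for y
  define \<theta> where "\<theta> y = Arg2pi (dd y / dd t)" for y
  have n1: "cmod (dd y) = r" if "{b, y} \<in> E" for y using r(3) that by (simp only: dd_def mem_neighbours)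
  have n: "cmod (dd y) = r" "dd y \<noteq> 0" if "{b, y} \<in> E" for y using n1[OF that] r(2) by auto
  have gp: "ccw_angle (dd y) (dd z) = gap (\<theta> y) (\<theta> z)" if "{b, y} \<in> E" "{b, z} \<in> E" for y z
   unfolding \<theta>_def by (rule ccw_angle_gap) (use n bt that in auto)
  have \<theta>t: "\<theta> t = 0" using n(2)[OF bt] by (simp add: \<theta>_def)
  have rng: "0 \<le> \<theta> y" "\<theta> y < 2 * pi" for y unfolding \<theta>_def by (simp_all add: Arg2pi_ge_0 Arg2pi_lt_2pi)
  have inj: "y = z" if "{b, y} \<in> E" "{b, z} \<in> E" "\<theta> y = \<theta> z" for y z
  proof -
   have "dd y = of_real r * cis (\<theta> y) * (dd t / of_real r)" if "{b, y} \<in> E" for y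
    using Arg2pi_polar[OF n(2)[OF bt], of "dd y"] unfolding n1[OF that] n1[OF bt] \<theta>_def .
   hence "dd y = dd z" using that by metis
   thus ?thesis using r(4) that by (auto simp: dd_def inj_on_def)
  qed
  have nx: "gap (\<theta> a) (\<theta> x) \<le> gap (\<theta> a) (\<theta> z)" if "{b, z} \<in> E" for z
  proof -
   have "ccw_angle (dd a) (dd x) \<le> ccw_angle (dd a) (dd z)"
   proof -
    have "ccw_next (\<lambda>x. last_exit (g b x) r - p b) (neighbours E b) a (\<rho> b a)" using r(1) ba by simp
    hence "\<forall>x\<in>neighbours E b. ccw_angle (dd a) (dd (\<rho> b a)) \<le> ccw_angle (dd a) (dd x)"
     unfolding ccw_next_def dd_def by (rule conjunct2)
    thus ?thesis using that x_def by simp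
   qed
   thus ?thesis unfolding gp[OF ba bx] gp[OF ba that] .
  qed
  \<comment> \<open>The right of an outgoing dart is just before its edge in counter-clockwise
    order, that of an incoming dart just after it. So \<open>t\<close> counts as 2 pi for outgoing
    darts, which gives \<open>\<psi>\<close> and a weak inequality, but as 0 for incoming ones,
    which gives \<open>\<theta>\<close> and a strict one.\<close>
  define \<psi> where "\<psi> y = gap 0 (\<theta> y)" for y
  have ang: "ccw_angle (dd t) (dd y) = \<psi> y" if "{b, y} \<in> E" for y using gp[OF bt that] \<theta>t by (simp add: \<psi>_def)
  have So: "side ?ys (b, y) = (if \<psi> y \<le> \<psi> s then R else R + 1)"
   if y: "{b, y} \<in> E" and Ly: "y \<noteq> s \<longrightarrow> y \<noteq> t \<longrightarrow> winding_number (cyc_loop ?ys) (g b y (1/2)) =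
   (if ccw_angle (dd t) (dd y) < ccw_angle (dd t) (dd s) then R else R + 1)" for y
  proof -
   consider "y = s" | "y = t" "y \<noteq> s" | "y \<noteq> s" "y \<noteq> t" by blast
   thus ?thesis
   proof cases
    case 1 thus ?thesis using out by (simp add: side_def R_def)
   next
    case 2
    have "\<theta> s \<noteq> 0" using inj[OF bs bt] st \<theta>t by auto
    hence "\<psi> s < \<psi> t" using rng[of s] \<theta>t by (simp add: \<psi>_def gap_def)
    thus ?thesis using 2 out st by (simp add: side_def R_def)
   next
    case 3
    have "\<theta> y \<noteq> \<theta> s" "\<theta> y \<noteq> 0" using inj[OF y bs] inj[OF y bt] 3 \<theta>t by auto
    hence "\<psi> y \<noteq> \<psi> s" using rng[of s] rng[of y] by (auto simp: \<psi>_def gap_def split: if_splits)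
    thus ?thesis using 3 out Ly ang[OF y] ang[OF bs] by (auto simp: side_def)
   qed
  qed
  have Si: "side ?ys (a, b) = (if \<theta> a < \<theta> s then R else R + 1)"
  proof -
   have "\<theta> s \<noteq> 0" using inj[OF bs bt] st \<theta>t by auto
   hence s0: "0 < \<theta> s" using rng[of s] by simp
   consider "a = t" | "a = s" | "a \<noteq> s" "a \<noteq> t" by blast
   thus ?thesis
   proof cases
    case 1 thus ?thesis using out s0 \<theta>t by (simp add: side_def R_def)
   next
    case 2 thus ?thesis using out st by (simp add: side_def R_def)
   next
    case 3
    have "\<theta> a \<noteq> \<theta> s" "\<theta> a \<noteq> 0" using inj[OF ba bs] inj[OF ba bt] 3 \<theta>t by auto
    hence "\<psi> a = \<theta> a" "\<psi> s = \<theta> s" using rng[of a] s0 by (auto simp: \<psi>_def gap_def)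
    thus ?thesis using 3 out La ang[OF ba] ang[OF bs] g_half[OF ab] unfolding dd_def[symmetric] by (simp add: side_def)
   qed
  qed
  have s0: "0 < \<theta> s" using inj[OF bs bt] st \<theta>t rng[of s] by force
  have "\<psi> x \<le> \<psi> s \<longleftrightarrow> \<theta> a < \<theta> s"
   using nx[OF bs] nx[OF bt] rng[of x] rng[of a] rng[of s] s0 \<theta>t by (auto simp: \<psi>_def gap_def split: if_splits)
  hence "side ?ys (b, x) = side ?ys (a, b)" using So[OF bx] Lx Si unfolding dd_def[symmetric] by auto
  thus ?thesis using side_cong[OF c ys(1) ys(3)[symmetric]] bx ab unfolding x_def[symmetric] by simp
 qed
qed

end

text \<open>With e edges and n vertices, the spanning tree leaves e-n+1 edges, one coordinate each.
  By \<open>card_separated\<close> the vectors of sides take at least e-n+2 values, and there are at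
  least as many faces.\<close>

theorem drawing_euler:
 assumes L: "laman V E" and dr: "noncrossing_drawing V E p g" and ind: "induces_rotation E p g \<rho>"
 shows "laman_map V E \<rho>" "card E + 2 \<le> card {Q. is_face E \<rho> Q} + card V"
proof -
 have simple: "simple_graph V E" using L by (simp add: laman_def)
 interpret rotated_drawing V E p g \<rho> by unfold_locales (use simple dr ind in auto)
 show lm: "laman_map V E \<rho>"
  by (simp add: laman_map_def laman_map_axioms_def comb_map_def simple rotation L)
 interpret m: laman_map V E \<rho> by (rule lm)
 have "V \<noteq> {}" using L by (auto simp: laman_def)
 then obtain v0 where v0: "v0 \<in> V" by auto
 have cr: "\<exists>y\<in>S. \<exists>z\<in>V - S. {y, z} \<in> E" if "{v0} \<subseteq> S" "S \<subset> V" for S using m.connected[OF that(2)] that by blast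
 have "{v0} \<subseteq> V" using v0 by simp
 then obtain par and r :: "'a \<Rightarrow> nat" where par: "\<And>z. z \<in> V - {v0} \<Longrightarrow> par z \<in> V \<and> {z, par z} \<in> E \<and> r (par z) < r z"
  using parent_function[OF finV _ cr] by metis
 define T where "T = (\<lambda>z. {z, par z}) ` (V - {v0})"
 have fA: "finite (V - {v0})" using finV by simp
 have cT: "card T = card (V - {v0})" unfolding T_def by (rule parent_edges(2)[OF fA, where r = r]) (use par in blast)
 have TE: "T \<subseteq> E" using par by (auto simp: T_def)
 define J where "J = E - T"
 have finJ: "finite J" using m.finE by (simp add: J_def)
 have cJ: "card E + 1 \<le> card J + card V"
 proof -
  have "card J = card E - card T" unfolding J_def by (rule card_Diff_subset) (use TE m.finE finite_subset in auto)
  moreover have "card T = card V - 1" using cT v0 finV by (simp add: card_Diff_singleton)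
  moreover have "0 < card V" using v0 finV by (auto simp: card_gt_0_iff)
  ultimately show ?thesis using card_mono[OF m.finE TE] by linarith
 qed
 define Rl where "Rl = {(x, y). {x, y} \<in> T}"
 have sym: "sym Rl" by (auto simp: Rl_def sym_def insert_commute)
 have root: "(z, v0) \<in> Rl\<^sup>*" if "z \<in> V" for z
  using that
 proof (induction "r z" arbitrary: z rule: less_induct)
  case less
  show ?case
  proof (cases "z = v0")
   case False
   hence z: "z \<in> V - {v0}" using less by simp
   hence "(z, par z) \<in> Rl" by (auto simp: Rl_def T_def)
   moreover have "(par z, v0) \<in> Rl\<^sup>*" using less par[OF z] by auto
   ultimately show ?thesis by (rule converse_rtrancl_into_rtrancl)
  qed simp
 qed
 have "\<exists>xs. is_cycle xs \<and> {last xs, hd xs} = e \<and> (\<forall>(a, b)\<in>steps xs. {a, b} \<in> T)" if e: "e \<in> J" for e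
 proof -
  obtain a b where ab: "e = {a, b}" "a \<noteq> b" "{a, b} \<in> E" using m.edgeE[of e] e by (auto simp: J_def)
  have "(v0, b) \<in> Rl\<^sup>*" using root[of b] sym_rtrancl[OF sym] edgeD[OF ab(3)] by (auto dest: symD)
  hence "(a, b) \<in> Rl\<^sup>*" using root[of a] edgeD[OF ab(3)] by (auto intro: rtrancl_trans)
  then obtain xs where xs: "xs \<noteq> []" "distinct xs" "hd xs = a" "last xs = b" "steps xs \<subseteq> Rl"
   by (rule rtrancl_distinct_path)
  have st: "{c, d} \<in> T" if "(c, d) \<in> steps xs" for c d using xs(5) that by (auto simp: Rl_def)
  \<comment> \<open>A tree path with one vertex would make \<open>e\<close> a loop, one with two
    vertices would make \<open>e\<close> a tree edge.\<close>
  have "3 \<le> length xs"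
  proof (rule ccontr)
   assume "\<not> ?thesis"
   moreover have "length xs \<noteq> 0" using xs(1) by simp
   ultimately have "length xs = 1 \<or> length xs = 2" by linarith
   then consider "xs = [a]" "a = b" | "xs = [a, b]" using xs(3,4) by (auto simp: length_Suc_conv eval_nat_numeral)
   thus False using ab st e by cases (auto simp: J_def)
  qed
  hence "is_cycle xs" using xs ab st TE unfolding is_cycle_def cyc_darts_def by (auto simp: insert_commute)
  thus ?thesis using xs ab st by (intro exI[of _ xs]) (auto simp: insert_commute)
 qed
 then obtain cy where cy: "\<And>e. e \<in> J \<Longrightarrow> is_cycle (cy e) \<and> {last (cy e), hd (cy e)} = e \<and> (\<forall>(a, b)\<in>steps (cy e). {a, b} \<in> T)"
  by metis
 have inv: "side (cy e) d' = side (cy e) d" if e: "e \<in> J" and d: "d \<in> darts E" "d' \<in> m.face d" for e d d'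
  using d(2)
 proof (induction rule: orbit.induct)
  case base
  thus ?case using side_step[of "cy e" "fst d" "snd d"] cy[OF e] d(1) by (cases d) auto
 next
  case (step d')
  have "d' \<in> darts E" using m.face_D[OF d(1)] step.hyps by auto
  thus ?case using side_step[of "cy e" "fst d'" "snd d'"] cy[OF e] step.IH by (cases d') auto
 qed
 let ?\<Phi> = "\<lambda>d. \<lambda>j. if j \<in> J then side (cy j) d else 0"
 have "E \<noteq> {}" using m.cardE m.cardV by auto
 then obtain e0 where "e0 \<in> E" by auto
 then obtain a0 b0 where "{a0, b0} \<in> E" by (rule m.edgeE)
 hence "(a0, b0) \<in> darts E" by simp
 hence Dne: "darts E \<noteq> {}" by blast
 have "card J + 1 \<le> card (?\<Phi> ` darts E)"
 proof (rule card_separated[OF m.finD Dne finJ])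
  fix e assume e: "e \<in> J"
  let ?a = "last (cy e)" and ?b = "hd (cy e)"
  have c: "is_cycle (cy e)" "{?a, ?b} = e" using cy[OF e] by auto
  have ab: "{?a, ?b} \<in> E" "{?b, ?a} \<in> E" using c(2) e by (auto simp: J_def insert_commute)
  have d1: "(?a, ?b) \<in> cyc_darts (cy e)" by (simp add: cyc_darts_def)
  have d2: "(?b, ?a) \<notin> cyc_darts (cy e)"
   using last_hd_not_step[of "cy e" ?b ?a] c(1) edgeD(1)[OF ab(1)] by (auto simp: cyc_darts_def is_cycle_def insert_commute)
  have "side (cy k) (?a, ?b) = side (cy k) (?b, ?a)" if k: "k \<in> J" "k \<noteq> e" for k
  proof -
   have "(x, y) \<notin> cyc_darts (cy k)" if "{x, y} = e" for x y
    using cy[OF k(1)] k(2) that e unfolding cyc_darts_def J_def by auto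
   hence "(?a, ?b) \<notin> cyc_darts (cy k)" "(?b, ?a) \<notin> cyc_darts (cy k)" using c(2) by (auto simp: insert_commute)
   thus ?thesis using side_rev[OF ab(1)] by simp
  qed
  moreover have "side (cy e) (?a, ?b) \<noteq> side (cy e) (?b, ?a)" using d1 d2 by (simp add: side_def)
  ultimately show "\<exists>d\<in>darts E. \<exists>d'\<in>darts E. side (cy e) d \<noteq> side (cy e) d' \<and> (\<forall>k\<in>J. k \<noteq> e \<longrightarrow> side (cy k) d = side (cy k) d')"
   using ab by (intro bexI[of _ "(?a, ?b)"] bexI[of _ "(?b, ?a)"]) auto
 qed
 moreover have "card (?\<Phi> ` darts E) \<le> card (m.face ` darts E)"
 proof -
  have eq: "?\<Phi> d = ?\<Phi> (SOME d'. d' \<in> m.face d)" if d: "d \<in> darts E" for d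
  proof -
   have "(SOME d'. d' \<in> m.face d) \<in> m.face d" using m.face_self[OF d] by (rule someI)
   hence "side (cy e) (SOME d'. d' \<in> m.face d) = side (cy e) d" if "e \<in> J" for e by (rule inv[OF that d])
   thus ?thesis by fastforce
  qed
  have "?\<Phi> ` darts E = (\<lambda>Q. ?\<Phi> (SOME d'. d' \<in> Q)) ` (m.face ` darts E)"
   unfolding image_image by (rule image_cong) (use eq in auto)
  thus ?thesis using card_image_le[of "m.face ` darts E" "\<lambda>Q. ?\<Phi> (SOME d'. d' \<in> Q)"] m.finD by simp
 qed
 ultimately show "card E + 2 \<le> card {Q. is_face E \<rho> Q} + card V" using cJ unfolding m.faces_eq by linarith
qed

subsection \<open>The faces of a straight-line embedding\<close>

lemma last_exit_linepath:
 fixes x y :: complex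
 assumes "x \<noteq> y"
 shows "\<forall>\<^sub>F r in at_right 0. last_exit (linepath x y) r - x = of_real (r / cmod (y - x)) * (y - x) \<and> 0 < r / cmod (y - x)"
proof -
 define l where "l = cmod (y - x)"
 have l: "0 < l" using assms by (simp add: l_def)
 have e: "linepath x y t - x = of_real t * (y - x)" for t
  by (simp add: linepath_def scaleR_conv_of_real algebra_simps)
 have d: "dist (linepath x y 0) (linepath x y t) = t * l" if "0 \<le> t" for t
 proof -
  have "linepath x y 0 = x" by (simp add: linepath_def)
  hence "dist (linepath x y 0) (linepath x y t) = cmod (linepath x y t - x)" by (simp add: dist_norm norm_minus_commute)
  thus ?thesis unfolding e using that by (simp add: norm_mult l_def)
 qed
 have "\<forall>\<^sub>F r in at_right 0. 0 < r \<and> r < l" using l unfolding eventually_at_right_field by blast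
 thus ?thesis
 proof eventually_elim
  case (elim r)
  have "{t \<in> {0..1}. dist (linepath x y 0) (linepath x y t) \<le> r} = {0..r / l}"
  proof (intro set_eqI iffI)
   fix t assume "t \<in> {t \<in> {0..1}. dist (linepath x y 0) (linepath x y t) \<le> r}"
   thus "t \<in> {0..r / l}" using d[of t] l by (auto simp: pos_le_divide_eq)
  next
   fix t assume t: "t \<in> {0..r / l}"
   hence "t * l \<le> r" using l by (auto simp: pos_le_divide_eq)
   moreover have "r / l \<le> 1" using elim l by (simp add: pos_divide_le_eq)
   ultimately show "t \<in> {t \<in> {0..1}. dist (linepath x y 0) (linepath x y t) \<le> r}" using t d[of t] by auto
  qed
  moreover have "0 < r / l" using elim l by simp
  ultimately have "last_exit (linepath x y) r = linepath x y (r / l)" by (simp add: last_exit_def)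
  thus ?case using e[of "r / l"] \<open>0 < r / l\<close> by (simp add: l_def)
 qed
qed

section \<open>The curve of a face and its right-hand side\<close>

locale realized3 = realized +
 assumes n3: "3 \<le> card V"
begin

abbreviation L :: "'a \<Rightarrow> 'a \<Rightarrow> real \<Rightarrow> complex" where "L u v \<equiv> linepath (p u) (p v)"

text \<open>Every vertex has an edge, and that edge meets \<open>{a, b}\<close> in common ends only;
  so the non-crossing of edges also keeps vertices off edges.\<close>

lemma vertex_on_edge:
 assumes "{a, b} \<in> E" "c \<in> V" "p c \<in> closed_segment (p a) (p b)" shows "c = a \<or> c = b"
proof (rule ccontr)
 assume n: "\<not> ?thesis"
 obtain d where d: "{c, d} \<in> E" using degree_ge_2[OF n3 assms(2)] by blast
 have "{a, b} \<noteq> {c, d}" using n by auto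
 hence "edge_segment p {a, b} \<inter> edge_segment p {c, d} = p ` ({a, b} \<inter> {c, d})" by (rule noncross[OF assms(1) d])
 hence "p c \<in> p ` ({a, b} \<inter> {c, d})" using assms(3) unfolding edge_segment_pair by auto
 hence "p c = p a \<or> p c = p b" by auto
 thus False using n p_eq assms(2) edgeD[OF assms(1)] by auto
qed

lemma seg_meet: assumes "{a, b} \<in> E" "{c, d} \<in> E" "{a, b} \<noteq> {c, d}"
 shows "closed_segment (p a) (p b) \<inter> closed_segment (p c) (p d) = p ` ({a, b} \<inter> {c, d})"
 using noncross[OF assms] unfolding edge_segment_pair .

lemma drawing: "drawing V E p L"
proof
 show "simple_graph V E" by (rule simple)
 have "path_image (L u v) \<inter> p ` V = {p u, p v}" if "{u, v} \<in> E" for u v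
  using vertex_on_edge[OF that] edgeD[OF that] by auto
 thus "noncrossing_drawing V E p L"
  unfolding noncrossing_drawing_def using p_inj p_eq edgeD seg_meet by (auto simp: arc_linepath)
qed

sublocale dr: drawing V E p L by (rule drawing)

abbreviation P where "P \<equiv> drawn_points V E p"

lemma P_eq: "P = (\<Union>(a, b)\<in>D. closed_segment (p a) (p b))"
proof
 show "P \<subseteq> (\<Union>(a, b)\<in>D. closed_segment (p a) (p b))"
 proof
  fix z assume "z \<in> P"
  then consider v where "v \<in> V" "z = p v" | e where "e \<in> E" "z \<in> edge_segment p e" by (auto simp: drawn_points_def)
  thus "z \<in> (\<Union>(a, b)\<in>D. closed_segment (p a) (p b))"
  proof cases
   case 1
   obtain d where "{v, d} \<in> E" using degree_ge_2[OF n3 1(1)] by blast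
   thus ?thesis using 1(2) by (intro UN_I[of "(v, d)"]) auto
  next
   case 2
   obtain a b where "e = {a, b}" "{a, b} \<in> E" using edgeE[OF 2(1)] by metis
   thus ?thesis using 2(2) edge_segment_pair[of a b] by (intro UN_I[of "(a, b)"]) auto
  qed
 qed
 show "(\<Union>(a, b)\<in>D. closed_segment (p a) (p b)) \<subseteq> P"
  using edge_segment_pair by (fastforce simp: drawn_points_def)
qed

lemma seg_P: "{a, b} \<in> E \<Longrightarrow> closed_segment (p a) (p b) \<subseteq> P"
 unfolding P_eq by (rule subsetI, rule UN_I[of "(a, b)"]) auto

lemma vertex_P: "v \<in> V \<Longrightarrow> p v \<in> P"
 by (simp add: drawn_points_def)

lemma compact_P: "compact P"
 unfolding P_eq using finD by (intro compact_UN) auto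

lemma closed_P: "closed P" using compact_P by (rule compact_imp_closed)

lemma fst_inj: assumes "d \<in> D" "(a, b) \<in> face d" "(a, c) \<in> face d" shows "b = c"
proof -
 have "inj_on fst (face d)" using real is_face_iff assms(1) by (auto simp: realization_def)
 thus ?thesis using inj_onD[of fst "face d" "(a, b)" "(a, c)"] assms(2,3) by simp
qed

text \<open>Injectivity of \<open>fst\<close>, carried along in \<open>realization\<close>, makes
  the tails along the orbit distinct, so the boundary of a face is a simple closed curve.\<close>

lemma ex_face_cycle:
 assumes d: "d \<in> D" shows "\<exists>xs. dr.is_cycle xs \<and> dr.cyc_darts xs = face d"
proof -
 obtain m where m: "0 < m" "(f ^^ m) d = d" "inj_on (\<lambda>k. (f ^^ k) d) {..<m}" "face d = (\<lambda>k. (f ^^ k) d) ` {..<m}"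
  using orbit_list[OF face_self[OF d]] by blast
 have "inj_on fst (face d)" using real is_face_iff d by (auto simp: realization_def)
 hence i: "inj_on (\<lambda>k. fst ((f ^^ k) d)) {..<m}"
  using comp_inj_on[OF m(3), of fst] unfolding m(4) by (simp add: comp_def)
 have "card (face d) = m" unfolding m(4) using card_image[OF m(3)] by simp
 hence m3: "3 \<le> m" using face_card_ge_3[OF degree_ge_2[OF n3] d] by simp
 define xs where "xs = map (\<lambda>k. fst ((f ^^ k) d)) [0..<m]"
 have pr: "(f ^^ k) d = (fst ((f ^^ k) d), fst ((f ^^ Suc k) d))" for k
  by (cases "(f ^^ k) d") simp
 have len: "length xs = m" and nth: "\<And>k. k < m \<Longrightarrow> xs ! k = fst ((f ^^ k) d)" by (auto simp: xs_def)
 have ne: "xs \<noteq> []" using len m3 by auto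
 have dist: "distinct xs" using i by (auto simp: xs_def distinct_map atLeast_upt[symmetric] lessThan_atLeast0)
 have st: "steps xs = (\<lambda>k. (f ^^ k) d) ` {..<m - 1}"
 proof (intro set_eqI iffI)
  fix y assume "y \<in> steps xs"
  then obtain i where "Suc i < m" "y = (xs ! i, xs ! Suc i)" using steps_nth[of "fst y" "snd y" xs] len by (cases y) auto
  hence "y = (f ^^ i) d" "i < m - 1" using nth[of i] nth[of "Suc i"] pr[of i] by auto
  thus "y \<in> (\<lambda>k. (f ^^ k) d) ` {..<m - 1}" by blast
 next
  fix y assume "y \<in> (\<lambda>k. (f ^^ k) d) ` {..<m - 1}"
  then obtain i where "i < m - 1" "y = (f ^^ i) d" by auto
  hence "Suc i < m" "y = (xs ! i, xs ! Suc i)" using nth[of i] nth[of "Suc i"] pr[of i] by auto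
  thus "y \<in> steps xs" using steps_nth[of "xs ! i" "xs ! Suc i" xs] len by auto
 qed
 have "last xs = fst ((f ^^ (m - 1)) d)" using ne nth[of "m - 1"] m(1) len by (simp add: last_conv_nth)
 moreover have "hd xs = fst ((f ^^ Suc (m - 1)) d)" using ne nth[of 0] m(1,2) len by (simp add: hd_conv_nth)
 ultimately have lh: "(last xs, hd xs) = (f ^^ (m - 1)) d" using pr[of "m - 1"] by metis
 have "{..<m} = insert (m - 1) {..<m - 1}" using m(1) by auto
 hence cd: "dr.cyc_darts xs = face d" unfolding dr.cyc_darts_def lh st m(4) by auto
 moreover have "dr.is_cycle xs" unfolding dr.is_cycle_def cd using face_D[OF d] len m3 dist by auto
 ultimately show ?thesis by blast
qed

definition fcyc :: "('a \<times> 'a) set \<Rightarrow> 'a list" where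
 "fcyc Q = (SOME xs. dr.is_cycle xs \<and> dr.cyc_darts xs = Q)"

abbreviation loop where "loop Q \<equiv> dr.cyc_loop (fcyc Q)"

definition curve :: "('a \<times> 'a) set \<Rightarrow> complex set" where
 "curve Q = (\<Union>(a, b)\<in>Q. closed_segment (p a) (p b))"

text \<open>The side of the face curve to the right of its darts. Being given by a winding number,
  it can be treated before it is known whether it is the inside or the outside of the curve.\<close>

definition comp :: "('a \<times> 'a) set \<Rightarrow> complex set" where
 "comp Q = {z. z \<notin> curve Q \<and> winding_number (loop Q) z = right_winding (loop Q)}"

lemma fcyc: assumes "d \<in> D"
 shows "dr.is_cycle (fcyc (face d))" "dr.cyc_darts (fcyc (face d)) = face d" "dr.cyc_curve (fcyc (face d)) = curve (face d)"
proof -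
 have "dr.is_cycle (fcyc (face d)) \<and> dr.cyc_darts (fcyc (face d)) = face d"
  unfolding fcyc_def by (rule someI_ex[OF ex_face_cycle[OF assms]])
 thus "dr.is_cycle (fcyc (face d))" "dr.cyc_darts (fcyc (face d)) = face d" "dr.cyc_curve (fcyc (face d)) = curve (face d)"
  by (auto simp: dr.cyc_curve_def curve_def)
qed

lemma loop: assumes "d \<in> D"
 shows "simple_path (loop (face d))" "pathfinish (loop (face d)) = pathstart (loop (face d))"
  "path_image (loop (face d)) = curve (face d)"
 using dr.cycle_loop[OF fcyc(1)[OF assms]] fcyc(3)[OF assms] by auto

lemma jordan: assumes "d \<in> D"
 shows "inside (curve (face d)) \<noteq> {}" "open (inside (curve (face d)))" "connected (inside (curve (face d)))"
  "open (outside (curve (face d)))" "connected (outside (curve (face d)))"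
  "bounded (inside (curve (face d)))" "\<not> bounded (outside (curve (face d)))"
  "frontier (inside (curve (face d))) = curve (face d)" "frontier (outside (curve (face d))) = curve (face d)"
 using Jordan_inside_outside[OF loop(1,2)[OF assms]] unfolding loop(3)[OF assms] by simp_all

lemma comp_cases: assumes d: "d \<in> D"
 shows "comp (face d) = inside (curve (face d)) \<or> comp (face d) = outside (curve (face d))"
proof -
 let ?C = "curve (face d)" and ?g = "loop (face d)"
 note l = loop[OF d]
 have ne: "inside ?C \<noteq> {}" and un: "inside ?C \<union> outside ?C = - ?C" and no: "inside ?C \<inter> ?C = {}" "outside ?C \<inter> ?C = {}"
  using Jordan_inside_outside[OF l(1,2)] inside_no_overlap outside_no_overlap unfolding l(3) by auto
 have io: "z \<in> inside ?C \<or> z \<in> outside ?C" if "z \<notin> ?C" for z using un that by blast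
 have no': "z \<notin> ?C" if "z \<in> inside ?C \<or> z \<in> outside ?C" for z using no that by blast
 have o: "winding_number ?g z = 0" if "z \<in> outside ?C" for z
  using winding_number_zero_in_outside[OF simple_path_imp_path[OF l(1)] l(2)] that unfolding l(3) .
 show ?thesis
 proof (cases rule: simple_closed_path_winding_number_inside[OF l(1)])
  case 1
  hence i: "\<And>z. z \<in> inside ?C \<Longrightarrow> winding_number ?g z = 1" unfolding l(3) by blast
  moreover obtain z0 where "z0 \<in> inside ?C" "z0 \<notin> ?C" using ne no by blast
  ultimately have "right_winding ?g = 0" unfolding right_winding_def l(3) by auto
  hence "z \<in> comp (face d) \<longleftrightarrow> z \<in> outside ?C" for z
   using i[of z] o[of z] io[of z] no'[of z] by (auto simp: comp_def)
  hence "comp (face d) = outside ?C" by blast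
  thus ?thesis ..
 next
  case 2
  hence i: "\<And>z. z \<in> inside ?C \<Longrightarrow> winding_number ?g z = -1" unfolding l(3) by blast
  have "winding_number ?g z \<noteq> 1" if "z \<notin> ?C" for z using i[of z] o[of z] io[OF that] by auto
  hence "right_winding ?g = -1" unfolding right_winding_def l(3) by auto
  hence "z \<in> comp (face d) \<longleftrightarrow> z \<in> inside ?C" for z
   using i[of z] o[of z] io[of z] no'[of z] by (auto simp: comp_def)
  hence "comp (face d) = inside ?C" by blast
  thus ?thesis ..
 qed
qed

lemma comp_conn:
 assumes "d \<in> D" "connected S" "S \<inter> curve (face d) = {}" "x \<in> S" "y \<in> S" "x \<in> comp (face d)" shows "y \<in> comp (face d)"
proof -
 note l = loop[OF assms(1)]
 have "winding_number (loop (face d)) x = winding_number (loop (face d)) y"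
  by (rule winding_number_eq[OF simple_path_imp_path[OF l(1)] l(2) assms(4,5,2)]) (use assms(3) l(3) in simp)
 thus ?thesis using assms by (auto simp: comp_def)
qed

lemma curve_P: "d \<in> D \<Longrightarrow> curve (face d) \<subseteq> P"
 using face_D[of d] unfolding curve_def P_eq by fast

lemma ex_pred: assumes "d \<in> D" "(b, s) \<in> face d" obtains t where "(t, b) \<in> face d" "\<rho> b t = s"
proof -
 have c: "f ` face d \<subseteq> face d" by (rule image_subsetI) (rule orbit.step)
 have "f ` face d = face d" by (rule f_image[OF face_D[OF assms(1)] c])
 then obtain y where "y \<in> face d" "(b, s) = f y" using assms(2) by blast
 obtain t b' where y: "y = (t, b')" by (cases y)
 hence "b' = b" "\<rho> b t = s" using \<open>(b, s) = f y\<close> by simp_all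
 thus thesis using that[of t] y \<open>y \<in> face d\<close> by simp
qed

text \<open>Which side of the two face edges at \<open>b\<close> a ray from \<open>p b\<close> starts into decides whether it starts in the face.\<close>

lemma corner_side:
 assumes tb: "{t, b} \<in> E" and z: "z \<noteq> p b" "closed_segment (p b) z \<inter> curve (face (t, b)) \<subseteq> {p b, z}"
 shows "midpoint (p b) z \<in> comp (face (t, b)) \<longleftrightarrow> ccw_angle (p t - p b) (z - p b) < corner p \<rho> t b"
proof -
 define s where "s = \<rho> b t"
 let ?Q = "face (t, b)"
 have d: "(t, b) \<in> D" using tb by simp
 have bt: "{b, t} \<in> E" using tb by (simp add: insert_commute)
 have bs: "{b, s} \<in> E" using rho_in[OF bt] by (simp add: s_def)
 have tQ: "(t, b) \<in> ?Q" by (rule face_self[OF d])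
 have sQ: "(b, s) \<in> ?Q" using orbit.step[OF tQ] by (simp add: s_def)
 note fc = fcyc[OF d]
 have "fcyc ?Q \<noteq> []" using fc(1) by (auto simp: dr.is_cycle_def)
 moreover have "(t, b) \<in> dr.cyc_darts (fcyc ?Q)" unfolding fc(2) by (rule tQ)
 ultimately have "b \<in> set (fcyc ?Q)" using dr.cyc_darts_set by blast
 then obtain s' rest where ys: "dr.is_cycle (b # s' # rest)" "rest \<noteq> []" "dr.cyc_darts (b # s' # rest) = ?Q"
  using dr.rotate_cycle[OF fc(1)] fc(2) by metis
 have "(b, s') \<in> ?Q" using ys(2,3) by (auto simp: dr.cyc_darts_def)
 hence s': "s' = s" using fst_inj[OF d] sQ by blast
 let ?ys = "b # s # rest"
 have lQ: "(last rest, b) \<in> ?Q" using ys(2,3) by (auto simp: dr.cyc_darts_def)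
 hence "(b, \<rho> b (last rest)) \<in> ?Q" using orbit.step[OF lQ] by simp
 hence "\<rho> b (last rest) = s" using fst_inj[OF d] sQ by blast
 hence "f (last rest, b) = f (t, b)" by (simp add: s_def)
 hence lt: "last rest = t" using inj_onD[OF f_inj, of "(last rest, b)" "(t, b)"] lQ face_D[OF d] d by blast
 have ys: "dr.is_cycle ?ys" "dr.cyc_darts ?ys = ?Q" using ys s' by auto
 note cg = dr.cyc_darts_cong[OF fc(1) ys(1), unfolded fc(2) ys(2), OF refl, unfolded fc(3)]
 let ?q = "linepath (p b) z"
 have aq: "arc ?q" using z by (simp add: arc_linepath)
 have sub: "path_image ?q \<inter> dr.cyc_curve ?ys \<subseteq> {p b, ?q 1}"
 proof -
  have "?q 1 = z" by (simp add: linepath_def)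
  thus ?thesis using z(2) cg(1) by simp
 qed
 have q0: "?q 0 = p b" by (simp add: linepath_def)
 have m: "?q (1/2) = midpoint (p b) z" by (simp add: linepath_def midpoint_def scaleR_conv_of_real algebra_simps)
 have ne: "p b \<noteq> p t" "p b \<noteq> p s" using dir_nz[OF bt] dir_nz[OF bs] by auto
 obtain r where r: "winding_number (dr.cyc_loop ?ys) (?q (1/2)) =
  (if ccw_angle (last_exit (L b t) r - p b) (last_exit ?q r - p b) < ccw_angle (last_exit (L b t) r - p b) (last_exit (L b s) r - p b)
   then right_winding (dr.cyc_loop ?ys) else right_winding (dr.cyc_loop ?ys) + 1)"
  and r1: "last_exit ?q r - p b = of_real (r / cmod (z - p b)) * (z - p b) \<and> 0 < r / cmod (z - p b)"
  and r2: "last_exit (L b t) r - p b = of_real (r / cmod (p t - p b)) * (p t - p b) \<and> 0 < r / cmod (p t - p b)"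
  and r3: "last_exit (L b s) r - p b = of_real (r / cmod (p s - p b)) * (p s - p b) \<and> 0 < r / cmod (p s - p b)"
  using eventually_happens'[OF _ eventually_conj[OF dr.side_local[OF ys(1) \<open>rest \<noteq> []\<close> aq q0 sub, unfolded lt]
    eventually_conj[OF last_exit_linepath[OF z(1)[symmetric]] eventually_conj[OF last_exit_linepath[OF ne(1)] last_exit_linepath[OF ne(2)]]]]]
  by (auto simp: trivial_limit_at_right_real)
 have a: "ccw_angle (last_exit (L b t) r - p b) (last_exit ?q r - p b) = ccw_angle (p t - p b) (z - p b)"
  using r1 r2 by (simp only: ccw_angle_scale)
 have b: "ccw_angle (last_exit (L b t) r - p b) (last_exit (L b s) r - p b) = corner p \<rho> t b"
  using r3 r2 unfolding corner_def s_def by (simp only: ccw_angle_scale)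
 have "midpoint (p b) z \<notin> curve ?Q"
 proof
  assume "midpoint (p b) z \<in> curve ?Q"
  moreover have "midpoint (p b) z \<in> closed_segment (p b) z" by simp
  ultimately have "midpoint (p b) z \<in> {p b, z}" using z(2) by blast
  thus False using z(1) by auto
 qed
 thus ?thesis using r cg(2)[of "midpoint (p b) z"] cg(3) unfolding a b m comp_def by (auto split: if_splits)
qed

lemma on_curve_vertex:
 assumes d: "d \<in> D" and "{b, y} \<in> E" "(b, y) \<notin> face d" "(y, b) \<notin> face d" "z \<in> closed_segment (p b) (p y)" "z \<in> curve (face d)"
 shows "\<exists>c s. c \<in> {b, y} \<and> z = p c \<and> (c, s) \<in> face d"
proof -
 obtain c c' where c: "(c, c') \<in> face d" "z \<in> closed_segment (p c) (p c')" using assms(6) by (auto simp: curve_def)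
 have cE: "{c, c'} \<in> E" using face_D[OF d] c(1) by auto
 have "{b, y} \<noteq> {c, c'}" using assms(3,4) c(1) by (auto simp: doubleton_eq_iff)
 hence "z \<in> p ` ({b, y} \<inter> {c, c'})" using seg_meet[OF assms(2) cE] assms(5) c(2) by blast
 moreover have "(c', \<rho> c' c) \<in> face d" using orbit.step[OF c(1)] by simp
 ultimately show ?thesis using c(1) by auto
qed

text \<open>The face arrives at \<open>b\<close> from \<open>t\<close> with
  \<open>\<rho> b t = s\<close>, so by \<open>next_le\<close> no edge at \<open>b\<close> points
  into the corner, and by \<open>corner_side\<close> no edge starts into the face there. It cannot
  enter the face later either, since it meets the curve only in its ends.\<close>

lemma comp_seg:
 assumes d: "d \<in> D" and bs: "(b, s) \<in> face d" and by': "{b, y} \<in> E"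
 shows "closed_segment (p b) (p y) \<inter> comp (face d) = {}"
proof (cases "(b, y) \<in> face d \<or> (y, b) \<in> face d")
 case True
 hence "closed_segment (p b) (p y) \<subseteq> curve (face d)"
 proof
  assume "(b, y) \<in> face d" thus ?thesis unfolding curve_def by blast
 next
  assume "(y, b) \<in> face d"
  hence "closed_segment (p y) (p b) \<subseteq> curve (face d)" unfolding curve_def by blast
  thus ?thesis by (simp only: closed_segment_commute)
 qed
 thus ?thesis by (auto simp: comp_def)
next
 case False
 obtain t where t: "(t, b) \<in> face d" "\<rho> b t = s" using ex_pred[OF d bs] .
 have tE: "{t, b} \<in> E" using face_D[OF d] t(1) by auto
 have bt: "{b, t} \<in> E" using tE by (simp add: insert_commute)
 have Q: "face (t, b) = face d" by (rule face_eq[OF d t(1)])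
 have sub: "closed_segment (p b) (p y) \<inter> curve (face d) \<subseteq> {p b, p y}"
  using on_curve_vertex[OF d by'] False by blast
 have m: "midpoint (p b) (p y) \<notin> comp (face d)"
  using corner_side[OF tE, of "p y"] dir_nz[OF by'] sub next_le[OF bt by'] unfolding Q by force
 show ?thesis
 proof (rule ccontr)
  assume "\<not> ?thesis"
  then obtain z where z: "z \<in> closed_segment (p b) (p y)" "z \<in> comp (face d)" by blast
  then obtain \<tau> where tau: "0 \<le> \<tau>" "\<tau> \<le> 1" "z = linepath (p b) (p y) \<tau>" by (auto simp: linepath_image_01[symmetric])
  have zc: "z \<notin> curve (face d)" using z(2) by (simp add: comp_def)
  have bc: "p b \<in> curve (face d)" using bs by (force simp: curve_def)
  have l0: "linepath (p b) (p y) 0 = p b" "linepath (p b) (p y) 1 = p y" by (simp_all add: linepath_def)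
  have t0: "0 < \<tau>" using tau zc bc l0 by (cases "\<tau> = 0") auto
  have inj: "inj_on (linepath (p b) (p y)) {0..1}" using dir_nz[OF by'] by (intro inj_on_linepath) auto
  let ?S = "linepath (p b) (p y) ` {min \<tau> (1/2)..max \<tau> (1/2)}"
  have "connected ?S" by (intro connected_continuous_image continuous_on_linepath) auto
  moreover have "?S \<inter> curve (face d) = {}"
  proof -
   have "linepath (p b) (p y) k \<notin> curve (face d)" if k: "min \<tau> (1/2) \<le> k" "k \<le> max \<tau> (1/2)" for k
   proof
    assume a: "linepath (p b) (p y) k \<in> curve (face d)"
    have k01: "k \<in> {0..1}" "0 < k" using k tau t0 by (auto simp: min_def max_def split: if_splits)
    have "linepath (p b) (p y) k \<in> closed_segment (p b) (p y)" using k01 linepath_image_01 by blast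
    hence "linepath (p b) (p y) k = linepath (p b) (p y) 0 \<or> linepath (p b) (p y) k = linepath (p b) (p y) 1"
     using sub a l0 by auto
    hence "k = 1" using inj_onD[OF inj, of k 0] inj_onD[OF inj, of k 1] k01 by auto
    hence "\<tau> = 1" using k tau by (auto simp: max_def split: if_splits)
    thus False using a \<open>k = 1\<close> zc tau by simp
   qed
   thus ?thesis by auto
  qed
  moreover have "z \<in> ?S" using tau by auto
  moreover have "midpoint (p b) (p y) \<in> ?S"
   by (intro image_eqI[of _ _ "1/2"]) (auto simp: linepath_def midpoint_def scaleR_conv_of_real algebra_simps)
  ultimately show False using comp_conn[OF d] z(2) m by blast
 qed
qed

text \<open>Lying outside the face is passed on from vertex to vertex: from a vertex on the curve by
  \<open>comp_seg\<close>, and between two vertices off the curve because their edge misses it.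
  Connectedness of the graph does the rest.\<close>

lemma comp_P: assumes d: "d \<in> D" shows "comp (face d) \<inter> P = {}"
proof -
 let ?on = "\<lambda>c. \<exists>s. (c, s) \<in> face d"
 have free: "p c' \<notin> comp (face d) \<and> closed_segment (p c) (p c') \<inter> comp (face d) = {}"
  if e: "{c, c'} \<in> E" "\<not> ?on c" "\<not> ?on c'" "p c \<notin> comp (face d)" for c c'
 proof -
  have i: "closed_segment (p c) (p c') \<inter> curve (face d) = {}" using on_curve_vertex[OF d e(1)] e(2,3) by blast
  have "closed_segment (p c) (p c') \<inter> comp (face d) = {}"
   using comp_conn[OF d connected_segment(1) i, of _ "p c"] e(4) by auto
  thus ?thesis by auto
 qed
 let ?S = "{c\<in>V. ?on c \<or> p c \<notin> comp (face d)}"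
 have SV: "?S = V"
 proof (rule ccontr)
  assume "?S \<noteq> V"
  hence psub: "?S \<subset> V" by auto
  have ne: "?S \<noteq> {}"
  proof -
   have "fst d \<in> V" "(fst d, snd d) \<in> face d" using face_self[OF d] d edgeD(2)[of "fst d" "snd d"] by (auto simp: darts_def)
   thus ?thesis by blast
  qed
  obtain y z where yz: "y \<in> ?S" "z \<in> V - ?S" "{y, z} \<in> E" using connected[OF psub ne] by blast
  show False
  proof (cases "?on y")
   case True thus ?thesis using comp_seg[OF d _ yz(3)] yz(2) by auto
  next
   case False thus ?thesis using free[OF yz(3)] yz by auto
  qed
 qed
 have "closed_segment (p c) (p c') \<inter> comp (face d) = {}" if e: "{c, c'} \<in> E" for c c'
 proof -
  have e': "{c', c} \<in> E" using e by (simp add: insert_commute)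
  consider "?on c" | "?on c'" | "\<not> ?on c" "\<not> ?on c'" by blast
  thus ?thesis
  proof cases
   case 1 thus ?thesis using comp_seg[OF d _ e] by blast
  next
   case 2 thus ?thesis using comp_seg[OF d _ e'] closed_segment_commute by blast
  next
   case 3
   have "c \<in> ?S" using SV edgeD(2)[OF e] by simp
   thus ?thesis using free[OF e] 3 by simp
  qed
 qed
 thus ?thesis unfolding P_eq by fastforce
qed

end

lemma convex_cross_less: "convex {z. cross m (z - x) < 0}"
proof -
 have "{z. cross m (z - x) < 0} = {z. (Complex (- Im m) (Re m)) \<bullet> z < (Complex (- Im m) (Re m)) \<bullet> x}"
  by (auto simp: cross_def inner_complex_def algebra_simps)
 thus ?thesis using convex_halfspace_lt[of "Complex (- Im m) (Re m)" "(Complex (- Im m) (Re m)) \<bullet> x"] by simp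
qed

lemma cross_turn: "cross (of_real s * d - of_real e * \<i> * d) d = e * (cmod d)\<^sup>2"
 by (simp add: cross_def cmod_power2) (simp add: power2_eq_square algebra_simps)

section \<open>Faces and components of the complement\<close>

context realized3
begin

text \<open>The point is joined to \<open>p b\<close> by a segment leaving just clockwise of the
  edge. For small \<open>eps\<close> this segment meets the drawing only at \<open>p b\<close>, and
  its direction lies in the corner at \<open>b\<close> that ends with \<open>s\<close>. It therefore
  starts in the face and stays there.\<close>

lemma right_near:
 assumes bs: "{b, s} \<in> E" and \<sigma>: "0 < \<sigma>" "\<sigma> < 1"
 shows "\<forall>\<^sub>F eps in at_right 0. p b + of_real \<sigma> * (p s - p b) - of_real eps * \<i> * (p s - p b) \<in> comp (face (b, s))"
proof -
 define d where "d = p s - p b"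
 define v where "v eps = of_real \<sigma> * d - of_real eps * \<i> * d" for eps :: real
 define x where "x = p b + of_real \<sigma> * d"
 have dn: "d \<noteq> 0" using dir_nz[OF bs] by (simp add: d_def)
 have "s \<in> \<rho> b ` neighbours E b" using rho_surj[OF edgeD(2)[OF bs]] bs by simp
 then obtain t where t: "{b, t} \<in> E" "\<rho> b t = s" by auto
 have tb: "{t, b} \<in> E" using t(1) by (simp add: insert_commute)
 have Q: "face (t, b) = face (b, s)" using face_step_eq[of "(t, b)"] tb t(2) by simp
 have dD: "(t, b) \<in> D" using tb by simp
 obtain y where y: "y \<noteq> t" "{b, y} \<in> E" using degree_ge_2[OF n3 edgeD(2)[OF bs], of t] by blast
 have ts: "t \<noteq> s" using rho_ne_self[OF t(1) y(2)] y(1) t(2) by auto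
 define e where "e = p t - p b"
 have en: "e \<noteq> 0" using dir_nz[OF t(1)] by (simp add: e_def)
 have \<Theta>: "corner p \<rho> t b = ccw_angle e d" using t(2) by (simp add: corner_def d_def e_def)
 have nsd: "\<not> same_dir e d" using dist_dir[OF t(1) bs ts] by (simp add: d_def e_def)
 have lim0: "(v \<longlongrightarrow> of_real \<sigma> * d - of_real 0 * \<i> * d) (at_right 0)"
  unfolding v_def by (intro tendsto_intros)
 hence lim: "(v \<longlongrightarrow> of_real \<sigma> * d) (at_right 0)" by simp
 have sdn: "of_real \<sigma> * d \<noteq> 0" using \<sigma> dn by simp
 have csc: "ccw_angle (of_real \<sigma> * d) w = ccw_angle d w" "ccw_angle w (of_real \<sigma> * d) = ccw_angle w d" for w
  using ccw_angle_scale[of \<sigma> 1 d w] ccw_angle_scale[of 1 \<sigma> w d] \<sigma> by simp_all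
 have pos: "\<forall>\<^sub>F eps in at_right (0::real). 0 < eps" by (simp add: eventually_at_right_less)
 have ang: "\<forall>\<^sub>F eps in at_right 0. ccw_angle e (v eps) < ccw_angle e d + pi \<and> ccw_angle e d - pi < ccw_angle e (v eps)"
 proof -
  have "\<not> same_dir e (of_real \<sigma> * d)" using nsd by (simp add: same_dir_ccw csc)
  hence l: "((\<lambda>eps. ccw_angle e (v eps)) \<longlongrightarrow> ccw_angle e d) (at_right 0)"
   using tendsto_ccw_angle[OF tendsto_const lim en] by (simp add: csc)
  show ?thesis using order_tendstoD(1)[OF l, of "ccw_angle e d - pi"] order_tendstoD(2)[OF l, of "ccw_angle e d + pi"] pi_gt_zero
   by (simp add: eventually_conj_iff)
 qed
 have "\<forall>\<^sub>F eps in at_right 0. \<forall>(c, c')\<in>D. closed_segment (p b) (p b + v eps) \<inter> closed_segment (p c) (p c') \<subseteq> {p b}"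
 proof (rule eventually_ball_finite[OF finD], rule ballI)
  fix y assume "y \<in> D"
  then obtain c c' where cc: "y = (c, c')" "{c, c'} \<in> E" by (cases y) auto
  have star: "\<forall>\<^sub>F eps in at_right 0. closed_segment (p b) (p b + v eps) \<inter> closed_segment (p b) (p u) \<subseteq> {p b}" if u: "{b, u} \<in> E" for u
  proof -
   have un: "p u - p b \<noteq> 0" by (rule dir_nz[OF u])
   have "\<forall>\<^sub>F eps in at_right 0. \<not> same_dir (v eps) (p u - p b) \<and> v eps \<noteq> 0"
   proof -
    have vn: "\<forall>\<^sub>F eps in at_right 0. v eps \<noteq> 0" using tendsto_imp_eventually_ne[OF lim sdn] .
    have "\<forall>\<^sub>F eps in at_right 0. \<not> same_dir (v eps) (p u - p b)"
    proof (cases "u = s")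
     case True
     have "cross (v eps) d \<noteq> 0" if "0 < eps" for eps
     proof -
      have "cross (v eps) d = eps * (cmod d)\<^sup>2" unfolding v_def by (rule cross_turn)
      thus ?thesis using that dn by simp
     qed
     thus ?thesis using pos True by (auto elim!: eventually_mono intro!: not_same_dir_cross simp: d_def)
    next
     case False
     have ns: "\<not> same_dir d (p u - p b)" using dist_dir[OF bs u] False by (simp add: d_def)
     hence "((\<lambda>eps. ccw_angle (v eps) (p u - p b)) \<longlongrightarrow> ccw_angle d (p u - p b)) (at_right 0)"
      using tendsto_ccw_angle[OF lim tendsto_const sdn, of "p u - p b"] by (simp add: csc same_dir_ccw)
     moreover have "ccw_angle d (p u - p b) < 2 * pi" using ns ccw_angle_range(2)[of d "p u - p b"] by (simp add: same_dir_ccw)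
     ultimately have "\<forall>\<^sub>F eps in at_right 0. ccw_angle (v eps) (p u - p b) < 2 * pi" by (rule order_tendstoD(2))
     thus ?thesis by (rule eventually_mono) (simp add: same_dir_ccw)
    qed
    thus ?thesis using vn by (rule eventually_conj)
   qed
   thus ?thesis
   proof (rule eventually_mono)
    fix eps assume a: "\<not> same_dir (v eps) (p u - p b) \<and> v eps \<noteq> 0"
    show "closed_segment (p b) (p b + v eps) \<inter> closed_segment (p b) (p u) \<subseteq> {p b}"
     using segments_same_start[of "p b + v eps" "p b" "p u"] a un by simp
   qed
  qed
  have "\<forall>\<^sub>F eps in at_right 0. closed_segment (p b) (p b + v eps) \<inter> closed_segment (p c) (p c') \<subseteq> {p b}"
  proof (cases "b = c \<or> b = c'")
   case True
   thus ?thesis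
   proof
    assume "b = c" thus ?thesis using star[of c'] cc(2) by simp
   next
    assume "b = c'"
    have "{b, c} \<in> E" using cc(2) \<open>b = c'\<close> by (simp add: insert_commute)
    from star[OF this] show ?thesis unfolding \<open>b = c'\<close> by (simp only: closed_segment_commute[of "p c'" "p c"])
   qed
  next
   case False
   have "closed_segment (p b) (p b + of_real \<sigma> * d) \<inter> closed_segment (p c) (p c') = {}"
   proof (rule ccontr)
    assume "\<not> ?thesis"
    then obtain z where z: "z \<in> closed_segment (p b) (p b + of_real \<sigma> * d)" "z \<in> closed_segment (p c) (p c')" by blast
    obtain q where q: "0 \<le> q" "q \<le> 1" "z = (1 - q) *\<^sub>R p b + q *\<^sub>R (p b + of_real \<sigma> * d)" using z(1) by (auto simp: in_segment)
    have zq: "z = p b + of_real (q * \<sigma>) * d" unfolding q(3) by (simp add: scaleR_conv_of_real algebra_simps)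
    have "q * \<sigma> \<le> \<sigma>" using q(2) \<sigma>(1) by (metis mult_1 mult_right_mono less_imp_le)
    hence q1: "0 \<le> q * \<sigma>" "q * \<sigma> < 1" using q(1) \<sigma> by (simp, linarith)
    have "z \<in> closed_segment (p b) (p s)" unfolding in_segment
     by (rule exI[of _ "q * \<sigma>"]) (use q1 zq in \<open>auto simp: d_def scaleR_conv_of_real algebra_simps\<close>)
    moreover have "{b, s} \<noteq> {c, c'}" using False by auto
    ultimately have "z \<in> p ` ({b, s} \<inter> {c, c'})" using seg_meet[OF bs cc(2)] z(2) by blast
    hence "z = p s" using False by auto
    hence "p s = p b + of_real (q * \<sigma>) * d" using zq by simp
    hence "d = of_real (q * \<sigma>) * d" using d_def by (metis add_diff_cancel_left')
    hence "of_real (q * \<sigma>) = (1::complex)" using dn by simp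
    hence "q * \<sigma> = 1" by (simp only: of_real_eq_1_iff)
    thus False using q1 by simp
   qed
   hence "\<forall>\<^sub>F eps in at_right 0. closed_segment (p b) (p b + v eps) \<inter> closed_segment (p c) (p c') = {}"
    by (rule eventually_segments_disjoint) (intro tendsto_intros lim)+
   thus ?thesis by (rule eventually_mono) simp
  qed
  thus "\<forall>\<^sub>F eps in at_right 0. case y of (c, c') \<Rightarrow> closed_segment (p b) (p b + v eps) \<inter> closed_segment (p c) (p c') \<subseteq> {p b}"
   by (simp add: cc(1))
 qed
 thus ?thesis using ang pos
 proof eventually_elim
  case (elim eps)
  define z where "z = p b + v eps"
  have sP: "closed_segment (p b) z \<inter> P \<subseteq> {p b}" using elim(1) unfolding P_eq z_def by blast
  have cv: "cross (v eps) d = eps * (cmod d)\<^sup>2" unfolding v_def by (rule cross_turn)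
  hence cpos: "0 < cross (v eps) d" using elim(3) dn by simp
  hence vn: "v eps \<noteq> 0" by auto
  have zb: "z \<noteq> p b" using vn by (simp add: z_def)
  have B: "ccw_angle (v eps) d < pi" using ccw_angle_lt_pi[OF vn] cpos by simp
  \<comment> \<open>The turn from \<open>v eps\<close> to \<open>d\<close> is below pi, and the two
    angles seen from \<open>e\<close> differ by less than pi; so passing from one to the other
    involves no full turn.\<close>
  have "ccw_angle e (v eps) < ccw_angle e d"
   using ccw_angle_gap[OF en en vn] ccw_angle_gap[OF en en dn] ccw_angle_gap[OF en vn dn] B elim(2)
    Arg2pi_ge_0[of "v eps / e"] Arg2pi_ge_0[of "d / e"] ccw_angle_range(1)[of "v eps" d] nsd en
   by (auto simp: gap_def same_dir_def split: if_splits)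
  hence "midpoint (p b) z \<in> comp (face (t, b))"
   using corner_side[OF tb zb] sP curve_P[OF dD] unfolding \<Theta> by (auto simp: z_def e_def)
  moreover have "closed_segment (midpoint (p b) z) z \<inter> curve (face (t, b)) = {}"
  proof -
   have "closed_segment (midpoint (p b) z) z \<subseteq> closed_segment (p b) z" by (simp add: subset_closed_segment)
   moreover have "p b \<notin> closed_segment (midpoint (p b) z) z"
   proof
    assume "p b \<in> closed_segment (midpoint (p b) z) z"
    hence "dist (p b) z \<le> dist (midpoint (p b) z) z" using dist_in_closed_segment[of "p b" "midpoint (p b) z" z] by (simp add: dist_commute)
    moreover have "0 < dist (p b) z" using zb by simp
    ultimately show False by (simp add: dist_midpoint)
   qed
   ultimately show ?thesis using sP curve_P[OF dD] by blast
  qed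
  ultimately have "z \<in> comp (face (t, b))" using comp_conn[OF dD connected_segment(1)] by blast
  thus ?case unfolding Q z_def v_def d_def by (simp add: algebra_simps)
 qed
qed

text \<open>The half disc is convex and misses the curve, and \<open>right_near\<close> provides one
  of its points in the face.\<close>

lemma half_ball:
 assumes bs: "{b, s} \<in> E" and x: "x \<in> open_segment (p b) (p s)" and e: "0 < e" "ball x e \<inter> P \<subseteq> closed_segment (p b) (p s)"
  and z: "z \<in> ball x e" "cross (p s - p b) (z - p b) < 0"
 shows "z \<in> comp (face (b, s))"
proof -
 define d where "d = p s - p b"
 have dn: "d \<noteq> 0" using dir_nz[OF bs] by (simp add: d_def)
 obtain \<sigma> where \<sigma>: "0 < \<sigma>" "\<sigma> < 1" "x = (1 - \<sigma>) *\<^sub>R p b + \<sigma> *\<^sub>R p s" using x by (auto simp: in_segment)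
 have xs: "x = p b + of_real \<sigma> * d" unfolding \<sigma>(3) d_def by (simp add: scaleR_conv_of_real algebra_simps)
 have near: "\<forall>\<^sub>F eps in at_right 0. x - of_real eps * \<i> * d \<in> comp (face (b, s))"
  using right_near[OF bs \<sigma>(1,2)] unfolding d_def[symmetric] xs .
 have "((\<lambda>eps. x - of_real eps * \<i> * d) \<longlongrightarrow> x - of_real 0 * \<i> * d) (at_right 0)" by (intro tendsto_intros)
 hence "\<forall>\<^sub>F eps in at_right 0. dist (x - of_real eps * \<i> * d) x < e" using tendstoD e(1) by fastforce
 moreover have "\<forall>\<^sub>F eps in at_right (0::real). 0 < eps" by (simp add: eventually_at_right_less)
 ultimately have "\<forall>\<^sub>F eps in at_right 0. dist (x - of_real eps * \<i> * d) x < e \<and> 0 < eps \<and> x - of_real eps * \<i> * d \<in> comp (face (b, s))"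
  using near by eventually_elim simp
 then obtain eps where eps: "dist (x - of_real eps * \<i> * d) x < e" "0 < eps" "x - of_real eps * \<i> * d \<in> comp (face (b, s))"
  using eventually_happens'[of "at_right (0::real)"] by (auto simp: trivial_limit_at_right_real)
 let ?H = "ball x e \<inter> {z. cross d (z - p b) < 0}"
 have "convex ?H" by (intro convex_Int convex_ball convex_cross_less)
 hence "connected ?H" by (rule convex_connected)
 moreover have "?H \<inter> curve (face (b, s)) = {}"
 proof -
  have "cross d (w - p b) = 0" if w: "w \<in> closed_segment (p b) (p s)" for w
  proof -
   obtain q where "w = (1 - q) *\<^sub>R p b + q *\<^sub>R p s" using w by (auto simp: in_segment)
   hence "w - p b = of_real q * d" by (simp add: d_def scaleR_conv_of_real algebra_simps)
   thus ?thesis by (simp add: cross_scale)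
  qed
  thus ?thesis using e(2) curve_P[of "(b, s)"] bs by fastforce
 qed
 moreover have "x - of_real eps * \<i> * d \<in> ?H"
 proof -
  have "cross d (x - of_real eps * \<i> * d - p b) = - eps * (cmod d)\<^sup>2"
  proof -
   have "x - of_real eps * \<i> * d - p b = of_real \<sigma> * d - of_real eps * \<i> * d" unfolding xs by simp
   show ?thesis unfolding \<open>x - of_real eps * \<i> * d - p b = of_real \<sigma> * d - of_real eps * \<i> * d\<close>
    using cross_turn[of \<sigma> d eps] cross_commute[of d "of_real \<sigma> * d - of_real eps * \<i> * d"] by simp
  qed
  thus ?thesis using eps(1,2) dn by (auto simp: dist_commute mult_pos_pos)
 qed
 moreover have "z \<in> ?H" using z by (simp add: d_def)
 ultimately show ?thesis using comp_conn[of "(b, s)" ?H] eps(3) bs by (metis mem_darts)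
qed

text \<open>Close to an inner point of an edge no other part of the drawing is present, so each half
  disc belongs to the face on its side.\<close>

lemma edge_ball:
 assumes bs: "{b, s} \<in> E" and x: "x \<in> open_segment (p b) (p s)"
 shows "\<exists>e>0. \<forall>z\<in>ball x e. z \<in> comp (face (b, s)) \<or> z \<in> comp (face (s, b)) \<or> z \<in> open_segment (p b) (p s)"
proof -
 let ?O = "(\<Union>(a, c)\<in>{(a, c)\<in>D. {a, c} \<noteq> {b, s}}. closed_segment (p a) (p c)) \<union> {p b, p s}"
 have f: "finite {(a, c)\<in>D. {a, c} \<noteq> {b, s}}" using finD by (rule finite_subset[rotated]) auto
 have "closed ?O" using f by (intro closed_Un closed_UN) auto
 moreover have xO: "x \<notin> ?O"
 proof
  assume "x \<in> ?O"
  moreover have "x \<noteq> p b" "x \<noteq> p s" using x by (auto simp: open_segment_def)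
  ultimately obtain a c where ac: "{a, c} \<in> E" "{a, c} \<noteq> {b, s}" "x \<in> closed_segment (p a) (p c)" by auto
  have "x \<in> closed_segment (p b) (p s)" using x by (simp add: open_segment_def)
  hence "x \<in> p ` ({b, s} \<inter> {a, c})" using seg_meet[OF bs ac(1)] ac(2,3) by blast
  thus False using \<open>x \<noteq> p b\<close> \<open>x \<noteq> p s\<close> by auto
 qed
 ultimately have "open (- ?O)" "x \<in> - ?O" by (simp_all only: open_Compl Compl_iff not_False_eq_True)
 then obtain e where e1: "0 < e" "ball x e \<subseteq> - ?O" by (rule openE)
 hence e: "0 < e" "ball x e \<inter> ?O = {}" by blast+
 have sub: "ball x e \<inter> P \<subseteq> closed_segment (p b) (p s)"
 proof
  fix z assume z: "z \<in> ball x e \<inter> P"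
  then obtain a c where ac: "{a, c} \<in> E" "z \<in> closed_segment (p a) (p c)" unfolding P_eq by auto
  have "{a, c} = {b, s}"
  proof (rule ccontr)
   assume "{a, c} \<noteq> {b, s}"
   hence "(a, c) \<in> {(a, c)\<in>D. {a, c} \<noteq> {b, s}}" using ac(1) by simp
   hence "z \<in> ?O" using ac(2) by blast
   thus False using e(2) z by blast
  qed
  hence "a = b \<and> c = s \<or> a = s \<and> c = b" by (auto simp: doubleton_eq_iff)
  thus "z \<in> closed_segment (p b) (p s)" using ac(2) closed_segment_commute by auto
 qed
 show ?thesis
 proof (intro exI[of _ e] conjI ballI e(1))
  fix z assume z: "z \<in> ball x e"
  define d where "d = p s - p b"
  have dn: "d \<noteq> 0" using dir_nz[OF bs] by (simp add: d_def)
  have sb: "{s, b} \<in> E" using bs by (simp add: insert_commute)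
  consider "cross d (z - p b) < 0" | "cross d (z - p b) > 0" | "cross d (z - p b) = 0" by linarith
  thus "z \<in> comp (face (b, s)) \<or> z \<in> comp (face (s, b)) \<or> z \<in> open_segment (p b) (p s)"
  proof cases
   case 1 thus ?thesis using half_ball[OF bs x e(1) sub z] by (simp add: d_def)
  next
   case 2
   have "cross (p b - p s) (z - p s) = - cross d (z - p b)" by (simp add: d_def cross_def algebra_simps)
   hence "cross (p b - p s) (z - p s) < 0" using 2 by simp
   moreover have "ball x e \<inter> P \<subseteq> closed_segment (p s) (p b)" using sub by (simp only: closed_segment_commute)
   moreover have "x \<in> open_segment (p s) (p b)" using x by (simp only: open_segment_commute)
   ultimately show ?thesis using half_ball[OF sb _ e(1) _ z] by blast
  next
   case 3
   obtain \<sigma> where \<sigma>: "0 < \<sigma>" "\<sigma> < 1" "x = (1 - \<sigma>) *\<^sub>R p b + \<sigma> *\<^sub>R p s" using x by (auto simp: in_segment)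
   have xs: "x = p b + of_real \<sigma> * d" unfolding \<sigma>(3) d_def by (simp add: scaleR_conv_of_real algebra_simps)
   define \<tau> where "\<tau> = Re ((z - p b) / d)"
   have "Im ((z - p b) / d) = 0" using 3 by (simp add: Im_divide_cross)
   hence "(z - p b) / d = of_real \<tau>" by (simp add: complex_eq_iff \<tau>_def)
   hence "z - p b = of_real \<tau> * d" using dn by (simp add: field_simps)
   hence zt: "z = p b + of_real \<tau> * d" by (simp add: algebra_simps)
   have "p b \<notin> ball x e" "p s \<notin> ball x e" using e(2) by auto
   moreover have "dist x (p b) = \<sigma> * cmod d"
   proof -
    have "x - p b = of_real \<sigma> * d" using xs by simp
    hence "cmod (x - p b) = \<bar>\<sigma>\<bar> * cmod d" by (simp only: norm_mult norm_of_real)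
    thus ?thesis using \<sigma>(1) by (simp add: dist_norm)
   qed
   moreover have "dist x (p s) = (1 - \<sigma>) * cmod d"
   proof -
    have "x - p s = of_real (\<sigma> - 1) * d" unfolding xs by (simp add: d_def algebra_simps)
    hence "cmod (x - p s) = \<bar>\<sigma> - 1\<bar> * cmod d" by (simp only: norm_mult norm_of_real)
    thus ?thesis using \<sigma> by (simp add: dist_norm)
   qed
   moreover have "dist x z = \<bar>\<sigma> - \<tau>\<bar> * cmod d"
   proof -
    have "x - z = of_real (\<sigma> - \<tau>) * d" unfolding xs zt by (simp add: algebra_simps)
    thus ?thesis by (simp only: dist_norm norm_mult norm_of_real)
   qed
   ultimately have "\<bar>\<sigma> - \<tau>\<bar> * cmod d < \<sigma> * cmod d" "\<bar>\<sigma> - \<tau>\<bar> * cmod d < (1 - \<sigma>) * cmod d" using z by auto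
   hence "\<bar>\<sigma> - \<tau>\<bar> < \<sigma>" "\<bar>\<sigma> - \<tau>\<bar> < 1 - \<sigma>" using dn by (simp_all add: mult_less_cancel_right)
   hence "0 < \<tau>" "\<tau> < 1" by linarith+
   hence "z \<in> open_segment (p b) (p s)" unfolding in_segment using zt dn
    by (intro conjI exI[of _ \<tau>]) (auto simp: d_def scaleR_conv_of_real algebra_simps)
   thus ?thesis by simp
  qed
 qed
qed

lemma comp_open: "d \<in> D \<Longrightarrow> open (comp (face d))"
 using comp_cases[of d] jordan[of d] by auto

text \<open>The plane without the finitely many vertices is connected. The faces together with the
  open edges form an open set by \<open>edge_ball\<close>, and the uncovered points form another; as
  the former is not empty, the latter is.\<close>

lemma cover: assumes "z \<notin> P" shows "\<exists>d\<in>D. z \<in> comp (face d)"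
proof (rule ccontr)
 assume no: "\<not> ?thesis"
 let ?U = "\<Union>d\<in>D. comp (face d)"
 let ?G = "?U \<union> (P - p ` V)" and ?H = "- P - ?U"
 have oG: "open ?G"
  unfolding open_contains_ball
 proof
  fix x assume "x \<in> ?G"
  then consider d where "d \<in> D" "x \<in> comp (face d)" | "x \<in> P" "x \<notin> p ` V" by blast
  thus "\<exists>e>0. ball x e \<subseteq> ?G"
  proof cases
   case 1
   then obtain e where "0 < e" "ball x e \<subseteq> comp (face d)" using comp_open[OF 1(1)] open_contains_ball by blast
   thus ?thesis using 1(1) by blast
  next
   case 2
   obtain b s where bs: "{b, s} \<in> E" "x \<in> closed_segment (p b) (p s)" using 2(1) unfolding P_eq by auto
   have V: "b \<in> V" "s \<in> V" using edgeD[OF bs(1)] by auto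
   hence "x \<in> open_segment (p b) (p s)" using bs(2) 2(2) by (auto simp: open_segment_def)
   from edge_ball[OF bs(1) this]
   obtain e where e: "0 < e" "\<forall>z\<in>ball x e. z \<in> comp (face (b, s)) \<or> z \<in> comp (face (s, b)) \<or> z \<in> open_segment (p b) (p s)" by blast
   have "open_segment (p b) (p s) \<subseteq> P - p ` V"
   proof
    fix w assume w: "w \<in> open_segment (p b) (p s)"
    hence c: "w \<in> closed_segment (p b) (p s)" "w \<noteq> p b" "w \<noteq> p s" by (auto simp: open_segment_def)
    have "w \<notin> p ` V" using vertex_on_edge[OF bs(1)] c by auto
    thus "w \<in> P - p ` V" using seg_P[OF bs(1)] c(1) by auto
   qed
   moreover have "(b, s) \<in> D" "(s, b) \<in> D" using bs(1) by (auto simp: insert_commute)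
   ultimately have "ball x e \<subseteq> ?G" using e(2) by fast
   thus ?thesis using e(1) by blast
  qed
 qed
 have oH: "open ?H"
  unfolding open_contains_ball
 proof
  fix x assume x: "x \<in> ?H"
  have "open (- P)" "x \<in> - P" using closed_P x by auto
  then obtain e where e: "0 < e" "ball x e \<subseteq> - P" by (rule openE)
  have "w \<notin> comp (face d)" if "d \<in> D" "w \<in> ball x e" for d w
  proof
   assume w: "w \<in> comp (face d)"
   have "x \<in> comp (face d)"
    by (rule comp_conn[OF that(1) connected_ball _ that(2) _ w]) (use e curve_P[OF that(1)] in auto)
   thus False using x that(1) by blast
  qed
  hence "ball x e \<subseteq> ?H" using e(2) by auto
  thus "\<exists>e>0. ball x e \<subseteq> ?H" using e(1) by blast
 qed
 have "\<not> collinear (UNIV :: complex set)"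
 proof
  assume "collinear (UNIV :: complex set)"
  hence "collinear {0, 1, \<i>}" using collinear_subset by blast
  hence "1 = (0::complex) \<or> \<i> = (0::complex) \<or> (\<exists>c. \<i> = c *\<^sub>R 1)" unfolding collinear_lemma by simp
  thus False by (auto simp: complex_eq_iff)
 qed
 hence con: "connected (UNIV - p ` V)" using finV by (intro connected_convex_diff_countable) (auto intro: countable_finite)
 have "p ` V \<subseteq> P" using vertex_P by auto
 hence "?G \<inter> ?H \<inter> (UNIV - p ` V) = {}" "UNIV - p ` V \<subseteq> ?G \<union> ?H" "z \<in> ?H \<inter> (UNIV - p ` V)" using assms no by auto
 hence gz: "?G \<inter> (UNIV - p ` V) = {}" using connectedD[OF con oG oH] by blast
 obtain d0 where d0: "d0 \<in> D" "F = face d0" using faceF is_face_iff by auto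
 have ne: "comp (face d0) \<noteq> {}" using comp_cases[OF d0(1)] jordan(1,7)[OF d0(1)] by auto
 then obtain w where "w \<in> comp (face d0)" by blast
 moreover have "w \<notin> p ` V" using calculation comp_P[OF d0(1)] \<open>p ` V \<subseteq> P\<close> by blast
 ultimately show False using gz d0(1) by blast
qed

end

lemma cyc_darts_nth:
 assumes "xs \<noteq> []"
 shows "(a, b) = (last xs, hd xs) \<or> (a, b) \<in> steps xs \<longleftrightarrow> (\<exists>i<length xs. a = xs ! i \<and> b = xs ! (Suc i mod length xs))"
proof
 assume "(a, b) = (last xs, hd xs) \<or> (a, b) \<in> steps xs"
 thus "\<exists>i<length xs. a = xs ! i \<and> b = xs ! (Suc i mod length xs)"
 proof
  assume "(a, b) = (last xs, hd xs)"
  thus ?thesis using assms by (intro exI[of _ "length xs - 1"]) (auto simp: last_conv_nth hd_conv_nth)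
 next
  assume "(a, b) \<in> steps xs"
  then obtain i where "Suc i < length xs" "a = xs ! i" "b = xs ! Suc i" using steps_nth[of a b xs] by blast
  thus ?thesis by (intro exI[of _ i]) auto
 qed
next
 assume "\<exists>i<length xs. a = xs ! i \<and> b = xs ! (Suc i mod length xs)"
 then obtain i where i: "i < length xs" "a = xs ! i" "b = xs ! (Suc i mod length xs)" by blast
 show "(a, b) = (last xs, hd xs) \<or> (a, b) \<in> steps xs"
 proof (cases "Suc i < length xs")
  case True thus ?thesis using i steps_nth[of a b xs] by auto
 next
  case False
  hence "Suc i = length xs" using i(1) by simp
  moreover from this have "i = length xs - 1" by simp
  ultimately show ?thesis using i assms by (simp add: last_conv_nth hd_conv_nth)
 qed
qed

context realized3
begin

lemma comp_connected: "d \<in> D \<Longrightarrow> connected (comp (face d))"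
 using comp_cases[of d] jordan[of d] by auto

lemma F_halfplane:
 assumes "(b, s) \<in> F" "c \<in> V" shows "0 \<le> cross (p s - p b) (p c - p b)"
 using hull[OF assms] by (cases "c = b"; cases "c = s") auto

lemma F_D: obtains d where "d \<in> D" "F = face d"
 using faceF is_face_iff by auto

text \<open>The curve of \<open>F\<close> lies in the closed half-plane to the left of a hull edge,
  while \<open>right_near\<close> gives points of the face across that edge. Such points are outside
  the curve, so the right-hand side of \<open>F\<close> is the unbounded one.\<close>

lemma outer: "comp F = outside (curve F)" "comp F = outside P"
proof -
 obtain d0 where d0: "d0 \<in> D" "F = face d0" by (rule F_D)
 obtain b s where d0': "d0 = (b, s)" by (cases d0)
 have bs: "{b, s} \<in> E" using d0 d0' by simp
 have bF: "(b, s) \<in> F" using face_self[OF d0(1)] d0 d0' by simp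
 define d where "d = p s - p b"
 have dn: "d \<noteq> 0" using dir_nz[OF bs] by (simp add: d_def)
 let ?T = "{z. 0 \<le> cross d (z - p b)}"
 have "closed_segment (p a) (p c) \<subseteq> ?T" if ac: "(a, c) \<in> F" for a c
 proof (rule closed_segment_subset[OF _ _ convex_functional])
  have "a \<in> V" "c \<in> V" using edgeD[of a c] F_closed(1) ac by auto
  thus "p a \<in> ?T" "p c \<in> ?T" using F_halfplane[OF bF] by (auto simp: d_def)
 qed
 hence cT: "curve F \<subseteq> ?T" unfolding curve_def by blast
 have "\<forall>\<^sub>F eps in at_right 0. p b + of_real (1/2) * d - of_real eps * \<i> * d \<in> comp F"
  using right_near[OF bs, of "1/2"] unfolding d_def[symmetric] d0(2) d0' by simp
 moreover have "\<forall>\<^sub>F eps in at_right (0::real). 0 < eps" by (simp add: eventually_at_right_less)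
 ultimately have "\<forall>\<^sub>F eps in at_right 0. p b + of_real (1/2) * d - of_real eps * \<i> * d \<in> comp F \<and> 0 < eps"
  by (rule eventually_conj)
 then obtain eps where eps: "p b + of_real (1/2) * d - of_real eps * \<i> * d \<in> comp F" "0 < eps"
  using eventually_happens'[of "at_right (0::real)"] by (auto simp: trivial_limit_at_right_real)
 define z where "z = p b + of_real (1/2) * d - of_real eps * \<i> * d"
 have "z - p b = of_real (1/2) * d - of_real eps * \<i> * d" by (simp add: z_def)
 hence "cross d (z - p b) = - (eps * (cmod d)\<^sup>2)" using cross_turn[of "1/2" d eps] cross_commute[of "z - p b" d] by simp
 moreover have "0 < eps * (cmod d)\<^sup>2" using eps(2) dn by simp
 ultimately have "z \<in> - ?T" by simp
 hence "z \<in> outside (curve F)" using outside_subset_convex[OF convex_functional cT] by blast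
 moreover have "z \<in> comp F" using eps(1) by (simp add: z_def)
 ultimately show o: "comp F = outside (curve F)"
  using comp_cases[OF d0(1)] inside_Int_outside[of "curve F"] unfolding d0(2) by blast
 have nb: "\<not> bounded (comp F)" using o jordan(7)[OF d0(1)] unfolding d0(2) by simp
 have FP: "comp F \<subseteq> - P" using comp_P[OF d0(1)] unfolding d0(2) by blast
 show "comp F = outside P"
 proof
  show "comp F \<subseteq> outside P"
  proof
   fix x assume x: "x \<in> comp F"
   have "comp F \<subseteq> connected_component_set (- P) x"
    using x comp_connected[OF d0(1)] FP unfolding d0(2) by (rule connected_component_maximal)
   hence "\<not> bounded (connected_component_set (- P) x)" using nb bounded_subset by blast
   thus "x \<in> outside P" using FP x by (auto simp: outside)
  qed
  hence zo: "z \<in> outside P" using \<open>z \<in> comp F\<close> by blast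
  have co: "connected (outside P)" by (rule connected_outside) (use compact_P in \<open>auto intro: compact_imp_bounded\<close>)
  have "outside P \<inter> curve (face d0) = {}" using curve_P[OF d0(1)] outside_no_overlap[of P] by blast
  thus "outside P \<subseteq> comp F"
   using comp_conn[OF d0(1) co _ zo] \<open>z \<in> comp F\<close> unfolding d0(2) by blast
 qed
qed

lemma comp_eq:
 assumes "d \<in> D" "d' \<in> D" "z \<in> comp (face d)" "z \<in> comp (face d')" shows "comp (face d) = comp (face d')"
proof -
 have "comp (face d) \<subseteq> comp (face d')" if d: "d \<in> D" "d' \<in> D" "z \<in> comp (face d)" "z \<in> comp (face d')" for d d'
 proof
  fix y assume y: "y \<in> comp (face d)"
  have "comp (face d) \<inter> curve (face d') = {}" using comp_P[OF d(1)] curve_P[OF d(2)] by blast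
  from comp_conn[OF d(2) comp_connected[OF d(1)] this d(3) y d(4)] show "y \<in> comp (face d')" .
 qed
 thus ?thesis using assms by blast
qed

lemma frontier_comp: "d \<in> D \<Longrightarrow> frontier (comp (face d)) = curve (face d)"
 using comp_cases[of d] jordan(8,9)[of d] by auto

text \<open>For the converse, an outer region on the right of \<open>(u, v)\<close> forces equal
  frontiers, so the edge belongs to \<open>F\<close>, possibly in the other direction. In that case
  both sides of the edge would be outer, although points inside the curve of \<open>F\<close> come
  arbitrarily close to the edge.\<close>

lemma outer_iff: assumes uv: "{u, v} \<in> E" shows "(u, v) \<in> F \<longleftrightarrow> outer_on_right V E p u v"
proof -
 obtain d0 where d0: "d0 \<in> D" "F = face d0" by (rule F_D)
 define x where "x = midpoint (p u) (p v)"
 have xm: "p u + of_real (1/2) * (p v - p u) = x" by (simp add: x_def midpoint_def complex_eq_iff field_simps)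
 have near: "\<forall>\<^sub>F eps in at_right 0. x - of_real eps * \<i> * (p v - p u) \<in> comp (face (u, v))"
  using right_near[OF uv, of "1/2"] unfolding xm by simp
 have uD: "(u, v) \<in> D" using uv by simp
 have vD: "(v, u) \<in> D" using uv by (simp add: insert_commute)
 show ?thesis
 proof
  assume "(u, v) \<in> F"
  hence "face (u, v) = F" using face_eq[OF d0(1)] d0(2) by simp
  thus "outer_on_right V E p u v" using near outer(2) unfolding outer_on_right_def x_def by simp
 next
  assume "outer_on_right V E p u v"
  hence "\<forall>\<^sub>F eps in at_right 0. x - of_real eps * \<i> * (p v - p u) \<in> comp F"
   unfolding outer_on_right_def x_def outer(2) .
  with near have "\<forall>\<^sub>F eps in at_right 0. x - of_real eps * \<i> * (p v - p u) \<in> comp (face (u, v)) \<and> x - of_real eps * \<i> * (p v - p u) \<in> comp F"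
   by (rule eventually_conj)
  then obtain z where z: "z \<in> comp (face (u, v))" "z \<in> comp F"
   using eventually_happens'[of "at_right (0::real)"] by (auto simp: trivial_limit_at_right_real)
  have ceq: "comp (face (u, v)) = comp F" using comp_eq[OF uD d0(1)] z unfolding d0(2) by blast
  hence cur: "curve (face (u, v)) = curve F" using frontier_comp[OF uD] frontier_comp[OF d0(1)] unfolding d0(2) by simp
  have pu: "p u \<noteq> p v" using dir_nz[OF uv] by auto
  hence xo: "x \<in> open_segment (p u) (p v)" by (simp add: x_def)
  hence xs: "x \<in> closed_segment (p u) (p v)" "x \<noteq> p u" "x \<noteq> p v" by (auto simp: open_segment_def)
  have "x \<in> curve (face (u, v))" using face_self[OF uD] xs(1) unfolding curve_def by blast
  hence xF: "x \<in> curve F" using cur by simp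
  then obtain a b where ab: "(a, b) \<in> F" "x \<in> closed_segment (p a) (p b)" unfolding curve_def by blast
  have abE: "{a, b} \<in> E" using F_closed(1) ab(1) by auto
  have "{u, v} = {a, b}"
  proof (rule ccontr)
   assume "{u, v} \<noteq> {a, b}"
   hence "x \<in> p ` ({u, v} \<inter> {a, b})" using seg_meet[OF uv abE] xs(1) ab(2) by blast
   thus False using xs(2,3) by auto
  qed
  then consider "(u, v) \<in> F" | "(v, u) \<in> F" using ab(1) by (auto simp: doubleton_eq_iff)
  thus "(u, v) \<in> F"
  proof cases
   case 2
   hence vF: "face (v, u) = F" using face_eq[OF d0(1)] d0(2) by simp
   obtain e where e: "0 < e" "\<forall>z\<in>ball x e. z \<in> comp (face (u, v)) \<or> z \<in> comp (face (v, u)) \<or> z \<in> open_segment (p u) (p v)"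
    using edge_ball[OF uv xo] by blast
   have "x \<in> frontier (inside (curve F))" using xF jordan(8)[OF d0(1)] unfolding d0(2) by simp
   hence "x \<in> closure (inside (curve F))" by (simp add: frontier_def)
   then obtain y where y: "y \<in> inside (curve F)" "dist y x < e" using e(1) unfolding closure_approachable by blast
   have yc: "y \<notin> curve F" "y \<notin> outside (curve F)" using y(1) inside_no_overlap[of "curve F"] inside_Int_outside[of "curve F"] by blast+
   have "open_segment (p u) (p v) \<subseteq> curve (face (u, v))"
    using face_self[OF uD] unfolding curve_def open_segment_def by blast
   hence "y \<in> comp F" using e(2) y(2) yc(1) ceq vF cur by (auto simp: dist_commute)
   thus ?thesis using yc(2) outer(1) by simp
  qed
 qed
qed

text \<open>Every point of the curve of \<open>F\<close> is on a supporting line of the hull, so it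
  is not in the interior of the hull. Conversely, if a boundary point of the hull were off the
  curve, a segment to it from inside the curve would cross the curve in the interior of the
  hull.\<close>

lemma convex_outer: "convex_outer_face V E p"
proof -
 obtain d0 where d0: "d0 \<in> D" "F = face d0" by (rule F_D)
 let ?K = "convex hull (p ` V)"
 note j = jordan[OF d0(1), folded d0(2)]
 have fr: "frontier (outside P) = curve F" using j(9) outer by simp
 have 1: "(\<Union>e \<in> {e\<in>E. edge_segment p e \<subseteq> curve F}. edge_segment p e) = curve F"
 proof
  show "curve F \<subseteq> (\<Union>e \<in> {e\<in>E. edge_segment p e \<subseteq> curve F}. edge_segment p e)"
  proof
   fix z assume "z \<in> curve F"
   then obtain a b where ab: "(a, b) \<in> F" "z \<in> closed_segment (p a) (p b)" unfolding curve_def by blast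
   have "edge_segment p {a, b} \<subseteq> curve F" unfolding edge_segment_pair curve_def using ab(1) by blast
   moreover have "{a, b} \<in> E" using F_closed(1) ab(1) by auto
   ultimately show "z \<in> (\<Union>e \<in> {e\<in>E. edge_segment p e \<subseteq> curve F}. edge_segment p e)"
    using ab(2) edge_segment_pair[of a b] by (intro UN_I[of "{a, b}"]) auto
  qed
 qed blast
 have K: "closed ?K" using finV by (intro compact_imp_closed compact_convex_hull finite_imp_compact) auto
 have cK: "curve F \<subseteq> ?K"
 proof -
  have "closed_segment (p a) (p b) \<subseteq> ?K" if "(a, b) \<in> F" for a b
   by (rule closed_segment_subset[OF _ _ convex_convex_hull]; rule hull_inc) (use edgeD[of a b] F_closed(1) that in auto)
  thus ?thesis unfolding curve_def by blast
 qed
 have "- ?K \<subseteq> outside (curve F)" by (rule outside_subset_convex[OF convex_convex_hull cK])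
 hence "inside (curve F) \<subseteq> ?K" using inside_Int_outside[of "curve F"] by blast
 hence iK: "inside (curve F) \<subseteq> interior ?K" using j(2) by (rule interior_maximal)
 have cI: "x \<notin> interior ?K" if xc: "x \<in> curve F" for x
 proof
  assume "x \<in> interior ?K"
  then obtain e where e: "0 < e" "ball x e \<subseteq> ?K" by (auto simp: mem_interior)
  obtain a b where ab: "(a, b) \<in> F" "x \<in> closed_segment (p a) (p b)" using xc unfolding curve_def by blast
  have abE: "{a, b} \<in> E" using F_closed(1) ab(1) by auto
  define d where "d = p b - p a"
  have dn: "d \<noteq> 0" using dir_nz[OF abE] by (simp add: d_def)
  have KT: "?K \<subseteq> {z. 0 \<le> cross d (z - p a)}"
   by (rule hull_minimal[where S = convex, OF _ convex_functional]) (use F_halfplane[OF ab(1)] in \<open>auto simp: d_def\<close>)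
  obtain q where "x = (1 - q) *\<^sub>R p a + q *\<^sub>R p b" using ab(2) by (auto simp: in_segment)
  hence xq: "x - p a = of_real q * d" by (simp add: d_def scaleR_conv_of_real algebra_simps)
  define \<delta> where "\<delta> = e / (2 * cmod d)"
  have dp: "0 < \<delta>" using e(1) dn by (simp add: \<delta>_def)
  define y where "y = x - of_real \<delta> * \<i> * d"
  have "dist x y = \<delta> * cmod d" using dp by (simp add: y_def dist_norm norm_mult)
  also have "\<dots> = e / 2" using dn by (simp add: \<delta>_def)
  finally have "y \<in> ball x e" using e(1) by simp
  hence "0 \<le> cross d (y - p a)" using e(2) KT by blast
  moreover have "y - p a = of_real q * d - of_real \<delta> * \<i> * d" using xq by (simp add: y_def algebra_simps)
  hence "cross d (y - p a) = - (\<delta> * (cmod d)\<^sup>2)" using cross_turn[of q d \<delta>] cross_commute[of "y - p a" d] by simp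
  moreover have "0 < \<delta> * (cmod d)\<^sup>2" using dp dn by simp
  ultimately show False by linarith
 qed
 have "frontier ?K = curve F"
 proof
  show "curve F \<subseteq> frontier ?K" using cK cI K by (auto simp: frontier_def closure_closed)
  show "frontier ?K \<subseteq> curve F"
  proof
   fix z assume z: "z \<in> frontier ?K"
   show "z \<in> curve F"
   proof (rule ccontr)
    assume zc: "z \<notin> curve F"
    obtain y where y: "y \<in> inside (curve F)" using j(1) by blast
    have zi: "z \<notin> inside (curve F)" "z \<in> closure ?K" using z iK by (auto simp: frontier_def)
    have os: "open_segment y z \<subseteq> interior ?K"
     by (rule in_interior_closure_convex_segment[OF convex_convex_hull _ zi(2)]) (use y iK in blast)
    have "closed_segment y z \<inter> frontier (inside (curve F)) \<noteq> {}"
     by (rule connected_Int_frontier[OF connected_segment(1)]) (use y zi(1) in auto)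
    then obtain x where x: "x \<in> closed_segment y z" "x \<in> curve F" using j(8) by auto
    have "x \<noteq> y" "x \<noteq> z" using x(2) y zc inside_no_overlap[of "curve F"] by blast+
    hence "x \<in> open_segment y z" using x(1) by (simp add: open_segment_def)
    thus False using os cI[OF x(2)] by blast
   qed
  qed
 qed
 thus ?thesis unfolding convex_outer_face_def fr 1 by simp
qed

text \<open>\<open>interior_angle\<close> selects the angle whose bisector starts into the polygon;
  this identifies it with \<open>corner\<close>. The bisector makes half the angle of the corner
  with its first edge, so \<open>corner_side\<close> applies once it is short enough to miss the
  curve.\<close>

lemma bisector:
 assumes ab: "{a, b} \<in> E"
 shows "\<forall>\<^sub>F eps in at_right 0. p b + of_real eps * cis (corner p \<rho> a b / 2) * (p a - p b) \<in> comp (face (a, b))"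
proof -
 define c where "c = \<rho> b a"
 define \<Theta> where "\<Theta> = corner p \<rho> a b"
 define w where "w = cis (\<Theta> / 2) * (p a - p b)"
 let ?Q = "face (a, b)"
 have dD: "(a, b) \<in> D" using ab by simp
 have ba: "{b, a} \<in> E" using ab by (simp add: insert_commute)
 have bc: "{b, c} \<in> E" using rho_in[OF ba] by (simp add: c_def)
 have an: "p a - p b \<noteq> 0" and cn: "p c - p b \<noteq> 0" using dir_nz[OF ba] dir_nz[OF bc] by auto
 have wn: "w \<noteq> 0" using an by (simp add: w_def)
 have \<Theta>c: "\<Theta> = ccw_angle (p a - p b) (p c - p b)" by (simp add: \<Theta>_def corner_def c_def)
 obtain y where y: "y \<noteq> a" "{b, y} \<in> E" using degree_ge_2[OF n3 edgeD(2)[OF ba], of a] by blast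
 have "c \<noteq> a" using rho_ne_self[OF ba y(2)] y(1) by (auto simp: c_def)
 hence "\<not> same_dir (p a - p b) (p c - p b)" using dist_dir[OF ba bc] by auto
 hence T: "0 < \<Theta>" "\<Theta> < 2 * pi" using ccw_angle_range[of "p a - p b" "p c - p b"] unfolding \<Theta>c same_dir_ccw by auto
 have wa: "Arg2pi (w / (p a - p b)) = \<Theta> / 2" using Arg2pi_cis[of "\<Theta> / 2" 1] T an by (simp add: w_def)
 hence aw: "ccw_angle (p a - p b) w = \<Theta> / 2" using T by (simp add: ccw_angle_def)
 have nsa: "\<not> same_dir w (p a - p b)"
 proof
  assume "same_dir w (p a - p b)"
  then obtain r where r: "0 \<le> r" "p a - p b = of_real r * w" using same_dirE wn by blast
  hence "0 < r" using an by (cases "r = 0") auto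
  hence "ccw_angle (p a - p b) (p a - p b) = ccw_angle (p a - p b) w" using ccw_angle_scale[of 1 r "p a - p b" w] r(2) by simp
  thus False using aw T by simp
 qed
 have nsc: "\<not> same_dir w (p c - p b)"
 proof
  assume "same_dir w (p c - p b)"
  then obtain r where r: "0 \<le> r" "p c - p b = of_real r * w" using same_dirE wn by blast
  hence "0 < r" using cn by (cases "r = 0") auto
  hence "ccw_angle (p a - p b) (p c - p b) = ccw_angle (p a - p b) w" using ccw_angle_scale[of 1 r "p a - p b" w] r(2) by simp
  thus False using aw T \<Theta>c by simp
 qed
 have lim0: "((\<lambda>\<delta>. p b + of_real \<delta> * w) \<longlongrightarrow> p b + of_real 0 * w) (at_right 0)" by (intro tendsto_intros)
 hence lim: "((\<lambda>\<delta>. p b + of_real \<delta> * w) \<longlongrightarrow> p b) (at_right 0)" by simp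
 have pos: "\<forall>\<^sub>F \<delta> in at_right (0::real). 0 < \<delta>" by (simp add: eventually_at_right_less)
 have star: "closed_segment (p b) (p b + of_real \<delta> * w) \<inter> closed_segment (p b) (p u) \<subseteq> {p b}"
  if d: "0 < \<delta>" and u: "p u - p b \<noteq> 0" "\<not> same_dir w (p u - p b)" for \<delta> u
 proof -
  have "\<not> same_dir (of_real \<delta> * w) (p u - p b)" using u(2) ccw_angle_scale[of \<delta> 1 w "p u - p b"] d by (simp add: same_dir_ccw)
  thus ?thesis using segments_same_start[of "p b + of_real \<delta> * w" "p b" "p u"] d u(1) wn by simp
 qed
 have fQ: "finite ?Q" using finite_subset[OF face_D[OF dD] finD] .
 have "\<forall>\<^sub>F \<delta> in at_right 0. \<forall>(u, u')\<in>?Q. closed_segment (p b) (p b + of_real \<delta> * w) \<inter> closed_segment (p u) (p u') \<subseteq> {p b}"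
 proof (rule eventually_ball_finite[OF fQ], rule ballI)
  fix y assume yQ: "y \<in> ?Q"
  obtain u u' where uu: "y = (u, u')" by (cases y)
  have uE: "{u, u'} \<in> E" using face_D[OF dD] yQ uu by auto
  have "(b, c) \<in> ?Q" using orbit.step[OF face_self[OF dD]] by (simp add: c_def)
  consider "u = b" | "u' = b" | "u \<noteq> b" "u' \<noteq> b" by blast
  hence "\<forall>\<^sub>F \<delta> in at_right 0. closed_segment (p b) (p b + of_real \<delta> * w) \<inter> closed_segment (p u) (p u') \<subseteq> {p b}"
  proof cases
   case 1
   hence "u' = c" using fst_inj[OF dD _ \<open>(b, c) \<in> ?Q\<close>] yQ uu by blast
   thus ?thesis using 1 star[OF _ cn nsc] pos by (auto elim!: eventually_mono)
  next
   case 2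
   have "(b, \<rho> b u) \<in> ?Q" using orbit.step[OF yQ] uu 2 by simp
   hence "\<rho> b u = c" using fst_inj[OF dD _ \<open>(b, c) \<in> ?Q\<close>] by blast
   hence "u = a" using inj_onD[OF f_inj, of "(u, b)" "(a, b)"] dD uE 2 by (simp add: c_def)
   thus ?thesis unfolding 2 closed_segment_commute[of "p u" "p b"] \<open>u = a\<close> using star[OF _ an nsa] pos
    by (auto elim!: eventually_mono simp: closed_segment_commute[of "p a" "p b"])
  next
   case 3
   have "p b \<notin> closed_segment (p u) (p u')" using vertex_on_edge[OF uE edgeD(2)[OF ba]] 3 by auto
   hence "closed_segment (p b) (p b) \<inter> closed_segment (p u) (p u') = {}" by simp
   hence "\<forall>\<^sub>F \<delta> in at_right 0. closed_segment (p b) (p b + of_real \<delta> * w) \<inter> closed_segment (p u) (p u') = {}"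
    by (rule eventually_segments_disjoint) (intro tendsto_const lim)+
   thus ?thesis by (rule eventually_mono) simp
  qed
  thus "\<forall>\<^sub>F \<delta> in at_right 0. case y of (u, u') \<Rightarrow> closed_segment (p b) (p b + of_real \<delta> * w) \<inter> closed_segment (p u) (p u') \<subseteq> {p b}"
   by (simp add: uu)
 qed
 hence "\<forall>\<^sub>F \<delta> in at_right 0. p b + of_real (\<delta> / 2) * w \<in> comp ?Q"
  using pos
 proof eventually_elim
  case (elim \<delta>)
  define z where "z = p b + of_real \<delta> * w"
  have sub: "closed_segment (p b) z \<inter> curve ?Q \<subseteq> {p b, z}" using elim(1) unfolding curve_def z_def by blast
  have zb: "z \<noteq> p b" using elim(2) wn by (simp add: z_def)
  have "ccw_angle (p a - p b) (z - p b) = \<Theta> / 2" using ccw_angle_scale[of 1 \<delta> "p a - p b" w] elim(2) aw by (simp add: z_def)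
  hence "midpoint (p b) z \<in> comp ?Q" using corner_side[OF ab zb sub] T by (simp add: \<Theta>_def)
  moreover have "midpoint (p b) z = p b + of_real (\<delta> / 2) * w" by (simp add: z_def midpoint_def scaleR_conv_of_real field_simps)
  ultimately show ?case by simp
 qed
 then obtain h where h: "0 < h" "\<And>\<delta>. 0 < \<delta> \<Longrightarrow> \<delta> < h \<Longrightarrow> p b + of_real (\<delta> / 2) * w \<in> comp ?Q" unfolding eventually_at_right_field by blast
 have "p b + of_real eps * cis (\<Theta> / 2) * (p a - p b) \<in> comp ?Q" if "0 < eps" "eps < h / 2" for eps
  using h(2)[of "2 * eps"] that by (simp add: w_def mult.assoc)
 thus ?thesis unfolding \<Theta>_def[symmetric] eventually_at_right_field using h(1) by (intro exI[of _ "h / 2"]) auto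
qed

text \<open>By \<open>cover\<close> the component is the right-hand side of a face; being bounded,
  it is the inside of that face's curve, and the face is not \<open>F\<close>. The three convex
  corners granted by \<open>realization\<close> are matched with the interior angles of the
  polygon.\<close>

lemma bounded_face:
 assumes C: "C \<in> components (- P)" "bounded C"
 shows "\<exists>ps. set ps \<subseteq> p ` V \<and> pseudo_triangle ps \<and> C = inside (polygon_boundary ps)"
proof -
 obtain d0 where d0: "d0 \<in> D" "F = face d0" by (rule F_D)
 obtain z where z: "z \<in> C" using in_components_nonempty[OF C(1)] by blast
 have CP: "C \<subseteq> - P" by (rule in_components_subset[OF C(1)])
 obtain d where d: "d \<in> D" "z \<in> comp (face d)" using cover CP z by blast
 define Q where "Q = face d"
 have C1: "comp Q \<subseteq> C" unfolding Q_def
  by (rule components_maximal[OF C(1) comp_connected[OF d(1)]]) (use comp_P[OF d(1)] d(2) z in blast)+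
 have "C \<subseteq> comp Q"
 proof
  fix y assume y: "y \<in> C"
  have "C \<inter> curve (face d) = {}" using CP curve_P[OF d(1)] by blast
  from comp_conn[OF d(1) in_components_connected[OF C(1)] this z y d(2)] show "y \<in> comp Q" by (simp add: Q_def)
 qed
 hence CQ: "C = comp Q" using C1 by blast
 hence Cin: "C = inside (curve Q)" 
 proof -
  have "comp (face d) \<noteq> outside (curve (face d))" using jordan(7)[OF d(1)] C(2) unfolding CQ Q_def by metis
  thus ?thesis using comp_cases[OF d(1)] unfolding CQ Q_def by blast
 qed
 have QF: "Q \<noteq> F"
 proof
  assume "Q = F"
  hence "C = outside (curve F)" using CQ outer(1) by simp
  thus False using jordan(7)[OF d0(1)] C(2) unfolding d0(2) by simp
 qed
 define xs where "xs = fcyc Q"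
 define n where "n = length xs"
 have cyc: "dr.is_cycle xs" and cd: "dr.cyc_darts xs = Q" unfolding xs_def Q_def by (rule fcyc[OF d(1)])+
 have n3': "3 \<le> n" and dist: "distinct xs" using cyc by (auto simp: dr.is_cycle_def n_def)
 have ne: "xs \<noteq> []" and n0: "0 < n" using n3' by (auto simp: n_def)
 have Qi: "(a, b) \<in> Q \<longleftrightarrow> (\<exists>i<n. a = xs ! i \<and> b = xs ! (Suc i mod n))" for a b
  using cyc_darts_nth[OF ne, of a b] unfolding cd[symmetric] dr.cyc_darts_def n_def by simp
 have QE: "{a, b} \<in> E" if "(a, b) \<in> Q" for a b using face_D[OF d(1)] that by (auto simp: Q_def)
 have dart: "(xs ! i, xs ! (Suc i mod n)) \<in> Q" if "i < n" for i using Qi that by blast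
 have xV: "xs ! i \<in> V" if "i < n" for i using edgeD(2)[OF QE[OF dart[OF that]]] .
 define ps where "ps = map p xs"
 have pl: "length ps = n" by (simp add: ps_def n_def)
 have pv: "polygon_vertex ps i = p (xs ! (i mod n))" for i unfolding polygon_vertex_def pl using n0 by (simp add: ps_def n_def)
 have side: "polygon_side ps i = closed_segment (p (xs ! i)) (p (xs ! (Suc i mod n)))" if "i < n" for i
  unfolding polygon_side_def pv using that by simp
 have bd: "polygon_boundary ps = curve Q"
 proof -
  have "polygon_boundary ps = (\<Union>i<n. closed_segment (p (xs ! i)) (p (xs ! (Suc i mod n))))"
   unfolding polygon_boundary_def pl using side by simp
  also have "\<dots> = curve Q" unfolding curve_def
  proof (intro equalityI subsetI)
   fix z assume "z \<in> (\<Union>i<n. closed_segment (p (xs ! i)) (p (xs ! (Suc i mod n))))"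
   thus "z \<in> (\<Union>(a, b)\<in>Q. closed_segment (p a) (p b))" using dart by blast
  next
   fix z assume "z \<in> (\<Union>(a, b)\<in>Q. closed_segment (p a) (p b))"
   then obtain a b where "(a, b) \<in> Q" "z \<in> closed_segment (p a) (p b)" by blast
   thus "z \<in> (\<Union>i<n. closed_segment (p (xs ! i)) (p (xs ! (Suc i mod n))))" unfolding Qi by blast
  qed
  finally show ?thesis .
 qed
 have nth_eq: "xs ! i = xs ! j \<longleftrightarrow> i = j" if "i < n" "j < n" for i j
  using nth_eq_iff_index_eq[OF dist] that by (simp add: n_def)
 have sm: "Suc i mod n < n" for i using n0 by simp
 have simple: "simple_polygon ps"
  unfolding simple_polygon_def pl
 proof (intro conjI allI impI)
  show "3 \<le> n" by (rule n3')
  have "set xs \<subseteq> V" using xV by (auto simp: in_set_conv_nth n_def)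
  thus "distinct ps" unfolding ps_def using dist p_inj by (simp add: distinct_map inj_on_subset)
  fix i j assume ij: "i < n" "j < n" "i \<noteq> j"
  let ?i = "Suc i mod n" and ?j = "Suc j mod n"
  \<comment> \<open>Two sides with the same ends would each follow the other, as in a polygon with
    only two sides.\<close>
  have ne: "{xs ! i, xs ! ?i} \<noteq> {xs ! j, xs ! ?j}"
  proof
   assume "{xs ! i, xs ! ?i} = {xs ! j, xs ! ?j}"
   hence "i = ?j \<and> ?i = j" using nth_eq[OF ij(1,2)] nth_eq[OF ij(1) sm, of j] nth_eq[OF sm ij(2), of i] ij(3) by (auto simp: doubleton_eq_iff)
   thus False using ij n3' by (auto simp: mod_Suc split: if_splits)
  qed
  have "closed_segment (p (xs ! i)) (p (xs ! ?i)) \<inter> closed_segment (p (xs ! j)) (p (xs ! ?j)) =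
    p ` ({xs ! i, xs ! ?i} \<inter> {xs ! j, xs ! ?j})"
   by (rule seg_meet[OF QE[OF dart[OF ij(1)]] QE[OF dart[OF ij(2)]] ne])
  also have "\<dots> = p ` {xs ! i, xs ! ?i} \<inter> p ` {xs ! j, xs ! ?j}"
   by (rule inj_on_image_Int[OF p_inj]) (use xV[OF ij(1)] xV[OF ij(2)] xV[OF sm] in auto)
  finally show "polygon_side ps i \<inter> polygon_side ps j =
     {polygon_vertex ps i, polygon_vertex ps (i + 1)} \<inter> {polygon_vertex ps j, polygon_vertex ps (j + 1)}"
   unfolding side[OF ij(1)] side[OF ij(2)] pv using ij by simp
 qed
 define pr where "pr i = (i + n - 1) mod n" for i
 have pr: "pr i < n" "Suc (pr i) mod n = i" if "i < n" for i
 proof -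
  show "pr i < n" using n0 by (simp add: pr_def)
  have "Suc (pr i) mod n = Suc (i + n - 1) mod n" by (simp add: pr_def mod_Suc_eq)
  also have "Suc (i + n - 1) = i + n" using n0 by simp
  finally show "Suc (pr i) mod n = i" using that by simp
 qed
 have pd: "(xs ! pr i, xs ! i) \<in> Q" if "i < n" for i using dart[OF pr(1)[OF that]] unfolding pr(2)[OF that] .
 have ang: "interior_angle ps i = corner p \<rho> (xs ! pr i) (xs ! i)" if i: "i < n" for i
 proof -
  let ?b = "xs ! i" and ?a = "xs ! pr i"
  have "(?b, \<rho> ?b ?a) \<in> Q" using orbit.step[of "(?a, ?b)" f d] pd[OF i] by (simp add: Q_def)
  hence nx: "xs ! (Suc i mod n) = \<rho> ?b ?a" using fst_inj[OF d(1)] dart[OF i] unfolding Q_def by blast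
  have fab: "face (?a, ?b) = Q" using face_eq[OF d(1)] pd[OF i] unfolding Q_def by blast
  have pvs: "polygon_vertex ps i = p ?b" "polygon_vertex ps (i + length ps - 1) = p ?a" "polygon_vertex ps (i + 1) = p (\<rho> ?b ?a)"
   unfolding pv pl using i nx by (simp_all add: pr_def)
  have "\<forall>\<^sub>F eps in at_right 0. p ?b + of_real eps * cis (corner p \<rho> ?a ?b / 2) * (p ?a - p ?b) \<in> inside (curve Q)"
   using bisector[OF QE[OF pd[OF i]]] unfolding fab CQ[symmetric] Cin .
  thus ?thesis unfolding interior_angle_def Let_def pvs bd by (simp add: corner_def)
 qed
 have "bij_betw (\<lambda>i. (xs ! pr i, xs ! i)) {i. i < n \<and> interior_angle ps i < pi} {d \<in> Q. corner p \<rho> (fst d) (snd d) < pi}"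
 proof (rule bij_betw_imageI)
  show "inj_on (\<lambda>i. (xs ! pr i, xs ! i)) {i. i < n \<and> interior_angle ps i < pi}"
   by (rule inj_onI) (use nth_eq in auto)
  show "(\<lambda>i. (xs ! pr i, xs ! i)) ` {i. i < n \<and> interior_angle ps i < pi} = {d \<in> Q. corner p \<rho> (fst d) (snd d) < pi}"
  proof (intro equalityI subsetI)
   fix x assume "x \<in> (\<lambda>i. (xs ! pr i, xs ! i)) ` {i. i < n \<and> interior_angle ps i < pi}"
   then obtain i where "i < n" "interior_angle ps i < pi" "x = (xs ! pr i, xs ! i)" by blast
   thus "x \<in> {d \<in> Q. corner p \<rho> (fst d) (snd d) < pi}" using pd ang by simp
  next
   fix x assume x: "x \<in> {d \<in> Q. corner p \<rho> (fst d) (snd d) < pi}"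
   obtain a b where ab: "x = (a, b)" by (cases x)
   obtain k where k: "k < n" "a = xs ! k" "b = xs ! (Suc k mod n)" using x ab Qi by auto
   let ?i = "Suc k mod n"
   have "(xs ! pr ?i, xs ! ?i) \<in> Q" by (rule pd[OF sm])
   hence "(pr ?i) = k"
   proof -
    have "Suc (pr ?i) mod n = Suc k mod n" using pr(2)[OF sm] .
    moreover have "j = k" if "j < n" "k < n" "Suc j mod n = Suc k mod n" for j k
     using that by (auto simp: mod_Suc split: if_splits)
    ultimately show ?thesis using pr(1)[OF sm] k(1) by blast
   qed
   hence "x = (xs ! pr ?i, xs ! ?i)" using ab k by simp
   moreover have "interior_angle ps ?i < pi" using x ang[OF sm] \<open>pr ?i = k\<close> ab k by simp
   ultimately show "x \<in> (\<lambda>i. (xs ! pr i, xs ! i)) ` {i. i < n \<and> interior_angle ps i < pi}" using sm by blast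
  qed
 qed
 hence "card {i. i < n \<and> interior_angle ps i < pi} = card {d \<in> Q. corner p \<rho> (fst d) (snd d) < pi}" by (rule bij_betw_same_card)
 also have "\<dots> = 3"
 proof -
  have "\<exists>d\<in>D. Q = face d" using d(1) by (auto simp: Q_def)
  hence "is_face E \<rho> Q" by (simp only: is_face_iff)
  thus ?thesis using real QF unfolding realization_def by metis
 qed
 finally have "pseudo_triangle ps" unfolding pseudo_triangle_def pl using simple by blast
 moreover have "set ps \<subseteq> p ` V" using xV by (auto simp: ps_def in_set_conv_nth n_def)
 ultimately show ?thesis by (intro exI[of _ ps] conjI) (simp_all add: Cin bd)
qed

end

section \<open>From realizations to pointed pseudo-triangulations\<close>

context realized
begin

lemma all_pointed: "v \<in> V \<Longrightarrow> pointed E p v"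
 using big[of v] nxt unfolding pointed_def corner_def by (metis mem_neighbours)

lemma rotation_linepath: "induces_rotation E p (\<lambda>u v. linepath (p u) (p v)) \<rho>"
 unfolding induces_rotation_def
proof (intro allI impI)
 fix v u assume vu: "{v, u} \<in> E"
 have "\<forall>\<^sub>F r in at_right 0. \<forall>x\<in>neighbours E v.
   last_exit (linepath (p v) (p x)) r - p v = of_real (r / cmod (p x - p v)) * (p x - p v) \<and> 0 < r / cmod (p x - p v)"
 proof (rule eventually_ball_finite[OF finN], rule ballI)
  fix x assume "x \<in> neighbours E v"
  hence "p v \<noteq> p x" using dir_nz[of v x] by auto
  thus "\<forall>\<^sub>F r in at_right 0. last_exit (linepath (p v) (p x)) r - p v = of_real (r / cmod (p x - p v)) * (p x - p v) \<and> 0 < r / cmod (p x - p v)"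
   by (rule last_exit_linepath)
 qed
 thus "\<forall>\<^sub>F r in at_right 0. ccw_next (\<lambda>x. last_exit (linepath (p v) (p x)) r - p v) (neighbours E v) u (\<rho> v u)"
 proof (rule eventually_mono)
  fix r assume a: "\<forall>x\<in>neighbours E v.
   last_exit (linepath (p v) (p x)) r - p v = of_real (r / cmod (p x - p v)) * (p x - p v) \<and> 0 < r / cmod (p x - p v)"
  have "ccw_next (\<lambda>x. last_exit (linepath (p v) (p x)) r - p v) (neighbours E v) u (\<rho> v u) \<longleftrightarrow>
    ccw_next (\<lambda>x. p x - p v) (neighbours E v) u (\<rho> v u)"
   by (rule ccw_next_scale[where s = "\<lambda>x. r / cmod (p x - p v)"]) (use a vu in auto)
  thus "ccw_next (\<lambda>x. last_exit (linepath (p v) (p x)) r - p v) (neighbours E v) u (\<rho> v u)" using nxt[OF vu] by simp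
 qed
qed

lemma embedding: "noncrossing_straight_line_embedding V E p"
 using real by (simp add: realization_def)

text \<open>With two vertices the only face runs back and forth along one segment, and there is no
  closed curve to which the Jordan curve theorem could be applied; this case is computed
  directly.\<close>

theorem realized_embedding: "pointed_pseudo_triangulation V E p \<and> realizes_plane_structure V E \<rho> F p"
proof (cases "3 \<le> card V")
 case True
 then interpret realized3 V E \<rho> F p by unfold_locales
 show ?thesis
  unfolding pointed_pseudo_triangulation_def pseudo_triangulation_def realizes_plane_structure_def
  using embedding convex_outer bounded_face all_pointed rotation_linepath outer_iff by simp
next
 case False
 hence "card V = 2" using cardV by simp
 then obtain a b where V: "V = {a, b}" "a \<noteq> b" by (auto simp: card_2_iff)
 have "card E = 1" using cardE \<open>card V = 2\<close> by simp
 then obtain e where "E = {e}" by (auto simp: card_1_singleton_iff)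
 moreover have "e \<subseteq> V" "card e = 2" using simple \<open>E = {e}\<close> by (auto simp: simple_graph_def)
 ultimately have E: "E = {V}" using \<open>card V = 2\<close> card_subset_eq[OF finV] by metis
 have pab: "p a \<noteq> p b" using p_eq V by simp
 let ?S = "closed_segment (p a) (p b)"
 have eV: "edge_segment p V = ?S" using edge_segment_pair V by simp
 have P: "drawn_points V E p = ?S" unfolding drawn_points_def E using eV V by auto
 have out: "outside ?S = - ?S" by (rule outside_convex) simp
 have int: "interior ?S = {}" by (simp add: interior_closed_segment)
 have fr: "frontier ?S = ?S" using int by (simp add: frontier_def)
 have "convex hull (p ` V) = ?S" using eV by (simp add: edge_segment_def)
 hence "convex_outer_face V E p"
  unfolding convex_outer_face_def P out frontier_complement fr using eV fr E by simp
 moreover have "\<not> bounded C" if "C \<in> components (- drawn_points V E p)" for C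
 proof -
  have "connected (outside ?S)" by (rule connected_outside) (simp_all add: compact_imp_bounded)
  hence "connected (- ?S)" unfolding out .
  moreover have "- ?S \<noteq> {}" using int by (metis Compl_UNIV_eq double_complement interior_UNIV UNIV_not_empty)
  ultimately have "components (- ?S) = {- ?S}" unfolding components_eq_sing_iff by (rule conjI)
  hence "C = - ?S" using that unfolding P by simp
  moreover have "bounded ?S" by (simp add: compact_imp_bounded)
  ultimately show ?thesis using cobounded_imp_unbounded[of "- ?S"] by simp
 qed
 moreover have "(u, v) \<in> F \<longleftrightarrow> outer_on_right V E p u v" if uv: "{u, v} \<in> E" for u v
 proof -
  have N: "neighbours E x = {y}" if "{x, y} \<in> E" for x y
   using that V unfolding E by (auto simp: neighbours_def doubleton_eq_iff)
  have "{v, u} \<in> E" using uv by (simp add: insert_commute)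
  hence r: "\<rho> v u = u" "\<rho> u v = v"
   using rho_in[of v u] rho_in[of u v] uv N[of v u] N[of u v] mem_neighbours[of "\<rho> v u" E v] mem_neighbours[of "\<rho> u v" E u]
   by (simp_all del: mem_neighbours)
  have "(u, v) \<in> F"
  proof -
   obtain d where d: "d \<in> D" "F = face d" using faceF is_face_iff by auto
   obtain c c' where c: "d = (c, c')" by (cases d)
   hence "{c, c'} \<in> E" using d(1) by simp
   hence "{c, c'} = {u, v}" using uv unfolding E by blast
   hence "d = (u, v) \<or> d = (v, u)" unfolding c by (simp add: doubleton_eq_iff)
   thus ?thesis
   proof
    assume "d = (u, v)" thus ?thesis using face_self[OF d(1)] d(2) by simp
   next
    assume "d = (v, u)" thus ?thesis using orbit.base[of f d] r(2) d(2) by simp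
   qed
  qed
  moreover have "outer_on_right V E p u v"
  proof -
   have s: "?S = closed_segment (p u) (p v)" using eV uv edge_segment_pair[of u v] unfolding E by simp
   define d where "d = p v - p u"
   have dn: "d \<noteq> 0" using dir_nz[OF uv] by (simp add: d_def)
   have "midpoint (p u) (p v) - of_real eps * \<i> * (p v - p u) \<notin> ?S" if "0 < eps" for eps
   proof
    assume "midpoint (p u) (p v) - of_real eps * \<i> * (p v - p u) \<in> ?S"
    then obtain q where "midpoint (p u) (p v) - of_real eps * \<i> * (p v - p u) = (1 - q) *\<^sub>R p u + q *\<^sub>R p v"
     unfolding s by (auto simp: in_segment)
    moreover have "midpoint (p u) (p v) = p u + of_real (1/2) * d" by (simp add: midpoint_def d_def complex_eq_iff field_simps)
    ultimately have "of_real (1/2) * d - of_real eps * \<i> * d = of_real q * d"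
     by (simp add: d_def scaleR_conv_of_real algebra_simps)
    hence "cross (of_real q * d) d = eps * (cmod d)\<^sup>2" using cross_turn[of "1/2" d eps] by simp
    thus False using that dn by (simp add: cross_scale)
   qed
   thus ?thesis unfolding outer_on_right_def P out using eventually_at_right_less[of "0::real"] by (auto elim: eventually_mono)
  qed
  ultimately show ?thesis by blast
 qed
 ultimately show ?thesis
  unfolding pointed_pseudo_triangulation_def pseudo_triangulation_def realizes_plane_structure_def
  using embedding all_pointed rotation_linepath by blast
qed

end

theorem theorem3p1:
 fixes V :: "'a set" and E :: "'a set set"
  and \<rho> :: "'a \<Rightarrow> 'a \<Rightarrow> 'a" and F :: "('a \<times> 'a) set"
 assumes "plane_graph V E \<rho> F" and "laman V E"
 shows "\<exists>p :: 'a \<Rightarrow> complex.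
      pointed_pseudo_triangulation V E p \<and> realizes_plane_structure V E \<rho> F p"
proof -
 obtain p0 g where dr: "noncrossing_drawing V E p0 g" "induces_rotation E p0 g \<rho>" and F: "is_face E \<rho> F"
  using assms(1) by (auto simp: plane_graph_def)
 note m = drawing_euler[OF assms(2) dr]
 obtain p where p: "realization V E \<rho> F p" using ex_realization[OF m F] by blast
 interpret laman_map V E \<rho> by (rule m(1))
 interpret realized V E \<rho> F p by unfold_locales (use F p in auto)
 show ?thesis using realized_embedding by blast
qed

end
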